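(* There exist an absolute constant $C>0$ and, for each $d\ge1$, $\varepsilon>0$, an $\varepsilon$-differentially private mechanism (with respect to its input sample, viewed as a dataset of $n$ points of $B_2^d$) that, given $n$ i.i.d. samples from any distribution $\mu$ on $B_2^d$ with covariance matrix $\Sigma$, outputs a $d\times d$ matrix $\widehat\Sigma$ such that, for any $\alpha\in(0,1)$, \[ \mathbb{E}\|\widehat\Sigma-\Sigma\|_F\le\alpha \] as long as \[ n\ge C\left(\min\left\{\frac{d^{1.5}}{\alpha\varepsilon},\frac{d}{\alpha^2\varepsilon}\right\}+\frac1{\alpha^2}\right). \] Moreover, the mechanism runs in time polynomial in $d,n,\frac1\varepsilon$.
   Context: $B_2^d$ is the closed Euclidean unit ball in $\mathbb{R}^d$, and $\|A\|_F=\sqrt{\mathrm{tr}(AA^\top)}$ is the Frobenius norm. The expectation is over both the samples and the mechanism's randomness. A mechanism $\mathcal{M}$ on datasets $X\in(B_2^d)^n$ is $\varepsilon$-differentially private if for all $X,X'$ differing in at most one element and every measurable $S$, $\Pr(\mathcal{M}(X)\in S)\le e^\varepsilon\Pr(\mathcal{M}(X')\in S)$. *)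

theory Defs
  imports "HOL-Probability.Probability"
begin

section \<open>Unit ball, datasets and matrices\<close>

text \<open>The dimension is a natural number bound inside the statement, so vectors and matrices are
  extensional functions on \<open>{..<d}\<close> and \<open>{..<d} \<times> {..<d}\<close>; the product sigma-algebra of finitely
  many copies of \<^term>\<open>borel :: real measure\<close> is the Borel sigma-algebra.\<close>

type_synonym vector = "nat \<Rightarrow> real"
type_synonym matrix = "nat \<times> nat \<Rightarrow> real"

definition ball_space :: "nat \<Rightarrow> vector measure" where
  "ball_space d = restrict_space (Pi\<^sub>M {..<d} (\<lambda>_. borel))
     {x \<in> space (Pi\<^sub>M {..<d} (\<lambda>_. borel)). L2_set x {..<d} \<le> 1}"

definition dataset_space :: "nat \<Rightarrow> nat \<Rightarrow> (nat \<Rightarrow> vector) measure" where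
  "dataset_space d n = Pi\<^sub>M {..<n} (\<lambda>_. ball_space d)"

definition matrix_space :: "nat \<Rightarrow> matrix measure" where
  "matrix_space d = Pi\<^sub>M ({..<d} \<times> {..<d}) (\<lambda>_. borel)"

definition mat_trace :: "nat \<Rightarrow> matrix \<Rightarrow> real" where
  "mat_trace d A = (\<Sum>i<d. A (i, i))"

definition mat_mult :: "nat \<Rightarrow> matrix \<Rightarrow> matrix \<Rightarrow> matrix" where
  "mat_mult d A B = (\<lambda>(i, j). \<Sum>k<d. A (i, k) * B (k, j))"

definition mat_transpose :: "matrix \<Rightarrow> matrix" where
  "mat_transpose A = (\<lambda>(i, j). A (j, i))"

definition frobenius_norm :: "nat \<Rightarrow> matrix \<Rightarrow> real" where
  "frobenius_norm d A = sqrt (mat_trace d (mat_mult d A (mat_transpose A)))"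

definition covariance_matrix :: "vector measure \<Rightarrow> matrix" where
  "covariance_matrix \<mu> = (\<lambda>(i, j).
     \<integral>x. (x i - (\<integral>y. y i \<partial>\<mu>)) * (x j - (\<integral>y. y j \<partial>\<mu>)) \<partial>\<mu>)"


section \<open>Differential privacy\<close>

definition differentially_private ::
    "real \<Rightarrow> nat \<Rightarrow> 'a measure \<Rightarrow> 'b measure \<Rightarrow> ((nat \<Rightarrow> 'a) \<Rightarrow> 'b measure) \<Rightarrow> bool" where
  "differentially_private \<epsilon> n D R M \<longleftrightarrow>
     (\<forall>X \<in> space (Pi\<^sub>M {..<n} (\<lambda>_. D)). \<forall>X' \<in> space (Pi\<^sub>M {..<n} (\<lambda>_. D)).
        card {i \<in> {..<n}. X i \<noteq> X' i} \<le> 1 \<longrightarrow>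
        (\<forall>S \<in> sets R. measure (M X) S \<le> exp \<epsilon> * measure (M X') S))"


section \<open>Randomized real-RAM programs\<close>

text \<open>Running time is measured in the real-RAM model, for a small imperative language.  Index
  variables hold natural numbers; the two-dimensional arrays hold reals, on which exact field
  operations, square roots and comparisons take unit time, as does drawing a uniform or a
  standard Gaussian sample.  To avoid the well-known spurious power of unit-cost models there is
  no rounding or bit access, real constants are integers (so a program cannot hide advice in a
  real constant), and indices cannot be multiplied (so that addresses computed in time \<open>t\<close> have
  \<open>O(t)\<close> bits).  Since the expressions of a fixed program have bounded size, evaluating one is
  charged as a single step.\<close>

type_synonym vname = string

datatype iexp = IConst nat | IVar vname | IAdd iexp iexp | ISub iexp iexp

datatype rexp = RConst int | RIdx iexp | RGet vname iexp iexp
  | RAdd rexp rexp | RSub rexp rexp | RMul rexp rexp | RDiv rexp rexp | RSqrt rexp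

datatype test = ILess iexp iexp | RLess rexp rexp | TNot test | TAnd test test

datatype prog =
    Skip
  | ISet vname iexp
  | RSet vname iexp iexp rexp
  | DrawUniform vname iexp iexp
  | DrawGaussian vname iexp iexp
  | Seq prog prog
  | Cond test prog prog
  | While test prog

record state =
  idx :: "vname \<Rightarrow> nat"
  arr :: "vname \<Rightarrow> nat \<times> nat \<Rightarrow> real"
  drawn :: nat

fun ival :: "state \<Rightarrow> iexp \<Rightarrow> nat" where
  "ival s (IConst k) = k"
| "ival s (IVar x) = idx s x"
| "ival s (IAdd a b) = ival s a + ival s b"
| "ival s (ISub a b) = ival s a - ival s b"

fun rval :: "state \<Rightarrow> rexp \<Rightarrow> real" where
  "rval s (RConst k) = of_int k"
| "rval s (RIdx a) = real (ival s a)"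
| "rval s (RGet x a b) = arr s x (ival s a, ival s b)"
| "rval s (RAdd p q) = rval s p + rval s q"
| "rval s (RSub p q) = rval s p - rval s q"
| "rval s (RMul p q) = rval s p * rval s q"
| "rval s (RDiv p q) = rval s p / rval s q"
| "rval s (RSqrt p) = sqrt (rval s p)"

fun tval :: "state \<Rightarrow> test \<Rightarrow> bool" where
  "tval s (ILess a b) = (ival s a < ival s b)"
| "tval s (RLess p q) = (rval s p < rval s q)"
| "tval s (TNot b) = (\<not> tval s b)"
| "tval s (TAnd b c) = (tval s b \<and> tval s c)"

definition set_arr :: "vname \<Rightarrow> nat \<Rightarrow> nat \<Rightarrow> real \<Rightarrow> state \<Rightarrow> state" where
  "set_arr x i j v s = s\<lparr>arr := (arr s)(x := (arr s x)((i, j) := v))\<rparr>"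

text \<open>All randomness comes from a tape of independent cells, each holding an independent pair of
  a uniform and a standard Gaussian sample; every draw consumes one fresh cell.\<close>

type_synonym tape = "nat \<Rightarrow> real \<times> real"

definition random_tape :: "tape measure" where
  "random_tape = Pi\<^sub>M UNIV
     (\<lambda>_. uniform_measure lborel {0..1} \<Otimes>\<^sub>M density lborel std_normal_density)"

text \<open>\<open>exec \<omega> P s t s'\<close>: on tape \<open>\<omega>\<close>, program \<open>P\<close> started in \<open>s\<close> halts in \<open>s'\<close> after \<open>t\<close> steps.\<close>

inductive exec :: "tape \<Rightarrow> prog \<Rightarrow> state \<Rightarrow> nat \<Rightarrow> state \<Rightarrow> bool" for \<omega> :: tape where
  exec_Skip: "exec \<omega> Skip s 1 s"
| exec_ISet: "exec \<omega> (ISet x a) s 1 (s\<lparr>idx := (idx s)(x := ival s a)\<rparr>)"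
| exec_RSet: "exec \<omega> (RSet x a b p) s 1 (set_arr x (ival s a) (ival s b) (rval s p) s)"
| exec_DrawUniform: "exec \<omega> (DrawUniform x a b) s 1
    (set_arr x (ival s a) (ival s b) (fst (\<omega> (drawn s))) (s\<lparr>drawn := Suc (drawn s)\<rparr>))"
| exec_DrawGaussian: "exec \<omega> (DrawGaussian x a b) s 1
    (set_arr x (ival s a) (ival s b) (snd (\<omega> (drawn s))) (s\<lparr>drawn := Suc (drawn s)\<rparr>))"
| exec_Seq: "exec \<omega> P s t s' \<Longrightarrow> exec \<omega> Q s' u s'' \<Longrightarrow> exec \<omega> (Seq P Q) s (t + u) s''"
| exec_CondT: "tval s b \<Longrightarrow> exec \<omega> P s t s' \<Longrightarrow> exec \<omega> (Cond b P Q) s (Suc t) s'"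
| exec_CondF: "\<not> tval s b \<Longrightarrow> exec \<omega> Q s t s' \<Longrightarrow> exec \<omega> (Cond b P Q) s (Suc t) s'"
| exec_WhileF: "\<not> tval s b \<Longrightarrow> exec \<omega> (While b P) s 1 s"
| exec_WhileT: "tval s b \<Longrightarrow> exec \<omega> P s t s' \<Longrightarrow> exec \<omega> (While b P) s' u s'' \<Longrightarrow>
    exec \<omega> (While b P) s (Suc (t + u)) s''"

lemma exec_deterministic:
  "exec \<omega> P s t s' \<Longrightarrow> exec \<omega> P s u s'' \<Longrightarrow> t = u \<and> s' = s''"
proof (induction arbitrary: u s'' rule: exec.induct)
  case (exec_Skip s)
  then show ?case by cases simp
next
  case (exec_ISet x a s)
  then show ?case by cases simp
next
  case (exec_RSet x a b p s)
  then show ?case by cases simp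
next
  case (exec_DrawUniform x a b s)
  then show ?case by cases simp
next
  case (exec_DrawGaussian x a b s)
  then show ?case by cases simp
next
  case (exec_Seq P s t s' Q v r)
  from exec_Seq.prems show ?case
    by cases (use exec_Seq.IH in blast)
next
  case (exec_CondT s b P t s' Q)
  from exec_CondT.prems show ?case
    by cases (use exec_CondT.IH exec_CondT.hyps in blast)+
next
  case (exec_CondF s b Q t s' P)
  from exec_CondF.prems show ?case
    by cases (use exec_CondF.IH exec_CondF.hyps in blast)+
next
  case (exec_WhileF s b P)
  from exec_WhileF.prems show ?case
    by cases (use exec_WhileF.hyps in blast)+
next
  case (exec_WhileT s b P t s' v r)
  from exec_WhileT.prems show ?case
    by cases (use exec_WhileT.IH exec_WhileT.hyps in blast)+
qed

definition input_state :: "nat \<Rightarrow> real \<Rightarrow> nat \<Rightarrow> (nat \<Rightarrow> vector) \<Rightarrow> state" where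
  "input_state d \<epsilon> n X =
     \<lparr>idx = (\<lambda>_. 0)(''d'' := d, ''n'' := n),
      arr = (\<lambda>_ _. 0)(''X'' := (\<lambda>(i, j). if i < n \<and> j < d then X i j else 0),
                       ''eps'' := (\<lambda>_. 0)((0, 0) := \<epsilon>)),
      drawn = 0\<rparr>"

definition output_matrix :: "nat \<Rightarrow> state \<Rightarrow> matrix" where
  "output_matrix d s = restrict (arr s ''out'') ({..<d} \<times> {..<d})"

text \<open>A single program implements the mechanism for all \<open>d\<close>, \<open>\<epsilon>\<close> and \<open>n\<close>, and halts on every tape
  within the stated bound.  A function of \<open>d\<close>, \<open>n\<close>, \<open>1/\<epsilon>\<close> is bounded by a polynomial iff it
  is bounded by some \<open>c * (1 + d + n + 1/\<epsilon>) ^ k\<close>.\<close>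

definition polynomial_time ::
    "(nat \<Rightarrow> real \<Rightarrow> nat \<Rightarrow> (nat \<Rightarrow> vector) \<Rightarrow> matrix measure) \<Rightarrow> bool" where
  "polynomial_time M \<longleftrightarrow>
     (\<exists>(P :: prog) (c :: real) (k :: nat). \<forall>d\<ge>1. \<forall>\<epsilon>>0. \<forall>n. \<forall>X \<in> space (dataset_space d n).
        \<exists>F \<in> random_tape \<rightarrow>\<^sub>M matrix_space d.
          M d \<epsilon> n X = distr random_tape (matrix_space d) F \<and>
          (\<forall>\<omega>. \<exists>t s. exec \<omega> P (input_state d \<epsilon> n X) t s \<and> F \<omega> = output_matrix d s \<and>
             real t \<le> c * (1 + real d + real n + 1 / \<epsilon>) ^ k))"

end

theory Submission
  imports Defs
begin

text \<open>
  Half the covariance matrix is estimated by a mean of rank-one matrices \<open>w w\<^sup>T\<close> with \<open>\<bar>w\<bar> \<le> 1\<close>, taken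
  over disjoint pairs of samples. It is perturbed by a random matrix of scale \<open>d / (n \<epsilon>)\<close> with columns
  \<open>a\<^sub>j = C\<^sub>j t\<^sub>j\<close>, where the \<open>t\<^sub>j\<close> are independent Student vectors and \<open>C\<^sub>j\<close> is the Cholesky factor of
  \<open>I + a\<^sub>0 a\<^sub>0\<^sup>T + \<dots> + a\<^sub>j\<^sub>-\<^sub>1 a\<^sub>j\<^sub>-\<^sub>1\<^sup>T\<close>. The density of this matrix is a product of powers of the
  determinants of the \<open>C\<^sub>j\<close>, so a rank-one shift of nuclear norm \<open>\<beta>\<close> changes it by a factor
  \<open>exp (O(d \<beta>))\<close>, whereas its expected operator norm is bounded by a constant: nuclear norm
  sensitivity is traded for noise that is small in the dual norm.

  The noisy matrix is then projected onto the positive semidefinite matrices of trace at most one by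
  the Frank--Wolfe method, whose linear steps are solved by repeated squaring. If the noise has
  operator norm \<open>\<tau>\<close>, the squared Frobenius error is \<open>O(\<tau>)\<close> by duality, and the error is at most
  twice the Frobenius norm \<open>\<surd>d \<tau>\<close> of the noise; these are the two terms of the minimum.
\<close>

section \<open>Cholesky factors of rank-one updates\<close>

text \<open>Pure privacy needs a bounded density ratio under shifts, which Gaussian noise does not
  have, and the program must halt on every tape within a fixed time, so the noise cannot come from
  rejection sampling. Student vectors meet both demands: they have polynomial tails, and they are
  made exactly from finitely many Gaussian draws, field operations and square roots. Multiplying
  each column by the Cholesky factor of its predecessors makes the determinants telescope, so that
  only about \<open>d + \<nu> + d\<close> powers of them survive in the density. The number
  \<open>\<nu>\<close> of degrees of freedom balances two demands: with \<open>\<nu>\<close> of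
  order \<open>d\<close> that count is still O(d), while the \<open>d\<close>-th moment of a
  quadratic form at most doubles with every column, and \<open>2 ^ d\<close> is a constant after a
  \<open>d\<close>-th root. Exact eigenvectors are in general beyond field operations and square
  roots; hence the approximate projection through matrix powers, whose spectral properties are
  derived from traces alone. Neither the noise nor the number of iterations refers to \<alpha>: one
  release attains both terms of the minimum.\<close>

definition sqn :: "nat \<Rightarrow> (nat \<Rightarrow> real) \<Rightarrow> real" where
  "sqn d x = (\<Sum>i<d. (x i)\<^sup>2)"

definition dot :: "nat \<Rightarrow> (nat \<Rightarrow> real) \<Rightarrow> (nat \<Rightarrow> real) \<Rightarrow> real" where
  "dot d x y = (\<Sum>i<d. x i * y i)"

definition mvec :: "nat \<Rightarrow> (nat \<Rightarrow> nat \<Rightarrow> real) \<Rightarrow> (nat \<Rightarrow> real) \<Rightarrow> nat \<Rightarrow> real" where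
  "mvec d C t = (\<lambda>i. \<Sum>l<d. C i l * t l)"

definition tvec :: "nat \<Rightarrow> (nat \<Rightarrow> nat \<Rightarrow> real) \<Rightarrow> (nat \<Rightarrow> real) \<Rightarrow> nat \<Rightarrow> real" where
  "tvec d C y = (\<lambda>l. \<Sum>i<d. C i l * y i)"

definition lower_tri :: "nat \<Rightarrow> (nat \<Rightarrow> nat \<Rightarrow> real) \<Rightarrow> bool" where
  "lower_tri d C \<longleftrightarrow> (\<forall>i<d. 0 < C i i) \<and> (\<forall>i<d. \<forall>j<d. i < j \<longrightarrow> C i j = 0)"

definition diag_prod :: "nat \<Rightarrow> (nat \<Rightarrow> nat \<Rightarrow> real) \<Rightarrow> real" where
  "diag_prod d C = (\<Prod>i<d. C i i)"

text \<open>The square of \<open>psum t i\<close> is the determinant of the leading \<open>i\<close>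
  by \<open>i\<close> block of I + t t^T, so quotients of consecutive values are the diagonal of its
  Cholesky factor.\<close>

definition psum :: "(nat \<Rightarrow> real) \<Rightarrow> nat \<Rightarrow> real" where
  "psum t i = sqrt (1 + sqn i t)"

text \<open>The entries of the Cholesky factor of \<open>I + t t\<^sup>T\<close>.\<close>

definition upd_factor :: "(nat \<Rightarrow> real) \<Rightarrow> nat \<Rightarrow> nat \<Rightarrow> real" where
  "upd_factor t i l = (if i < l then 0 else if i = l then psum t (Suc l) / psum t l
     else t i * t l / (psum t l * psum t (Suc l)))"

text \<open>The product of \<open>C\<close> with the Cholesky factor of I + t t^T, hence a Cholesky
  factor of C C^T + (C t)(C t)^T. The products C C^T are never formed; the quadratic form
  \<open>sqn d (tvec d C y)\<close> stands for them.\<close>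

definition chol_step :: "nat \<Rightarrow> (nat \<Rightarrow> nat \<Rightarrow> real) \<Rightarrow> (nat \<Rightarrow> real) \<Rightarrow> nat \<Rightarrow> nat \<Rightarrow> real" where
  "chol_step d C t = (\<lambda>i l. \<Sum>j<d. C i j * upd_factor t j l)"

lemma sqn_nonneg [simp]: "0 \<le> sqn d x"
  by (simp add: sqn_def sum_nonneg)

lemma psum_ge_1: "1 \<le> psum t i"
  by (simp add: psum_def)

lemma psum_pos [simp]: "0 < psum t i"
  using psum_ge_1[of t i] by linarith

lemma psum_nonzero [simp]: "psum t i \<noteq> 0"
  using psum_pos[of t i] by linarith

lemma psum_sq: "(psum t i)\<^sup>2 = 1 + sqn i t"
  by (simp add: psum_def add_nonneg_nonneg)

lemma psum_Suc_sq: "(psum t (Suc i))\<^sup>2 = (psum t i)\<^sup>2 + (t i)\<^sup>2"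
  by (simp add: psum_sq sqn_def)

lemma dot_commute: "dot d x y = dot d y x"
  by (simp add: dot_def mult.commute)

lemma dot_self: "dot d x x = sqn d x"
  by (simp add: dot_def sqn_def power2_eq_square)

lemma dot_mvec: "dot d (mvec d C t) y = dot d t (tvec d C y)"
proof -
  have "dot d (mvec d C t) y = (\<Sum>i<d. \<Sum>l<d. C i l * t l * y i)"
    by (simp add: dot_def mvec_def sum_distrib_right)
  also have "\<dots> = (\<Sum>l<d. \<Sum>i<d. C i l * t l * y i)"
    by (rule sum.swap)
  also have "\<dots> = dot d t (tvec d C y)"
    by (simp add: dot_def tvec_def sum_distrib_left mult_ac)
  finally show ?thesis .
qed

lemma dot_Cauchy_Schwarz: "(dot d x y)\<^sup>2 \<le> sqn d x * sqn d y"
  unfolding dot_def sqn_def by (rule Cauchy_Schwarz_ineq_sum)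

text \<open>Each squared coordinate differs from \<open>(w l)\<^sup>2\<close> by a difference of
  consecutive terms, so that the sum over \<open>l\<close> telescopes; \<open>p l\<close> is a tail
  of the inner product of \<open>t\<close> and \<open>w\<close>.\<close>

lemma tvec_upd_factor_term:
  fixes t w :: "nat \<Rightarrow> real"
  assumes l: "l < d"
  defines "p \<equiv> \<lambda>l. \<Sum>i=l..<d. t i * w i"
  shows "(tvec d (upd_factor t) w l)\<^sup>2
    = (w l)\<^sup>2 + (p l)\<^sup>2 / (psum t l)\<^sup>2 - (p (Suc l))\<^sup>2 / (psum t (Suc l))\<^sup>2"
proof -
  define s s' where "s = psum t l" and "s' = psum t (Suc l)"
  have pos: "0 < s" "0 < s'" by (simp_all add: s_def s'_def)
  have s'2: "s'\<^sup>2 = s\<^sup>2 + (t l)\<^sup>2" by (simp add: s_def s'_def psum_Suc_sq)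
  have pl: "p l = t l * w l + p (Suc l)"
    using l by (simp add: p_def sum.atLeast_Suc_lessThan)
  have "tvec d (upd_factor t) w l = (\<Sum>i=l..<d. upd_factor t i l * w i)"
    unfolding tvec_def by (rule sum.mono_neutral_right) (auto simp: upd_factor_def)
  also have "\<dots> = s' / s * w l + (\<Sum>i=Suc l..<d. upd_factor t i l * w i)"
    using l by (simp add: sum.atLeast_Suc_lessThan upd_factor_def s_def s'_def)
  also have "(\<Sum>i=Suc l..<d. upd_factor t i l * w i) = t l / (s * s') * p (Suc l)"
    unfolding p_def sum_distrib_left
    by (rule sum.cong) (auto simp: upd_factor_def s_def s'_def)
  finally have v: "tvec d (upd_factor t) w l = s' / s * w l + t l / (s * s') * p (Suc l)" .
  have "s' / s * w l + t l / (s * s') * p (Suc l) = (s'\<^sup>2 * w l + t l * p (Suc l)) / (s * s')"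
    using pos by (simp add: field_simps power2_eq_square)
  also have "s'\<^sup>2 * w l + t l * p (Suc l) = s\<^sup>2 * w l + t l * p l"
    unfolding s'2 pl by (simp add: algebra_simps power2_eq_square)
  finally have v2: "tvec d (upd_factor t) w l = (s\<^sup>2 * w l + t l * p l) / (s * s')"
    using v by simp
  have "(s\<^sup>2 * w l + t l * p l)\<^sup>2
      = (w l)\<^sup>2 * (s\<^sup>2 * s'\<^sup>2) + (p l)\<^sup>2 * s'\<^sup>2 - (p l - t l * w l)\<^sup>2 * s\<^sup>2"
    unfolding s'2 by (simp add: algebra_simps power2_eq_square)
  also have "p l - t l * w l = p (Suc l)" using pl by simp
  finally have "(s\<^sup>2 * w l + t l * p l)\<^sup>2 / (s\<^sup>2 * s'\<^sup>2)
      = (w l)\<^sup>2 + (p l)\<^sup>2 / s\<^sup>2 - (p (Suc l))\<^sup>2 / s'\<^sup>2"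
    using pos by (simp add: field_simps)
  then show ?thesis
    unfolding v2 power_divide power_mult_distrib s_def s'_def .
qed

text \<open>The quadratic form of L L^T = I + t t^T. Only the ends of the telescoping sum remain:
  \<open>q d\<close> comes from an empty sum, and \<open>psum t 0\<close> is 1.\<close>

lemma sqn_upd_factor: "sqn d (tvec d (upd_factor t) w) = sqn d w + (dot d t w)\<^sup>2"
proof -
  define q where "q = (\<lambda>l. (\<Sum>i=l..<d. t i * w i)\<^sup>2 / (psum t l)\<^sup>2)"
  have "sqn d (tvec d (upd_factor t) w) = (\<Sum>l<d. (w l)\<^sup>2 + (q l - q (Suc l)))"
    unfolding sqn_def q_def by (rule sum.cong) (auto simp: tvec_upd_factor_term)
  also have "\<dots> = sqn d w + (q 0 - q d)"
    by (simp add: sum.distrib sum_lessThan_telescope' sqn_def)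
  also have "q 0 - q d = (dot d t w)\<^sup>2"
    by (simp add: q_def psum_def sqn_def dot_def atLeast0LessThan)
  finally show ?thesis .
qed

lemma tvec_chol_step: "tvec d (chol_step d C t) y = tvec d (upd_factor t) (tvec d C y)"
proof
  fix l
  have "tvec d (chol_step d C t) y l = (\<Sum>i<d. \<Sum>j<d. C i j * upd_factor t j l * y i)"
    by (simp add: tvec_def chol_step_def sum_distrib_right)
  also have "\<dots> = (\<Sum>j<d. \<Sum>i<d. C i j * upd_factor t j l * y i)"
    by (rule sum.swap)
  also have "\<dots> = tvec d (upd_factor t) (tvec d C y) l"
    by (simp add: tvec_def sum_distrib_left mult_ac)
  finally show "tvec d (chol_step d C t) y l = tvec d (upd_factor t) (tvec d C y) l" .
qed

lemma sqn_tvec_chol_step: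
  "sqn d (tvec d (chol_step d C t) y) = sqn d (tvec d C y) + (dot d (mvec d C t) y)\<^sup>2"
  by (simp add: tvec_chol_step sqn_upd_factor dot_mvec)

lemma lower_tri_chol_step_entry:
  assumes "lower_tri d C" "i < d" "l < d" "i \<le> l"
  shows "chol_step d C t i l = (if i = l then C i i * (psum t (Suc i) / psum t i) else 0)"
proof -
  have "C i j * upd_factor t j l = 0" if "j < d" "j \<noteq> i \<or> i \<noteq> l" for j
    using assms that by (cases "i < j") (auto simp: lower_tri_def upd_factor_def)
  then have "chol_step d C t i l = (\<Sum>j<d. if j = i then (if i = l then C i i * upd_factor t i i else 0) else 0)"
    unfolding chol_step_def by (intro sum.cong) auto
  then show ?thesis using assms by (simp add: upd_factor_def)
qed

lemma lower_tri_chol_step: "lower_tri d C \<Longrightarrow> lower_tri d (chol_step d C t)"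
  using lower_tri_chol_step_entry[of d C] by (auto simp: lower_tri_def)

text \<open>The matrix determinant lemma in square-root form: the quotients on the diagonal of the
  update factor telescope to \<open>psum t d\<close>.\<close>

lemma diag_prod_chol_step:
  assumes "lower_tri d C"
  shows "diag_prod d (chol_step d C t) = diag_prod d C * psum t d"
proof -
  have "diag_prod d (chol_step d C t) = (\<Prod>i<d. C i i * (psum t (Suc i) / psum t i))"
    unfolding diag_prod_def by (rule prod.cong) (auto simp: lower_tri_chol_step_entry assms)
  also have "\<dots> = diag_prod d C * (\<Prod>i<d. psum t (Suc i) / psum t i)"
    unfolding diag_prod_def by (rule prod.distrib)
  also have "(\<Prod>i<d. psum t (Suc i) / psum t i) = psum t d / psum t 0"
    by (rule prod_lessThan_telescope) auto
  finally show ?thesis by (simp add: psum_def sqn_def)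
qed

lemma diag_prod_pos: "lower_tri d C \<Longrightarrow> 0 < diag_prod d C"
  unfolding diag_prod_def lower_tri_def by (intro prod_pos) auto

text \<open>Forward substitution, the inverse of \<^const>\<open>mvec\<close> for a lower triangular matrix.\<close>

function fsub :: "(nat \<Rightarrow> nat \<Rightarrow> real) \<Rightarrow> (nat \<Rightarrow> real) \<Rightarrow> nat \<Rightarrow> real" where
  "fsub C a i = (a i - (\<Sum>l<i. C i l * fsub C a l)) / C i i"
  by auto
termination by (relation "Wellfounded.measure (\<lambda>(C, a, i). i)") auto

declare fsub.simps [simp del]

lemma mvec_lower_tri:
  assumes "lower_tri d C" "i < d"
  shows "mvec d C t i = C i i * t i + (\<Sum>l<i. C i l * t l)"
proof -
  have "mvec d C t i = (\<Sum>l\<in>{..<Suc i}. C i l * t l)"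
    unfolding mvec_def using assms by (intro sum.mono_neutral_right) (auto simp: lower_tri_def)
  then show ?thesis by simp
qed

lemma mvec_fsub:
  assumes "lower_tri d C" "i < d"
  shows "mvec d C (fsub C a) i = a i"
proof -
  have "C i i \<noteq> 0" using assms by (auto simp: lower_tri_def)
  then show ?thesis unfolding mvec_lower_tri[OF assms] by (simp add: fsub.simps[of C a i])
qed

lemma fsub_mvec:
  assumes "lower_tri d C" "i < d"
  shows "fsub C (mvec d C t) i = t i"
  using assms(2)
proof (induction i rule: less_induct)
  case (less i)
  have "C i i \<noteq> 0" using assms less by (auto simp: lower_tri_def)
  moreover have "(\<Sum>l<i. C i l * fsub C (mvec d C t) l) = (\<Sum>l<i. C i l * t l)"
    using less by (intro sum.cong) auto
  ultimately show ?case
    unfolding fsub.simps[of C _ i] mvec_lower_tri[OF assms(1) less.prems] by simp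
qed

lemma fsub_cong:
  assumes "\<And>l. l < d \<Longrightarrow> a l = b l" "i < d"
  shows "fsub C a i = fsub C b i"
  using assms(2)
proof (induction i rule: less_induct)
  case (less i)
  then have "(\<Sum>l<i. C i l * fsub C a l) = (\<Sum>l<i. C i l * fsub C b l)"
    by (intro sum.cong) auto
  then show ?case using less assms by (simp add: fsub.simps[of C _ i])
qed

lemma tvec_lower_tri:
  assumes "lower_tri d C" "l < d"
  shows "tvec d C y l = C l l * y l + (\<Sum>i=Suc l..<d. C i l * y i)"
proof -
  have "tvec d C y l = (\<Sum>i=l..<d. C i l * y i)"
    unfolding tvec_def using assms by (intro sum.mono_neutral_right) (auto simp: lower_tri_def)
  also have "\<dots> = C l l * y l + (\<Sum>i=Suc l..<d. C i l * y i)"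
    using assms by (simp add: sum.atLeast_Suc_lessThan)
  finally show ?thesis .
qed

text \<open>The transpose of \<open>C\<close> is invertible. The system is solved from the last
  coordinate upwards; \<open>k\<close> counts the coordinates already determined.\<close>

lemma back_substitution:
  assumes "lower_tri d C"
  shows "\<exists>y. \<forall>l<d. tvec d C y l = b l"
proof -
  have "\<exists>y. \<forall>l<d. d - k \<le> l \<longrightarrow> C l l * y l + (\<Sum>i=Suc l..<d. C i l * y i) = b l" if "k \<le> d" for k
    using that
  proof (induction k)
    case (Suc k)
    then obtain y where y: "\<forall>l<d. d - k \<le> l \<longrightarrow> C l l * y l + (\<Sum>i=Suc l..<d. C i l * y i) = b l"
      by auto
    define r where "r = d - Suc k"
    have r: "r < d" "d - k = Suc r" using Suc.prems by (auto simp: r_def)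
    \<comment> \<open>Position \<open>r\<close> does not occur in the equations with
      \<open>l > r\<close>, so changing \<open>y\<close> there preserves them.\<close>
    define z where "z = y(r := (b r - (\<Sum>i=Suc r..<d. C i r * y i)) / C r r)"
    have "C l l * z l + (\<Sum>i=Suc l..<d. C i l * z i) = b l" if "l < d" "r \<le> l" for l
    proof -
      have e: "(\<Sum>i=Suc l..<d. C i l * z i) = (\<Sum>i=Suc l..<d. C i l * y i)"
        using that by (intro sum.cong) (auto simp: z_def)
      show ?thesis
      proof (cases "l = r")
        case True
        then show ?thesis using e assms r by (auto simp: z_def lower_tri_def)
      next
        case False
        then show ?thesis using e y r that by (auto simp: z_def)
      qed
    qed
    then show ?case unfolding r_def by blast
  qed auto
  from this[of d] obtain y where "\<forall>l<d. C l l * y l + (\<Sum>i=Suc l..<d. C i l * y i) = b l" by auto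
  then show ?thesis using tvec_lower_tri[OF assms] by auto
qed

text \<open>\<open>C\<^sub>i\<^sub>i\<^sup>2\<close> is the minimum of the quadratic form \<open>\<bar>C\<^sup>T y\<bar>\<^sup>2\<close> over the \<open>y\<close> with \<open>y\<^sub>i = 1\<close>
  and \<open>y\<^sub>l = 0\<close> for \<open>l > i\<close>; hence the diagonal of a Cholesky factor is monotone in the form.\<close>

lemma diag_mono:
  assumes C: "lower_tri d C" and C': "lower_tri d C'"
    and le: "\<And>y. sqn d (tvec d C y) \<le> sqn d (tvec d C' y)" and i: "i < d"
  shows "C i i \<le> C' i i"
proof -
  \<comment> \<open>This \<open>y\<close> is the minimiser for \<open>C'\<close>: its transform has
    the single nonzero entry \<open>C' i i\<close>, whence \<open>y i = 1\<close> and
    \<open>y l = 0\<close> for \<open>l > i\<close>.\<close>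
  obtain y where y: "\<And>l. l < d \<Longrightarrow> tvec d C' y l = (if l = i then C' i i else 0)"
    using back_substitution[OF C', of "\<lambda>l. if l = i then C' i i else 0"] by auto
  have C'pos: "\<And>l. l < d \<Longrightarrow> 0 < C' l l" using C' by (auto simp: lower_tri_def)
  have y0: "y l = 0" if "i < l" "l < d" for l
    using that
  proof (induction "d - l" arbitrary: l rule: less_induct)
    case less
    have "(\<Sum>j=Suc l..<d. C' j l * y j) = 0"
      using less by (intro sum.neutral) auto
    then show ?case using y[of l] tvec_lower_tri[OF C', of l y] less.prems C'pos[of l] by auto
  qed
  have s0: "(\<Sum>j=Suc i..<d. A j i * y j) = 0" for A :: "nat \<Rightarrow> nat \<Rightarrow> real"
    by (intro sum.neutral) (auto simp: y0)
  have y1: "y i = 1"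
    using y[of i] tvec_lower_tri[OF C' i, of y] s0[of C'] C'pos[OF i] i by auto
  have "(C i i)\<^sup>2 = (tvec d C y i)\<^sup>2"
    using tvec_lower_tri[OF C i, of y] s0[of C] y1 by simp
  also have "\<dots> \<le> sqn d (tvec d C y)"
    unfolding sqn_def using i by (intro member_le_sum) auto
  also have "\<dots> \<le> sqn d (tvec d C' y)" by (rule le)
  also have "\<dots> = (\<Sum>l<d. if l = i then (C' i i)\<^sup>2 else 0)"
    unfolding sqn_def by (intro sum.cong) (auto simp: y)
  also have "\<dots> = (C' i i)\<^sup>2" using i by simp
  finally show ?thesis
    by (rule power2_le_imp_le) (use C'pos[OF i] in simp)
qed

text \<open>The determinant is monotone in the order of quadratic forms, and here even each diagonal
  entry is.\<close>

lemma diag_prod_mono: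
  assumes "lower_tri d C" "lower_tri d C'" "\<And>y. sqn d (tvec d C y) \<le> sqn d (tvec d C' y)"
  shows "diag_prod d C \<le> diag_prod d C'"
  unfolding diag_prod_def
proof (rule prod_mono)
  fix i assume "i \<in> {..<d}"
  then show "0 \<le> C i i \<and> C i i \<le> C' i i"
    using diag_mono[OF assms, of i] assms(1) by (auto simp: lower_tri_def less_imp_le)
qed

section \<open>Determinants of I + A A^T under rank-one shifts of A\<close>

definition idm :: "nat \<Rightarrow> nat \<Rightarrow> real" where
  "idm i l = (if i = l then 1 else 0)"

text \<open>Recovers the Cholesky factor of the identity plus the outer products of the first
  \<open>r\<close> columns from the columns themselves: forward substitution yields the
  \<open>t\<close> with C t = \<open>a r\<close>. A density is a function of the outcome
  \<open>a\<close>, not of the Student vectors, and needs this form.\<close>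

primrec cfac :: "nat \<Rightarrow> (nat \<Rightarrow> nat \<Rightarrow> real) \<Rightarrow> nat \<Rightarrow> nat \<Rightarrow> nat \<Rightarrow> real" where
  "cfac d a 0 = idm"
| "cfac d a (Suc r) = chol_step d (cfac d a r) (fsub (cfac d a r) (a r))"

lemma lower_tri_idm: "lower_tri d idm"
  by (auto simp: lower_tri_def idm_def)

lemma tvec_idm: "l < d \<Longrightarrow> tvec d idm y l = y l"
  by (simp add: tvec_def idm_def if_distrib if_distribR cong: if_cong)

lemma lower_tri_cfac: "lower_tri d (cfac d a r)"
  by (induction r) (auto simp: lower_tri_idm lower_tri_chol_step)

lemma dot_cong:
  assumes "\<And>i. i < d \<Longrightarrow> x i = x' i" "\<And>i. i < d \<Longrightarrow> y i = y' i"
  shows "dot d x y = dot d x' y'"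
  using assms by (simp add: dot_def)

lemma sqn_cong: "(\<And>i. i < d \<Longrightarrow> x i = x' i) \<Longrightarrow> sqn d x = sqn d x'"
  by (simp add: sqn_def)

lemma sqn_tvec_cfac: "sqn d (tvec d (cfac d a r) y) = sqn d y + (\<Sum>j<r. (dot d (a j) y)\<^sup>2)"
proof (induction r)
  case 0
  then show ?case by (simp add: sqn_cong[OF tvec_idm])
next
  case (Suc r)
  have "dot d (mvec d (cfac d a r) (fsub (cfac d a r) (a r))) y = dot d (a r) y"
    by (rule dot_cong) (auto simp: mvec_fsub lower_tri_cfac)
  then show ?case using Suc by (simp add: sqn_tvec_chol_step)
qed

lemma sqn_scale: "sqn d (\<lambda>i. c * x i) = c\<^sup>2 * sqn d x"
  by (simp add: sqn_def power_mult_distrib sum_distrib_left)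

text \<open>A rank-one update by a vector of norm at most \<open>\<beta>\<close> in the dual of the quadratic form changes
  the determinant by a factor of at most \<open>1 + \<beta>\<close>.\<close>

lemma sqn_fsub_le:
  assumes C: "lower_tri d C" and b: "0 \<le> \<beta>"
    and x: "\<And>y. (dot d x y)\<^sup>2 \<le> \<beta> * sqn d (tvec d C y)"
  shows "sqn d (fsub C x) \<le> \<beta>"
proof -
  let ?t = "fsub C x"
  \<comment> \<open>With C^T y = t and C t = x the squared norm of \<open>?t\<close> equals
    \<open>dot d x y\<close>, so the dual bound at this \<open>y\<close> compares that norm with
    itself.\<close>
  obtain y where y: "\<And>l. l < d \<Longrightarrow> tvec d C y l = ?t l"
    using back_substitution[OF C, of ?t] by auto
  have "sqn d ?t = dot d ?t (tvec d C y)"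
    unfolding dot_self[symmetric] by (rule dot_cong) (auto simp: y)
  also have "\<dots> = dot d (mvec d C ?t) y" by (simp add: dot_mvec)
  also have "\<dots> = dot d x y" by (rule dot_cong) (auto simp: mvec_fsub C)
  finally have e: "sqn d ?t = dot d x y" .
  have "(sqn d ?t)\<^sup>2 \<le> \<beta> * sqn d (tvec d C y)" unfolding e by (rule x)
  also have "sqn d (tvec d C y) = sqn d ?t" by (rule sqn_cong) (auto simp: y)
  finally have "sqn d ?t * sqn d ?t \<le> \<beta> * sqn d ?t" by (simp add: power2_eq_square)
  then show ?thesis using sqn_nonneg[of d ?t] b by (cases "sqn d ?t = 0") auto
qed

text \<open>Expanding the shifted form leaves cross terms between \<open>u\<close> and
  \<open>x\<close>, the combination of the columns with weights \<open>v\<close>. Since 2ab is at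
  most a^2 + b^2, they are dominated by two separate rank-one terms, so two Cholesky updates of the
  old factor majorise the new one. The bounds on \<open>u\<close> and \<open>v\<close> make \<beta>
  a bound on the nuclear norm of the shift.\<close>

lemma diag_prod_rank_one_shift:
  assumes v: "(\<Sum>j<r. (v j)\<^sup>2) \<le> \<beta>" and u: "sqn d u \<le> \<beta>"
    and a': "\<And>j i. j < r \<Longrightarrow> i < d \<Longrightarrow> a' j i = a j i + v j * u i"
  shows "diag_prod d (cfac d a' r) \<le> diag_prod d (cfac d a r) * exp (3 / 2 * \<beta>)"
proof -
  let ?C = "cfac d a r" and ?C' = "cfac d a' r"
  define V where "V = (\<Sum>j<r. (v j)\<^sup>2)"
  have V0: "0 \<le> V" by (simp add: V_def sum_nonneg)
  have b0: "0 \<le> \<beta>" using V0 v by (simp add: V_def)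
  define x where "x i = (\<Sum>j<r. v j * a j i)" for i
  \<comment> \<open>The weight \<open>1 + V\<close> collects the square of the shift, with weight
    \<open>V\<close>, and the 1 from splitting the cross terms.\<close>
  define z where "z i = sqrt (1 + V) * u i" for i
  define C1 where "C1 = chol_step d ?C (fsub ?C x)"
  define C2 where "C2 = chol_step d C1 (fsub C1 z)"
  have C: "lower_tri d ?C" "lower_tri d ?C'" by (simp_all add: lower_tri_cfac)
  have C1: "lower_tri d C1" by (simp add: C1_def C lower_tri_chol_step)
  have C2: "lower_tri d C2" by (simp add: C2_def C1 lower_tri_chol_step)
  have f1: "sqn d (tvec d C1 y) = sqn d (tvec d ?C y) + (dot d x y)\<^sup>2" for y
  proof -
    have "dot d (mvec d ?C (fsub ?C x)) y = dot d x y"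
      by (rule dot_cong) (auto simp: mvec_fsub C)
    then show ?thesis unfolding C1_def sqn_tvec_chol_step by simp
  qed
  have f2: "sqn d (tvec d C2 y) = sqn d (tvec d C1 y) + (1 + V) * (dot d u y)\<^sup>2" for y
  proof -
    have "dot d (mvec d C1 (fsub C1 z)) y = dot d z y"
      by (rule dot_cong) (auto simp: mvec_fsub C1)
    also have "\<dots> = sqrt (1 + V) * dot d u y"
      by (simp add: dot_def z_def sum_distrib_left mult_ac)
    finally show ?thesis unfolding C2_def sqn_tvec_chol_step
      using V0 by (simp add: power_mult_distrib)
  qed
  have dx: "dot d x y = (\<Sum>j<r. v j * dot d (a j) y)" for y
  proof -
    have "dot d x y = (\<Sum>i<d. \<Sum>j<r. v j * a j i * y i)"
      by (simp add: dot_def x_def sum_distrib_right)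
    also have "\<dots> = (\<Sum>j<r. \<Sum>i<d. v j * a j i * y i)" by (rule sum.swap)
    finally show ?thesis by (simp add: dot_def sum_distrib_left mult_ac)
  qed
  have "sqn d (tvec d ?C' y) \<le> sqn d (tvec d C2 y)" for y
  proof -
    have "(\<Sum>j<r. (dot d (a' j) y)\<^sup>2) = (\<Sum>j<r. (dot d (a j) y + v j * dot d u y)\<^sup>2)"
    proof (rule sum.cong)
      fix j assume "j \<in> {..<r}"
      then have "dot d (a' j) y = (\<Sum>i<d. (a j i + v j * u i) * y i)"
        by (simp add: dot_def a')
      also have "\<dots> = dot d (a j) y + v j * dot d u y"
        by (simp add: dot_def distrib_right sum.distrib sum_distrib_left mult.assoc)
      finally show "(dot d (a' j) y)\<^sup>2 = (dot d (a j) y + v j * dot d u y)\<^sup>2" by simp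
    qed simp
    also have "\<dots> = (\<Sum>j<r. (dot d (a j) y)\<^sup>2 + 2 * dot d u y * (v j * dot d (a j) y) + (v j)\<^sup>2 * (dot d u y)\<^sup>2)"
      by (rule sum.cong) (auto simp: power2_eq_square algebra_simps)
    also have "\<dots> = (\<Sum>j<r. (dot d (a j) y)\<^sup>2) + 2 * dot d u y * dot d x y + V * (dot d u y)\<^sup>2"
      by (simp add: sum.distrib sum_distrib_left[symmetric] sum_distrib_right[symmetric] dx V_def)
    also have "2 * dot d u y * dot d x y \<le> (dot d u y)\<^sup>2 + (dot d x y)\<^sup>2"
      using sum_squares_bound[of "dot d u y" "dot d x y"] by simp
    finally show ?thesis
      by (simp add: f1 f2 sqn_tvec_cfac algebra_simps)
  qed
  then have "diag_prod d ?C' \<le> diag_prod d C2"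
    using C C2 by (intro diag_prod_mono)
  also have "\<dots> = diag_prod d ?C * psum (fsub ?C x) d * psum (fsub C1 z) d"
    by (simp add: C2_def C1_def diag_prod_chol_step C lower_tri_chol_step)
  \<comment> \<open>The vector \<open>x\<close> is small against \<open>?C\<close> because it
    combines columns that are part of that form; \<open>z\<close> is small already against the
    identity. The first update costs \<open>sqrt (1 + \<beta>)\<close>, the second at most
    \<open>1 + \<beta>\<close>; together they give the exponent 3/2.\<close>
  also have "\<dots> \<le> diag_prod d ?C * sqrt (1 + \<beta>) * sqrt ((1 + \<beta>)\<^sup>2)"
  proof -
    have "sqn d (fsub ?C x) \<le> \<beta>"
    proof (rule sqn_fsub_le[OF C(1) b0])
      fix y
      have "(dot d x y)\<^sup>2 \<le> V * (\<Sum>j<r. (dot d (a j) y)\<^sup>2)"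
        unfolding dx V_def by (rule Cauchy_Schwarz_ineq_sum)
      also have "\<dots> \<le> \<beta> * sqn d (tvec d ?C y)"
        using v b0 by (intro mult_mono) (auto simp: V_def sqn_tvec_cfac sum_nonneg)
      finally show "(dot d x y)\<^sup>2 \<le> \<beta> * sqn d (tvec d ?C y)" .
    qed
    then have p1: "psum (fsub ?C x) d \<le> sqrt (1 + \<beta>)" by (simp add: psum_def)
    have "sqn d (fsub C1 z) \<le> (1 + V) * sqn d u"
    proof (rule sqn_fsub_le[OF C1])
      fix y
      have "(dot d z y)\<^sup>2 \<le> sqn d z * sqn d y" by (rule dot_Cauchy_Schwarz)
      also have "sqn d z = (1 + V) * sqn d u"
        unfolding z_def sqn_scale using V0 by simp
      also have "(1 + V) * sqn d u * sqn d y \<le> (1 + V) * sqn d u * sqn d (tvec d C1 y)"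
        using V0 by (intro mult_left_mono) (auto simp: f1 sqn_tvec_cfac sum_nonneg)
      finally show "(dot d z y)\<^sup>2 \<le> (1 + V) * sqn d u * sqn d (tvec d C1 y)" .
    qed (use V0 in simp)
    also have "\<dots> \<le> (1 + \<beta>) * \<beta>"
      using u v V0 b0 by (intro mult_mono) (auto simp: V_def)
    finally have "1 + sqn d (fsub C1 z) \<le> (1 + \<beta>)\<^sup>2"
      using b0 by (simp add: power2_eq_square algebra_simps)
    then have p2: "psum (fsub C1 z) d \<le> sqrt ((1 + \<beta>)\<^sup>2)"
      unfolding psum_def by (rule real_sqrt_le_mono)
    show ?thesis
      using p1 p2 diag_prod_pos[OF C(1)] b0
      by (intro mult_mono mult_nonneg_nonneg) (auto intro: less_imp_le[OF psum_pos])
  qed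
  also have "\<dots> = diag_prod d ?C * sqrt ((1 + \<beta>) ^ 3)"
    by (simp add: power3_eq_cube power2_eq_square real_sqrt_mult mult.assoc)
  also have "sqrt ((1 + \<beta>) ^ 3) \<le> exp (3 / 2 * \<beta>)"
  proof (rule real_le_lsqrt)
    have "(1 + \<beta>) ^ 3 \<le> exp \<beta> ^ 3"
      using b0 by (intro power_mono) auto
    also have "\<dots> = (exp (3 / 2 * \<beta>))\<^sup>2"
      by (simp add: exp_of_nat_mult[symmetric] flip: exp_double)
    finally show "(1 + \<beta>) ^ 3 \<le> (exp (3 / 2 * \<beta>))\<^sup>2" .
  qed (use b0 in auto)
  finally show ?thesis using diag_prod_pos[OF C(1)] by simp
qed

section \<open>Gaussian and Student vectors\<close>

abbreviation Lv :: "nat set \<Rightarrow> (nat \<Rightarrow> real) measure" where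
  "Lv I \<equiv> Pi\<^sub>M I (\<lambda>_. lborel)"

abbreviation std_normal :: "real measure" where
  "std_normal \<equiv> density lborel std_normal_density"

abbreviation Nv :: "nat set \<Rightarrow> (nat \<Rightarrow> real) measure" where
  "Nv I \<equiv> Pi\<^sub>M I (\<lambda>_. std_normal)"

interpretation plb: product_sigma_finite "\<lambda>_::'i. lborel :: real measure"
  by standard

lemma prob_space_std_normal: "prob_space std_normal"
  by (rule prob_space_normal_density) simp

interpretation pnv: product_sigma_finite "\<lambda>_::'i. std_normal"
  by (simp add: product_sigma_finite_def prob_space_imp_sigma_finite prob_space_std_normal)

lemma sets_Nv [measurable_cong]: "sets (Nv I) = sets (Lv I)"
  by (rule sets_PiM_cong) auto

lemma nn_integral_scale_coords:
  assumes "finite I" "0 < c" and f: "f \<in> borel_measurable (Lv I)"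
  shows "(\<integral>\<^sup>+x. f x \<partial>Lv I) = ennreal (c ^ card I) * (\<integral>\<^sup>+x. f (\<lambda>i\<in>I. c * x i) \<partial>Lv I)"
  using assms(1) f
proof (induction I arbitrary: f)
  case empty
  then show ?case by (simp add: PiM_empty nn_integral_count_space_finite)
next
  case (insert k I)
  note [measurable] = insert.prems
  have meas_upd: "(\<lambda>(x, y). x(k := y)) \<in> Lv I \<Otimes>\<^sub>M lborel \<rightarrow>\<^sub>M Lv (insert k I)"
    using measurable_add_dim[of k I "\<lambda>_. lborel :: real measure"] by simp
  note [measurable] = measurable_compose[OF meas_upd insert.prems, unfolded split_beta]
  have "(\<integral>\<^sup>+x. f x \<partial>Lv (insert k I)) = (\<integral>\<^sup>+x. \<integral>\<^sup>+y. f (x(k := y)) \<partial>lborel \<partial>Lv I)"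
    using insert by (intro plb.product_nn_integral_insert) auto
  also have "\<dots> = (\<integral>\<^sup>+x. ennreal c * (\<integral>\<^sup>+y. f (x(k := c * y)) \<partial>lborel) \<partial>Lv I)"
  proof (rule nn_integral_cong)
    fix x assume [measurable]: "x \<in> space (Lv I)"
    have "(\<lambda>y. f (x(k := y))) \<in> borel_measurable borel" by measurable
    from nn_integral_real_affine[OF this, of c 0] \<open>0 < c\<close>
    show "(\<integral>\<^sup>+y. f (x(k := y)) \<partial>lborel) = ennreal c * (\<integral>\<^sup>+y. f (x(k := c * y)) \<partial>lborel)" by simp
  qed
  also have "\<dots> = ennreal c * (\<integral>\<^sup>+x. (\<integral>\<^sup>+y. f (x(k := c * y)) \<partial>lborel) \<partial>Lv I)"
    by (rule nn_integral_cmult) measurable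
  also have "(\<integral>\<^sup>+x. (\<integral>\<^sup>+y. f (x(k := c * y)) \<partial>lborel) \<partial>Lv I)
      = ennreal (c ^ card I) * (\<integral>\<^sup>+x. (\<integral>\<^sup>+y. f ((\<lambda>i\<in>I. c * x i)(k := c * y)) \<partial>lborel) \<partial>Lv I)"
    by (rule insert.IH) measurable
  also have "(\<integral>\<^sup>+x. (\<integral>\<^sup>+y. f ((\<lambda>i\<in>I. c * x i)(k := c * y)) \<partial>lborel) \<partial>Lv I)
      = (\<integral>\<^sup>+x. (\<integral>\<^sup>+y. f (\<lambda>i\<in>insert k I. c * (x(k := y)) i) \<partial>lborel) \<partial>Lv I)"
    using insert.hyps by (intro nn_integral_cong arg_cong[where f = f]) (auto simp: fun_eq_iff)
  also have "\<dots> = (\<integral>\<^sup>+x. f (\<lambda>i\<in>insert k I. c * x i) \<partial>Lv (insert k I))"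
    by (rule plb.product_nn_integral_insert[symmetric]) (use insert.hyps in \<open>auto, measurable\<close>)
  finally show ?case
    using insert.hyps \<open>0 < c\<close> by (simp add: ennreal_mult mult.assoc del: insert_iff restrict_apply)
qed

text \<open>In a lower triangular map each coordinate is affine in itself, with an offset that
  depends on earlier coordinates only; so one affine substitution per coordinate takes the place of
  a Jacobian.\<close>

lemma nn_integral_triangular:
  assumes C: "\<And>i. i < d \<Longrightarrow> 0 < C i i" and f: "f \<in> borel_measurable (Lv {..<d})"
  shows "(\<integral>\<^sup>+x. f x \<partial>Lv {..<d})
    = ennreal (diag_prod d C) * (\<integral>\<^sup>+x. f (\<lambda>i\<in>{..<d}. C i i * x i + (\<Sum>l<i. C i l * x l)) \<partial>Lv {..<d})"
  using assms
proof (induction d arbitrary: f)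
  case 0
  then show ?case by (simp add: PiM_empty nn_integral_count_space_finite diag_prod_def)
next
  case (Suc k)
  let ?L = "\<lambda>k x. \<lambda>i\<in>{..<k}. C i i * x i + (\<Sum>l<i. C i l * x l)"
  note [measurable] = Suc.prems(2)
  have C: "0 < C k k" "0 < diag_prod k C"
    using Suc.prems by (auto simp: diag_prod_def intro!: prod_pos)
  have meas_upd: "(\<lambda>(x, y). x(k := y)) \<in> Lv {..<k} \<Otimes>\<^sub>M lborel \<rightarrow>\<^sub>M Lv {..<Suc k}"
    using measurable_add_dim[of k "{..<k}" "\<lambda>_. lborel :: real measure"] unfolding lessThan_Suc .
  note [measurable] = measurable_compose[OF meas_upd Suc.prems(2), unfolded split_beta]
  have L: "?L k \<in> Lv {..<k} \<rightarrow>\<^sub>M Lv {..<k}" for k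
  proof (rule measurable_restrict)
    fix i assume "i \<in> {..<k}"
    then have "l \<in> {..<k}" if "l \<le> i" for l using that by auto
    then show "(\<lambda>x. C i i * x i + (\<Sum>l<i. C i l * x l)) \<in> Lv {..<k} \<rightarrow>\<^sub>M lborel"
      by simp
  qed
  note [measurable] = L[of k]
  have "(\<integral>\<^sup>+x. f x \<partial>Lv {..<Suc k}) = (\<integral>\<^sup>+x. \<integral>\<^sup>+y. f (x(k := y)) \<partial>lborel \<partial>Lv {..<k})"
    unfolding lessThan_Suc by (rule plb.product_nn_integral_insert) (auto simp flip: lessThan_Suc)
  also have "\<dots> = ennreal (diag_prod k C) * (\<integral>\<^sup>+x. \<integral>\<^sup>+y. f ((?L k x)(k := y)) \<partial>lborel \<partial>Lv {..<k})"
  proof (rule Suc.IH)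
    note [measurable] = measurable_compose[OF meas_upd Suc.prems(2), unfolded split_beta]
    show "(\<lambda>x. \<integral>\<^sup>+y. f (x(k := y)) \<partial>lborel) \<in> borel_measurable (Lv {..<k})"
      by (rule lborel.borel_measurable_nn_integral)
         (use measurable_compose[OF meas_upd Suc.prems(2)] in \<open>simp add: split_beta\<close>)
  qed (use Suc.prems in auto)
  also have "(\<integral>\<^sup>+x. \<integral>\<^sup>+y. f ((?L k x)(k := y)) \<partial>lborel \<partial>Lv {..<k})
      = (\<integral>\<^sup>+x. ennreal (C k k) * (\<integral>\<^sup>+y. f (?L (Suc k) (x(k := y))) \<partial>lborel) \<partial>Lv {..<k})"
  proof (rule nn_integral_cong)
    fix x assume "x \<in> space (Lv {..<k})"
    then have [measurable]: "?L k x \<in> space (Lv {..<k})" using measurable_space[OF L] by blast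
    have "(\<lambda>y. f ((?L k x)(k := y))) \<in> borel_measurable borel"
      using measurable_compose[OF measurable_component_update[OF \<open>?L k x \<in> space (Lv {..<k})\<close>, of k]] Suc.prems(2)
      by (simp add: lessThan_Suc)
    from nn_integral_real_affine[OF this, of "C k k" "\<Sum>l<k. C k l * x l"] C
    have "(\<integral>\<^sup>+y. f ((?L k x)(k := y)) \<partial>lborel) = ennreal (C k k) *
      (\<integral>\<^sup>+y. f ((?L k x)(k := (\<Sum>l<k. C k l * x l) + C k k * y)) \<partial>lborel)" by simp
    also have "(\<lambda>y. (?L k x)(k := (\<Sum>l<k. C k l * x l) + C k k * y)) = (\<lambda>y. ?L (Suc k) (x(k := y)))"
    proof (intro ext)
      fix y i
      have "(\<Sum>l<j. C j l * x l) = (\<Sum>l<j. C j l * (x(k := y)) l)" if "j \<le> k" for j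
        using that by (intro sum.cong) auto
      then show "((?L k x)(k := (\<Sum>l<k. C k l * x l) + C k k * y)) i = ?L (Suc k) (x(k := y)) i"
        by (auto simp: less_Suc_eq)
    qed
    finally show "(\<integral>\<^sup>+y. f ((?L k x)(k := y)) \<partial>lborel) = ennreal (C k k) *
      (\<integral>\<^sup>+y. f (?L (Suc k) (x(k := y))) \<partial>lborel)" .
  qed
  also have "\<dots> = ennreal (C k k) * (\<integral>\<^sup>+x. (\<integral>\<^sup>+y. f (?L (Suc k) (x(k := y))) \<partial>lborel) \<partial>Lv {..<k})"
  proof (rule nn_integral_cmult)
    note [measurable] = measurable_compose[OF meas_upd measurable_compose[OF L Suc.prems(2)], unfolded split_beta]
    show "(\<lambda>x. \<integral>\<^sup>+y. f (?L (Suc k) (x(k := y))) \<partial>lborel) \<in> borel_measurable (Lv {..<k})" by measurable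
  qed
  also have "(\<integral>\<^sup>+x. (\<integral>\<^sup>+y. f (?L (Suc k) (x(k := y))) \<partial>lborel) \<partial>Lv {..<k})
      = (\<integral>\<^sup>+x. f (?L (Suc k) x) \<partial>Lv {..<Suc k})"
    using measurable_compose[OF L Suc.prems(2)] unfolding lessThan_Suc
    by (intro plb.product_nn_integral_insert[symmetric]) (auto simp del: insert_iff restrict_apply)
  finally show ?case
    using C by (simp add: diag_prod_def ennreal_mult mult.assoc del: restrict_apply)
qed

section \<open>The density of a Gaussian vector\<close>

definition gauss :: "nat set \<Rightarrow> (nat \<Rightarrow> real) \<Rightarrow> real" where
  "gauss I x = (1 / sqrt (2 * pi)) ^ card I * exp (- (\<Sum>i\<in>I. (x i)\<^sup>2) / 2)"

lemma gauss_nonneg [simp]: "0 \<le> gauss I x"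
  by (simp add: gauss_def)

lemma gauss_eq_prod: "finite I \<Longrightarrow> gauss I x = (\<Prod>i\<in>I. std_normal_density (x i))"
  by (simp add: gauss_def std_normal_density_def prod_dividef power_divide sum_divide_distrib sum_negf flip: exp_sum)

lemma measurable_gauss [measurable]: "finite I \<Longrightarrow> gauss I \<in> borel_measurable (Lv I)"
  unfolding gauss_def by measurable

lemma Nv_eq_density:
  assumes "finite I"
  shows "Nv I = density (Lv I) (\<lambda>x. ennreal (gauss I x))"
proof (rule pnv.PiM_eqI[symmetric, OF assms])
  note [measurable] = measurable_gauss[OF assms]
  show "sets (density (Lv I) (\<lambda>x. ennreal (gauss I x))) = sets (Nv I)"
    by (simp add: sets_Nv)
  fix A :: "nat \<Rightarrow> real set" assume "\<And>i. i \<in> I \<Longrightarrow> A i \<in> sets std_normal"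
  then have A [measurable]: "\<And>i. i \<in> I \<Longrightarrow> A i \<in> sets borel" by simp
  have [measurable]: "Pi\<^sub>E I A \<in> sets (Lv I)"
    using assms A by (intro sets_PiM_I_finite) auto
  have "emeasure (density (Lv I) (\<lambda>x. ennreal (gauss I x))) (Pi\<^sub>E I A)
    = (\<integral>\<^sup>+x. ennreal (gauss I x) * indicator (Pi\<^sub>E I A) x \<partial>Lv I)"
    by (rule emeasure_density) measurable
  also have "\<dots> = (\<integral>\<^sup>+x. (\<Prod>i\<in>I. ennreal (std_normal_density (x i)) * indicator (A i) (x i)) \<partial>Lv I)"
  proof (rule nn_integral_cong)
    fix x assume "x \<in> space (Lv I)"
    then have e: "x \<in> extensional I" by (simp add: space_PiM PiE_def)
    have "(\<Prod>i\<in>I. indicator (A i) (x i) :: ennreal) = indicator (Pi\<^sub>E I A) x"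
    proof (cases "x \<in> Pi\<^sub>E I A")
      case True
      then show ?thesis by (auto simp: PiE_def Pi_iff intro!: prod.neutral)
    next
      case False
      then obtain i where "i \<in> I" "x i \<notin> A i" using e by (auto simp: PiE_def)
      then show ?thesis using False assms by (auto intro!: prod_zero bexI[of _ i])
    qed
    then show "ennreal (gauss I x) * indicator (Pi\<^sub>E I A) x =
      (\<Prod>i\<in>I. ennreal (std_normal_density (x i)) * indicator (A i) (x i))"
      by (simp add: prod.distrib gauss_eq_prod assms prod_ennreal)
  qed
  also have "\<dots> = (\<Prod>i\<in>I. \<integral>\<^sup>+x. ennreal (std_normal_density x) * indicator (A i) x \<partial>lborel)"
    using assms by (intro plb.product_nn_integral_prod) auto
  also have "\<dots> = (\<Prod>i\<in>I. emeasure std_normal (A i))"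
    by (intro prod.cong) (auto simp: emeasure_density)
  finally show "emeasure (density (Lv I) (\<lambda>x. ennreal (gauss I x))) (Pi\<^sub>E I A) = (\<Prod>i\<in>I. emeasure std_normal (A i))" .
qed

lemma nn_integral_Nv:
  assumes "finite I" "f \<in> borel_measurable (Lv I)"
  shows "(\<integral>\<^sup>+x. f x \<partial>Nv I) = (\<integral>\<^sup>+x. ennreal (gauss I x) * f x \<partial>Lv I)"
  unfolding Nv_eq_density[OF assms(1)] using assms by (intro nn_integral_density) auto

section \<open>The density of a Student vector\<close>

definition norm_on :: "nat set \<Rightarrow> (nat \<Rightarrow> real) \<Rightarrow> real" where
  "norm_on J y = sqrt (\<Sum>l\<in>J. (y l)\<^sup>2)"

text \<open>A multivariate Student vector: \<open>d\<close> Gaussians divided by the norm of \<open>\<nu>\<close> further ones.\<close>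

definition student :: "nat \<Rightarrow> nat \<Rightarrow> (nat \<Rightarrow> real) \<Rightarrow> nat \<Rightarrow> real" where
  "student d \<nu> x = (\<lambda>i\<in>{..<d}. x i / norm_on {d..<d + \<nu>} x)"

text \<open>The normalising constant of the Student density, left as an integral: in the comparison
  of two densities it is a common factor.\<close>

definition student_const :: "nat \<Rightarrow> nat \<Rightarrow> ennreal" where
  "student_const d \<nu> = (\<integral>\<^sup>+y. ennreal ((1 / sqrt (2 * pi)) ^ (d + \<nu>) *
     norm_on {d..<d + \<nu>} y ^ d * exp (- (norm_on {d..<d + \<nu>} y)\<^sup>2 / 2)) \<partial>Lv {d..<d + \<nu>})"

lemma norm_on_sq: "(norm_on J y)\<^sup>2 = (\<Sum>l\<in>J. (y l)\<^sup>2)"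
  by (simp add: norm_on_def sum_nonneg)

lemma norm_on_nonneg [simp]: "0 \<le> norm_on J y"
  by (simp add: norm_on_def sum_nonneg)

lemma measurable_norm_on [measurable]: "J \<subseteq> I \<Longrightarrow> norm_on J \<in> borel_measurable (Lv I)"
  unfolding norm_on_def
  by (intro measurable_compose[OF _ borel_measurable_sqrt] borel_measurable_sum borel_measurable_power) auto

lemma norm_on_scale: "finite J \<Longrightarrow> 0 \<le> c \<Longrightarrow> norm_on J (\<lambda>i\<in>J. c * y i) = c * norm_on J y"
  by (simp add: norm_on_def power_mult_distrib sum_distrib_left[symmetric] real_sqrt_mult)

lemma measurable_sqn [measurable]: "d \<le> k \<Longrightarrow> sqn d \<in> borel_measurable (Lv {..<k})"
  unfolding sqn_def by (intro borel_measurable_sum) (auto intro!: borel_measurable_power)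

lemma measurable_psum_Lv [measurable]: "i \<le> k \<Longrightarrow> (\<lambda>t. psum t i) \<in> borel_measurable (Lv {..<k})"
  unfolding psum_def by measurable

lemma measurable_student [measurable]: "student d \<nu> \<in> Lv {..<d + \<nu>} \<rightarrow>\<^sub>M Lv {..<d}"
proof -
  have "norm_on {d..<d + \<nu>} \<in> borel_measurable (Lv {..<d + \<nu>})" by (rule measurable_norm_on) auto
  then show ?thesis unfolding student_def
    by (intro measurable_restrict) (auto intro!: borel_measurable_divide)
qed

lemma AE_norm_on_pos:
  assumes "finite J" "J \<noteq> {}"
  shows "AE y in Nv J. 0 < norm_on J y"
proof -
  obtain j where j: "j \<in> J" using assms by auto
  have "AE x in std_normal. x \<noteq> 0"
    using AE_lborel_singleton[of "0 :: real"] by (subst AE_density) auto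
  then have "AE y in Nv J. y j \<noteq> 0"
    by (rule AE_PiM_component[OF prob_space_std_normal j])
  then show ?thesis
  proof eventually_elim
    case (elim y)
    have "0 < (y j)\<^sup>2" using elim by simp
    also have "\<dots> \<le> (\<Sum>l\<in>J. (y l)\<^sup>2)" using j assms by (intro member_le_sum) auto
    finally show ?case by (simp add: norm_on_def)
  qed
qed

text \<open>Up to the constant, the density is 1 + |t|^2 to the power -(d + \<nu>) / 2. Two scalings
  prove it: for a fixed denominator block \<open>y\<close> the numerator is scaled by |y|, and after
  exchanging the integrals \<open>y\<close> is scaled by \<open>1 / psum t d\<close>, which makes
  the exponential independent of \<open>t\<close>.\<close>

lemma student_density:
  assumes f [measurable]: "f \<in> borel_measurable (Lv {..<d})" and nu: "0 < \<nu>"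
  shows "(\<integral>\<^sup>+x. f (student d \<nu> x) \<partial>Nv {..<d + \<nu>})
    = student_const d \<nu> * (\<integral>\<^sup>+t. ennreal (1 / psum t d ^ (d + \<nu>)) * f t \<partial>Lv {..<d})"
proof -
  define I J where "I = {..<d}" and "J = {d..<d + \<nu>}"
  have fin: "finite I" "finite J" and dis: "J \<inter> I = {}" and ne: "J \<noteq> {}" and cI: "card I = d" and cJ: "card J = \<nu>"
    and un: "J \<union> I = {..<d + \<nu>}"
    using nu by (auto simp: I_def J_def)
  have [measurable]: "norm_on J \<in> borel_measurable (Lv J)" "gauss I \<in> borel_measurable (Lv I)"
    "gauss J \<in> borel_measurable (Lv J)" "f \<in> borel_measurable (Lv I)"
    "(\<lambda>t. psum t d) \<in> borel_measurable (Lv I)"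
    using fin by (auto simp: I_def)
  define c where "c = 1 / sqrt (2 * pi)"
  have c: "0 < c" by (simp add: c_def)
  \<comment> \<open>The joint density of \<open>y\<close> and \<open>t\<close>; the two Gaussian
    exponents combine through \<open>(psum t d)\<^sup>2 = 1 + sqn d t\<close>.\<close>
  define K where "K y t = c ^ (d + \<nu>) * norm_on J y ^ d * exp (- ((norm_on J y)\<^sup>2 * (psum t d)\<^sup>2) / 2)" for y t
  have [measurable]: "(\<lambda>(y, t). K y t) \<in> borel_measurable (Lv J \<Otimes>\<^sub>M Lv I)"
    unfolding K_def by measurable
  have sc [measurable]: "(\<lambda>(y, x). \<lambda>i\<in>I. x i / norm_on J y) \<in> Lv J \<Otimes>\<^sub>M Lv I \<rightarrow>\<^sub>M Lv I"
    unfolding split_beta by (intro measurable_restrict) (measurable, auto)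
  note [measurable] = sc[unfolded split_beta]
  have "(\<integral>\<^sup>+x. f (student d \<nu> x) \<partial>Nv {..<d + \<nu>})
      = (\<integral>\<^sup>+y. \<integral>\<^sup>+x. f (student d \<nu> (merge J I (y, x))) \<partial>Nv I \<partial>Nv J)"
    unfolding un[symmetric]
    by (intro pnv.product_nn_integral_fold fin dis) (simp add: un)
  also have "\<dots> = (\<integral>\<^sup>+y. \<integral>\<^sup>+x. f (\<lambda>i\<in>I. x i / norm_on J y) \<partial>Nv I \<partial>Nv J)"
  proof (intro nn_integral_cong arg_cong[where f = f])
    fix y x
    have "norm_on J (merge J I (y, x)) = norm_on J y"
      using dis by (auto simp: norm_on_def intro!: sum.cong arg_cong[where f = sqrt])
    then show "student d \<nu> (merge J I (y, x)) = (\<lambda>i\<in>I. x i / norm_on J y)"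
      using dis unfolding student_def I_def[symmetric] J_def[symmetric]
      by (auto simp: fun_eq_iff merge_def)
  qed
  also have "\<dots> = (\<integral>\<^sup>+y. \<integral>\<^sup>+t. ennreal (norm_on J y ^ d * gauss I (\<lambda>i\<in>I. norm_on J y * t i)) * f t \<partial>Lv I \<partial>Nv J)"
    using AE_norm_on_pos[OF fin(2) ne]
  proof (intro nn_integral_cong_AE, eventually_elim)
    case (elim y)
    have [measurable]: "(\<lambda>x. \<lambda>i\<in>I. x i / norm_on J y) \<in> Lv I \<rightarrow>\<^sub>M Lv I"
      by (intro measurable_restrict) auto
    have "(\<integral>\<^sup>+x. f (\<lambda>i\<in>I. x i / norm_on J y) \<partial>Nv I)
        = (\<integral>\<^sup>+x. ennreal (gauss I x) * f (\<lambda>i\<in>I. x i / norm_on J y) \<partial>Lv I)"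
      by (intro nn_integral_Nv fin) measurable
    also have "\<dots> = ennreal (norm_on J y ^ card I) * (\<integral>\<^sup>+t. ennreal (gauss I (\<lambda>i\<in>I. norm_on J y * t i)) *
        f (\<lambda>i\<in>I. (\<lambda>i\<in>I. norm_on J y * t i) i / norm_on J y) \<partial>Lv I)"
      by (intro nn_integral_scale_coords fin elim) measurable
    also have "(\<integral>\<^sup>+t. ennreal (gauss I (\<lambda>i\<in>I. norm_on J y * t i)) *
        f (\<lambda>i\<in>I. (\<lambda>i\<in>I. norm_on J y * t i) i / norm_on J y) \<partial>Lv I)
        = (\<integral>\<^sup>+t. ennreal (gauss I (\<lambda>i\<in>I. norm_on J y * t i)) * f t \<partial>Lv I)"
    proof (intro nn_integral_cong)
      fix t assume "t \<in> space (Lv I)"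
      then have "(\<lambda>i\<in>I. (\<lambda>i\<in>I. norm_on J y * t i) i / norm_on J y) = t"
        using elim by (auto simp: fun_eq_iff space_PiM PiE_def extensional_def)
      then show "ennreal (gauss I (\<lambda>i\<in>I. norm_on J y * t i)) * f (\<lambda>i\<in>I. (\<lambda>i\<in>I. norm_on J y * t i) i / norm_on J y)
        = ennreal (gauss I (\<lambda>i\<in>I. norm_on J y * t i)) * f t" by simp
    qed
    also have "ennreal (norm_on J y ^ card I) * \<dots> = (\<integral>\<^sup>+t. ennreal (norm_on J y ^ d * gauss I (\<lambda>i\<in>I. norm_on J y * t i)) * f t \<partial>Lv I)"
      unfolding cI
    proof (subst nn_integral_cmult[symmetric])
      have [measurable]: "(\<lambda>t. \<lambda>i\<in>I. norm_on J y * t i) \<in> Lv I \<rightarrow>\<^sub>M Lv I"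
        by (intro measurable_restrict) auto
      show "(\<lambda>t. ennreal (gauss I (\<lambda>i\<in>I. norm_on J y * t i)) * f t) \<in> borel_measurable (Lv I)" by measurable
    qed (simp add: ennreal_mult mult.assoc)
    finally show ?case .
  qed
  also have "\<dots> = (\<integral>\<^sup>+y. ennreal (gauss J y) * (\<integral>\<^sup>+t. ennreal (norm_on J y ^ d * gauss I (\<lambda>i\<in>I. norm_on J y * t i)) * f t \<partial>Lv I) \<partial>Lv J)"
  proof (intro nn_integral_Nv fin)
    have [measurable]: "(\<lambda>p. \<lambda>i\<in>I. norm_on J (fst p) * snd p i) \<in> Lv J \<Otimes>\<^sub>M Lv I \<rightarrow>\<^sub>M Lv I"
      by (intro measurable_restrict) (measurable, auto)
    show "(\<lambda>y. \<integral>\<^sup>+t. ennreal (norm_on J y ^ d * gauss I (\<lambda>i\<in>I. norm_on J y * t i)) * f t \<partial>Lv I) \<in> borel_measurable (Lv J)"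
      unfolding split_beta
      by (intro sigma_finite_measure.borel_measurable_nn_integral[OF plb.sigma_finite[OF fin(1)]]) (unfold split_beta, measurable)
  qed
  also have "\<dots> = (\<integral>\<^sup>+y. \<integral>\<^sup>+t. ennreal (K y t) * f t \<partial>Lv I \<partial>Lv J)"
  proof (intro nn_integral_cong)
    fix y
    have [measurable]: "(\<lambda>t. \<lambda>i\<in>I. norm_on J y * t i) \<in> Lv I \<rightarrow>\<^sub>M Lv I"
      by (intro measurable_restrict) auto
    have e: "gauss J y * (norm_on J y ^ d * gauss I (\<lambda>i\<in>I. norm_on J y * t i)) = K y t" for t
    proof -
      have "(\<Sum>i\<in>I. ((\<lambda>i\<in>I. norm_on J y * t i) i)\<^sup>2) = (norm_on J y)\<^sup>2 * sqn d t"
        by (simp add: power_mult_distrib sum_distrib_left sqn_def I_def)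
      then have "gauss I (\<lambda>i\<in>I. norm_on J y * t i) = c ^ d * exp (- ((norm_on J y)\<^sup>2 * sqn d t) / 2)"
        unfolding gauss_def cI c_def by simp
      moreover have "gauss J y = c ^ \<nu> * exp (- (norm_on J y)\<^sup>2 / 2)"
        unfolding gauss_def cJ c_def norm_on_sq ..
      moreover have "exp (- (norm_on J y)\<^sup>2 / 2) * exp (- ((norm_on J y)\<^sup>2 * sqn d t) / 2)
        = exp (- ((norm_on J y)\<^sup>2 * (psum t d)\<^sup>2) / 2)"
        unfolding psum_sq exp_add[symmetric] by (simp add: field_simps)
      ultimately show ?thesis
        unfolding K_def by (simp add: power_add)
    qed
    have "ennreal (gauss J y) * (\<integral>\<^sup>+t. ennreal (norm_on J y ^ d * gauss I (\<lambda>i\<in>I. norm_on J y * t i)) * f t \<partial>Lv I)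
      = (\<integral>\<^sup>+t. ennreal (gauss J y) * (ennreal (norm_on J y ^ d * gauss I (\<lambda>i\<in>I. norm_on J y * t i)) * f t) \<partial>Lv I)"
      by (intro nn_integral_cmult[symmetric]) measurable
    then show "ennreal (gauss J y) * (\<integral>\<^sup>+t. ennreal (norm_on J y ^ d * gauss I (\<lambda>i\<in>I. norm_on J y * t i)) * f t \<partial>Lv I)
      = (\<integral>\<^sup>+t. ennreal (K y t) * f t \<partial>Lv I)"
      by (simp add: e[symmetric] ennreal_mult mult.assoc)
  qed
  also have "\<dots> = (\<integral>\<^sup>+t. \<integral>\<^sup>+y. ennreal (K y t) * f t \<partial>Lv J \<partial>Lv I)"
    by (intro pair_sigma_finite.Fubini' pair_sigma_finite.intro plb.sigma_finite fin) measurable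
  also have "\<dots> = (\<integral>\<^sup>+t. student_const d \<nu> * (ennreal (1 / psum t d ^ (d + \<nu>)) * f t) \<partial>Lv I)"
  proof (intro nn_integral_cong)
    fix t assume [measurable]: "t \<in> space (Lv I)"
    \<comment> \<open>The substitution contributes \<open>s ^ \<nu>\<close> from the volume and
      \<open>s ^ d\<close> from the factor \<open>norm_on J y ^ d\<close>; their product is the
      Student kernel.\<close>
    define s where "s = 1 / psum t d"
    have s: "0 < s" by (simp add: s_def)
    have "(\<integral>\<^sup>+y. ennreal (K y t) * f t \<partial>Lv J) = (\<integral>\<^sup>+y. ennreal (K y t) \<partial>Lv J) * f t"
      by (rule nn_integral_multc) measurable
    also have "(\<integral>\<^sup>+y. ennreal (K y t) \<partial>Lv J) = ennreal (s ^ card J) * (\<integral>\<^sup>+y. ennreal (K (\<lambda>i\<in>J. s * y i) t) \<partial>Lv J)"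
      by (intro nn_integral_scale_coords fin s) measurable
    also have "(\<integral>\<^sup>+y. ennreal (K (\<lambda>i\<in>J. s * y i) t) \<partial>Lv J) = (\<integral>\<^sup>+y. ennreal (s ^ d) *
        ennreal (c ^ (d + \<nu>) * norm_on J y ^ d * exp (- (norm_on J y)\<^sup>2 / 2)) \<partial>Lv J)"
    proof (intro nn_integral_cong)
      fix y
      have "K (\<lambda>i\<in>J. s * y i) t = s ^ d * (c ^ (d + \<nu>) * norm_on J y ^ d * exp (- (norm_on J y)\<^sup>2 / 2))"
        using s unfolding K_def norm_on_scale[OF fin(2) less_imp_le[OF s]]
        by (simp add: power_mult_distrib s_def power_divide)
      then show "ennreal (K (\<lambda>i\<in>J. s * y i) t) =
        ennreal (s ^ d) * ennreal (c ^ (d + \<nu>) * norm_on J y ^ d * exp (- (norm_on J y)\<^sup>2 / 2))"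
        using s by (simp add: ennreal_mult')
    qed
    also have "\<dots> = ennreal (s ^ d) * student_const d \<nu>"
      unfolding student_const_def J_def[symmetric] c_def[symmetric]
      by (rule nn_integral_cmult) measurable
    finally have "(\<integral>\<^sup>+y. ennreal (K y t) * f t \<partial>Lv J)
      = (ennreal (s ^ \<nu>) * ennreal (s ^ d)) * student_const d \<nu> * f t" by (simp add: cJ mult.assoc)
    also have "ennreal (s ^ \<nu>) * ennreal (s ^ d) = ennreal (1 / psum t d ^ (d + \<nu>))"
    proof -
      have "1 / psum t d ^ (d + \<nu>) = s ^ \<nu> * s ^ d"
        by (simp add: s_def power_add power_divide)
      then show ?thesis using s by (simp add: ennreal_mult')
    qed
    finally show "(\<integral>\<^sup>+y. ennreal (K y t) * f t \<partial>Lv J) = student_const d \<nu> * (ennreal (1 / psum t d ^ (d + \<nu>)) * f t)"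
      by (simp add: mult_ac)
  qed
  also have "\<dots> = student_const d \<nu> * (\<integral>\<^sup>+t. ennreal (1 / psum t d ^ (d + \<nu>)) * f t \<partial>Lv I)"
    by (rule nn_integral_cmult) measurable
  finally show ?thesis by (simp add: I_def)
qed

section \<open>The noise matrix\<close>

lemma measurable_Lv_component: "i \<in> I \<Longrightarrow> (\<lambda>x. x i) \<in> borel_measurable (Lv I)"
  by simp

lemma fsub_cong_mat:
  assumes "\<And>i l. i < d \<Longrightarrow> l < d \<Longrightarrow> C i l = C' i l" "\<And>i. i < d \<Longrightarrow> a i = b i" "i < d"
  shows "fsub C a i = fsub C' b i"
  using assms(3)
proof (induction i rule: less_induct)
  case (less i)
  have "(\<Sum>l<i. C i l * fsub C a l) = (\<Sum>l<i. C' i l * fsub C' b l)"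
    using less assms(1) by (intro sum.cong) auto
  then show ?case using less assms by (simp add: fsub.simps[of _ _ i])
qed

lemma chol_step_cong:
  assumes "\<And>i l. i < d \<Longrightarrow> l < d \<Longrightarrow> C i l = C' i l" "\<And>i. i < d \<Longrightarrow> t i = t' i" "i < d" "l < d"
  shows "chol_step d C t i l = chol_step d C' t' i l"
proof -
  have p: "psum t j = psum t' j" if "j \<le> d" for j
    unfolding psum_def using that assms(2) by (simp add: sqn_cong[of j t t'])
  have "upd_factor t j l = upd_factor t' j l" if "j < d" for j
    using that assms p by (simp add: upd_factor_def)
  then show ?thesis using assms by (simp add: chol_step_def)
qed

lemma cfac_cong:
  assumes "\<And>j i. j < r \<Longrightarrow> i < d \<Longrightarrow> a j i = b j i" "i < d" "l < d"
  shows "cfac d a r i l = cfac d b r i l"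
  using assms
proof (induction r arbitrary: i l)
  case (Suc r)
  have IH: "\<And>i l. i < d \<Longrightarrow> l < d \<Longrightarrow> cfac d a r i l = cfac d b r i l"
    using Suc by auto
  have "fsub (cfac d a r) (a r) i = fsub (cfac d b r) (b r) i" if "i < d" for i
    using IH Suc.prems that by (intro fsub_cong_mat[where d = d]) auto
  then show ?case using IH Suc.prems by (auto intro!: chol_step_cong)
qed auto

text \<open>The same factors, driven by the Student vectors \<open>\<tau>\<close> instead of the
  columns. The sampler and the moment bounds use this form; \<open>gfac_eq_cfac\<close> links it to
  \<open>cfac\<close>, in which the density is written.\<close>

primrec gfac :: "nat \<Rightarrow> (nat \<Rightarrow> nat \<Rightarrow> real) \<Rightarrow> nat \<Rightarrow> nat \<Rightarrow> nat \<Rightarrow> real" where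
  "gfac d \<tau> 0 = idm"
| "gfac d \<tau> (Suc r) = chol_step d (gfac d \<tau> r) (\<tau> r)"

definition gcol :: "nat \<Rightarrow> (nat \<Rightarrow> nat \<Rightarrow> real) \<Rightarrow> nat \<Rightarrow> nat \<Rightarrow> real" where
  "gcol d \<tau> j = mvec d (gfac d \<tau> j) (\<tau> j)"

lemma lower_tri_gfac: "lower_tri d (gfac d \<tau> r)"
  by (induction r) (auto simp: lower_tri_idm lower_tri_chol_step)

lemma gfac_cong:
  assumes "\<And>j i. j < r \<Longrightarrow> i < d \<Longrightarrow> \<tau> j i = \<tau>' j i" "i < d" "l < d"
  shows "gfac d \<tau> r i l = gfac d \<tau>' r i l"
  using assms
proof (induction r arbitrary: i l)
  case (Suc r)
  then show ?case by (auto intro!: chol_step_cong)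
qed auto

lemma gcol_cong:
  assumes "\<And>j i. j \<le> r \<Longrightarrow> i < d \<Longrightarrow> \<tau> j i = \<tau>' j i" "i < d"
  shows "gcol d \<tau> r i = gcol d \<tau>' r i"
  unfolding gcol_def mvec_def
  using assms gfac_cong[of r d \<tau> \<tau>'] by (intro sum.cong) auto

text \<open>Forward substitution in the column \<open>gcol d \<tau> r\<close> returns
  \<open>\<tau> r\<close>, so both recursions take the same step.\<close>

lemma gfac_eq_cfac:
  assumes "\<And>j i. j < r \<Longrightarrow> i < d \<Longrightarrow> a j i = gcol d \<tau> j i" "i < d" "l < d"
  shows "gfac d \<tau> r i l = cfac d a r i l"
  using assms
proof (induction r arbitrary: i l)
  case (Suc r)
  have IH: "\<And>i l. i < d \<Longrightarrow> l < d \<Longrightarrow> gfac d \<tau> r i l = cfac d a r i l"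
    using Suc by auto
  have "fsub (cfac d a r) (a r) i = fsub (gfac d \<tau> r) (mvec d (gfac d \<tau> r) (\<tau> r)) i" if "i < d" for i
    using IH Suc.prems that by (intro fsub_cong_mat[where d = d]) (auto simp: gcol_def)
  then have "fsub (cfac d a r) (a r) i = \<tau> r i" if "i < d" for i
    using that by (simp add: fsub_mvec lower_tri_gfac)
  then show ?case using IH Suc.prems by (auto intro!: chol_step_cong)
qed auto

lemma measurable_fsub:
  assumes "\<And>i l. i < d \<Longrightarrow> l < d \<Longrightarrow> (\<lambda>x. C x i l) \<in> borel_measurable M"
    and "\<And>i. i < d \<Longrightarrow> (\<lambda>x. a x i) \<in> borel_measurable M" "i < d"
  shows "(\<lambda>x. fsub (C x) (a x) i) \<in> borel_measurable M"
  using assms(3)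
proof (induction i rule: less_induct)
  case (less i)
  then show ?case
    unfolding fsub.simps[of _ _ i] using assms
    by (intro borel_measurable_divide borel_measurable_diff borel_measurable_sum borel_measurable_times) auto
qed

lemma measurable_psum:
  assumes "\<And>i. i < d \<Longrightarrow> (\<lambda>x. t x i) \<in> borel_measurable M" "i \<le> d"
  shows "(\<lambda>x. psum (t x) i) \<in> borel_measurable M"
  unfolding psum_def sqn_def using assms
  by (intro measurable_compose[OF _ borel_measurable_sqrt] borel_measurable_add borel_measurable_sum
      borel_measurable_power) auto

lemma measurable_chol_step:
  assumes "\<And>i l. i < d \<Longrightarrow> l < d \<Longrightarrow> (\<lambda>x. C x i l) \<in> borel_measurable M"
    and t: "\<And>i. i < d \<Longrightarrow> (\<lambda>x. t x i) \<in> borel_measurable M" and "i < d" "l < d"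
  shows "(\<lambda>x. chol_step d (C x) (t x) i l) \<in> borel_measurable M"
proof -
  have "(\<lambda>x. upd_factor (t x) j l) \<in> borel_measurable M" if "j < d" for j
  proof -
    have [measurable]: "(\<lambda>x. psum (t x) l) \<in> borel_measurable M" "(\<lambda>x. psum (t x) (Suc l)) \<in> borel_measurable M"
      "(\<lambda>x. t x j) \<in> borel_measurable M" "(\<lambda>x. t x l) \<in> borel_measurable M"
      using \<open>l < d\<close> that t by (auto intro!: measurable_psum[OF t])
    show ?thesis unfolding upd_factor_def by measurable
  qed
  then show ?thesis unfolding chol_step_def using assms
    by (intro borel_measurable_sum borel_measurable_times) auto
qed

lemma measurable_cfac:
  assumes "\<And>j i. j < r \<Longrightarrow> i < d \<Longrightarrow> (\<lambda>x. a x j i) \<in> borel_measurable M" "i < d" "l < d"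
  shows "(\<lambda>x. cfac d (a x) r i l) \<in> borel_measurable M"
  using assms
proof (induction r arbitrary: i l)
  case (Suc r)
  show ?case unfolding cfac.simps
    by (rule measurable_chol_step[OF _ measurable_fsub[where d = d]]) (use Suc in auto)
qed auto

lemma measurable_gfac:
  assumes "\<And>j i. j < r \<Longrightarrow> i < d \<Longrightarrow> (\<lambda>x. \<tau> x j i) \<in> borel_measurable M" "i < d" "l < d"
  shows "(\<lambda>x. gfac d (\<tau> x) r i l) \<in> borel_measurable M"
  using assms
proof (induction r arbitrary: i l)
  case (Suc r)
  show ?case unfolding gfac.simps
    by (rule measurable_chol_step) (use Suc in auto)
qed auto

lemma measurable_gcol:
  assumes "\<And>j i. j \<le> r \<Longrightarrow> i < d \<Longrightarrow> (\<lambda>x. \<tau> x j i) \<in> borel_measurable M" "i < d"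
  shows "(\<lambda>x. gcol d (\<tau> x) r i) \<in> borel_measurable M"
  unfolding gcol_def mvec_def using assms
  by (intro borel_measurable_sum borel_measurable_times measurable_gfac) auto

section \<open>The density of the noise matrix\<close>

definition cdet :: "nat \<Rightarrow> (nat \<Rightarrow> nat \<Rightarrow> real) \<Rightarrow> nat \<Rightarrow> real" where
  "cdet d a r = diag_prod d (cfac d a r)"

text \<open>One factor per column. Substituting \<open>a j\<close> = C t divides by
  \<open>cdet d a j\<close>, and the Student kernel is the power \<open>- e\<close> of
  \<open>psum t d\<close>, which is the quotient of \<open>cdet d a (Suc j)\<close> by
  \<open>cdet d a j\<close>.\<close>

definition noise_density :: "nat \<Rightarrow> nat \<Rightarrow> nat \<Rightarrow> (nat \<Rightarrow> nat \<Rightarrow> real) \<Rightarrow> real" where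
  "noise_density d e r a = (\<Prod>j<r. cdet d a j ^ (e - 1) / cdet d a (Suc j) ^ e)"

lemma cdet_pos [simp]: "0 < cdet d a r"
  by (simp add: cdet_def diag_prod_pos lower_tri_cfac)

lemma cdet_cong:
  assumes "\<And>j i. j < r \<Longrightarrow> i < d \<Longrightarrow> a j i = b j i"
  shows "cdet d a r = cdet d b r"
  unfolding cdet_def diag_prod_def using assms by (intro prod.cong) (auto intro: cfac_cong)

lemma measurable_cdet:
  assumes "\<And>j i. j < r \<Longrightarrow> i < d \<Longrightarrow> (\<lambda>x. a x j i) \<in> borel_measurable M"
  shows "(\<lambda>x. cdet d (a x) r) \<in> borel_measurable M"
  unfolding cdet_def diag_prod_def using assms by (intro borel_measurable_prod measurable_cfac) auto

lemma measurable_noise_density: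
  assumes "\<And>j i. j < r \<Longrightarrow> i < d \<Longrightarrow> (\<lambda>x. a x j i) \<in> borel_measurable M"
  shows "(\<lambda>x. noise_density d e r (a x)) \<in> borel_measurable M"
  unfolding noise_density_def using assms
  by (intro borel_measurable_prod borel_measurable_divide borel_measurable_power measurable_cdet) auto

lemma noise_density_pos: "0 < noise_density d e r a"
  unfolding noise_density_def by (intro prod_pos) auto

text \<open>The numerator of each factor cancels all but one power of the denominator of the factor
  before. Only the last determinant keeps the power \<open>e\<close>, so a shift acts on
  \<open>e + r\<close> powers in total and not on a number of order \<open>e * r\<close>.\<close>

lemma noise_density_eq:
  assumes "0 < e"
  shows "noise_density d e (Suc r) a = (1 / cdet d a (Suc r) ^ e) * (\<Prod>j\<in>{1..r}. 1 / cdet d a j)"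
proof (induction r)
  case 0
  then show ?case by (simp add: noise_density_def cdet_def diag_prod_def idm_def)
next
  case (Suc r)
  let ?D = "cdet d a"
  have "noise_density d e (Suc (Suc r)) a = noise_density d e (Suc r) a * (?D (Suc r) ^ (e - 1) / ?D (Suc (Suc r)) ^ e)"
    by (simp add: noise_density_def)
  also have "\<dots> = (1 / ?D (Suc r) ^ e * ?D (Suc r) ^ (e - 1)) * (\<Prod>j\<in>{1..r}. 1 / ?D j) * (1 / ?D (Suc (Suc r)) ^ e)"
    unfolding Suc by simp
  also have "1 / ?D (Suc r) ^ e * ?D (Suc r) ^ (e - 1) = 1 / ?D (Suc r)"
  proof -
    have "?D (Suc r) ^ e = ?D (Suc r) * ?D (Suc r) ^ (e - 1)"
      using assms by (cases e) auto
    then show ?thesis by simp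
  qed
  finally show ?case by (simp add: prod.nat_ivl_Suc' mult_ac)
qed

lemma noise_density_shift:
  assumes e: "0 < e" and r: "0 < r" "r \<le> d"
    and v: "(\<Sum>j<r. (v j)\<^sup>2) \<le> \<beta>" and u: "sqn d u \<le> \<beta>"
    and a': "\<And>j i. j < r \<Longrightarrow> i < d \<Longrightarrow> a' j i = a j i + v j * u i"
  shows "noise_density d e r a \<le> exp (3 / 2 * \<beta> * real (e + d)) * noise_density d e r a'"
proof -
  obtain k where k: "r = Suc k" using r by (cases r) auto
  define E where "E = exp (3 / 2 * \<beta>)"
  have b: "0 \<le> \<beta>" using u sqn_nonneg[of d u] by linarith
  have E1: "1 \<le> E" by (simp add: E_def b)
  \<comment> \<open>Initial segments of \<open>v\<close> satisfy the same bound, so the rank-one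
    estimate holds at every stage \<open>j\<close>.\<close>
  have D: "1 / cdet d a j \<le> E * (1 / cdet d a' j)" if "j \<le> r" for j
  proof -
    have "(\<Sum>j<j. (v j)\<^sup>2) \<le> (\<Sum>j<r. (v j)\<^sup>2)" using that by (intro sum_mono2) auto
    then have "cdet d a' j \<le> cdet d a j * E"
      unfolding cdet_def E_def using that v u a' by (intro diag_prod_rank_one_shift[where v = v and u = u]) auto
    then show ?thesis using cdet_pos[of d a j] cdet_pos[of d a' j] by (simp add: field_simps)
  qed
  have "noise_density d e r a = (1 / cdet d a r) ^ e * (\<Prod>j\<in>{1..k}. 1 / cdet d a j)"
    unfolding k noise_density_eq[OF e] by (simp add: power_divide)
  also have "\<dots> \<le> (E * (1 / cdet d a' r)) ^ e * (\<Prod>j\<in>{1..k}. E * (1 / cdet d a' j))"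
    using D k E1 by (intro mult_mono power_mono prod_mono prod_nonneg) (auto simp: less_imp_le)
  also have "\<dots> = E ^ (e + k) * noise_density d e r a'"
    unfolding k noise_density_eq[OF e] prod.distrib power_mult_distrib
    by (simp add: power_divide power_add)
  also have "\<dots> \<le> E ^ (e + d) * noise_density d e r a'"
    using E1 k r less_imp_le[OF noise_density_pos] by (intro mult_right_mono power_increasing) auto
  also have "E ^ (e + d) = exp (3 / 2 * \<beta> * real (e + d))"
    by (simp add: E_def mult.commute flip: exp_of_nat_mult)
  finally show ?thesis .
qed

abbreviation LLv :: "nat \<Rightarrow> nat \<Rightarrow> (nat \<Rightarrow> nat \<Rightarrow> real) measure" where
  "LLv r d \<equiv> Pi\<^sub>M {..<r} (\<lambda>_. Lv {..<d})"

abbreviation NNv :: "nat \<Rightarrow> nat \<Rightarrow> (nat \<Rightarrow> nat \<Rightarrow> real) measure" where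
  "NNv r q \<equiv> Pi\<^sub>M {..<r} (\<lambda>_. Nv {..<q})"

definition noise_cols :: "nat \<Rightarrow> nat \<Rightarrow> nat \<Rightarrow> (nat \<Rightarrow> nat \<Rightarrow> real) \<Rightarrow> nat \<Rightarrow> nat \<Rightarrow> real" where
  "noise_cols d \<nu> r x = (\<lambda>j\<in>{..<r}. \<lambda>i\<in>{..<d}. gcol d (\<lambda>j. student d \<nu> (x j)) j i)"

interpretation pll: product_sigma_finite "\<lambda>_::'i. Lv {..<d}" for d
  by (simp add: product_sigma_finite_def plb.sigma_finite)

lemma prob_space_Nv: "prob_space (Nv I)"
  by (rule prob_space_PiM) (rule prob_space_std_normal)

interpretation pnn: product_sigma_finite "\<lambda>_::'i. Nv {..<q}" for q
  by (simp add: product_sigma_finite_def prob_space_Nv prob_space_imp_sigma_finite)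

lemma measurable_LLv_component:
  "j < r \<Longrightarrow> i < d \<Longrightarrow> (\<lambda>a. a j i) \<in> borel_measurable (LLv r d)"
  by (rule measurable_compose[OF measurable_component_singleton[of j]]) auto

lemma measurable_student_component:
  "i < d \<Longrightarrow> (\<lambda>x. student d \<nu> x i) \<in> borel_measurable (Nv {..<d + \<nu>})"
  using measurable_compose[OF measurable_student measurable_component_singleton[of i]] by (simp add: sets_Nv cong: measurable_cong_sets)

lemma measurable_noise_cols [measurable]: "noise_cols d \<nu> r \<in> NNv r (d + \<nu>) \<rightarrow>\<^sub>M LLv r d"
  unfolding noise_cols_def
proof (intro measurable_restrict)
  fix j i assume ji: "j \<in> {..<r}" "i \<in> {..<d}"
  have "(\<lambda>x. gcol d (\<lambda>j. student d \<nu> (x j)) j i) \<in> borel_measurable (NNv r (d + \<nu>))"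
  proof (rule measurable_gcol)
    fix j' i assume "j' \<le> j" "i < d"
    then show "(\<lambda>x. student d \<nu> (x j') i) \<in> borel_measurable (NNv r (d + \<nu>))"
      using ji by (intro measurable_compose[OF measurable_component_singleton[of j'] measurable_student_component]) auto
  qed (use ji in auto)
  then show "(\<lambda>x. gcol d (\<lambda>j. student d \<nu> (x j)) j i) \<in> NNv r (d + \<nu>) \<rightarrow>\<^sub>M lborel" by simp
qed

text \<open>One column with its predecessors fixed: the triangular substitution a = C t in the
  Student density, rewritten so that only determinants of Cholesky factors appear.\<close>

lemma student_column_density:
  assumes C: "lower_tri d C" and f [measurable]: "f \<in> borel_measurable (Lv {..<d})" and nu: "0 < \<nu>"
  shows "(\<integral>\<^sup>+z. f (\<lambda>i\<in>{..<d}. mvec d C (student d \<nu> z) i) \<partial>Nv {..<d + \<nu>})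
    = student_const d \<nu> * (\<integral>\<^sup>+a. ennreal (diag_prod d C ^ (d + \<nu> - 1) / diag_prod d (chol_step d C (fsub C a)) ^ (d + \<nu>)) * f a \<partial>Lv {..<d})"
proof -
  define e where "e = d + \<nu>"
  define D where "D = diag_prod d C"
  have D: "0 < D" using C by (simp add: D_def diag_prod_pos)
  have e: "0 < e" using nu by (simp add: e_def)
  let ?L = "\<lambda>t. \<lambda>i\<in>{..<d}. C i i * t i + (\<Sum>l<i. C i l * t l)"
  have Ceq: "(\<lambda>i\<in>{..<d}. mvec d C t i) = ?L t" for t
    by (auto simp: fun_eq_iff mvec_lower_tri[OF C])
  have L [measurable]: "(\<lambda>t. \<lambda>i\<in>{..<d}. mvec d C t i) \<in> Lv {..<d} \<rightarrow>\<^sub>M Lv {..<d}"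
    unfolding mvec_def
    by (intro measurable_restrict) (auto intro!: borel_measurable_sum borel_measurable_times measurable_Lv_component)
  have [measurable]: "(\<lambda>a. psum (fsub C a) d) \<in> borel_measurable (Lv {..<d})"
    by (intro measurable_psum[where d = d] measurable_fsub[where d = d]) (auto intro: measurable_Lv_component)
  have "(\<integral>\<^sup>+z. f (\<lambda>i\<in>{..<d}. mvec d C (student d \<nu> z) i) \<partial>Nv {..<d + \<nu>})
      = student_const d \<nu> * (\<integral>\<^sup>+t. ennreal (1 / psum t d ^ e) * f (\<lambda>i\<in>{..<d}. mvec d C t i) \<partial>Lv {..<d})"
    unfolding e_def by (rule student_density[OF _ nu]) measurable
  also have "(\<integral>\<^sup>+t. ennreal (1 / psum t d ^ e) * f (\<lambda>i\<in>{..<d}. mvec d C t i) \<partial>Lv {..<d})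
     = ennreal (1 / D) * (ennreal D * (\<integral>\<^sup>+t. ennreal (1 / psum t d ^ e) * f (\<lambda>i\<in>{..<d}. mvec d C t i) \<partial>Lv {..<d}))"
    using D by (simp add: mult.assoc[symmetric] ennreal_mult[symmetric])
  also have "ennreal D * (\<integral>\<^sup>+t. ennreal (1 / psum t d ^ e) * f (\<lambda>i\<in>{..<d}. mvec d C t i) \<partial>Lv {..<d})
     = ennreal D * (\<integral>\<^sup>+t. ennreal (1 / psum (fsub C (?L t)) d ^ e) * f (?L t) \<partial>Lv {..<d})"
  proof (rule arg_cong[where f = "\<lambda>x. ennreal D * x"], rule nn_integral_cong)
    fix t
    have "fsub C (?L t) i = t i" if "i < d" for i
      using fsub_cong[of d "?L t" "mvec d C t" i C] that by (simp add: mvec_lower_tri[OF C] fsub_mvec[OF C])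
    then have "psum (fsub C (?L t)) d = psum t d"
      unfolding psum_def using sqn_cong[of d "fsub C (?L t)" t] by simp
    then show "ennreal (1 / psum t d ^ e) * f (\<lambda>i\<in>{..<d}. mvec d C t i) = ennreal (1 / psum (fsub C (?L t)) d ^ e) * f (?L t)"
      by (simp only: Ceq)
  qed
  also have "\<dots> = (\<integral>\<^sup>+a. ennreal (1 / psum (fsub C a) d ^ e) * f a \<partial>Lv {..<d})"
    unfolding D_def
    by (intro nn_integral_triangular[symmetric]) (use C in \<open>auto simp: lower_tri_def\<close>)
  also have "ennreal (1 / D) * \<dots> = (\<integral>\<^sup>+a. ennreal (1 / D) * (ennreal (1 / psum (fsub C a) d ^ e) * f a) \<partial>Lv {..<d})"
    by (intro nn_integral_cmult[symmetric]) measurable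
  also have "\<dots> = (\<integral>\<^sup>+a. ennreal (D ^ (e - 1) / diag_prod d (chol_step d C (fsub C a)) ^ e) * f a \<partial>Lv {..<d})"
  proof (intro nn_integral_cong)
    fix a
    have De: "D ^ e = D * D ^ (e - 1)" using e by (cases e) auto
    have "D ^ (e - 1) / diag_prod d (chol_step d C (fsub C a)) ^ e = 1 / D * (1 / psum (fsub C a) d ^ e)"
      unfolding diag_prod_chol_step[OF C] D_def[symmetric] power_mult_distrib De using D by (simp add: field_simps)
    then show "ennreal (1 / D) * (ennreal (1 / psum (fsub C a) d ^ e) * f a)
      = ennreal (D ^ (e - 1) / diag_prod d (chol_step d C (fsub C a)) ^ e) * f a"
      using D ennreal_mult[of "1 / D" "1 / psum (fsub C a) d ^ e"] zero_le_power[OF less_imp_le[OF psum_pos]]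
      by (simp add: mult.assoc)
  qed
  finally show ?thesis unfolding e_def D_def .
qed

text \<open>Induction on the columns. The last Gaussian block is integrated with the earlier blocks
  fixed; these determine the factor \<open>?C\<close>, which by \<open>gfac_eq_cfac\<close> is a
  function of the columns already formed.\<close>

lemma noise_cols_density:
  assumes f: "f \<in> borel_measurable (LLv r d)" and nu: "0 < \<nu>"
  shows "(\<integral>\<^sup>+x. f (noise_cols d \<nu> r x) \<partial>NNv r (d + \<nu>))
    = student_const d \<nu> ^ r * (\<integral>\<^sup>+a. ennreal (noise_density d (d + \<nu>) r a) * f a \<partial>LLv r d)"
  using f
proof (induction r arbitrary: f)
  case 0
  then show ?case by (simp add: PiM_empty nn_integral_count_space_finite noise_density_def noise_cols_def)
next
  case (Suc r)
  define e where "e = d + \<nu>"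
  define \<kappa> where "\<kappa> = student_const d \<nu>"
  define w where "w b a = cdet d b r ^ (e - 1) / cdet d (b(r := a)) (Suc r) ^ e" for b a
  define \<Phi> where "\<Phi> b = (\<integral>\<^sup>+a. ennreal (w b a) * f (b(r := a)) \<partial>Lv {..<d})" for b
  have upd: "(\<lambda>(b, a). b(r := a)) \<in> LLv r d \<Otimes>\<^sub>M Lv {..<d} \<rightarrow>\<^sub>M LLv (Suc r) d"
    using measurable_add_dim[of r "{..<r}" "\<lambda>_. Lv {..<d}"] unfolding lessThan_Suc .
  have comp: "(\<lambda>x. ((fst x)(r := snd x)) j i) \<in> borel_measurable (LLv r d \<Otimes>\<^sub>M Lv {..<d})" if "j < Suc r" "i < d" for j i
    using measurable_compose[OF upd measurable_LLv_component[OF that]] by (simp add: split_beta)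
  have [measurable]: "(\<lambda>x. w (fst x) (snd x)) \<in> borel_measurable (LLv r d \<Otimes>\<^sub>M Lv {..<d})"
    unfolding w_def
    by (intro borel_measurable_divide borel_measurable_power measurable_cdet comp
         measurable_compose[OF measurable_fst]) (auto intro: measurable_LLv_component)
  have [measurable]: "(\<lambda>x. f ((fst x)(r := snd x))) \<in> borel_measurable (LLv r d \<Otimes>\<^sub>M Lv {..<d})"
    using measurable_compose[OF upd Suc.prems] by (simp add: split_beta del: fun_upd_apply)
  have \<Phi> [measurable]: "\<Phi> \<in> borel_measurable (LLv r d)"
    unfolding \<Phi>_def
    by (intro sigma_finite_measure.borel_measurable_nn_integral[OF plb.sigma_finite]) (unfold split_beta, auto)
  have "(\<integral>\<^sup>+x. f (noise_cols d \<nu> (Suc r) x) \<partial>NNv (Suc r) (d + \<nu>))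
      = (\<integral>\<^sup>+x. \<integral>\<^sup>+z. f (noise_cols d \<nu> (Suc r) (x(r := z))) \<partial>Nv {..<d + \<nu>} \<partial>NNv r (d + \<nu>))"
    using measurable_compose[OF measurable_noise_cols Suc.prems] unfolding lessThan_Suc
    by (intro pnn.product_nn_integral_insert) auto
  also have "\<dots> = (\<integral>\<^sup>+x. \<kappa> * \<Phi> (noise_cols d \<nu> r x) \<partial>NNv r (d + \<nu>))"
  proof (intro nn_integral_cong)
    fix x assume x: "x \<in> space (NNv r (d + \<nu>))"
    let ?b = "noise_cols d \<nu> r x"
    have b: "?b \<in> space (LLv r d)" using measurable_space[OF measurable_noise_cols x] .
    let ?C = "gfac d (\<lambda>j. student d \<nu> (x j)) r"
    have Ceq: "?C i l = cfac d ?b r i l" if "i < d" "l < d" for i l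
      by (rule gfac_eq_cfac[OF _ that]) (auto simp: noise_cols_def)
    have "(\<integral>\<^sup>+z. f (noise_cols d \<nu> (Suc r) (x(r := z))) \<partial>Nv {..<d + \<nu>})
      = (\<integral>\<^sup>+z. f (?b(r := (\<lambda>i\<in>{..<d}. mvec d ?C (student d \<nu> z) i))) \<partial>Nv {..<d + \<nu>})"
    proof (intro nn_integral_cong arg_cong[where f = f] ext)
      fix z j i
      show "noise_cols d \<nu> (Suc r) (x(r := z)) j i = (?b(r := (\<lambda>i\<in>{..<d}. mvec d ?C (student d \<nu> z) i))) j i"
      proof (cases "j = r")
        case True
        have "gcol d (\<lambda>j. student d \<nu> ((x(r := z)) j)) r i = mvec d ?C (student d \<nu> z) i" if "i < d"
          unfolding gcol_def mvec_def using that
          by (intro sum.cong arg_cong2[where f = "(*)"] gfac_cong) auto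
        then show ?thesis using True by (simp add: noise_cols_def)
      next
        case False
        have "gcol d (\<lambda>j. student d \<nu> ((x(r := z)) j)) j i = gcol d (\<lambda>j. student d \<nu> (x j)) j i" if "i < d" "j < r"
          using that by (intro gcol_cong) auto
        then show ?thesis using False by (simp add: noise_cols_def)
      qed
    qed
    also have "\<dots> = \<kappa> * (\<integral>\<^sup>+a. ennreal (diag_prod d ?C ^ (e - 1) / diag_prod d (chol_step d ?C (fsub ?C a)) ^ e) * f (?b(r := a)) \<partial>Lv {..<d})"
      unfolding \<kappa>_def e_def
    proof (rule student_column_density[OF lower_tri_gfac _ nu])
      show "(\<lambda>a. f (?b(r := a))) \<in> borel_measurable (Lv {..<d})"
        using measurable_compose[OF measurable_component_update[OF b, of r], of f] Suc.prems by (simp add: lessThan_Suc)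
    qed
    also have "(\<integral>\<^sup>+a. ennreal (diag_prod d ?C ^ (e - 1) / diag_prod d (chol_step d ?C (fsub ?C a)) ^ e) * f (?b(r := a)) \<partial>Lv {..<d}) = \<Phi> ?b"
      unfolding \<Phi>_def
    proof (intro nn_integral_cong arg_cong2[where f = "(*)"] arg_cong[where f = ennreal] refl)
      fix a
      have 1: "diag_prod d ?C = cdet d ?b r"
        unfolding cdet_def diag_prod_def by (intro prod.cong) (auto simp: Ceq)
      have C2: "?C i l = cfac d (?b(r := a)) r i l" if "i < d" "l < d" for i l
        using Ceq[OF that] cfac_cong[OF _ that, of r ?b "?b(r := a)"] by simp
      have "chol_step d ?C (fsub ?C a) i l = cfac d (?b(r := a)) (Suc r) i l" if "i < d" "l < d" for i l
        unfolding cfac.simps using that C2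
        by (intro chol_step_cong fsub_cong_mat[where d = d]) auto
      then have "diag_prod d (chol_step d ?C (fsub ?C a)) = cdet d (?b(r := a)) (Suc r)"
        unfolding cdet_def diag_prod_def by (intro prod.cong) auto
      with 1 show "diag_prod d ?C ^ (e - 1) / diag_prod d (chol_step d ?C (fsub ?C a)) ^ e = w ?b a"
        by (simp add: w_def)
    qed
    finally show "(\<integral>\<^sup>+z. f (noise_cols d \<nu> (Suc r) (x(r := z))) \<partial>Nv {..<d + \<nu>}) = \<kappa> * \<Phi> ?b" .
  qed
  also have "\<dots> = \<kappa> * (\<integral>\<^sup>+x. \<Phi> (noise_cols d \<nu> r x) \<partial>NNv r (d + \<nu>))"
    by (intro nn_integral_cmult) measurable
  also have "\<dots> = \<kappa> * (\<kappa> ^ r * (\<integral>\<^sup>+b. ennreal (noise_density d e r b) * \<Phi> b \<partial>LLv r d))"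
    unfolding \<kappa>_def e_def by (simp add: Suc.IH[OF \<Phi>])
  also have "(\<integral>\<^sup>+b. ennreal (noise_density d e r b) * \<Phi> b \<partial>LLv r d)
      = (\<integral>\<^sup>+b. \<integral>\<^sup>+a. ennreal (noise_density d e (Suc r) (b(r := a))) * f (b(r := a)) \<partial>Lv {..<d} \<partial>LLv r d)"
  proof (intro nn_integral_cong)
    fix b assume b [measurable]: "b \<in> space (LLv r d)"
    have [measurable]: "(\<lambda>a. w b a) \<in> borel_measurable (Lv {..<d})" "(\<lambda>a. f (b(r := a))) \<in> borel_measurable (Lv {..<d})"
      using measurable_compose[OF measurable_Pair1'[OF b], of "\<lambda>x. w (fst x) (snd x)" "Lv {..<d}" borel]
        measurable_compose[OF measurable_Pair1'[OF b], of "\<lambda>x. f ((fst x)(r := snd x))" "Lv {..<d}" borel] by simp_all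
    have "ennreal (noise_density d e r b) * \<Phi> b = (\<integral>\<^sup>+a. ennreal (noise_density d e r b) * (ennreal (w b a) * f (b(r := a))) \<partial>Lv {..<d})"
      unfolding \<Phi>_def by (intro nn_integral_cmult[symmetric]) measurable
    also have "\<dots> = (\<integral>\<^sup>+a. ennreal (noise_density d e (Suc r) (b(r := a))) * f (b(r := a)) \<partial>Lv {..<d})"
    proof (intro nn_integral_cong)
      fix a
      have c: "cdet d (b(r := a)) j = cdet d b j" if "j \<le> r" for j
        by (rule cdet_cong) (use that in auto)
      have "noise_density d e (Suc r) (b(r := a)) = noise_density d e r b * w b a"
        unfolding noise_density_def w_def by (auto simp: c intro!: prod.cong)
      then show "ennreal (noise_density d e r b) * (ennreal (w b a) * f (b(r := a)))
        = ennreal (noise_density d e (Suc r) (b(r := a))) * f (b(r := a))"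
        by (simp add: ennreal_mult' less_imp_le[OF noise_density_pos] mult.assoc)
    qed
    finally show "ennreal (noise_density d e r b) * \<Phi> b = \<dots>" .
  qed
  also have "\<dots> = (\<integral>\<^sup>+a. ennreal (noise_density d e (Suc r) a) * f a \<partial>LLv (Suc r) d)"
  proof -
    have "(\<lambda>a. ennreal (noise_density d e (Suc r) a) * f a) \<in> borel_measurable (LLv (Suc r) d)"
      by (intro borel_measurable_times_ennreal Suc.prems measurable_compose[OF measurable_noise_density measurable_ennreal]
           measurable_LLv_component)
    then show ?thesis unfolding lessThan_Suc
      by (intro pll.product_nn_integral_insert[symmetric]) auto
  qed
  finally show ?case by (simp add: \<kappa>_def e_def mult.assoc)
qed

section \<open>Translations and the shift inequality for the noise\<close>

lemma distr_PiM_coordinatewise: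
  assumes M: "product_sigma_finite M" and N: "product_sigma_finite N" and I: "finite I"
    and f: "\<And>i. i \<in> I \<Longrightarrow> f i \<in> M i \<rightarrow>\<^sub>M N i" "\<And>i. i \<in> I \<Longrightarrow> distr (M i) (N i) (f i) = N i"
  shows "distr (Pi\<^sub>M I M) (Pi\<^sub>M I N) (\<lambda>x. \<lambda>i\<in>I. f i (x i)) = Pi\<^sub>M I N"
proof (rule product_sigma_finite.PiM_eqI[OF N I])
  interpret product_sigma_finite M by (rule M)
  have meas: "(\<lambda>x. \<lambda>i\<in>I. f i (x i)) \<in> Pi\<^sub>M I M \<rightarrow>\<^sub>M Pi\<^sub>M I N"
    using f by (intro measurable_restrict measurable_compose[OF measurable_component_singleton]) auto
  fix A assume A: "\<And>i. i \<in> I \<Longrightarrow> A i \<in> sets (N i)"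
  let ?B = "\<lambda>i. f i -` A i \<inter> space (M i)"
  have "emeasure (distr (Pi\<^sub>M I M) (Pi\<^sub>M I N) (\<lambda>x. \<lambda>i\<in>I. f i (x i))) (Pi\<^sub>E I A)
    = emeasure (Pi\<^sub>M I M) ((\<lambda>x. \<lambda>i\<in>I. f i (x i)) -` Pi\<^sub>E I A \<inter> space (Pi\<^sub>M I M))"
    using A I by (intro emeasure_distr meas sets_PiM_I_finite) auto
  also have "(\<lambda>x. \<lambda>i\<in>I. f i (x i)) -` Pi\<^sub>E I A \<inter> space (Pi\<^sub>M I M) = Pi\<^sub>E I ?B"
    by (auto simp: space_PiM PiE_iff)
  also have "emeasure (Pi\<^sub>M I M) (Pi\<^sub>E I ?B) = (\<Prod>i\<in>I. emeasure (M i) (?B i))"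
    using f A I by (intro emeasure_PiM) (auto intro: measurable_sets)
  also have "\<dots> = (\<Prod>i\<in>I. emeasure (distr (M i) (N i) (f i)) (A i))"
    using f(1) A by (intro prod.cong) (simp_all add: emeasure_distr)
  also have "\<dots> = (\<Prod>i\<in>I. emeasure (N i) (A i))" using f by simp
  finally show "emeasure (distr (Pi\<^sub>M I M) (Pi\<^sub>M I N) (\<lambda>x. \<lambda>i\<in>I. f i (x i))) (Pi\<^sub>E I A) = (\<Prod>i\<in>I. emeasure (N i) (A i))" .
qed simp

lemma Lv_translation:
  assumes "finite I"
  shows "distr (Lv I) (Lv I) (\<lambda>x. \<lambda>i\<in>I. x i + c i) = Lv I"
proof (rule distr_PiM_coordinatewise[where f = "\<lambda>i x. x + c i", OF plb.product_sigma_finite_axioms plb.product_sigma_finite_axioms assms])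
  fix i
  show "distr lborel lborel (\<lambda>x. x + c i) = lborel"
    using lborel_distr_plus[of "c i"] by (simp add: add.commute cong: distr_cong)
qed auto

lemma measurable_LLv_translation:
  "(\<lambda>a. \<lambda>j\<in>{..<r}. \<lambda>i\<in>{..<d}. a j i + c j i) \<in> LLv r d \<rightarrow>\<^sub>M LLv r d"
  by (intro measurable_restrict) (auto intro!: borel_measurable_add measurable_LLv_component)

lemma nn_integral_LLv_translation:
  assumes "f \<in> borel_measurable (LLv r d)"
  shows "(\<integral>\<^sup>+a. f (\<lambda>j\<in>{..<r}. \<lambda>i\<in>{..<d}. a j i + c j i) \<partial>LLv r d) = (\<integral>\<^sup>+a. f a \<partial>LLv r d)"
proof -
  have m: "(\<lambda>x. \<lambda>i\<in>{..<d}. x i + b i) \<in> Lv {..<d} \<rightarrow>\<^sub>M Lv {..<d}" for b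
    by (intro measurable_restrict) (auto intro!: borel_measurable_add measurable_Lv_component)
  have "distr (LLv r d) (LLv r d) (\<lambda>a. \<lambda>j\<in>{..<r}. \<lambda>i\<in>{..<d}. a j i + c j i) = LLv r d"
    by (rule distr_PiM_coordinatewise[where f = "\<lambda>j a. \<lambda>i\<in>{..<d}. a i + c j i", OF pll.product_sigma_finite_axioms pll.product_sigma_finite_axioms])
       (auto simp: Lv_translation m)
  then show ?thesis
    using nn_integral_distr[OF measurable_LLv_translation, of f r d c] assms by simp
qed

text \<open>The property of the noise on which privacy rests. It is stated for functions of the
  noise, so that two shifts compose by applying it a second time to a shifted function.\<close>

lemma noise_rank_one_shift:
  assumes f: "f \<in> borel_measurable (LLv d d)" and nu: "0 < \<nu>" and d: "0 < d"
    and v: "sqn d v \<le> \<beta>" and u: "sqn d u \<le> \<beta>"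
  shows "(\<integral>\<^sup>+x. f (noise_cols d \<nu> d x) \<partial>NNv d (d + \<nu>))
    \<le> ennreal (exp (3 / 2 * \<beta> * real (d + \<nu> + d))) *
      (\<integral>\<^sup>+x. f (\<lambda>j\<in>{..<d}. \<lambda>i\<in>{..<d}. noise_cols d \<nu> d x j i + v j * u i) \<partial>NNv d (d + \<nu>))"
proof -
  define e where "e = d + \<nu>"
  define \<kappa> where "\<kappa> = student_const d \<nu>"
  define E where "E = exp (3 / 2 * \<beta> * real (e + d))"
  define sh where "sh a = (\<lambda>j\<in>{..<d}. \<lambda>i\<in>{..<d}. a j i + v j * u i)" for a :: "nat \<Rightarrow> nat \<Rightarrow> real"
  have W: "(\<lambda>a. ennreal (noise_density d e d a)) \<in> borel_measurable (LLv d d)"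
    by (intro measurable_compose[OF measurable_noise_density measurable_ennreal] measurable_LLv_component)
  have sh: "sh \<in> LLv d d \<rightarrow>\<^sub>M LLv d d" unfolding sh_def
    by (rule measurable_LLv_translation)
  have fsh: "(\<lambda>a. f (sh a)) \<in> borel_measurable (LLv d d)"
    by (rule measurable_compose[OF sh f])
  \<comment> \<open>Lebesgue measure is translation invariant, so the shift moves into the density,
    where the determinant bound applies.\<close>
  have "(\<integral>\<^sup>+a. ennreal (noise_density d e d a) * f a \<partial>LLv d d)
      = (\<integral>\<^sup>+a. ennreal (noise_density d e d (sh a)) * f (sh a) \<partial>LLv d d)"
    unfolding sh_def using W f by (intro nn_integral_LLv_translation[symmetric]) auto
  also have "\<dots> \<le> (\<integral>\<^sup>+a. ennreal E * (ennreal (noise_density d e d a) * f (sh a)) \<partial>LLv d d)"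
  proof (intro nn_integral_mono)
    fix a
    have "noise_density d e d (sh a) \<le> E * noise_density d e d a"
      unfolding E_def
    proof (rule noise_density_shift)
      \<comment> \<open>Going from \<open>sh a\<close> back to \<open>a\<close> is the shift with
        \<open>- v\<close>.\<close>
      show "a j i = sh a j i + (- v j) * u i" if "j < d" "i < d" for j i using that by (simp add: sh_def)
    qed (use v u d in \<open>auto simp: e_def sqn_def\<close>)
    then have "ennreal (noise_density d e d (sh a)) \<le> ennreal E * ennreal (noise_density d e d a)"
      using ennreal_leI ennreal_mult'[of E "noise_density d e d a"] by (fastforce simp: E_def)
    then show "ennreal (noise_density d e d (sh a)) * f (sh a) \<le> ennreal E * (ennreal (noise_density d e d a) * f (sh a))"
      by (simp add: mult.assoc[symmetric] mult_right_mono)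
  qed
  also have "\<dots> = ennreal E * (\<integral>\<^sup>+a. ennreal (noise_density d e d a) * f (sh a) \<partial>LLv d d)"
    using W fsh by (intro nn_integral_cmult) auto
  finally have "\<kappa> ^ d * (\<integral>\<^sup>+a. ennreal (noise_density d e d a) * f a \<partial>LLv d d)
    \<le> \<kappa> ^ d * (ennreal E * (\<integral>\<^sup>+a. ennreal (noise_density d e d a) * f (sh a) \<partial>LLv d d))"
    by (rule mult_left_mono) simp
  then show ?thesis
    using noise_cols_density[OF f nu] noise_cols_density[OF fsh nu]
    unfolding \<kappa>_def e_def E_def sh_def by (simp only: mult.left_commute)
qed

section \<open>Moments of the noise\<close>

lemma nn_integral_std_normal:
  assumes [measurable]: "f \<in> borel_measurable borel"
  shows "(\<integral>\<^sup>+x. f x \<partial>std_normal) = (\<integral>\<^sup>+x. ennreal (std_normal_density x) * f x \<partial>lborel)"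
  by (rule nn_integral_density) auto

lemma nn_integral_std_normal_exp: "(\<integral>\<^sup>+x. ennreal (exp (a * x)) \<partial>std_normal) = ennreal (exp (a\<^sup>2 / 2))"
proof -
  have "(\<integral>\<^sup>+x. ennreal (exp (a * x)) \<partial>std_normal)
    = (\<integral>\<^sup>+x. ennreal (std_normal_density x) * ennreal (exp (a * x)) \<partial>lborel)"
    by (rule nn_integral_std_normal) measurable
  also have "\<dots> = (\<integral>\<^sup>+x. ennreal (exp (a\<^sup>2 / 2)) * ennreal (normal_density a 1 x) \<partial>lborel)"
  proof (rule nn_integral_cong)
    fix x
    have "std_normal_density x * exp (a * x) = exp (a\<^sup>2 / 2) * normal_density a 1 x"
      by (simp add: normal_density_def flip: exp_add)
         (simp add: power2_eq_square field_simps)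
    then show "ennreal (std_normal_density x) * ennreal (exp (a * x)) = ennreal (exp (a\<^sup>2 / 2)) * ennreal (normal_density a 1 x)"
      by (simp flip: ennreal_mult')
  qed
  also have "\<dots> = ennreal (exp (a\<^sup>2 / 2)) * (\<integral>\<^sup>+x. ennreal (normal_density a 1 x) \<partial>lborel)"
    by (rule nn_integral_cmult) measurable
  also have "(\<integral>\<^sup>+x. ennreal (normal_density a 1 x) \<partial>lborel) = 1"
    using prob_space.emeasure_space_1[OF prob_space_normal_density[of 1 a]] by (simp add: emeasure_density)
  finally show ?thesis by simp
qed

text \<open>The weight turns the standard normal density into twice the normal density with standard
  deviation 2. The exponent 3/8 is the sum of the 1/4 and the 1/8 that occur in
  \<open>nn_integral_gauss_average_weight\<close>.\<close>

lemma nn_integral_std_normal_exp_square: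
  "(\<integral>\<^sup>+x. ennreal (exp (3 / 8 * x\<^sup>2)) \<partial>std_normal) = 2"
proof -
  have "(\<integral>\<^sup>+x. ennreal (exp (3 / 8 * x\<^sup>2)) \<partial>std_normal)
    = (\<integral>\<^sup>+x. ennreal (std_normal_density x) * ennreal (exp (3 / 8 * x\<^sup>2)) \<partial>lborel)"
    by (rule nn_integral_std_normal) measurable
  also have "\<dots> = (\<integral>\<^sup>+x. 2 * ennreal (normal_density 0 2 x) \<partial>lborel)"
  proof (rule nn_integral_cong)
    fix x :: real
    have "std_normal_density x * exp (3 / 8 * x\<^sup>2) = 2 * normal_density 0 2 x"
    proof -
      have "sqrt (2 * pi * 2\<^sup>2) = 2 * sqrt (2 * pi)"
        using real_sqrt_mult[of "2 * pi" "2\<^sup>2"] by simp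
      moreover have "exp (- x\<^sup>2 / 2) * exp (3 / 8 * x\<^sup>2) = exp (- x\<^sup>2 / (2 * 2\<^sup>2))"
        by (simp flip: exp_add)
      ultimately show ?thesis unfolding normal_density_def by simp
    qed
    then have "ennreal (std_normal_density x * exp (3 / 8 * x\<^sup>2)) = ennreal (2 * normal_density 0 2 x)"
      by simp
    then show "ennreal (std_normal_density x) * ennreal (exp (3 / 8 * x\<^sup>2)) = 2 * ennreal (normal_density 0 2 x)"
      by (simp add: ennreal_mult')
  qed
  also have "\<dots> = 2 * (\<integral>\<^sup>+x. ennreal (normal_density 0 2 x) \<partial>lborel)"
    by (rule nn_integral_cmult) measurable
  also have "(\<integral>\<^sup>+x. ennreal (normal_density 0 2 x) \<partial>lborel) = 1"
    using prob_space.emeasure_space_1[OF prob_space_normal_density[of 2 0]] by (simp add: emeasure_density)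
  finally show ?thesis by simp
qed

text \<open>The power -1/2 is integrable at 0, and division by 3 brings the integral below 1, so
  that a product over independent coordinates stays bounded by 1 in every dimension.\<close>

lemma nn_integral_std_normal_inverse_sqrt:
  "(\<integral>\<^sup>+x. ennreal (\<bar>x\<bar> powr (- 1 / 2) / 3) \<partial>std_normal) \<le> 1"
proof -
  define g where "g x = indicator {0..1::real} x * ennreal (x powr (- 1 / 2))" for x :: real
  have [measurable]: "g \<in> borel_measurable borel" unfolding g_def by measurable
  have "((\<lambda>x. x powr (- 1 / 2)) has_integral 1 powr (- 1 / 2 + 1) / (- 1 / 2 + 1)) {0..1::real}"
    by (rule has_integral_powr_from_0) auto
  then have "((\<lambda>x. x powr (- 1 / 2)) has_integral 2) {0..1::real}" by simp
  then have g2: "(\<integral>\<^sup>+x. g x \<partial>lborel) = 2"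
    using nn_integral_has_integral_lebesgue'[of "{0..1}" "\<lambda>x. x powr (- 1 / 2)" 2]
    unfolding g_def by (simp add: mult.commute)
  have dens: "std_normal_density x \<le> 1 / 2" for x
  proof -
    have "2 \<le> sqrt (2 * pi)" using pi_ge_two by (intro real_le_rsqrt) auto
    then have "1 / sqrt (2 * pi) \<le> 1 / 2" by (simp add: field_simps)
    moreover have "std_normal_density x \<le> 1 / sqrt (2 * pi)"
      unfolding std_normal_density_def using mult_left_mono[of "exp (- x\<^sup>2 / 2)" 1 "1 / sqrt (2 * pi)"] by simp
    ultimately show ?thesis by linarith
  qed
  \<comment> \<open>\<open>g\<close> is the singular part, on the unit interval. It has integral 2
    on either side of 0; with the density bound 1/2 the total is 1 + 2 = 3.\<close>
  have pw: "ennreal (\<bar>x\<bar> powr (- 1 / 2)) \<le> 1 + (g x + g (- x))" for x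
  proof (cases "\<bar>x\<bar> \<le> 1")
    case True
    then have "ennreal (\<bar>x\<bar> powr (- 1 / 2)) \<le> g x + g (- x)"
      by (cases "0 \<le> x") (auto simp: g_def indicator_def)
    then show ?thesis by (simp add: add_increasing)
  next
    case False
    then have "\<bar>x\<bar> powr (- 1 / 2) \<le> \<bar>x\<bar> powr 0" by (intro powr_mono) auto
    also have "\<bar>x\<bar> powr 0 = 1" using False by (intro powr_zero_eq_one[THEN trans]) auto
    finally have "\<bar>x\<bar> powr (- 1 / 2) \<le> 1" .
    then have "ennreal (\<bar>x\<bar> powr (- 1 / 2)) \<le> 1" by (metis ennreal_1 ennreal_leI)
    then show ?thesis by (simp add: add_increasing2)
  qed
  have "(\<integral>\<^sup>+x. ennreal (\<bar>x\<bar> powr (- 1 / 2) / 3) \<partial>std_normal)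
      \<le> (\<integral>\<^sup>+x. ennreal (1 / 3) * (1 + (g x + g (- x))) \<partial>std_normal)"
  proof (intro nn_integral_mono)
    fix x :: real
    have "ennreal (\<bar>x\<bar> powr (- 1 / 2) / 3) = ennreal (1 / 3) * ennreal (\<bar>x\<bar> powr (- 1 / 2))"
      by (subst ennreal_mult[symmetric]) auto
    also have "\<dots> \<le> ennreal (1 / 3) * (1 + (g x + g (- x)))"
      by (intro mult_left_mono pw) simp
    finally show "ennreal (\<bar>x\<bar> powr (- 1 / 2) / 3) \<le> ennreal (1 / 3) * (1 + (g x + g (- x)))" .
  qed
  also have "\<dots> = ennreal (1 / 3) * (\<integral>\<^sup>+x. 1 + (g x + g (- x)) \<partial>std_normal)"
    by (intro nn_integral_cmult) measurable
  also have "(\<integral>\<^sup>+x. 1 + (g x + g (- x)) \<partial>std_normal) = 1 + (\<integral>\<^sup>+x. g x + g (- x) \<partial>std_normal)"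
    using prob_space.emeasure_space_1[OF prob_space_std_normal]
    by (subst nn_integral_add) (auto simp: nn_integral_const)
  also have "(\<integral>\<^sup>+x. g x + g (- x) \<partial>std_normal) = (\<integral>\<^sup>+x. ennreal (std_normal_density x) * (g x + g (- x)) \<partial>lborel)"
    by (rule nn_integral_std_normal) measurable
  also have "\<dots> \<le> (\<integral>\<^sup>+x. ennreal (1 / 2) * (g x + g (- x)) \<partial>lborel)"
    using dens by (intro nn_integral_mono mult_right_mono ennreal_leI) auto
  also have "\<dots> = ennreal (1 / 2) * ((\<integral>\<^sup>+x. g x \<partial>lborel) + (\<integral>\<^sup>+x. g (- x) \<partial>lborel))"
    by (simp add: nn_integral_cmult nn_integral_add)
  also have "(\<integral>\<^sup>+x. g (- x) \<partial>lborel) = (\<integral>\<^sup>+x. g x \<partial>lborel)"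
    using nn_integral_real_affine[of g "-1" 0] by simp
  also have "ennreal (1 / 2) * ((\<integral>\<^sup>+x. g x \<partial>lborel) + (\<integral>\<^sup>+x. g x \<partial>lborel)) = 2"
  proof -
    have "ennreal (1 / 2) * ennreal 4 = ennreal 2" by (subst ennreal_mult[symmetric]) auto
    then show ?thesis unfolding g2 by simp
  qed
  finally have "(\<integral>\<^sup>+x. ennreal (\<bar>x\<bar> powr (- 1 / 2) / 3) \<partial>std_normal) \<le> ennreal (1 / 3) * (1 + 2)"
    by (simp add: mult_left_mono add_left_mono)
  also have "ennreal (1 / 3) * (1 + 2) = 1"
  proof -
    have "ennreal (1 / 3) * ennreal 3 = ennreal 1" by (subst ennreal_mult[symmetric]) auto
    then show ?thesis by simp
  qed
  finally show ?thesis .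
qed

text \<open>By the inequality of arithmetic and geometric means, negative moments of a sum of squares
  reduce to a product of independent factors.\<close>

lemma inverse_norm_on_power_le:
  assumes J: "finite J" "J \<noteq> {}" and y: "\<And>i. i \<in> J \<Longrightarrow> y i \<noteq> 0" and l: "4 * l \<le> card J"
  shows "1 / norm_on J y ^ (2 * l) \<le> (81 / real (card J)) ^ l * (1 + (\<Prod>i\<in>J. \<bar>y i\<bar> powr (- 1 / 2) / 3))"
proof -
  define n where "n = real (card J)"
  have n: "0 < n" using J by (simp add: n_def card_gt_0_iff)
  define z where "z = (\<Prod>i\<in>J. \<bar>y i\<bar> powr (- 1 / 2) / 3)"
  have z: "0 < z" using y by (auto simp: z_def intro!: prod_pos)
  \<comment> \<open>The numerator is \<open>4 * l\<close> because each \<open>(y i)\<^sup>2\<close>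
    is the power -4 of \<open>\<bar>y i\<bar> powr (- 1 / 2)\<close>; the hypothesis on
    \<open>card J\<close> keeps \<open>\<theta>\<close> at most 1.\<close>
  define \<theta> where "\<theta> = 4 * real l / n"
  have \<theta>: "0 \<le> \<theta>" "\<theta> \<le> 1" using n l by (auto simp: \<theta>_def n_def)
  have P: "(\<Prod>i\<in>J. (y i)\<^sup>2) = (3 powr n * z) powr (- 4)"
  proof -
    have "3 powr n * z = (\<Prod>i\<in>J. \<bar>y i\<bar> powr (- 1 / 2))"
      by (simp add: z_def prod_dividef n_def powr_realpow)
    then have "(3 powr n * z) powr (- 4) = (\<Prod>i\<in>J. (\<bar>y i\<bar> powr (- 1 / 2)) powr (- 4))"
      using y by (simp add: prod_powr_distrib)
    also have "\<dots> = (\<Prod>i\<in>J. (y i)\<^sup>2)"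
    proof (rule prod.cong)
      fix i assume "i \<in> J"
      then have "\<bar>y i\<bar> powr 2 = \<bar>y i\<bar> ^ 2" using y by (subst powr_numeral) auto
      then show "(\<bar>y i\<bar> powr (- 1 / 2)) powr (- 4) = (y i)\<^sup>2" by (simp add: powr_powr)
    qed simp
    finally show ?thesis ..
  qed
  have "(\<Prod>i\<in>J. (y i)\<^sup>2) powr (1 / n) \<le> (\<Sum>i\<in>J. (y i)\<^sup>2 / n)"
    unfolding n_def by (intro arith_geom_mean J) auto
  also have "\<dots> = (norm_on J y)\<^sup>2 / n" by (simp add: norm_on_sq sum_divide_distrib)
  finally have "n * (\<Prod>i\<in>J. (y i)\<^sup>2) powr (1 / n) \<le> (norm_on J y)\<^sup>2"
    using n by (simp add: field_simps)
  moreover have "(\<Prod>i\<in>J. (y i)\<^sup>2) powr (1 / n) = (3 powr n * z) powr (- 4 / n)"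
    unfolding P by (simp add: powr_powr)
  ultimately have a: "n * (3 powr n * z) powr (- 4 / n) \<le> (norm_on J y)\<^sup>2" by simp
  have pos: "0 < n * (3 powr n * z) powr (- 4 / n)" using n z by simp
  have "1 / norm_on J y ^ (2 * l) = 1 / ((norm_on J y)\<^sup>2) ^ l" by (simp add: power_mult)
  also have "\<dots> \<le> 1 / (n * (3 powr n * z) powr (- 4 / n)) ^ l"
  proof (rule divide_left_mono)
    show "(n * (3 powr n * z) powr (- 4 / n)) ^ l \<le> ((norm_on J y)\<^sup>2) ^ l"
      by (rule power_mono[OF a less_imp_le[OF pos]])
    show "0 < ((norm_on J y)\<^sup>2) ^ l * (n * (3 powr n * z) powr (- 4 / n)) ^ l"
      by (rule mult_pos_pos[OF zero_less_power[OF less_le_trans[OF pos a]] zero_less_power[OF pos]])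
  qed simp
  also have "\<dots> = (1 / n) ^ l * (3 powr n * z) powr \<theta>"
  proof -
    have "((3 powr n * z) powr (- 4 / n)) ^ l = (3 powr n * z) powr (- \<theta>)"
      using z by (simp add: \<theta>_def powr_powr flip: powr_realpow)
    then show ?thesis using n by (simp add: power_mult_distrib power_divide powr_minus_divide)
  qed
  \<comment> \<open>The constant 81 is \<open>3 ^ 4\<close>: undoing the division by 3 in all
    \<open>n\<close> factors of \<open>z\<close>, at the power \<open>\<theta>\<close>, gives
    \<open>3 ^ (4 * l)\<close>.\<close>
  also have "(3 powr n * z) powr \<theta> = 81 ^ l * z powr \<theta>"
  proof -
    have "(3 powr n) powr \<theta> = 3 powr (4 * real l)" using n by (simp add: powr_powr \<theta>_def)
    also have "\<dots> = 3 ^ (4 * l)" using powr_realpow[of 3 "4 * l"] by simp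
    also have "\<dots> = 81 ^ l" by (simp add: power_mult)
    finally show ?thesis using z by (simp add: powr_mult)
  qed
  also have "(1 / n) ^ l * (81 ^ l * z powr \<theta>) \<le> (1 / n) ^ l * (81 ^ l * (1 + z))"
  proof (intro mult_left_mono)
    \<comment> \<open>Replaces the power by a quantity linear in \<open>z\<close>, whose expectation
      factorises over the coordinates.\<close>
    show "z powr \<theta> \<le> 1 + z"
    proof (cases "z \<le> 1")
    case True
    then have "z powr \<theta> \<le> 1" using powr_le1[of \<theta> z] \<theta> z by simp
    then show ?thesis using z by simp
  next
    case False
    then have "z powr \<theta> \<le> z powr 1" using \<theta> by (intro powr_mono) auto
    then show ?thesis using z by simp
    qed
  qed (use n in auto)
  also have "(1 / n) ^ l * (81 ^ l * (1 + z)) = (81 / n) ^ l * (1 + z)" by (simp add: power_divide)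
  finally show ?thesis unfolding z_def n_def .
qed

text \<open>By independence the product of the factors has expectation at most 1, which accounts for
  the factor 2 = 1 + 1.\<close>

lemma nn_integral_inverse_norm_on:
  assumes J: "finite J" "J \<noteq> {}" and l: "4 * l \<le> card J"
  shows "(\<integral>\<^sup>+y. ennreal (1 / norm_on J y ^ (2 * l)) \<partial>Nv J) \<le> ennreal (2 * (81 / real (card J)) ^ l)"
proof -
  have ae: "AE y in Nv J. y i \<noteq> 0" if "i \<in> J" for i
  proof (rule AE_PiM_component[OF prob_space_std_normal that])
    show "AE x in std_normal. x \<noteq> 0" using AE_lborel_singleton[of "0 :: real"] by (subst AE_density) auto
  qed
  have "AE y in Nv J. \<forall>i\<in>J. y i \<noteq> 0"
    using ae J by (intro AE_finite_allI) auto
  then have "(\<integral>\<^sup>+y. ennreal (1 / norm_on J y ^ (2 * l)) \<partial>Nv J) \<le>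
    (\<integral>\<^sup>+y. ennreal ((81 / real (card J)) ^ l) * (1 + (\<Prod>i\<in>J. ennreal (\<bar>y i\<bar> powr (- 1 / 2) / 3))) \<partial>Nv J)"
  proof (intro nn_integral_mono_AE, eventually_elim)
    case (elim y)
    have "ennreal (1 / norm_on J y ^ (2 * l)) \<le>
      ennreal ((81 / real (card J)) ^ l * (1 + (\<Prod>i\<in>J. \<bar>y i\<bar> powr (- 1 / 2) / 3)))"
      using elim by (intro ennreal_leI inverse_norm_on_power_le J l) auto
    also have "\<dots> = ennreal ((81 / real (card J)) ^ l) * ennreal (1 + (\<Prod>i\<in>J. \<bar>y i\<bar> powr (- 1 / 2) / 3))"
      by (rule ennreal_mult) (auto intro!: add_nonneg_nonneg prod_nonneg)
    also have "ennreal (1 + (\<Prod>i\<in>J. \<bar>y i\<bar> powr (- 1 / 2) / 3)) = 1 + (\<Prod>i\<in>J. ennreal (\<bar>y i\<bar> powr (- 1 / 2) / 3))"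
      by (subst ennreal_plus) (auto intro!: prod_nonneg simp: prod_ennreal)
    finally show ?case .
  qed
  also have "\<dots> = ennreal ((81 / real (card J)) ^ l) * (1 + (\<integral>\<^sup>+y. (\<Prod>i\<in>J. ennreal (\<bar>y i\<bar> powr (- 1 / 2) / 3)) \<partial>Nv J))"
  proof -
    have [measurable]: "(\<lambda>y. \<Prod>i\<in>J. ennreal (\<bar>y i\<bar> powr (- 1 / 2) / 3)) \<in> borel_measurable (Nv J)"
      by (intro borel_measurable_prod_ennreal) simp
    show ?thesis using prob_space.emeasure_space_1[OF prob_space_Nv[of J]]
      by (simp add: nn_integral_cmult nn_integral_add)
  qed
  also have "(\<integral>\<^sup>+y. (\<Prod>i\<in>J. ennreal (\<bar>y i\<bar> powr (- 1 / 2) / 3)) \<partial>Nv J)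
    = (\<Prod>i\<in>J. \<integral>\<^sup>+x. ennreal (\<bar>x\<bar> powr (- 1 / 2) / 3) \<partial>std_normal)"
    using J by (intro pnv.product_nn_integral_prod) auto
  also have "\<dots> \<le> 1"
    using nn_integral_std_normal_inverse_sqrt by (intro prod_le_1) auto
  finally have "(\<integral>\<^sup>+y. ennreal (1 / norm_on J y ^ (2 * l)) \<partial>Nv J) \<le> ennreal ((81 / real (card J)) ^ l) * (1 + 1)"
    by (simp add: mult_left_mono add_left_mono)
  also have "\<dots> = ennreal (2 * (81 / real (card J)) ^ l)"
    by (simp add: ennreal_mult' mult.commute)
  finally show ?thesis .
qed

section \<open>Even moments of projections of Gaussian and Student vectors\<close>

lemma power_le_fact_exp:
  fixes x :: real assumes "0 \<le> x" shows "x ^ n \<le> fact n * exp x"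
proof -
  have "x ^ n /\<^sub>R fact n \<le> exp x"
  proof -
    have "(\<Sum>k\<in>{n}. x ^ k /\<^sub>R fact k) \<le> (\<Sum>k. x ^ k /\<^sub>R fact k)"
      using summable_exp_generic[of x] assms by (intro sum_le_suminf) auto
    then show ?thesis by (simp add: exp_def)
  qed
  then show ?thesis by (simp add: field_simps)
qed

lemma even_power_le_fact_exp:
  fixes x :: real shows "x ^ (2 * l) \<le> fact (2 * l) * (exp x + exp (- x))"
proof -
  have "x ^ (2 * l) = \<bar>x\<bar> ^ (2 * l)" by (simp add: power_even_abs)
  also have "\<dots> \<le> fact (2 * l) * exp \<bar>x\<bar>" by (rule power_le_fact_exp) simp
  also have "\<dots> \<le> fact (2 * l) * (exp x + exp (- x))"
    by (intro mult_left_mono) (cases "0 \<le> x", auto)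
  finally show ?thesis .
qed

lemma fact_double_le: "fact (2 * l) \<le> (4 ^ l * (fact l)\<^sup>2 :: real)"
proof -
  have "real (fact (2 * l)) = real (fact l * fact l * ((2 * l) choose l))"
    using binomial_fact_lemma[of l "2 * l"] by (simp add: mult_2)
  also have "\<dots> \<le> real (fact l * fact l * 2 ^ (2 * l))"
    using binomial_le_pow2[of "2 * l" l] by (intro of_nat_mono mult_left_mono) auto
  also have "(2 :: nat) ^ (2 * l) = 4 ^ l" by (simp add: power_mult)
  finally show ?thesis by (simp add: power2_eq_square mult_ac)
qed

lemma nn_integral_dot_Nv:
  "(\<integral>\<^sup>+x. ennreal (exp (dot d w x)) \<partial>Nv {..<d}) = ennreal (exp (sqn d w / 2))"
proof -
  have "(\<integral>\<^sup>+x. ennreal (exp (dot d w x)) \<partial>Nv {..<d}) = (\<integral>\<^sup>+x. (\<Prod>i<d. ennreal (exp (w i * x i))) \<partial>Nv {..<d})"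
    by (simp add: dot_def exp_sum prod_ennreal)
  also have "\<dots> = (\<Prod>i<d. \<integral>\<^sup>+x. ennreal (exp (w i * x)) \<partial>std_normal)"
    by (intro pnv.product_nn_integral_prod) auto
  also have "\<dots> = ennreal (exp (sqn d w / 2))"
    by (simp add: nn_integral_std_normal_exp prod_ennreal sqn_def sum_divide_distrib exp_sum)
  finally show ?thesis .
qed

lemma measurable_dot_Lv [measurable]: "dot d w \<in> borel_measurable (Lv {..<d})"
  unfolding dot_def by (intro borel_measurable_sum borel_measurable_times) (auto intro: measurable_Lv_component)

text \<open>The power is compared with exponentials at the scale \<open>c\<^sup>2 = 2 * l\<close>.
  The bound has the form \<open>fact l * 6 ^ l\<close> for the sake of the binomial expansion in
  \<open>student_moment_unit\<close>, where \<open>fact l\<close> cancels.\<close>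

lemma nn_integral_dot_even_moment:
  assumes w: "sqn d w = 1"
  shows "(\<integral>\<^sup>+x. ennreal (dot d w x ^ (2 * l)) \<partial>Nv {..<d}) \<le> ennreal (2 * (fact l * 6 ^ l))"
proof (cases "l = 0")
  case True
  then show ?thesis using prob_space.emeasure_space_1[OF prob_space_Nv[of "{..<d}"]] by simp
next
  case False
  define c where "c = sqrt (2 * real l)"
  have c: "0 < c" "c\<^sup>2 = 2 * real l" using False by (auto simp: c_def)
  define k where "k = fact (2 * l) / c ^ (2 * l)"
  have k: "0 \<le> k" using c by (simp add: k_def)
  have dots: "dot d (\<lambda>i. a * w i) x = a * dot d w x" for a x
    by (simp add: dot_def sum_distrib_left mult_ac)
  have "(\<integral>\<^sup>+x. ennreal (dot d w x ^ (2 * l)) \<partial>Nv {..<d}) \<le> (\<integral>\<^sup>+x. ennreal k *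
     (ennreal (exp (dot d (\<lambda>i. c * w i) x)) + ennreal (exp (dot d (\<lambda>i. - c * w i) x))) \<partial>Nv {..<d})"
  proof (rule nn_integral_mono)
    fix x
    have "dot d w x ^ (2 * l) = (c * dot d w x) ^ (2 * l) / c ^ (2 * l)"
      using c by (simp add: power_mult_distrib)
    also have "\<dots> \<le> fact (2 * l) * (exp (c * dot d w x) + exp (- (c * dot d w x))) / c ^ (2 * l)"
      using c by (intro divide_right_mono even_power_le_fact_exp) auto
    finally have "dot d w x ^ (2 * l) \<le> k * (exp (dot d (\<lambda>i. c * w i) x) + exp (dot d (\<lambda>i. - c * w i) x))"
      unfolding dots k_def by simp
    then have "ennreal (dot d w x ^ (2 * l)) \<le> ennreal (k * (exp (dot d (\<lambda>i. c * w i) x) + exp (dot d (\<lambda>i. - c * w i) x)))"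
      by (rule ennreal_leI)
    also have "\<dots> = ennreal k * (ennreal (exp (dot d (\<lambda>i. c * w i) x)) + ennreal (exp (dot d (\<lambda>i. - c * w i) x)))"
      using k by (simp add: ennreal_mult)
    finally show "ennreal (dot d w x ^ (2 * l)) \<le> \<dots>" .
  qed
  also have "\<dots> = ennreal k * (ennreal (exp (sqn d (\<lambda>i. c * w i) / 2)) + ennreal (exp (sqn d (\<lambda>i. - c * w i) / 2)))"
    unfolding nn_integral_dot_Nv[symmetric]
    by (subst nn_integral_cmult, simp add: sets_Nv cong: measurable_cong_sets, subst nn_integral_add)
       (simp_all add: sets_Nv cong: measurable_cong_sets)
  also have "\<dots> = ennreal (k * (2 * exp (real l)))"
  proof -
    have e: "sqn d (\<lambda>i. c * w i) / 2 = real l" "sqn d (\<lambda>i. - c * w i) / 2 = real l"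
      unfolding sqn_scale w using c by simp_all
    show ?thesis unfolding e using k by (simp add: ennreal_mult flip: ennreal_plus)
  qed
  \<comment> \<open>The base 6 is 2, left by the quotient of factorial and power, times 3, a bound
    for e.\<close>
  also have "k * (2 * exp (real l)) \<le> 2 * (fact l * 6 ^ l)"
  proof -
    have "k \<le> 4 ^ l * (fact l)\<^sup>2 / c ^ (2 * l)"
      unfolding k_def using fact_double_le[of l] c by (intro divide_right_mono) auto
    also have "\<dots> = fact l * 4 ^ l * (fact l / (2 * real l) ^ l)"
      using c by (simp add: power_mult power2_eq_square)
    also have "\<dots> \<le> fact l * 4 ^ l * (1 / 2 ^ l)"
    proof -
      have "fact l / (2 * real l) ^ l \<le> (real l) ^ l / (2 * real l) ^ l"
        using fact_le_power[of l, where 'a = real] by (intro divide_right_mono) auto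
      also have "\<dots> = 1 / 2 ^ l" using False by (simp add: power_mult_distrib)
      finally show ?thesis by (intro mult_left_mono) auto
    qed
    also have "\<dots> = fact l * 2 ^ l"
      using power_mult_distrib[of "2 :: real" 2 l] by simp
    finally have "k \<le> fact l * 2 ^ l" .
    moreover have "exp (real l) \<le> 3 ^ l"
      using power_mono[OF exp_le, of l] by (simp flip: exp_of_nat_mult)
    ultimately have "k * (2 * exp (real l)) \<le> (fact l * 2 ^ l) * (2 * 3 ^ l)"
      using k by (intro mult_mono) auto
    also have "\<dots> = 2 * (fact l * (2 * 3) ^ l)" unfolding power_mult_distrib by simp
    finally show ?thesis by simp
  qed
  finally show ?thesis by (simp add: ennreal_leI)
qed

lemma geometric_sum_le:
  fixes q :: real assumes "0 \<le> q" "q < 1"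
  shows "(\<Sum>l\<le>p. q ^ l) \<le> 1 / (1 - q)"
proof -
  have "(\<Sum>l\<le>p. q ^ l) = (1 - q ^ Suc p) / (1 - q)"
    using assms by (simp add: sum_gp0)
  also have "\<dots> \<le> 1 / (1 - q)" using assms by (intro divide_right_mono) auto
  finally show ?thesis .
qed

lemma binomial_le_pow_div_fact: "real (p choose l) \<le> real p ^ l / fact l"
proof -
  have "real ((p choose l) * fact l) \<le> real (p ^ l)"
    by (rule of_nat_mono[OF binomial_fact_pow])
  then show ?thesis by (simp add: pos_le_divide_eq)
qed

text \<open>After the binomial expansion, numerator and denominator separate by independence. The
  term of index \<open>l\<close> is at most \<open>4 * q ^ l\<close> with q = 6 * 81 * p / \<nu>;
  the constant 4096 is large enough for \<open>q \<le> 1 / 8\<close>, and the terms with positive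
  index then sum to at most 4/7.\<close>

lemma student_moment_unit:
  assumes w: "sqn d w = 1" and p: "0 < p" "4096 * p \<le> \<nu>"
  shows "(\<integral>\<^sup>+x. ennreal ((1 + (dot d w (student d \<nu> x))\<^sup>2) ^ p) \<partial>Nv {..<d + \<nu>}) \<le> 2"
proof -
  define I J where "I = {..<d}" and "J = {d..<d + \<nu>}"
  have fin: "finite I" "finite J" and dis: "J \<inter> I = {}" and ne: "J \<noteq> {}" and cJ: "card J = \<nu>"
    and un: "J \<union> I = {..<d + \<nu>}"
    using p by (auto simp: I_def J_def)
  have [measurable]: "norm_on J \<in> borel_measurable (Lv J)" "dot d w \<in> borel_measurable (Lv I)"
    by (auto simp: I_def)
  have [measurable]: "(\<lambda>x. dot d w (student d \<nu> x)) \<in> borel_measurable (Lv {..<d + \<nu>})"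
    by measurable
  define q where "q = 486 * real p / real \<nu>"
  have nu: "0 < real \<nu>" "4096 * real p \<le> real \<nu>" using p by linarith+
  have q: "0 \<le> q" "q \<le> 1 / 8" using nu by (simp_all add: q_def field_simps)
  define B where "B l = real (p choose l) * (2 * (fact l * 6 ^ l))" for l
  have B: "0 \<le> B l" for l by (simp add: B_def)
  have "(\<integral>\<^sup>+x. ennreal ((1 + (dot d w (student d \<nu> x))\<^sup>2) ^ p) \<partial>Nv {..<d + \<nu>})
      = (\<integral>\<^sup>+y. \<integral>\<^sup>+x. ennreal ((1 + (dot d w (student d \<nu> (merge J I (y, x))))\<^sup>2) ^ p) \<partial>Nv I \<partial>Nv J)"
    unfolding un[symmetric]
    by (intro pnv.product_nn_integral_fold fin dis) (simp add: un sets_Nv cong: measurable_cong_sets)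
  also have "\<dots> \<le> (\<integral>\<^sup>+y. 1 + (\<Sum>l\<in>{1..p}. ennreal (B l) * ennreal (1 / norm_on J y ^ (2 * l))) \<partial>Nv J)"
  proof (intro nn_integral_mono)
    fix y
    let ?r = "norm_on J y"
    have "(1 + (dot d w (student d \<nu> (merge J I (y, x))))\<^sup>2) ^ p
        = 1 + (\<Sum>l\<in>{1..p}. real (p choose l) / ?r ^ (2 * l) * dot d w x ^ (2 * l))" for x
    proof -
      have "norm_on J (merge J I (y, x)) = ?r"
        using dis by (auto simp: norm_on_def intro!: sum.cong arg_cong[where f = sqrt])
      then have "dot d w (student d \<nu> (merge J I (y, x))) = dot d w x / ?r"
        using dis unfolding dot_def student_def I_def[symmetric] J_def[symmetric] sum_divide_distrib
        by (intro sum.cong) (auto simp: merge_def I_def J_def)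
      then have "(1 + (dot d w (student d \<nu> (merge J I (y, x))))\<^sup>2) ^ p = ((dot d w x / ?r)\<^sup>2 + 1) ^ p"
        by (simp add: add.commute)
      also have "\<dots> = (\<Sum>l\<le>p. real (p choose l) * (dot d w x / ?r) ^ (2 * l))"
        by (subst binomial_ring) (simp add: power_mult)
      also have "{..p} = insert 0 {1..p}" by auto
      finally show ?thesis by (simp add: power_divide)
    qed
    then have "(\<integral>\<^sup>+x. ennreal ((1 + (dot d w (student d \<nu> (merge J I (y, x))))\<^sup>2) ^ p) \<partial>Nv I)
      = (\<integral>\<^sup>+x. 1 + (\<Sum>l\<in>{1..p}. ennreal (real (p choose l) / ?r ^ (2 * l)) * ennreal (dot d w x ^ (2 * l))) \<partial>Nv I)"
    proof (intro nn_integral_cong)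
      fix x
      assume *: "\<And>x. (1 + (dot d w (student d \<nu> (merge J I (y, x))))\<^sup>2) ^ p
        = 1 + (\<Sum>l\<in>{1..p}. real (p choose l) / ?r ^ (2 * l) * dot d w x ^ (2 * l))"
      have nn: "0 \<le> real (p choose l) / ?r ^ (2 * l) * dot d w x ^ (2 * l)" for l
        by simp
      have "ennreal (real (p choose l) / ?r ^ (2 * l) * dot d w x ^ (2 * l))
        = ennreal (real (p choose l) / ?r ^ (2 * l)) * ennreal (dot d w x ^ (2 * l))" for l
        by (rule ennreal_mult) auto
      then show "ennreal ((1 + (dot d w (student d \<nu> (merge J I (y, x))))\<^sup>2) ^ p)
        = 1 + (\<Sum>l\<in>{1..p}. ennreal (real (p choose l) / ?r ^ (2 * l)) * ennreal (dot d w x ^ (2 * l)))"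
        unfolding * using nn by (subst ennreal_plus) (auto intro!: sum_nonneg simp: sum_ennreal[symmetric] simp del: times_divide_eq_left)
    qed
    also have "\<dots> = 1 + (\<Sum>l\<in>{1..p}. ennreal (real (p choose l) / ?r ^ (2 * l)) * (\<integral>\<^sup>+x. ennreal (dot d w x ^ (2 * l)) \<partial>Nv I))"
    proof -
      have [measurable]: "(\<lambda>x. ennreal (dot d w x ^ (2 * l))) \<in> borel_measurable (Nv I)" for l
        by (simp add: sets_Nv cong: measurable_cong_sets)
      show ?thesis using prob_space.emeasure_space_1[OF prob_space_Nv[of I]]
        by (simp add: nn_integral_add nn_integral_sum nn_integral_cmult)
    qed
    also have "\<dots> \<le> 1 + (\<Sum>l\<in>{1..p}. ennreal (real (p choose l) / ?r ^ (2 * l)) * ennreal (2 * (fact l * 6 ^ l)))"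
      unfolding I_def by (intro add_left_mono sum_mono mult_left_mono nn_integral_dot_even_moment w) auto
    also have "\<dots> = 1 + (\<Sum>l\<in>{1..p}. ennreal (B l) * ennreal (1 / ?r ^ (2 * l)))"
    proof -
      have "ennreal (real (p choose l) / ?r ^ (2 * l)) * ennreal (2 * (fact l * 6 ^ l)) = ennreal (B l) * ennreal (1 / ?r ^ (2 * l))" for l
        by (subst (1 2) ennreal_mult[symmetric]) (auto simp: B_def)
      then show ?thesis by simp
    qed
    finally show "(\<integral>\<^sup>+x. ennreal ((1 + (dot d w (student d \<nu> (merge J I (y, x))))\<^sup>2) ^ p) \<partial>Nv I) \<le> \<dots>" .
  qed
  also have "\<dots> = 1 + (\<Sum>l\<in>{1..p}. ennreal (B l) * (\<integral>\<^sup>+y. ennreal (1 / norm_on J y ^ (2 * l)) \<partial>Nv J))"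
  proof -
    have [measurable]: "(\<lambda>y. ennreal (1 / norm_on J y ^ (2 * l))) \<in> borel_measurable (Nv J)" for l
      by (simp add: sets_Nv cong: measurable_cong_sets)
    show ?thesis using prob_space.emeasure_space_1[OF prob_space_Nv[of J]]
      by (simp add: nn_integral_add nn_integral_sum nn_integral_cmult)
  qed
  also have "\<dots> \<le> 1 + (\<Sum>l\<in>{1..p}. ennreal (4 * q ^ l))"
  proof (intro add_left_mono sum_mono)
    fix l assume l: "l \<in> {1..p}"
    have "(\<integral>\<^sup>+y. ennreal (1 / norm_on J y ^ (2 * l)) \<partial>Nv J) \<le> ennreal (2 * (81 / real (card J)) ^ l)"
      using l p cJ by (intro nn_integral_inverse_norm_on fin ne) auto
    then have "ennreal (B l) * (\<integral>\<^sup>+y. ennreal (1 / norm_on J y ^ (2 * l)) \<partial>Nv J)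
      \<le> ennreal (B l) * ennreal (2 * (81 / real \<nu>) ^ l)"
      unfolding cJ by (intro mult_left_mono) auto
    also have "\<dots> = ennreal (B l * (2 * (81 / real \<nu>) ^ l))"
      using B by (simp add: ennreal_mult)
    also have "B l * (2 * (81 / real \<nu>) ^ l) \<le> (real p ^ l / fact l) * (2 * (fact l * 6 ^ l)) * (2 * (81 / real \<nu>) ^ l)"
      unfolding B_def by (intro mult_right_mono binomial_le_pow_div_fact) auto
    also have "\<dots> = 4 * (real p ^ l * 6 ^ l * (81 / real \<nu>) ^ l)" by simp
    also have "real p ^ l * 6 ^ l * (81 / real \<nu>) ^ l = q ^ l"
      unfolding q_def power_mult_distrib[symmetric] by simp
    finally show "ennreal (B l) * (\<integral>\<^sup>+y. ennreal (1 / norm_on J y ^ (2 * l)) \<partial>Nv J) \<le> ennreal (4 * q ^ l)"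
      by (simp add: ennreal_leI)
  qed
  also have "1 + (\<Sum>l\<in>{1..p}. ennreal (4 * q ^ l)) = ennreal (1 + (\<Sum>l\<in>{1..p}. 4 * q ^ l))"
    using q by (simp add: sum_nonneg sum_ennreal flip: ennreal_1)
  also have "1 + (\<Sum>l\<in>{1..p}. 4 * q ^ l) \<le> 2"
  proof -
    have "{..p} = insert 0 {1..p}" by auto
    then have "1 + (\<Sum>l\<in>{1..p}. q ^ l) \<le> 1 / (1 - q)"
      using geometric_sum_le[of q p] q by simp
    also have "\<dots> \<le> 1 / (1 - 1 / 8)" using q by (intro divide_left_mono) auto
    finally show ?thesis by (simp add: sum_distrib_left[symmetric])
  qed
  finally show ?thesis by (simp add: ennreal_leI)
qed

text \<open>The homogeneous form of the unit case: in \<open>gfac_moment\<close> the vector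
  \<open>w\<close> is the image of \<open>y\<close> under the transposed factor built so
  far.\<close>

lemma student_moment:
  assumes p: "0 < p" "4096 * p \<le> \<nu>"
  shows "(\<integral>\<^sup>+x. ennreal ((sqn d w + (dot d (student d \<nu> x) w)\<^sup>2) ^ p) \<partial>Nv {..<d + \<nu>}) \<le> 2 * ennreal (sqn d w ^ p)"
proof (cases "sqn d w = 0")
  case True
  have "(dot d t w)\<^sup>2 = 0" for t
    using dot_Cauchy_Schwarz[of d t w] zero_le_power2[of "dot d t w"] unfolding True by simp
  then show ?thesis using True p by (simp add: zero_power)
next
  case False
  define c where "c = sqrt (sqn d w)"
  have c2: "c\<^sup>2 = sqn d w" by (simp add: c_def)
  have c: "0 < c" using False sqn_nonneg[of d w] by (simp add: c_def less_le)
  define u where "u i = w i / c" for i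
  have w: "w = (\<lambda>i. c * u i)" using c by (auto simp: u_def)
  have u: "sqn d u = 1"
    using sqn_scale[of d c u] c c2 False unfolding w[symmetric] by simp
  have "(sqn d w + (dot d t w)\<^sup>2) ^ p = sqn d w ^ p * (1 + (dot d u t)\<^sup>2) ^ p" for t
  proof -
    have "dot d t w = c * dot d u t"
      unfolding w dot_def by (simp add: sum_distrib_left mult_ac)
    then have "sqn d w + (dot d t w)\<^sup>2 = sqn d w * (1 + (dot d u t)\<^sup>2)"
      by (simp add: power_mult_distrib c2 algebra_simps)
    then show ?thesis by (simp add: power_mult_distrib)
  qed
  then have "(\<integral>\<^sup>+x. ennreal ((sqn d w + (dot d (student d \<nu> x) w)\<^sup>2) ^ p) \<partial>Nv {..<d + \<nu>})
    = (\<integral>\<^sup>+x. ennreal (sqn d w ^ p) * ennreal ((1 + (dot d u (student d \<nu> x))\<^sup>2) ^ p) \<partial>Nv {..<d + \<nu>})"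
    by (simp add: ennreal_mult)
  also have "\<dots> = ennreal (sqn d w ^ p) * (\<integral>\<^sup>+x. ennreal ((1 + (dot d u (student d \<nu> x))\<^sup>2) ^ p) \<partial>Nv {..<d + \<nu>})"
    by (intro nn_integral_cmult) (simp add: sets_Nv cong: measurable_cong_sets)
  also have "\<dots> \<le> ennreal (sqn d w ^ p) * 2"
    by (intro mult_left_mono student_moment_unit u p) simp
  finally show ?thesis by (simp add: mult.commute)
qed

text \<open>Appending a column adds to the form the square of an inner product with a fresh Student
  vector; with the past fixed, the \<open>p\<close>-th moment at most doubles. For
  \<open>p = d\<close> the accumulated \<open>2 ^ d\<close> is only a constant per power.\<close>

lemma gfac_moment:
  assumes p: "0 < p" "4096 * p \<le> \<nu>"
  shows "(\<integral>\<^sup>+x. ennreal (sqn d (tvec d (gfac d (\<lambda>j. student d \<nu> (x j)) r) y) ^ p) \<partial>NNv r (d + \<nu>))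
    \<le> 2 ^ r * ennreal (sqn d y ^ p)"
proof (induction r)
  case 0
  then show ?case by (simp add: PiM_empty nn_integral_count_space_finite sqn_cong[OF tvec_idm])
next
  case (Suc r)
  let ?G = "\<lambda>r x. gfac d (\<lambda>j. student d \<nu> (x j)) r"
  have meas: "(\<lambda>x. ennreal (sqn d (tvec d (?G r x) y) ^ p)) \<in> borel_measurable (NNv r (d + \<nu>))" for r
  proof -
    have "(\<lambda>x. student d \<nu> (x j) i) \<in> borel_measurable (NNv r (d + \<nu>))" if "j < r" "i < d" for j i
      using that by (intro measurable_compose[OF measurable_component_singleton[of j] measurable_student_component]) auto
    then show ?thesis unfolding sqn_def tvec_def
      by (intro measurable_compose[OF _ measurable_ennreal] borel_measurable_power borel_measurable_sum
          borel_measurable_times measurable_gfac) auto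
  qed
  have "(\<integral>\<^sup>+x. ennreal (sqn d (tvec d (?G (Suc r) x) y) ^ p) \<partial>NNv (Suc r) (d + \<nu>))
    = (\<integral>\<^sup>+x. \<integral>\<^sup>+z. ennreal (sqn d (tvec d (?G (Suc r) (x(r := z))) y) ^ p) \<partial>Nv {..<d + \<nu>} \<partial>NNv r (d + \<nu>))"
    using meas[of "Suc r"] unfolding lessThan_Suc by (intro pnn.product_nn_integral_insert) auto
  also have "\<dots> \<le> (\<integral>\<^sup>+x. 2 * ennreal (sqn d (tvec d (?G r x) y) ^ p) \<partial>NNv r (d + \<nu>))"
  proof (intro nn_integral_mono)
    fix x
    have "sqn d (tvec d (?G (Suc r) (x(r := z))) y) = sqn d (tvec d (?G r x) y) + (dot d (student d \<nu> z) (tvec d (?G r x) y))\<^sup>2" for z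
    proof -
      have "tvec d (?G r (x(r := z))) y l = tvec d (?G r x) y l" if "l < d" for l
        unfolding tvec_def using that by (intro sum.cong arg_cong2[where f = "(*)"] gfac_cong) auto
      then have "sqn d (tvec d (?G r (x(r := z))) y) = sqn d (tvec d (?G r x) y)"
        "dot d (student d \<nu> z) (tvec d (?G r (x(r := z))) y) = dot d (student d \<nu> z) (tvec d (?G r x) y)"
        by (auto intro!: sqn_cong dot_cong)
      then show ?thesis by (simp add: tvec_chol_step sqn_upd_factor)
    qed
    then show "(\<integral>\<^sup>+z. ennreal (sqn d (tvec d (?G (Suc r) (x(r := z))) y) ^ p) \<partial>Nv {..<d + \<nu>}) \<le> 2 * ennreal (sqn d (tvec d (?G r x) y) ^ p)"
      using student_moment[OF p, of d "tvec d (?G r x) y"] by simp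
  qed
  also have "\<dots> = 2 * (\<integral>\<^sup>+x. ennreal (sqn d (tvec d (?G r x) y) ^ p) \<partial>NNv r (d + \<nu>))"
    by (intro nn_integral_cmult meas)
  also have "\<dots> \<le> 2 * (2 ^ r * ennreal (sqn d y ^ p))" by (intro mult_left_mono Suc) simp
  finally show ?case by (simp add: mult.assoc)
qed

text \<open>Averaging the quadratic form over a Gaussian vector, reweighted to absorb a shift by
  \<open>\<plusminus>\<surd>d v\<close>, controls it at every unit vector \<open>v\<close>; this replaces a net over the sphere.\<close>

definition gauss_average :: "nat \<Rightarrow> (nat \<Rightarrow> nat \<Rightarrow> real) \<Rightarrow> ennreal" where
  "gauss_average d C = (\<integral>\<^sup>+g. ennreal (gauss {..<d} g * exp (sqn d g / 4) * sqn d (tvec d C g) ^ d) \<partial>Lv {..<d})"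

text \<open>A nonnegative x is at most 128 or at most x^d / 128^(d - 1). The sum of the two bounds
  is linear in the \<open>d\<close>-th power, so its expectation follows from the moment bound
  without a \<open>d\<close>-th root. The threshold 128 exceeds the base 64 that arises in the
  expectation.\<close>

definition op_bound :: "nat \<Rightarrow> (nat \<Rightarrow> nat \<Rightarrow> real) \<Rightarrow> ennreal" where
  "op_bound d C = 128 + ennreal (2 * exp (real d / 2) / (real d ^ d * 128 ^ (d - 1))) * gauss_average d C"

text \<open>Translation moves \<open>c * v i\<close> into the density. The weight
  \<open>exp (sqn d g / 4)\<close> absorbs the cross term \<open>c * dot d g v\<close>, at the price
  of a constant \<open>exp (c\<^sup>2 / 2)\<close> that is the same for all unit vectors
  \<open>v\<close>.\<close>

lemma gauss_shift_average:
  assumes v: "sqn d v = 1"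
  shows "(\<integral>\<^sup>+g. ennreal (gauss {..<d} g * sqn d (tvec d C (\<lambda>i. g i + c * v i)) ^ d) \<partial>Lv {..<d})
    \<le> ennreal (exp (c\<^sup>2 / 2)) * gauss_average d C"
proof -
  have [measurable]: "(\<lambda>g. sqn d (tvec d C g)) \<in> borel_measurable (Lv {..<d})"
    unfolding sqn_def tvec_def
    by (intro borel_measurable_sum borel_measurable_power borel_measurable_times) (auto intro: measurable_Lv_component)
  let ?T = "\<lambda>g. \<lambda>i\<in>{..<d}. g i + c * v i"
  have T: "?T \<in> Lv {..<d} \<rightarrow>\<^sub>M Lv {..<d}"
    by (intro measurable_restrict) (auto intro!: borel_measurable_add measurable_Lv_component)
  define f where "f g = ennreal (gauss {..<d} (\<lambda>i. g i - c * v i) * sqn d (tvec d C g) ^ d)" for g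
  have f [measurable]: "f \<in> borel_measurable (Lv {..<d})"
    unfolding f_def gauss_def by measurable
  have "(\<integral>\<^sup>+g. ennreal (gauss {..<d} g * sqn d (tvec d C (\<lambda>i. g i + c * v i)) ^ d) \<partial>Lv {..<d}) = (\<integral>\<^sup>+g. f (?T g) \<partial>Lv {..<d})"
    unfolding f_def gauss_def by (simp add: tvec_def)
  also have "\<dots> = (\<integral>\<^sup>+g. f g \<partial>distr (Lv {..<d}) (Lv {..<d}) ?T)"
    by (intro nn_integral_distr[symmetric] T) simp
  also have "\<dots> = (\<integral>\<^sup>+g. f g \<partial>Lv {..<d})" by (simp add: Lv_translation)
  also have "\<dots> \<le> (\<integral>\<^sup>+g. ennreal (exp (c\<^sup>2 / 2)) * ennreal (gauss {..<d} g * exp (sqn d g / 4) * sqn d (tvec d C g) ^ d) \<partial>Lv {..<d})"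
  proof (intro nn_integral_mono)
    fix g
    have "sqn d (\<lambda>i. g i - c * v i) = sqn d g - 2 * c * dot d g v + c\<^sup>2 * sqn d v"
      by (simp add: sqn_def dot_def power2_diff sum.distrib sum_subtractf sum_distrib_left power_mult_distrib mult_ac)
    \<comment> \<open>Young's inequality, read off from the squared norm of g / 2 - c v.\<close>
    moreover have "c * dot d g v \<le> sqn d g / 4 + c\<^sup>2"
    proof -
      have "0 \<le> sqn d (\<lambda>i. g i / 2 - c * v i)" by simp
      also have "sqn d (\<lambda>i. g i / 2 - c * v i) = sqn d g / 4 - c * dot d g v + c\<^sup>2 * sqn d v"
        by (simp add: sqn_def dot_def power2_diff sum.distrib sum_subtractf sum_distrib_left power_mult_distrib power_divide sum_divide_distrib mult_ac)
      finally show ?thesis using v by simp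
    qed
    ultimately have "- sqn d (\<lambda>i. g i - c * v i) / 2 \<le> - sqn d g / 2 + sqn d g / 4 + c\<^sup>2 / 2"
      using v by simp
    then have "exp (- sqn d (\<lambda>i. g i - c * v i) / 2) \<le> exp (- sqn d g / 2) * exp (sqn d g / 4) * exp (c\<^sup>2 / 2)"
      by (simp flip: exp_add)
    then have "gauss {..<d} (\<lambda>i. g i - c * v i) \<le> exp (c\<^sup>2 / 2) * (gauss {..<d} g * exp (sqn d g / 4))"
      unfolding gauss_def sqn_def[symmetric]
      using mult_left_mono[of _ _ "(1 / sqrt (2 * pi)) ^ card {..<d}"] by (fastforce simp: mult_ac)
    then have "gauss {..<d} (\<lambda>i. g i - c * v i) * sqn d (tvec d C g) ^ d
      \<le> exp (c\<^sup>2 / 2) * (gauss {..<d} g * exp (sqn d g / 4)) * sqn d (tvec d C g) ^ d"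
      by (intro mult_right_mono) auto
    then show "f g \<le> ennreal (exp (c\<^sup>2 / 2)) * ennreal (gauss {..<d} g * exp (sqn d g / 4) * sqn d (tvec d C g) ^ d)"
      unfolding f_def by (subst ennreal_mult[symmetric]) (auto intro!: ennreal_leI simp: mult_ac)
  qed
  also have "\<dots> = ennreal (exp (c\<^sup>2 / 2)) * gauss_average d C"
    unfolding gauss_average_def by (intro nn_integral_cmult) measurable
  finally show ?thesis .
qed

text \<open>By the parallelogram law the forms at g + c v and g - c v add up to at least
  \<open>2 * d\<close> times the form at \<open>v\<close>, whatever \<open>g\<close> is; hence one
  of them is at least \<open>d\<close> times it, also after taking powers. The choice
  \<open>c\<^sup>2 = d\<close> keeps \<open>exp (c\<^sup>2 / 2)\<close> of the order of a constant
  to the power \<open>d\<close>.\<close>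

lemma power_sqn_le_gauss_average:
  assumes v: "sqn d v = 1"
  shows "ennreal ((real d * sqn d (tvec d C v)) ^ d) \<le> ennreal (2 * exp (real d / 2)) * gauss_average d C"
proof -
  define c where "c = sqrt (real d)"
  have c: "c\<^sup>2 = real d" by (simp add: c_def)
  let ?F = "\<lambda>b g. gauss {..<d} g * sqn d (tvec d C (\<lambda>i. g i + b * v i)) ^ d"
  have [measurable]: "(\<lambda>g. sqn d (tvec d C (\<lambda>i. g i + b * v i))) \<in> borel_measurable (Lv {..<d})" for b
    unfolding sqn_def tvec_def
    by (intro borel_measurable_sum borel_measurable_power borel_measurable_times borel_measurable_add)
       (auto intro: measurable_Lv_component)
  have pw: "(real d * sqn d (tvec d C v)) ^ d \<le> sqn d (tvec d C (\<lambda>i. g i + c * v i)) ^ d + sqn d (tvec d C (\<lambda>i. g i + - c * v i)) ^ d" for g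
  proof -
    let ?p = "sqn d (tvec d C (\<lambda>i. g i + c * v i))" and ?q = "sqn d (tvec d C (\<lambda>i. g i + - c * v i))"
    have t: "tvec d C (\<lambda>i. g i + b * v i) l = tvec d C g l + b * tvec d C v l" for b l
      by (simp add: tvec_def sum.distrib distrib_left sum_distrib_left mult_ac)
    have "2 * (real d * sqn d (tvec d C v)) \<le> ?p + ?q"
    proof -
      have "?p + ?q = (\<Sum>l<d. 2 * (tvec d C g l)\<^sup>2 + 2 * (c\<^sup>2 * (tvec d C v l)\<^sup>2))"
        unfolding sqn_def t sum.distrib[symmetric]
        by (intro sum.cong) (auto simp: power2_eq_square algebra_simps)
      also have "\<dots> = 2 * sqn d (tvec d C g) + 2 * (c\<^sup>2 * sqn d (tvec d C v))"
        by (simp add: sum.distrib sum_distrib_left sqn_def)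
      finally show ?thesis by (simp add: c)
    qed
    then have "real d * sqn d (tvec d C v) \<le> ?p \<or> real d * sqn d (tvec d C v) \<le> ?q" by linarith
    then have "(real d * sqn d (tvec d C v)) ^ d \<le> ?p ^ d \<or> (real d * sqn d (tvec d C v)) ^ d \<le> ?q ^ d"
      by (elim disjE) (auto intro: power_mono)
    then show ?thesis
      using zero_le_power[OF sqn_nonneg, of d "tvec d C (\<lambda>i. g i + c * v i)" d]
        zero_le_power[OF sqn_nonneg, of d "tvec d C (\<lambda>i. g i + - c * v i)" d] by linarith
  qed
  have "ennreal ((real d * sqn d (tvec d C v)) ^ d) = (\<integral>\<^sup>+g. ennreal ((real d * sqn d (tvec d C v)) ^ d) \<partial>Nv {..<d})"
    using prob_space.emeasure_space_1[OF prob_space_Nv[of "{..<d}"]] by simp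
  also have "\<dots> = (\<integral>\<^sup>+g. ennreal (gauss {..<d} g) * ennreal ((real d * sqn d (tvec d C v)) ^ d) \<partial>Lv {..<d})"
    by (intro nn_integral_Nv) auto
  also have "\<dots> \<le> (\<integral>\<^sup>+g. ennreal (?F c g) + ennreal (?F (- c) g) \<partial>Lv {..<d})"
  proof (intro nn_integral_mono)
    fix g
    have le: "gauss {..<d} g * (real d * sqn d (tvec d C v)) ^ d \<le> ?F c g + ?F (- c) g"
      using mult_left_mono[OF pw[of g] gauss_nonneg[of "{..<d}" g]] by (simp only: distrib_left)
    have "ennreal (gauss {..<d} g) * ennreal ((real d * sqn d (tvec d C v)) ^ d)
      = ennreal (gauss {..<d} g * (real d * sqn d (tvec d C v)) ^ d)"
      by (rule ennreal_mult[symmetric]) auto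
    also have "\<dots> \<le> ennreal (?F c g + ?F (- c) g)" by (rule ennreal_leI[OF le])
    also have "\<dots> = ennreal (?F c g) + ennreal (?F (- c) g)" by (rule ennreal_plus) auto
    finally show "ennreal (gauss {..<d} g) * ennreal ((real d * sqn d (tvec d C v)) ^ d) \<le> ennreal (?F c g) + ennreal (?F (- c) g)" .
  qed
  also have "\<dots> = (\<integral>\<^sup>+g. ennreal (?F c g) \<partial>Lv {..<d}) + (\<integral>\<^sup>+g. ennreal (?F (- c) g) \<partial>Lv {..<d})"
    by (intro nn_integral_add) measurable
  also have "\<dots> \<le> ennreal (exp (real d / 2)) * gauss_average d C + ennreal (exp (real d / 2)) * gauss_average d C"
    using gauss_shift_average[OF v, of C c] gauss_shift_average[OF v, of C "- c"] c by (intro add_mono) auto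
  also have "\<dots> = ennreal (2 * exp (real d / 2)) * gauss_average d C"
  proof -
    have "ennreal (2 * exp (real d / 2)) = ennreal (exp (real d / 2)) + ennreal (exp (real d / 2))"
      by (simp only: mult_2 ennreal_plus[OF exp_ge_zero exp_ge_zero])
    then show ?thesis by (simp only: distrib_right)
  qed
  finally show ?thesis .
qed

lemma sqn_tvec_le_op_bound:
  assumes v: "sqn d v = 1" and d: "0 < d"
  shows "ennreal (sqn d (tvec d C v)) \<le> op_bound d C"
proof (cases "sqn d (tvec d C v) \<le> 128")
  case True
  then have "ennreal (sqn d (tvec d C v)) \<le> ennreal 128" by (rule ennreal_leI)
  then show ?thesis unfolding op_bound_def by (simp add: add_increasing2)
next
  case False
  let ?y = "sqn d (tvec d C v)"
  define k where "k = 1 / (real d ^ d * 128 ^ (d - 1))"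
  have k: "0 \<le> k" by (simp add: k_def)
  have "128 ^ (d - 1) * ?y \<le> ?y ^ (d - 1) * ?y"
    using False by (intro mult_right_mono power_mono) auto
  also have "\<dots> = ?y ^ d" using d by (cases d) auto
  finally have "?y \<le> k * (real d * ?y) ^ d"
    using d by (simp add: k_def power_mult_distrib field_simps)
  then have "ennreal ?y \<le> ennreal (k * (real d * ?y) ^ d)" by (rule ennreal_leI)
  also have "\<dots> = ennreal k * ennreal ((real d * ?y) ^ d)"
    using k by (simp add: ennreal_mult)
  also have "\<dots> \<le> ennreal k * (ennreal (2 * exp (real d / 2)) * gauss_average d C)"
    by (intro mult_left_mono power_sqn_le_gauss_average v) simp
  also have "\<dots> = ennreal (2 * exp (real d / 2) / (real d ^ d * 128 ^ (d - 1))) * gauss_average d C"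
    unfolding mult.assoc[symmetric] by (subst ennreal_mult[symmetric]) (auto simp: k_def)
  finally show ?thesis unfolding op_bound_def by (simp add: add_increasing)
qed

text \<open>An eighth of the square in the exponent absorbs the polynomial, at the price
  \<open>8 ^ d * fact d\<close>; what remains factorises over the coordinates, each contributing
  2.\<close>

lemma nn_integral_gauss_average_weight:
  "(\<integral>\<^sup>+g. ennreal (gauss {..<d} g * exp (sqn d g / 4) * sqn d g ^ d) \<partial>Lv {..<d}) \<le> ennreal (16 ^ d * fact d)"
proof -
  have "(\<integral>\<^sup>+g. ennreal (gauss {..<d} g * exp (sqn d g / 4) * sqn d g ^ d) \<partial>Lv {..<d})
    \<le> (\<integral>\<^sup>+g. ennreal (8 ^ d * fact d) * (ennreal (gauss {..<d} g) * (\<Prod>i<d. ennreal (exp (3 / 8 * (g i)\<^sup>2)))) \<partial>Lv {..<d})"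
  proof (intro nn_integral_mono)
    fix g
    have "sqn d g ^ d = 8 ^ d * (sqn d g / 8) ^ d" by (simp flip: power_mult_distrib)
    also have "\<dots> \<le> 8 ^ d * (fact d * exp (sqn d g / 8))"
      by (intro mult_left_mono power_le_fact_exp) auto
    finally have "gauss {..<d} g * exp (sqn d g / 4) * sqn d g ^ d
      \<le> gauss {..<d} g * exp (sqn d g / 4) * (8 ^ d * (fact d * exp (sqn d g / 8)))"
      by (intro mult_left_mono) auto
    also have "\<dots> = (8 ^ d * fact d) * (gauss {..<d} g * (exp (sqn d g / 4) * exp (sqn d g / 8)))" by simp
    also have "exp (sqn d g / 4) * exp (sqn d g / 8) = exp (3 / 8 * sqn d g)"
      by (simp flip: exp_add)
    also have "3 / 8 * sqn d g = (\<Sum>i<d. 3 / 8 * (g i)\<^sup>2)" by (simp add: sqn_def sum_distrib_left)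
    also have "exp \<dots> = (\<Prod>i<d. exp (3 / 8 * (g i)\<^sup>2))" by (rule exp_sum) simp
    finally have "ennreal (gauss {..<d} g * exp (sqn d g / 4) * sqn d g ^ d)
      \<le> ennreal ((8 ^ d * fact d) * (gauss {..<d} g * (\<Prod>i<d. exp (3 / 8 * (g i)\<^sup>2))))"
      by (rule ennreal_leI)
    also have "\<dots> = ennreal (8 ^ d * fact d) * (ennreal (gauss {..<d} g) * (\<Prod>i<d. ennreal (exp (3 / 8 * (g i)\<^sup>2))))"
      by (subst ennreal_mult, simp, simp add: prod_nonneg, subst (2) ennreal_mult) (auto simp: prod_ennreal prod_nonneg)
    finally show "ennreal (gauss {..<d} g * exp (sqn d g / 4) * sqn d g ^ d) \<le> \<dots>" .
  qed
  also have "\<dots> = ennreal (8 ^ d * fact d) * (\<integral>\<^sup>+g. (\<Prod>i<d. ennreal (exp (3 / 8 * (g i)\<^sup>2))) \<partial>Nv {..<d})"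
  proof -
    have [measurable]: "(\<lambda>g. \<Prod>i<d. ennreal (exp (3 / 8 * (g i)\<^sup>2))) \<in> borel_measurable (Lv {..<d})"
      by (intro borel_measurable_prod_ennreal) (simp add: measurable_Lv_component)
    show ?thesis by (simp add: nn_integral_Nv nn_integral_cmult)
  qed
  also have "(\<integral>\<^sup>+g. (\<Prod>i<d. ennreal (exp (3 / 8 * (g i)\<^sup>2))) \<partial>Nv {..<d}) = (\<Prod>i<d. \<integral>\<^sup>+x. ennreal (exp (3 / 8 * x\<^sup>2)) \<partial>std_normal)"
    by (intro pnv.product_nn_integral_prod) auto
  also have "\<dots> = ennreal (2 ^ d)"
    by (simp only: nn_integral_std_normal_exp_square) (simp flip: ennreal_power)
  also have "ennreal (8 ^ d * fact d) * ennreal (2 ^ d) = ennreal (16 ^ d * fact d)"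
    using power_mult_distrib[of "8 :: real" 2 d] by (simp add: mult_ac flip: ennreal_mult)
  finally show ?thesis .
qed

text \<open>Exchanging the integrals reduces the average over \<open>g\<close> to the moment bound
  of order \<open>d\<close> at each fixed \<open>g\<close>. The factor \<open>real d ^ d\<close> in
  \<open>op_bound\<close> then cancels \<open>fact d\<close>, and each of the two summands is at
  most 128.\<close>

lemma op_bound_expectation:
  assumes d: "0 < d" and nu: "4096 * d \<le> \<nu>"
  shows "(\<integral>\<^sup>+x. op_bound d (gfac d (\<lambda>j. student d \<nu> (x j)) d) \<partial>NNv d (d + \<nu>)) \<le> 256"
    and "(\<lambda>x. op_bound d (gfac d (\<lambda>j. student d \<nu> (x j)) d)) \<in> borel_measurable (NNv d (d + \<nu>))"
proof -
  let ?G = "\<lambda>x. gfac d (\<lambda>j. student d \<nu> (x j)) d"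
  let ?K = "\<lambda>x g. ennreal (gauss {..<d} g * exp (sqn d g / 4) * sqn d (tvec d (?G x) g) ^ d)"
  have st: "(\<lambda>x. student d \<nu> (fst x j) i) \<in> borel_measurable (NNv d (d + \<nu>) \<Otimes>\<^sub>M Lv {..<d})" if "j < d" "i < d" for j i
    using that by (intro measurable_compose[OF measurable_fst] measurable_compose[OF measurable_component_singleton[of j] measurable_student_component]) auto
  have [measurable]: "(\<lambda>x. sqn d (tvec d (?G (fst x)) (snd x))) \<in> borel_measurable (NNv d (d + \<nu>) \<Otimes>\<^sub>M Lv {..<d})"
    unfolding sqn_def tvec_def using st
    by (intro borel_measurable_power borel_measurable_sum
          borel_measurable_times measurable_gfac measurable_compose[OF measurable_snd]) (auto intro: measurable_Lv_component)
  have [measurable]: "(\<lambda>x. gauss {..<d} (snd x)) \<in> borel_measurable (NNv d (d + \<nu>) \<Otimes>\<^sub>M Lv {..<d})"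
    "(\<lambda>x. sqn d (snd x)) \<in> borel_measurable (NNv d (d + \<nu>) \<Otimes>\<^sub>M Lv {..<d})"
    by (auto intro!: measurable_compose[OF measurable_snd] measurable_gauss measurable_sqn)
  have K [measurable]: "(\<lambda>(x, g). ?K x g) \<in> borel_measurable (NNv d (d + \<nu>) \<Otimes>\<^sub>M Lv {..<d})"
    unfolding split_beta by measurable
  have sf: "sigma_finite_measure (Lv {..<d})" "sigma_finite_measure (NNv d (d + \<nu>))"
    by (auto intro: plb.sigma_finite pnn.sigma_finite)
  have ga: "(\<lambda>x. gauss_average d (?G x)) \<in> borel_measurable (NNv d (d + \<nu>))"
    unfolding gauss_average_def by (rule sigma_finite_measure.borel_measurable_nn_integral[OF sf(1) K])
  then show "(\<lambda>x. op_bound d (?G x)) \<in> borel_measurable (NNv d (d + \<nu>))"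
    unfolding op_bound_def by measurable
  have "(\<integral>\<^sup>+x. gauss_average d (?G x) \<partial>NNv d (d + \<nu>)) = (\<integral>\<^sup>+g. \<integral>\<^sup>+x. ?K x g \<partial>NNv d (d + \<nu>) \<partial>Lv {..<d})"
    unfolding gauss_average_def by (intro pair_sigma_finite.Fubini'[symmetric] pair_sigma_finite.intro sf K)
  also have "\<dots> \<le> (\<integral>\<^sup>+g. 2 ^ d * ennreal (gauss {..<d} g * exp (sqn d g / 4) * sqn d g ^ d) \<partial>Lv {..<d})"
  proof (intro nn_integral_mono)
    fix g assume g: "g \<in> space (Lv {..<d})"
    have m: "(\<lambda>x. ennreal (sqn d (tvec d (?G x) g) ^ d)) \<in> borel_measurable (NNv d (d + \<nu>))"
      using measurable_compose[OF measurable_Pair2'[OF g], of "\<lambda>x. ennreal (sqn d (tvec d (?G (fst x)) (snd x)) ^ d)" "NNv d (d + \<nu>)" borel] by simp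
    have "(\<integral>\<^sup>+x. ?K x g \<partial>NNv d (d + \<nu>)) = (\<integral>\<^sup>+x. ennreal (gauss {..<d} g * exp (sqn d g / 4)) * ennreal (sqn d (tvec d (?G x) g) ^ d) \<partial>NNv d (d + \<nu>))"
      by (simp add: ennreal_mult)
    also have "\<dots> = ennreal (gauss {..<d} g * exp (sqn d g / 4)) * (\<integral>\<^sup>+x. ennreal (sqn d (tvec d (?G x) g) ^ d) \<partial>NNv d (d + \<nu>))"
      by (rule nn_integral_cmult[OF m])
    also have "\<dots> \<le> ennreal (gauss {..<d} g * exp (sqn d g / 4)) * (2 ^ d * ennreal (sqn d g ^ d))"
      by (intro mult_left_mono gfac_moment d nu) auto
    also have "\<dots> = 2 ^ d * ennreal (gauss {..<d} g * exp (sqn d g / 4) * sqn d g ^ d)"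
      by (simp add: ennreal_mult mult_ac)
    finally show "(\<integral>\<^sup>+x. ?K x g \<partial>NNv d (d + \<nu>)) \<le> \<dots>" .
  qed
  also have "\<dots> = 2 ^ d * (\<integral>\<^sup>+g. ennreal (gauss {..<d} g * exp (sqn d g / 4) * sqn d g ^ d) \<partial>Lv {..<d})"
    by (intro nn_integral_cmult) measurable
  also have "\<dots> \<le> 2 ^ d * ennreal (16 ^ d * fact d)"
    by (intro mult_left_mono nn_integral_gauss_average_weight) simp
  also have "\<dots> = ennreal (32 ^ d * fact d)"
    using power_mult_distrib[of "2 :: real" 16 d] by (simp add: ennreal_mult mult.assoc[symmetric] flip: ennreal_power)
  finally have avg: "(\<integral>\<^sup>+x. gauss_average d (?G x) \<partial>NNv d (d + \<nu>)) \<le> ennreal (32 ^ d * fact d)" .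
  define k where "k = 2 * exp (real d / 2) / (real d ^ d * 128 ^ (d - 1))"
  have k: "0 \<le> k" by (simp add: k_def)
  interpret prob_space "NNv d (d + \<nu>)" by (rule prob_space_PiM) (rule prob_space_Nv)
  have "(\<integral>\<^sup>+x. op_bound d (?G x) \<partial>NNv d (d + \<nu>)) = 128 + ennreal k * (\<integral>\<^sup>+x. gauss_average d (?G x) \<partial>NNv d (d + \<nu>))"
    unfolding op_bound_def k_def[symmetric] using ga emeasure_space_1
    by (simp add: nn_integral_add nn_integral_cmult)
  also have "\<dots> \<le> 128 + ennreal k * ennreal (32 ^ d * fact d)"
    by (intro add_left_mono mult_left_mono avg) simp
  also have "ennreal k * ennreal (32 ^ d * fact d) = ennreal (k * (32 ^ d * fact d))"
    using k by (simp add: ennreal_mult)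
  \<comment> \<open>The bases combine to 64 against 128, and the leading \<open>2 * 64\<close> is
    the asserted 128.\<close>
  also have "k * (32 ^ d * fact d) \<le> 128"
  proof -
    have e: "exp (real d / 2) \<le> 2 ^ d"
    proof -
      have "exp (1 / 2 :: real) \<le> 2"
      proof (rule power2_le_imp_le)
        show "(exp (1 / 2 :: real))\<^sup>2 \<le> 2\<^sup>2" using exp_le by (simp flip: exp_double)
      qed simp
      then have "exp (1 / 2 :: real) ^ d \<le> 2 ^ d" by (intro power_mono) auto
      then show ?thesis by (simp flip: exp_of_nat_mult)
    qed
    have "k * (32 ^ d * fact d) \<le> 2 * 2 ^ d / (real d ^ d * 128 ^ (d - 1)) * (32 ^ d * real d ^ d)"
      unfolding k_def using e fact_le_power[of d, where 'a = real]
      by (intro mult_mono divide_right_mono) auto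
    also have "\<dots> = 2 * (2 ^ d * 32 ^ d) / 128 ^ (d - 1)"
    proof -
      have "2 * a / (X * Y) * (b * X) = 2 * (a * b) / Y" if "X \<noteq> 0" for a b X Y :: real
        using that by simp
      then show ?thesis using d by simp
    qed
    also have "2 ^ d * 32 ^ d = (64 :: real) ^ d"
      using power_mult_distrib[of "2 :: real" 32 d] by simp
    also have "2 * (64 :: real) ^ d / 128 ^ (d - 1) = 128 * (64 / 128) ^ (d - 1)"
      using d by (cases d) (simp_all only: power_divide, simp_all)
    also have "\<dots> \<le> 128 * 1" by (intro mult_left_mono power_le_one) auto
    finally show ?thesis by simp
  qed
  finally show "(\<integral>\<^sup>+x. op_bound d (?G x) \<partial>NNv d (d + \<nu>)) \<le> 256"
    by (simp add: ennreal_leI add_left_mono flip: ennreal_numeral ennreal_plus)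
qed

section \<open>Approximate projection by the Frank--Wolfe method\<close>

definition frob :: "nat \<Rightarrow> (nat \<Rightarrow> nat \<Rightarrow> real) \<Rightarrow> (nat \<Rightarrow> nat \<Rightarrow> real) \<Rightarrow> real" where
  "frob d A B = (\<Sum>i<d. \<Sum>j<d. A i j * B i j)"

definition qf :: "nat \<Rightarrow> (nat \<Rightarrow> nat \<Rightarrow> real) \<Rightarrow> (nat \<Rightarrow> real) \<Rightarrow> real" where
  "qf d A v = dot d v (mvec d A v)"

definition mmul :: "nat \<Rightarrow> (nat \<Rightarrow> nat \<Rightarrow> real) \<Rightarrow> (nat \<Rightarrow> nat \<Rightarrow> real) \<Rightarrow> nat \<Rightarrow> nat \<Rightarrow> real" where
  "mmul d A B = (\<lambda>i j. \<Sum>l<d. A i l * B l j)"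

definition sym_on :: "nat \<Rightarrow> (nat \<Rightarrow> nat \<Rightarrow> real) \<Rightarrow> bool" where
  "sym_on d A \<longleftrightarrow> (\<forall>i<d. \<forall>j<d. A i j = A j i)"

text \<open>Membership in the convex hull of the \<open>w w\<^sup>T\<close> with \<open>\<bar>w\<bar> \<le> 1\<close> (the positive semidefinite matrices
  of trace at most one), expressed by duality; only the symmetric part of the matrix is constrained.\<close>

definition psd_hull :: "nat \<Rightarrow> (nat \<Rightarrow> nat \<Rightarrow> real) \<Rightarrow> bool" where
  "psd_hull d M \<longleftrightarrow> (\<forall>G b. (\<forall>w. sqn d w \<le> 1 \<longrightarrow> qf d G w \<le> b) \<longrightarrow> frob d G M \<le> b)"

lemma qf_alt: "qf d A v = (\<Sum>i<d. \<Sum>j<d. A i j * (v i * v j))"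
  by (simp add: qf_def dot_def mvec_def sum_distrib_left mult_ac)

lemma qf_eq_frob: "qf d A v = frob d A (\<lambda>i j. v i * v j)"
  by (simp add: qf_alt frob_def)

lemma frob_add_right: "frob d A (\<lambda>i j. B i j + C i j) = frob d A B + frob d A C"
  by (simp add: frob_def distrib_left sum.distrib)

lemma frob_diff_right: "frob d A (\<lambda>i j. B i j - C i j) = frob d A B - frob d A C"
  by (simp add: frob_def right_diff_distrib sum_subtractf)

lemma frob_scale_right: "frob d A (\<lambda>i j. c * B i j) = c * frob d A B"
  by (simp add: frob_def sum_distrib_left mult_ac)

lemma frob_commute: "frob d A B = frob d B A"
  by (simp add: frob_def mult.commute)

lemma frob_diff_left: "frob d (\<lambda>i j. B i j - C i j) A = frob d B A - frob d C A"
  using frob_diff_right[of d A B C] by (simp add: frob_commute)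

lemma frob_add_left: "frob d (\<lambda>i j. B i j + C i j) A = frob d B A + frob d C A"
  using frob_add_right[of d A B C] by (simp add: frob_commute)

lemma frob_self_nonneg [simp]: "0 \<le> frob d A A"
  by (auto simp: frob_def intro!: sum_nonneg)

lemma frob_Cauchy_Schwarz: "(frob d A B)\<^sup>2 \<le> frob d A A * frob d B B"
proof -
  have "frob d X Y = (\<Sum>p\<in>{..<d} \<times> {..<d}. X (fst p) (snd p) * Y (fst p) (snd p))" for X Y
    by (simp add: frob_def sum.cartesian_product split_beta)
  then show ?thesis
    using Cauchy_Schwarz_ineq_sum[of "\<lambda>p. A (fst p) (snd p)" "\<lambda>p. B (fst p) (snd p)" "{..<d} \<times> {..<d}"]
    by (simp add: power2_eq_square)
qed

lemma qf_scale: "qf d A (\<lambda>i. c * v i) = c\<^sup>2 * qf d A v"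
  by (simp add: qf_alt sum_distrib_left power2_eq_square mult_ac)

lemma qf_outer: "qf d (\<lambda>i j. v i * v j) w = (dot d v w)\<^sup>2"
  by (simp add: qf_alt dot_def power2_eq_square sum_product mult_ac)

lemma frob_cong:
  assumes "\<And>i j. i < d \<Longrightarrow> j < d \<Longrightarrow> A i j = A' i j" "\<And>i j. i < d \<Longrightarrow> j < d \<Longrightarrow> B i j = B' i j"
  shows "frob d A B = frob d A' B'"
  using assms by (simp add: frob_def)

lemma psd_hull_outer: "sqn d w \<le> 1 \<Longrightarrow> psd_hull d (\<lambda>i j. w i * w j)"
  by (simp add: psd_hull_def flip: qf_eq_frob)

lemma psd_hull_zero: "psd_hull d (\<lambda>i j. 0)"
  unfolding psd_hull_def
proof (intro allI impI)
  fix G b assume "\<forall>w. sqn d w \<le> 1 \<longrightarrow> qf d G w \<le> b"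
  from this[rule_format, of "\<lambda>_. 0"] show "frob d G (\<lambda>i j. 0) \<le> b"
    by (simp add: frob_def qf_alt sqn_def)
qed

lemma psd_hull_convex:
  assumes "psd_hull d A" "psd_hull d B" "0 \<le> \<gamma>" "\<gamma> \<le> 1"
  shows "psd_hull d (\<lambda>i j. A i j + \<gamma> * (B i j - A i j))"
  unfolding psd_hull_def
proof (intro allI impI)
  fix G b assume G: "\<forall>w. sqn d w \<le> 1 \<longrightarrow> qf d G w \<le> b"
  have "frob d G (\<lambda>i j. A i j + \<gamma> * (B i j - A i j)) = (1 - \<gamma>) * frob d G A + \<gamma> * frob d G B"
    by (simp add: frob_add_right frob_scale_right frob_diff_right algebra_simps)
  also have "\<dots> \<le> (1 - \<gamma>) * b + \<gamma> * b"
    using assms G by (intro add_mono mult_left_mono) (auto simp: psd_hull_def)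
  finally show "frob d G (\<lambda>i j. A i j + \<gamma> * (B i j - A i j)) \<le> b" by (simp add: algebra_simps)
qed

lemma psd_hull_mean:
  assumes "\<And>l. l < m \<Longrightarrow> psd_hull d (A l)"
  shows "psd_hull d (\<lambda>i j. (\<Sum>l<m. A l i j / real m))"
proof (cases "m = 0")
  case True
  then show ?thesis by (simp add: psd_hull_zero)
next
  case False
  show ?thesis unfolding psd_hull_def
  proof (intro allI impI)
    fix G b assume G: "\<forall>w. sqn d w \<le> 1 \<longrightarrow> qf d G w \<le> b"
    have "frob d G (\<lambda>i j. (\<Sum>l<m. A l i j / real m)) = (\<Sum>i<d. \<Sum>l<m. \<Sum>j<d. G i j * A l i j / real m)"
      unfolding frob_def sum_distrib_left times_divide_eq_right by (intro sum.cong refl sum.swap)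
    also have "\<dots> = (\<Sum>l<m. frob d G (A l) / real m)"
      unfolding frob_def sum_divide_distrib by (rule sum.swap)
    also have "\<dots> \<le> (\<Sum>l<m. b / real m)"
      using assms G by (intro sum_mono divide_right_mono) (auto simp: psd_hull_def)
    finally show "frob d G (\<lambda>i j. (\<Sum>l<m. A l i j / real m)) \<le> b" using False by simp
  qed
qed

text \<open>Membership is tested twice: with v v^T, which bounds the quadratic form of
  \<open>B\<close> by 1 on the unit ball, and then with \<open>B\<close> itself.\<close>

lemma psd_hull_frob_le:
  assumes "psd_hull d B"
  shows "frob d B B \<le> 1"
proof -
  have "qf d B v \<le> 1" if v: "sqn d v \<le> 1" for v
  proof -
    have "frob d (\<lambda>i j. v i * v j) B \<le> 1"
    proof (rule assms[unfolded psd_hull_def, rule_format])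
      fix w assume "sqn d w \<le> 1"
      then have "(dot d v w)\<^sup>2 \<le> 1 * 1"
        using dot_Cauchy_Schwarz[of d v w] mult_mono[OF v] by (smt (verit) sqn_nonneg)
      then show "qf d (\<lambda>i j. v i * v j) w \<le> 1" by (simp add: qf_outer)
    qed
    then show ?thesis by (simp add: qf_eq_frob frob_commute)
  qed
  then show ?thesis using assms unfolding psd_hull_def by blast
qed

lemma exists_unit_multiple:
  assumes "sqn d w \<noteq> 0"
  obtains u where "sqn d u = 1" "qf d G w = sqn d w * qf d G u" "\<And>G'. qf d G' w = sqn d w * qf d G' u"
proof -
  define c where "c = sqrt (sqn d w)"
  have c2: "c\<^sup>2 = sqn d w" by (simp add: c_def)
  have c: "0 < c" using assms sqn_nonneg[of d w] by (simp add: c_def less_le)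
  define u where "u i = w i / c" for i
  have w: "w = (\<lambda>i. c * u i)" using c by (auto simp: u_def)
  have "sqn d u = 1" using sqn_scale[of d c u] c c2 assms unfolding w[symmetric] by simp
  moreover have "qf d G' w = sqn d w * qf d G' u" for G'
    by (subst w) (simp add: qf_scale c2)
  ultimately show ?thesis using that by blast
qed

text \<open>Duality of nuclear and operator norm, by testing the hull with \<open>N\<close> and with
  its negative.\<close>

lemma psd_hull_abs_le:
  assumes B: "psd_hull d B" and t: "0 \<le> \<tau>" and N: "\<And>v. sqn d v = 1 \<Longrightarrow> \<bar>qf d N v\<bar> \<le> \<tau>"
  shows "\<bar>frob d N B\<bar> \<le> \<tau>"
proof -
  have le: "\<bar>qf d N w\<bar> \<le> \<tau>" if w: "sqn d w \<le> 1" for w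
  proof (cases "sqn d w = 0")
    case True
    then have "\<And>i. i < d \<Longrightarrow> w i = 0" by (auto simp: sqn_def sum_nonneg_eq_0_iff)
    then show ?thesis using t by (simp add: qf_alt)
  next
    case False
    then obtain u where "sqn d u = 1" "qf d N w = sqn d w * qf d N u" by (rule exists_unit_multiple)
    then show ?thesis using N[of u] w mult_mono[of "sqn d w" 1 "\<bar>qf d N u\<bar>" \<tau>] by (simp add: abs_mult)
  qed
  have "frob d N B \<le> \<tau>"
    using B le unfolding psd_hull_def by (meson abs_le_D1)
  moreover have "frob d (\<lambda>i j. - N i j) B \<le> \<tau>"
  proof -
    have "qf d (\<lambda>i j. - N i j) w = - qf d N w" for w by (simp add: qf_alt sum_negf)
    then show ?thesis using B le unfolding psd_hull_def by (metis abs_le_D2)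
  qed
  moreover have "frob d (\<lambda>i j. - N i j) B = - frob d N B" by (simp add: frob_def sum_negf)
  ultimately show ?thesis by linarith
qed

section \<open>Powers of a positive semidefinite matrix without eigenvalues\<close>

primrec msq :: "nat \<Rightarrow> (nat \<Rightarrow> nat \<Rightarrow> real) \<Rightarrow> nat \<Rightarrow> nat \<Rightarrow> nat \<Rightarrow> real" where
  "msq d H 0 = H"
| "msq d H (Suc q) = mmul d (msq d H q) (msq d H q)"

definition mtrace :: "nat \<Rightarrow> (nat \<Rightarrow> nat \<Rightarrow> real) \<Rightarrow> real" where
  "mtrace d A = (\<Sum>i<d. A i i)"

lemma mvec_mmul: "mvec d (mmul d A B) v = mvec d A (mvec d B v)"
proof
  fix i
  have "mvec d (mmul d A B) v i = (\<Sum>j<d. \<Sum>l<d. A i l * B l j * v j)"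
    by (simp add: mvec_def mmul_def sum_distrib_right)
  also have "\<dots> = (\<Sum>l<d. \<Sum>j<d. A i l * B l j * v j)" by (rule sum.swap)
  finally show "mvec d (mmul d A B) v i = mvec d A (mvec d B v) i"
    by (simp add: mvec_def sum_distrib_left mult.assoc)
qed

text \<open>Iterates of the linear map replace matrix powers, so that the laws of exponents are
  those of function composition.\<close>

lemma mvec_msq: "mvec d (msq d H q) = (mvec d H ^^ (2 ^ q))"
proof (induction q)
  case (Suc q)
  have "mvec d (msq d H (Suc q)) = mvec d (msq d H q) \<circ> mvec d (msq d H q)"
    by (auto simp: mvec_mmul)
  then show ?case by (simp add: Suc mult_2 funpow_add)
qed simp

lemma mvec_idm: "l < d \<Longrightarrow> mvec d A (idm l) i = A i l"
  by (simp add: mvec_def idm_def if_distrib cong: if_cong)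

lemma dot_idm: "i < d \<Longrightarrow> dot d (idm i) v = v i"
  by (simp add: dot_def idm_def if_distribR if_distrib cong: if_cong)

lemma mvec_add_scale: "mvec d A (\<lambda>i. u i + s * v i) = (\<lambda>i. mvec d A u i + s * mvec d A v i)"
  by (auto simp: mvec_def distrib_left sum.distrib sum_distrib_left mult_ac)

lemma dot_add_scale: "dot d x (\<lambda>i. u i + s * v i) = dot d x u + s * dot d x v"
  by (simp add: dot_def distrib_left sum.distrib sum_distrib_left mult_ac)

lemma dot_add_scale_left: "dot d (\<lambda>i. u i + s * v i) x = dot d u x + s * dot d v x"
  using dot_add_scale[of d x u s v] by (simp add: dot_commute)

lemma dot_mvec_sym:
  assumes "sym_on d H"
  shows "dot d (mvec d H u) v = dot d u (mvec d H v)"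
proof -
  have "tvec d H v i = mvec d H v i" if "i < d" for i
    using that assms by (simp add: tvec_def mvec_def sym_on_def)
  then show ?thesis unfolding dot_mvec by (intro dot_cong) auto
qed

lemma dot_funpow_mvec:
  assumes "sym_on d H"
  shows "dot d ((mvec d H ^^ k) u) v = dot d u ((mvec d H ^^ k) v)"
proof (induction k arbitrary: u)
  case (Suc k)
  have "dot d ((mvec d H ^^ Suc k) u) v = dot d ((mvec d H ^^ k) (mvec d H u)) v"
    by (simp add: funpow_swap1)
  also have "\<dots> = dot d u (mvec d H ((mvec d H ^^ k) v))" by (simp add: Suc dot_mvec_sym[OF assms])
  finally show ?case by simp
qed simp

lemma quadratic_nonneg_discriminant:
  fixes A B C :: real
  assumes "\<And>s. 0 \<le> A + 2 * s * B + s\<^sup>2 * C" "0 \<le> C"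
  shows "B\<^sup>2 \<le> A * C"
proof (cases "C = 0")
  case True
  have "B = 0"
  proof (rule ccontr)
    assume "B \<noteq> 0"
    then have "A + 2 * (- (A + 1) / (2 * B)) * B = - 1" by (simp add: field_simps)
    then show False using assms(1)[of "- (A + 1) / (2 * B)"] True by simp
  qed
  then show ?thesis using True by simp
next
  case False
  then have C: "0 < C" using assms by simp
  have "0 \<le> C * (A + 2 * (- B / C) * B + (- B / C)\<^sup>2 * C)"
    by (intro mult_nonneg_nonneg assms)
  also have "\<dots> = A * C - B\<^sup>2" using C by (simp add: field_simps power2_eq_square)
  finally show ?thesis by simp
qed

context
  fixes d :: nat and H :: "nat \<Rightarrow> nat \<Rightarrow> real"
  assumes sym: "sym_on d H" and psd: "\<And>v. 0 \<le> qf d H v"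
begin

private definition "hp k = (mvec d H ^^ k)"

text \<open>The trace of the \<open>k\<close>-th power of \<open>H\<close>, that is, the
  \<open>k\<close>-th power sum of its eigenvalues, written with the unit vectors
  \<open>idm i\<close>. These traces carry all the spectral information that the oracle
  needs.\<close>

definition trace_power :: "nat \<Rightarrow> real" where
  "trace_power k = (\<Sum>i<d. dot d (idm i) ((mvec d H ^^ k) (idm i)))"

private lemma tp_add: "trace_power (j + k) = (\<Sum>i<d. dot d (hp j (idm i)) (hp k (idm i)))"
  by (simp add: trace_power_def hp_def funpow_add dot_funpow_mvec[OF sym])

private lemma hp_Suc: "hp (Suc k) v = mvec d H (hp k v)"
  by (simp add: hp_def)

private lemma trace_power_even: "trace_power (2 * j) = (\<Sum>i<d. sqn d (hp j (idm i)))"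
  using tp_add[of j j] by (simp add: mult_2 dot_self)

private lemma trace_power_odd: "trace_power (2 * j + 1) = (\<Sum>i<d. qf d H (hp j (idm i)))"
  using tp_add[of j "Suc j"] by (simp add: mult_2 qf_def hp_Suc)

lemma trace_power_nonneg: "0 \<le> trace_power k"
proof (cases "even k")
  case True
  then show ?thesis by (auto simp: trace_power_even elim!: evenE intro!: sum_nonneg)
next
  case False
  then obtain j where "k = 2 * j + 1" by (elim oddE)
  then show ?thesis by (simp only: trace_power_odd) (auto intro!: sum_nonneg psd)
qed

text \<open>The Cauchy-Schwarz inequality for the vectors H^j e_i, in the standard inner product for
  even \<open>k\<close> and in the form of \<open>H\<close> for odd \<open>k\<close>. In both cases
  a quadratic polynomial in \<open>s\<close> is a sum of nonnegative terms.\<close>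

lemma trace_power_log_convex: "(trace_power (Suc k))\<^sup>2 \<le> trace_power k * trace_power (Suc (Suc k))"
proof (rule quadratic_nonneg_discriminant)
  fix s :: real
  show "0 \<le> trace_power k + 2 * s * trace_power (Suc k) + s\<^sup>2 * trace_power (Suc (Suc k))"
  proof (cases "even k")
    case True
    then obtain j where j: "k = 2 * j" by (elim evenE)
    let ?u = "\<lambda>i. hp j (idm i)" and ?v = "\<lambda>i. hp (Suc j) (idm i)"
    have "0 \<le> (\<Sum>i<d. sqn d (\<lambda>l. ?u i l + s * ?v i l))" by (intro sum_nonneg) simp
    also have "\<dots> = (\<Sum>i<d. dot d (?u i) (?u i)) + 2 * s * (\<Sum>i<d. dot d (?u i) (?v i)) + s\<^sup>2 * (\<Sum>i<d. dot d (?v i) (?v i))"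
    proof -
      have vu: "dot d (?v i) (?u i) = dot d (?u i) (?v i)" for i by (rule dot_commute)
      show ?thesis
        unfolding dot_self[symmetric] dot_add_scale dot_add_scale_left vu
        by (simp add: sum.distrib sum_distrib_left power2_eq_square algebra_simps)
    qed
    finally show ?thesis
      unfolding j tp_add[symmetric] mult_2[of j] by (simp only: add_Suc add_Suc_right)
  next
    case False
    then obtain j where j: "k = 2 * j + 1" by (elim oddE)
    let ?u = "\<lambda>i. hp j (idm i)" and ?v = "\<lambda>i. hp (Suc j) (idm i)" and ?w = "\<lambda>i. hp (Suc (Suc j)) (idm i)"
    have "0 \<le> (\<Sum>i<d. qf d H (\<lambda>l. ?u i l + s * ?v i l))" by (intro sum_nonneg psd)
    also have "\<dots> = (\<Sum>i<d. dot d (?u i) (?v i)) + 2 * s * (\<Sum>i<d. dot d (?v i) (?v i)) + s\<^sup>2 * (\<Sum>i<d. dot d (?v i) (?w i))"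
    proof -
      have uw: "dot d (?u i) (?w i) = dot d (?v i) (?v i)" for i
        by (simp only: hp_Suc dot_mvec_sym[OF sym])
      show ?thesis
        unfolding qf_def mvec_add_scale hp_Suc[symmetric] dot_add_scale dot_add_scale_left uw
        by (simp add: sum.distrib sum_distrib_left power2_eq_square algebra_simps)
    qed
    finally show ?thesis
      unfolding j tp_add[symmetric] mult_2[of j] by (simp only: add_Suc add_Suc_right Suc_eq_plus1[symmetric])
  qed
qed (rule trace_power_nonneg)

lemma trace_power_0: "trace_power 0 = real d"
  by (simp add: trace_power_def dot_idm) (simp add: idm_def)

text \<open>Log-convexity iterated from \<open>trace_power 0 = d\<close>. If r denotes the quotient
  of \<open>trace_power (Suc k)\<close> by \<open>trace_power k\<close>, it says that
  \<open>trace_power k\<close> is at most d * r^k.\<close>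

lemma trace_power_growth: "trace_power k ^ Suc k \<le> real d * trace_power (Suc k) ^ k"
proof (induction k)
  case 0
  then show ?case by (simp add: trace_power_0)
next
  case (Suc k)
  let ?a = trace_power
  show ?case
  proof (cases "?a (Suc k) = 0")
    case True
    then show ?thesis using trace_power_nonneg[of "Suc (Suc k)"] by simp
  next
    case False
    then have pos: "0 < ?a (Suc k)" using trace_power_nonneg[of "Suc k"] by simp
    have "?a (Suc k) ^ k * ?a (Suc k) ^ Suc (Suc k) = ((?a (Suc k))\<^sup>2) ^ Suc k"
      unfolding power_mult[symmetric] power_add[symmetric] by (rule arg_cong[where f = "\<lambda>n. _ ^ n"]) simp
    also have "\<dots> \<le> (?a k * ?a (Suc (Suc k))) ^ Suc k"
      by (intro power_mono trace_power_log_convex) simp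
    also have "\<dots> = ?a k ^ Suc k * ?a (Suc (Suc k)) ^ Suc k" by (rule power_mult_distrib)
    also have "\<dots> \<le> real d * ?a (Suc k) ^ k * ?a (Suc (Suc k)) ^ Suc k"
      by (intro mult_right_mono Suc zero_le_power trace_power_nonneg)
    also have "\<dots> = ?a (Suc k) ^ k * (real d * ?a (Suc (Suc k)) ^ Suc k)" by simp
    finally show ?thesis using pos by simp
  qed
qed

text \<open>For a unit vector the Cauchy-Schwarz inequality gives
  \<open>(b k)\<^sup>2 \<le> b (2 * k)\<close>; doubling reaches all powers of two, the exponents
  that repeated squaring produces. Finally the squared norm of the image of \<open>w\<close> is
  bounded by the sum of the squared column norms.\<close>

lemma qf_power_le_trace_power:
  assumes w: "sqn d w = 1"
  shows "qf d H w ^ (2 ^ Suc q) \<le> trace_power (2 ^ Suc q)"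
proof -
  define b where "b k = dot d w (hp k w)" for k
  have bb: "b (2 * k) = sqn d (hp k w)" for k
    using dot_funpow_mvec[OF sym, of k w "hp k w"] by (simp add: b_def hp_def mult_2 funpow_add flip: dot_self)
  have b2: "(b k)\<^sup>2 \<le> b (2 * k)" for k
    using dot_Cauchy_Schwarz[of d w "hp k w"] w unfolding bb b_def[of k] by simp
  have "b 1 ^ (2 ^ j) \<le> b (2 ^ j)" for j
  proof (induction j)
    case (Suc j)
    have b1: "0 \<le> b 1" using psd[of w] by (simp add: b_def hp_def qf_def)
    have "b 1 ^ (2 ^ Suc j) = (b 1 ^ (2 ^ j))\<^sup>2" by (simp add: power_mult[symmetric] mult.commute)
    also have "\<dots> \<le> (b (2 ^ j))\<^sup>2" using b1 Suc by (intro power_mono) auto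
    also have "\<dots> \<le> b (2 ^ Suc j)" using b2[of "2 ^ j"] by simp
    finally show ?case .
  qed simp
  from this[of "Suc q"] have "qf d H w ^ (2 ^ Suc q) \<le> b (2 * 2 ^ q)"
    by (simp add: b_def hp_def qf_def)
  also have "\<dots> = sqn d (hp (2 ^ q) w)" by (rule bb)
  also have "\<dots> = (\<Sum>l<d. (dot d (hp (2 ^ q) (idm l)) w)\<^sup>2)"
    unfolding sqn_def by (intro sum.cong) (auto simp: hp_def dot_funpow_mvec[OF sym] dot_idm)
  also have "\<dots> \<le> (\<Sum>l<d. sqn d (hp (2 ^ q) (idm l)))"
    using dot_Cauchy_Schwarz[of d _ w] w by (intro sum_mono) (metis mult.right_neutral)
  also have "\<dots> = trace_power (2 ^ Suc q)" using trace_power_even[of "2 ^ q"] by simp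
  finally show ?thesis .
qed

lemma mtrace_msq: "mtrace d (msq d H q) = trace_power (2 ^ q)"
  unfolding mtrace_def trace_power_def mvec_msq[symmetric]
  by (intro sum.cong) (auto simp: dot_idm mvec_idm)

lemma frob_msq: "frob d H (msq d H q) = trace_power (Suc (2 ^ q))"
proof -
  have "trace_power (Suc (2 ^ q)) = (\<Sum>i<d. dot d (idm i) (mvec d H (mvec d (msq d H q) (idm i))))"
    by (simp add: trace_power_def mvec_msq)
  also have "\<dots> = (\<Sum>i<d. \<Sum>j<d. H i j * msq d H q j i)"
    by (intro sum.cong) (auto simp: dot_idm mvec_def[of d H] mvec_idm)
  also have "\<dots> = (\<Sum>j<d. \<Sum>i<d. H j i * msq d H q j i)"
    by (subst sum.swap) (use sym in \<open>auto simp: sym_on_def intro!: sum.cong\<close>)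
  finally show ?thesis by (simp add: frob_def)
qed

text \<open>The square of a symmetric matrix is a sum of outer products, so the power divided by its
  trace lies in the hull.\<close>

lemma msq_outer_sum:
  assumes "i < d" "j < d"
  shows "msq d H (Suc q) i j = (\<Sum>l<d. hp (2 ^ q) (idm l) i * hp (2 ^ q) (idm l) j)"
proof -
  have e: "msq d H q a b = hp (2 ^ q) (idm b) a" if "a < d" "b < d" for a b
    using that by (simp add: hp_def flip: mvec_msq mvec_idm)
  have s: "hp (2 ^ q) (idm b) a = hp (2 ^ q) (idm a) b" if "a < d" "b < d" for a b
  proof -
    have "hp (2 ^ q) (idm b) a = dot d (idm a) (hp (2 ^ q) (idm b))" using that by (simp add: dot_idm)
    also have "\<dots> = dot d (hp (2 ^ q) (idm a)) (idm b)" by (simp add: hp_def dot_funpow_mvec[OF sym])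
    also have "\<dots> = hp (2 ^ q) (idm a) b" using that by (subst dot_commute) (simp add: dot_idm)
    finally show ?thesis .
  qed
  have "msq d H (Suc q) i j = (\<Sum>l<d. msq d H q i l * msq d H q l j)" by (simp add: mmul_def)
  also have "\<dots> = (\<Sum>l<d. hp (2 ^ q) (idm l) i * hp (2 ^ q) (idm l) j)"
    using assms by (intro sum.cong) (auto simp: e s[of j])
  finally show ?thesis .
qed

lemma frob_msq_le:
  assumes G: "\<And>w. sqn d w \<le> 1 \<Longrightarrow> qf d G w \<le> b"
  shows "frob d G (msq d H (Suc q)) \<le> b * mtrace d (msq d H (Suc q))"
proof -
  have b: "0 \<le> b" using G[of "\<lambda>_. 0"] by (simp add: qf_alt sqn_def)
  have le: "qf d G w \<le> b * sqn d w" for w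
  proof (cases "sqn d w = 0")
    case True
    then have "\<And>i. i < d \<Longrightarrow> w i = 0" by (auto simp: sqn_def sum_nonneg_eq_0_iff)
    then show ?thesis using True by (simp add: qf_alt)
  next
    case False
    then obtain u where "sqn d u = 1" "qf d G w = sqn d w * qf d G u" by (rule exists_unit_multiple)
    then show ?thesis using mult_left_mono[OF G[of u] sqn_nonneg[of d w]] by (simp add: mult.commute)
  qed
  have "frob d G (msq d H (Suc q)) = (\<Sum>i<d. \<Sum>j<d. \<Sum>l<d. G i j * (hp (2 ^ q) (idm l) i * hp (2 ^ q) (idm l) j))"
    unfolding frob_def by (intro sum.cong) (auto simp: msq_outer_sum sum_distrib_left simp del: msq.simps)
  also have "\<dots> = (\<Sum>i<d. \<Sum>l<d. \<Sum>j<d. G i j * (hp (2 ^ q) (idm l) i * hp (2 ^ q) (idm l) j))"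
    by (intro sum.cong refl sum.swap)
  also have "\<dots> = (\<Sum>l<d. qf d G (hp (2 ^ q) (idm l)))"
    unfolding qf_alt by (rule sum.swap)
  also have "\<dots> \<le> (\<Sum>l<d. b * sqn d (hp (2 ^ q) (idm l)))" by (intro sum_mono le)
  also have "\<dots> = b * trace_power (2 ^ Suc q)"
    using trace_power_even[of "2 ^ q"] by (simp add: sum_distrib_left)
  finally show ?thesis by (simp only: mtrace_msq)
qed

text \<open>The normalised power nearly maximises the form of \<open>H\<close>, with no gap between
  eigenvalues assumed. If \<open>r\<close> is the quotient on the right, then
  \<open>\<rho> ^ P \<le> trace_power P\<close> and
  \<open>trace_power P \<le> real d * r ^ P\<close>, so \<open>r\<close> is at least \<rho> times
  the power -1/P of d; and \<open>1 - real d / real P\<close> is no larger than that power of d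
  because its own power \<open>P\<close> is at most \<open>exp (- real d)\<close>.\<close>

lemma rayleigh_quotient_msq:
  assumes d: "0 < d" and w: "sqn d w = 1" and T: "mtrace d (msq d H (Suc q)) \<noteq> 0"
  shows "qf d H w * (1 - real d / 2 ^ Suc q) \<le> frob d H (msq d H (Suc q)) / mtrace d (msq d H (Suc q))"
proof -
  define P where "P = (2 :: nat) ^ Suc q"
  define a where "a = trace_power P"
  define r where "r = trace_power (Suc P) / a"
  define \<rho> where "\<rho> = qf d H w"
  have P: "0 < P" by (simp add: P_def)
  have a: "0 < a" using T trace_power_nonneg[of P] unfolding mtrace_msq a_def P_def by simp
  have r0: "0 \<le> r" using a trace_power_nonneg by (simp add: r_def)
  have l0: "0 \<le> \<rho>" using psd by (simp add: \<rho>_def)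
  have "a ^ P * a \<le> a ^ P * (real d * r ^ P)"
  proof -
    have e: "trace_power (Suc P) = r * a" using a by (simp add: r_def)
    have "a ^ P * a = a ^ Suc P" by simp
    also have "\<dots> \<le> real d * (r * a) ^ P" using trace_power_growth[of P] unfolding a_def[symmetric] e .
    also have "\<dots> = a ^ P * (real d * r ^ P)" unfolding power_mult_distrib by (simp only: mult_ac)
    finally show ?thesis .
  qed
  then have ar: "a \<le> real d * r ^ P" using a by simp
  have la: "\<rho> ^ P \<le> a" unfolding \<rho>_def a_def P_def by (rule qf_power_le_trace_power[OF w])
  have "\<rho> * (1 - real d / real P) \<le> r"
  proof (rule ccontr)
    assume "\<not> ?thesis"
    then have lt: "r < \<rho> * (1 - real d / real P)" by simp
    then have "0 < \<rho> * (1 - real d / real P)" using r0 by linarith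
    then have pos: "0 < \<rho>" "0 < 1 - real d / real P"
      using l0 unfolding zero_less_mult_iff by linarith+
    have "r ^ P < (\<rho> * (1 - real d / real P)) ^ P" using lt r0 P by (intro power_strict_mono) auto
    also have "\<dots> = \<rho> ^ P * (1 - real d / real P) ^ P" by (rule power_mult_distrib)
    also have "\<dots> \<le> \<rho> ^ P * (1 / real d)"
    proof (intro mult_left_mono)
      have "1 - real d / real P \<le> exp (- real d / real P)"
        using exp_ge_add_one_self[of "- real d / real P"] by simp
      then have "(1 - real d / real P) ^ P \<le> exp (- real d / real P) ^ P" using pos by (intro power_mono) auto
      also have "\<dots> = exp (- real d)" unfolding exp_of_nat_mult[symmetric] using P by simp
      also have "\<dots> = 1 / exp (real d)" by (simp add: exp_minus divide_inverse)
      also have "\<dots> \<le> 1 / real d" using d order.trans[OF _ exp_ge_add_one_self[of "real d"], of "real d"] by (intro divide_left_mono) auto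
      finally show "(1 - real d / real P) ^ P \<le> 1 / real d" .
    qed (use l0 in simp)
    finally have "real d * r ^ P < real d * (\<rho> ^ P * (1 / real d))" using d by (intro mult_strict_left_mono) auto
    also have "real d * (\<rho> ^ P * (1 / real d)) = \<rho> ^ P" using d by simp
    finally have "real d * r ^ P < \<rho> ^ P" .
    then show False using ar la by simp
  qed
  then show ?thesis
    unfolding frob_msq mtrace_msq \<rho>_def r_def a_def P_def by simp
qed

end

section \<open>Frank-Wolfe directions, the oracle inequality and convergence\<close>

definition fw_shift :: "nat \<Rightarrow> (nat \<Rightarrow> nat \<Rightarrow> real) \<Rightarrow> nat \<Rightarrow> nat \<Rightarrow> real" where
  "fw_shift d G = (\<lambda>i j. G i j + sqrt (frob d G G) * idm i j)"

definition fw_power :: "nat \<Rightarrow> nat \<Rightarrow> (nat \<Rightarrow> nat \<Rightarrow> real) \<Rightarrow> nat \<Rightarrow> nat \<Rightarrow> real" where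
  "fw_power d q G = (\<lambda>i j. msq d (fw_shift d G) q i j / mtrace d (msq d (fw_shift d G) q))"

text \<open>The first factor is \<open>1\<close>, \<open>0\<close> or \<open>1/2\<close> according to the sign of \<open>r\<close>, because \<open>0 / 0 = 0\<close>.\<close>

definition fw_dir :: "nat \<Rightarrow> nat \<Rightarrow> (nat \<Rightarrow> nat \<Rightarrow> real) \<Rightarrow> nat \<Rightarrow> nat \<Rightarrow> real" where
  "fw_dir d q G = (\<lambda>i j. (1 + frob d G (fw_power d q G) / sqrt (frob d G (fw_power d q G) * frob d G (fw_power d q G))) / 2
     * fw_power d q G i j)"

text \<open>Frank-Wolfe for the squared distance to \<open>Y\<close>, started at the hull element 0;
  \<open>Y\<close> minus the iterate is the negative gradient, and 2 / (k + 2) is the standard step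
  length.\<close>

primrec fw :: "nat \<Rightarrow> nat \<Rightarrow> (nat \<Rightarrow> nat \<Rightarrow> real) \<Rightarrow> nat \<Rightarrow> nat \<Rightarrow> nat \<Rightarrow> real" where
  "fw d q Y 0 = (\<lambda>i j. 0)"
| "fw d q Y (Suc k) = (\<lambda>i j. fw d q Y k i j
     + 2 / (real k + 2) * (fw_dir d q (\<lambda>i j. Y i j - fw d q Y k i j) i j - fw d q Y k i j))"

lemma abs_qf_le_frob:
  assumes "sqn d v = 1"
  shows "\<bar>qf d G v\<bar> \<le> sqrt (frob d G G)"
proof -
  have "frob d (\<lambda>i j. v i * v j) (\<lambda>i j. v i * v j) = 1"
    using qf_outer[of d v v] assms by (simp add: qf_eq_frob dot_self)
  then have "(qf d G v)\<^sup>2 \<le> frob d G G"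
    using frob_Cauchy_Schwarz[of d G "\<lambda>i j. v i * v j"] by (simp add: qf_eq_frob)
  then show ?thesis by (simp add: real_le_rsqrt)
qed

lemma qf_fw_shift: "qf d (fw_shift d G) v = qf d G v + sqrt (frob d G G) * sqn d v"
proof -
  have "mvec d (fw_shift d G) v i = mvec d G v i + sqrt (frob d G G) * v i" if "i < d" for i
  proof -
    have "mvec d (fw_shift d G) v i = mvec d G v i + sqrt (frob d G G) * (\<Sum>l<d. idm i l * v l)"
      by (simp add: mvec_def fw_shift_def distrib_right sum.distrib mult.assoc flip: sum_distrib_left)
    then show ?thesis using that dot_idm[of i d v] by (simp add: dot_def)
  qed
  then have "qf d (fw_shift d G) v = dot d v (\<lambda>i. mvec d G v i + sqrt (frob d G G) * v i)"
    unfolding qf_def by (intro dot_cong) auto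
  then show ?thesis by (simp add: dot_add_scale qf_def dot_self)
qed

lemma frob_fw_shift: "frob d (fw_shift d G) A = frob d G A + sqrt (frob d G G) * mtrace d A"
proof -
  have "frob d (fw_shift d G) A = frob d G A + (\<Sum>i<d. \<Sum>j<d. sqrt (frob d G G) * (idm i j * A i j))"
    by (simp add: frob_def fw_shift_def distrib_right sum.distrib mult.assoc)
  also have "(\<Sum>i<d. \<Sum>j<d. sqrt (frob d G G) * (idm i j * A i j)) = (\<Sum>i<d. sqrt (frob d G G) * A i i)"
    by (intro sum.cong) (auto simp: idm_def if_distrib if_distribR cong: if_cong)
  finally show ?thesis by (simp add: mtrace_def sum_distrib_left)
qed

text \<open>The Frobenius norm bounds the operator norm, so this multiple of the identity outweighs
  every negative direction of \<open>G\<close>; it costs the program a single square root.\<close>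

lemma fw_shift_psd: "0 \<le> qf d (fw_shift d G) v"
proof (cases "sqn d v = 0")
  case True
  then have "\<And>i. i < d \<Longrightarrow> v i = 0" by (auto simp: sqn_def sum_nonneg_eq_0_iff)
  then show ?thesis by (simp add: qf_alt)
next
  case False
  then obtain u where u: "sqn d u = 1" "qf d (fw_shift d G) v = sqn d v * qf d (fw_shift d G) u"
    by (rule exists_unit_multiple)
  have "0 \<le> qf d (fw_shift d G) u" using abs_qf_le_frob[OF u(1), of G] u by (simp add: qf_fw_shift abs_le_iff)
  then show ?thesis using u by simp
qed

lemma fw_shift_sym: "sym_on d G \<Longrightarrow> sym_on d (fw_shift d G)"
  by (simp add: sym_on_def fw_shift_def idm_def)

lemma sym_on_msq: "sym_on d H \<Longrightarrow> sym_on d (msq d H q)"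
proof (induction q)
  case (Suc q)
  then have "msq d H q i j = msq d H q j i" if "i < d" "j < d" for i j
    using that by (simp add: sym_on_def)
  then show ?case by (auto simp: sym_on_def mmul_def mult.commute intro!: sum.cong)
qed simp

lemma fw_dir_sym: "sym_on d G \<Longrightarrow> sym_on d (fw_dir d q G)"
  using sym_on_msq[OF fw_shift_sym, of d G q] by (simp add: sym_on_def fw_dir_def fw_power_def)

lemma fw_sym: "sym_on d Y \<Longrightarrow> sym_on d (fw d q Y k)"
proof (induction k)
  case (Suc k)
  then have "sym_on d (\<lambda>i j. Y i j - fw d q Y k i j)" by (simp add: sym_on_def)
  from fw_dir_sym[OF this, of q] Suc show ?case by (simp add: sym_on_def)
qed (simp add: sym_on_def)

text \<open>The hull contains 0, which is the better direction when the normalised power has a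
  negative value. The additive error comes from the Rayleigh quotient, applied to a shifted form of
  size at most \<open>2 * sqrt (frob d G G)\<close>.\<close>

lemma fw_dir_properties:
  assumes G: "sym_on d G" and d: "0 < d"
  shows fw_dir_hull: "psd_hull d (fw_dir d (Suc q) G)"
    and fw_dir_oracle: "sqn d w \<le> 1 \<Longrightarrow> qf d G w \<le> frob d G (fw_dir d (Suc q) G) + 2 * sqrt (frob d G G) * real d / 2 ^ Suc q"
proof -
  let ?H = "fw_shift d G"
  define c where "c = sqrt (frob d G G)"
  define T where "T = mtrace d (msq d ?H (Suc q))"
  define r where "r = frob d G (fw_power d (Suc q) G)"
  define \<theta> where "\<theta> = (1 + r / sqrt (r * r)) / 2"
  note H = fw_shift_sym[OF G] fw_shift_psd
  have c0: "0 \<le> c" by (simp add: c_def)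
  have T0: "0 \<le> T" unfolding T_def mtrace_msq[OF H] by (rule trace_power_nonneg[OF H])
  \<comment> \<open>With this factor the value of the direction becomes \<open>max 0 r\<close>,
    computed without a test.\<close>
  have th: "0 \<le> \<theta>" "\<theta> \<le> 1" "\<theta> * r = max 0 r"
    by (cases "r = 0"; cases "0 < r"; simp add: \<theta>_def real_sqrt_mult_self)+
  have dir: "frob d N (fw_dir d (Suc q) G) = \<theta> * (frob d N (msq d ?H (Suc q)) / T)" for N
    unfolding fw_dir_def r_def[symmetric] \<theta>_def[symmetric] frob_scale_right
    by (simp add: fw_power_def frob_def sum_divide_distrib T_def)
  show "psd_hull d (fw_dir d (Suc q) G)" unfolding psd_hull_def
  proof (intro allI impI)
    fix N b assume N: "\<forall>w. sqn d w \<le> 1 \<longrightarrow> qf d N w \<le> b"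
    have b: "0 \<le> b" using N[rule_format, of "\<lambda>_. 0"] by (simp add: qf_alt sqn_def)
    have "frob d N (msq d ?H (Suc q)) \<le> b * T"
      unfolding T_def using N by (intro frob_msq_le[OF H]) auto
    then have "frob d N (msq d ?H (Suc q)) / T \<le> b"
      using T0 b by (cases "T = 0") (auto simp: field_simps)
    then have "\<theta> * (frob d N (msq d ?H (Suc q)) / T) \<le> \<theta> * b" using th by (intro mult_left_mono)
    also have "\<dots> \<le> b" using th b by (simp add: mult_left_le_one_le)
    finally show "frob d N (fw_dir d (Suc q) G) \<le> b" by (simp add: dir)
  qed
  have G_dir: "frob d G (fw_dir d (Suc q) G) = max 0 r"
    unfolding fw_dir_def r_def[symmetric] \<theta>_def[symmetric] frob_scale_right using th by simp
  have unit: "qf d G u \<le> max 0 r + 2 * c * real d / 2 ^ Suc q" if u: "sqn d u = 1" for u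
  \<comment> \<open>A zero trace forces the shifted form to vanish at unit vectors, where
    \<open>G\<close> then has the value \<open>- c\<close>. Division by 0 yields 0, so the direction
    is 0, and that is optimal.\<close>
  proof (cases "T = 0")
    case True
    have "qf d ?H u ^ (2 ^ Suc q) \<le> 0"
      using qf_power_le_trace_power[OF H u, of q] True unfolding T_def mtrace_msq[OF H] by simp
    then have "qf d ?H u = 0" using fw_shift_psd[of d G u] by (metis power_eq_0_iff power_le_zero_eq_numeral zero_le_power antisym)
    then have "qf d G u = - c" using u by (simp add: qf_fw_shift c_def)
    then have "qf d G u \<le> 0" using c0 by simp
    also have "0 \<le> max 0 r + 2 * c * real d / 2 ^ Suc q" using c0 by (intro add_nonneg_nonneg) auto
    finally show ?thesis .
  next
    case False
    have rT: "r = frob d ?H (msq d ?H (Suc q)) / T - c"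
    proof -
      have "r = frob d G (msq d ?H (Suc q)) / T"
        by (simp add: r_def fw_power_def frob_def sum_divide_distrib T_def)
      moreover have "frob d ?H (msq d ?H (Suc q)) = frob d G (msq d ?H (Suc q)) + c * T"
        unfolding frob_fw_shift c_def T_def ..
      ultimately show ?thesis using False by (simp add: field_simps)
    qed
    have H2: "qf d ?H u = qf d G u + c" using u by (simp add: qf_fw_shift c_def)
    have "qf d ?H u \<le> 2 * c" using abs_qf_le_frob[OF u, of G] H2 by (simp add: c_def abs_le_iff)
    then have "qf d ?H u * (real d / 2 ^ Suc q) \<le> 2 * c * (real d / 2 ^ Suc q)" by (intro mult_right_mono) auto
    moreover have "qf d ?H u * (1 - real d / 2 ^ Suc q) \<le> r + c"
      using rayleigh_quotient_msq[OF H d u, of q] False rT by (simp add: T_def del: msq.simps)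
    ultimately have "qf d ?H u \<le> r + c + 2 * c * (real d / 2 ^ Suc q)" by (simp add: algebra_simps)
    then show ?thesis using H2 by simp
  qed
  show "qf d G w \<le> frob d G (fw_dir d (Suc q) G) + 2 * sqrt (frob d G G) * real d / 2 ^ Suc q" if w: "sqn d w \<le> 1"
  proof -
    have nn: "0 \<le> max 0 r + 2 * c * real d / 2 ^ Suc q" using c0 by (intro add_nonneg_nonneg) auto
    show ?thesis
    proof (cases "sqn d w = 0")
      case True
      then have "\<And>i. i < d \<Longrightarrow> w i = 0" by (auto simp: sqn_def sum_nonneg_eq_0_iff)
      then have "qf d G w = 0" by (simp add: qf_alt)
      then show ?thesis using nn unfolding G_dir c_def by simp
    next
      case False
      then obtain u where u: "sqn d u = 1" "qf d G w = sqn d w * qf d G u" by (rule exists_unit_multiple)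
      have "sqn d w * qf d G u \<le> 1 * (max 0 r + 2 * c * real d / 2 ^ Suc q)"
        using w nn by (intro mult_mono' order.trans[OF mult_left_mono[OF unit[OF u(1)]]] mult_right_mono) auto
      then show ?thesis using u unfolding G_dir c_def by simp
    qed
  qed
qed

lemma psd_hull_fw:
  assumes Y: "sym_on d Y" and d: "0 < d"
  shows "psd_hull d (fw d (Suc q) Y k)"
proof (induction k)
  case 0
  then show ?case by (simp add: psd_hull_zero)
next
  case (Suc k)
  have "sym_on d (\<lambda>i j. Y i j - fw d (Suc q) Y k i j)"
    using Y fw_sym[OF Y, of "Suc q" k] by (simp add: sym_on_def)
  from psd_hull_convex[OF Suc fw_dir_hull[OF this d, of q], of "2 / (real k + 2)"]
  show ?case by simp
qed

lemma frob_sum_le: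
  "frob d (\<lambda>i j. A i j - B i j) (\<lambda>i j. A i j - B i j) \<le> 2 * (frob d A A + frob d B B)"
proof -
  have "0 \<le> frob d (\<lambda>i j. A i j + B i j) (\<lambda>i j. A i j + B i j)" by simp
  then show ?thesis by (simp add: frob_add_right frob_add_left frob_diff_right frob_diff_left frob_commute[of d B A])
qed

lemma sqrt_frob_diff_le:
  "sqrt (frob d (\<lambda>i j. A i j - B i j) (\<lambda>i j. A i j - B i j)) \<le> sqrt (frob d A A) + sqrt (frob d B B)"
proof (rule real_le_lsqrt)
  have "\<bar>frob d A B\<bar> \<le> sqrt (frob d A A) * sqrt (frob d B B)"
    using frob_Cauchy_Schwarz[of d A B] by (simp add: real_le_rsqrt flip: real_sqrt_mult)
  then show "frob d (\<lambda>i j. A i j - B i j) (\<lambda>i j. A i j - B i j) \<le> (sqrt (frob d A A) + sqrt (frob d B B))\<^sup>2"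
    by (simp add: frob_diff_right frob_diff_left frob_commute[of d B A] power2_sum abs_le_iff)
qed auto

text \<open>The oracle error does not accumulate over the iterations: \<open>\<delta>\<close> is
  subtracted in \<open>e\<close>, and each step contracts \<open>e\<close> up to a term
  \<open>2 * \<gamma>\<^sup>2\<close>.\<close>

lemma fw_convergence:
  fixes q k :: nat
  assumes Y: "sym_on d Y" and d: "0 < d" and M: "psd_hull d M"
  defines "f \<equiv> \<lambda>B. frob d (\<lambda>i j. B i j - Y i j) (\<lambda>i j. B i j - Y i j) / 2"
  defines "\<delta> \<equiv> 2 * (sqrt (frob d Y Y) + 1) * real d / 2 ^ Suc q"
  shows "f (fw d (Suc q) Y (Suc k)) \<le> f M + \<delta> + 8 / (real k + 3)"
proof -
  let ?B = "fw d (Suc q) Y"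
  define e where "e k = f (?B k) - f M - \<delta>" for k
  have step: "e (Suc k) \<le> (1 - \<gamma>) * e k + 2 * \<gamma>\<^sup>2" if \<gamma>: "\<gamma> = 2 / (real k + 2)" for k \<gamma>
  proof -
    define B where "B = ?B k"
    define G where "G = (\<lambda>i j. Y i j - B i j)"
    define D where "D = fw_dir d (Suc q) G"
    define \<delta>' where "\<delta>' = 2 * sqrt (frob d G G) * real d / 2 ^ Suc q"
    have \<gamma>01: "0 \<le> \<gamma>" "\<gamma> \<le> 1" using \<gamma> by auto
    have B: "psd_hull d B" "sym_on d B" unfolding B_def by (rule psd_hull_fw[OF Y d] fw_sym[OF Y])+
    have G: "sym_on d G" using Y B by (simp add: G_def sym_on_def)
    have D: "psd_hull d D" unfolding D_def by (rule fw_dir_hull[OF G d])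
    \<comment> \<open>The iterate lies in the hull and has norm at most 1; this makes the oracle
      error uniform over the iterations.\<close>
    have "sqrt (frob d G G) \<le> sqrt (frob d Y Y) + sqrt (frob d B B)"
      unfolding G_def by (rule sqrt_frob_diff_le)
    also have "sqrt (frob d B B) \<le> 1" using psd_hull_frob_le[OF B(1)] by simp
    finally have \<delta>: "\<delta>' \<le> \<delta>"
      unfolding \<delta>'_def \<delta>_def by (intro divide_right_mono mult_right_mono mult_left_mono) auto
    have "frob d G M \<le> frob d G D + \<delta>'"
      using M fw_dir_oracle[OF G d] unfolding psd_hull_def D_def \<delta>'_def by blast
    then have GM: "frob d G M \<le> frob d G D + \<delta>" using \<delta> by simp
    have Bs: "?B (Suc k) = (\<lambda>i j. B i j + \<gamma> * (D i j - B i j))"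
      by (simp add: B_def D_def G_def \<gamma>)
    have f': "f X = frob d X X / 2 - frob d Y X + frob d Y Y / 2" for X
      by (simp add: f_def frob_diff_right frob_diff_left frob_commute[of d X Y])
    define S where "S = frob d (\<lambda>i j. D i j - B i j) (\<lambda>i j. D i j - B i j)"
    have "f (?B (Suc k)) = f B + \<gamma> * (frob d G B - frob d G D) + \<gamma>\<^sup>2 / 2 * S"
    proof -
      have e1: "frob d (\<lambda>i j. B i j + \<gamma> * (D i j - B i j)) (\<lambda>i j. B i j + \<gamma> * (D i j - B i j))
        = frob d B B + 2 * \<gamma> * (frob d B D - frob d B B) + \<gamma>\<^sup>2 * S"
        unfolding S_def frob_def
        by (simp add: sum_distrib_left sum.distrib[symmetric] sum_subtractf[symmetric] power2_eq_square algebra_simps)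
      have e2: "frob d Y (\<lambda>i j. B i j + \<gamma> * (D i j - B i j)) = frob d Y B + \<gamma> * (frob d Y D - frob d Y B)"
        by (simp add: frob_add_right frob_scale_right frob_diff_right)
      have e3: "frob d G X = frob d Y X - frob d B X" for X by (simp add: G_def frob_diff_left)
      show ?thesis unfolding Bs f' e1 e2 e3[of B] e3[of D] by (simp add: field_simps)
    qed
    \<comment> \<open>A bound on the squared diameter of the hull; halved, it is the coefficient 2
      of \<open>\<gamma>\<^sup>2\<close>.\<close>
    also have "S \<le> 4"
      using frob_sum_le[of d D B] psd_hull_frob_le[OF D] psd_hull_frob_le[OF B(1)] by (simp add: S_def)
    \<comment> \<open>Convexity of \<open>f\<close>, followed by the oracle inequality at
      \<open>M\<close>.\<close>
    also have "frob d G B - frob d G D \<le> f M - f B + \<delta>"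
    proof -
      have "0 \<le> frob d (\<lambda>i j. M i j - B i j) (\<lambda>i j. M i j - B i j)" by simp
      then have "frob d G B - frob d G M \<le> f M - f B"
        unfolding f' by (simp add: G_def frob_diff_left frob_diff_right frob_commute[of d M B] algebra_simps)
      then show ?thesis using GM by linarith
    qed
    finally have "f (?B (Suc k)) \<le> f B + \<gamma> * (f M - f B + \<delta>) + \<gamma>\<^sup>2 / 2 * 4"
      using \<gamma>01 by (simp add: mult_left_mono)
    then show ?thesis by (simp add: e_def B_def algebra_simps)
  qed
  have "e (Suc k) \<le> 8 / (real k + 3)"
  proof (induction k)
    case 0
    \<comment> \<open>The first step has \<open>\<gamma> = 1\<close> and forgets the starting
      point.\<close>
    then show ?case using step[of 1 0] by simp
  next
    case (Suc k)
    define K where "K = real k + 3"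
    have K: "0 < K" "2 / K \<le> 1" by (auto simp: K_def)
    have "e (Suc (Suc k)) \<le> (1 - 2 / K) * e (Suc k) + 2 * (2 / K)\<^sup>2"
      using step[of "2 / K" "Suc k"] by (simp add: K_def add_ac)
    also have "\<dots> \<le> (1 - 2 / K) * (8 / K) + 2 * (2 / K)\<^sup>2"
      using K Suc by (intro add_right_mono mult_left_mono) (auto simp: K_def)
    also have "\<dots> = 8 * (K - 1) / K\<^sup>2" using K by (simp add: field_simps power2_eq_square)
    also have "\<dots> \<le> 8 / (K + 1)"
      using K by (simp add: field_simps power2_eq_square)
    finally show ?case by (simp add: K_def add_ac)
  qed
  then show ?thesis by (simp add: e_def)
qed

section \<open>Loops of the program language\<close>

definition mk :: "(vname \<Rightarrow> nat) \<Rightarrow> (vname \<Rightarrow> nat \<times> nat \<Rightarrow> real) \<Rightarrow> nat \<Rightarrow> state" where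
  "mk I \<sigma> k = \<lparr>idx = I, arr = \<sigma>, drawn = k\<rparr>"

lemma mk_simps [simp]: "idx (mk I \<sigma> k) = I" "arr (mk I \<sigma> k) = \<sigma>" "drawn (mk I \<sigma> k) = k"
  by (simp_all add: mk_def)

text \<open>An upper bound in place of the exact number of steps, so that bounds for parts of a
  program add up and can be rounded.\<close>

definition runs :: "tape \<Rightarrow> prog \<Rightarrow> nat \<Rightarrow> state \<Rightarrow> state \<Rightarrow> bool" where
  "runs \<omega> P T s s' \<longleftrightarrow> (\<exists>t\<le>T. exec \<omega> P s t s')"

lemma runs_mono: "runs \<omega> P T s s' \<Longrightarrow> T \<le> T' \<Longrightarrow> runs \<omega> P T' s s'"
  by (auto simp: runs_def intro: order.trans)

lemma runs_Seq: "runs \<omega> P T s s' \<Longrightarrow> runs \<omega> Q U s' s'' \<Longrightarrow> runs \<omega> (Seq P Q) (T + U) s s''"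
  unfolding runs_def by (meson add_mono exec_Seq)

lemma runs_ISet: "runs \<omega> (ISet x a) 1 (mk I \<sigma> k) (mk (I(x := ival (mk I \<sigma> k) a)) \<sigma> k)"
  unfolding runs_def using exec_ISet[of \<omega> x a "mk I \<sigma> k"] by (auto simp: mk_def)

lemma runs_RSet: "runs \<omega> (RSet x a b p) 1 (mk I \<sigma> k)
    (mk I (\<sigma>(x := (\<sigma> x)((ival (mk I \<sigma> k) a, ival (mk I \<sigma> k) b) := rval (mk I \<sigma> k) p))) k)"
  unfolding runs_def using exec_RSet[of \<omega> x a b p "mk I \<sigma> k"] by (auto simp: mk_def set_arr_def)

lemma runs_DrawGaussian: "runs \<omega> (DrawGaussian x a b) 1 (mk I \<sigma> k)
    (mk I (\<sigma>(x := (\<sigma> x)((ival (mk I \<sigma> k) a, ival (mk I \<sigma> k) b) := snd (\<omega> k)))) (Suc k))"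
  unfolding runs_def using exec_DrawGaussian[of \<omega> x a b "mk I \<sigma> k"] by (auto simp: mk_def set_arr_def)

text \<open>Loops reset their counter, so that the final state is a function of the initial one.\<close>

definition For :: "vname \<Rightarrow> iexp \<Rightarrow> prog \<Rightarrow> prog" where
  "For x e P = Seq (While (ILess (IVar x) e) (Seq P (ISet x (IAdd (IVar x) (IConst 1))))) (ISet x (IConst 0))"

text \<open>The state before iteration \<open>k\<close> is an explicit function of \<open>k\<close>,
  with the counter overwritten separately, so that the final reset restores its value 0. An
  iteration costs 2 steps beyond its body, for the test and the increment; the last 2 are the
  failing test and the reset.\<close>

lemma runs_For:
  assumes x0: "\<And>k. I k x = 0"
    and e: "\<And>k. k \<le> N \<Longrightarrow> ival (mk ((I k)(x := k)) (\<sigma> k) (c k)) e = N"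
    and body: "\<And>k. k < N \<Longrightarrow> runs \<omega> P T (mk ((I k)(x := k)) (\<sigma> k) (c k)) (mk ((I (Suc k))(x := k)) (\<sigma> (Suc k)) (c (Suc k)))"
  shows "runs \<omega> (For x e P) (N * (T + 2) + 2) (mk (I 0) (\<sigma> 0) (c 0)) (mk (I N) (\<sigma> N) (c N))"
proof -
  let ?W = "While (ILess (IVar x) e) (Seq P (ISet x (IAdd (IVar x) (IConst 1))))"
  let ?S = "\<lambda>k. mk ((I k)(x := k)) (\<sigma> k) (c k)"
  have W: "runs \<omega> ?W (k * (T + 2) + 1) (?S (N - k)) (?S N)" if "k \<le> N" for k
    using that
  proof (induction k)
    case 0
    have "exec \<omega> ?W (?S N) 1 (?S N)" using e[of N] by (intro exec_WhileF) auto
    then have "runs \<omega> ?W 1 (?S N) (?S N)" unfolding runs_def by blast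
    then show ?case by (simp del: fun_upd_apply)
  next
    case (Suc k)
    define j where "j = N - Suc k"
    have j: "j < N" "Suc j = N - k" using Suc.prems by (auto simp: j_def)
    have "runs \<omega> (Seq P (ISet x (IAdd (IVar x) (IConst 1)))) (T + 1) (?S j) (?S (Suc j))"
      using runs_Seq[OF body[OF j(1)] runs_ISet[of \<omega> x "IAdd (IVar x) (IConst 1)" "(I (Suc j))(x := j)"]]
      by simp
    moreover have "tval (?S j) (ILess (IVar x) e)" using e[of j] j by simp
    moreover have "runs \<omega> ?W (k * (T + 2) + 1) (?S (Suc j)) (?S N)"
      unfolding j(2) using Suc.prems by (intro Suc.IH) simp
    ultimately obtain t u where "t \<le> T + 1" "u \<le> k * (T + 2) + 1"
      "exec \<omega> ?W (?S j) (Suc (t + u)) (?S N)"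
      unfolding runs_def by (meson exec_WhileT)
    then show ?case unfolding runs_def j_def by (intro exI[of _ "Suc (t + u)"]) auto
  qed
  have triv: "(I k)(x := 0) = I k" for k using x0[of k] by (auto simp: fun_eq_iff)
  have "runs \<omega> (For x e P) (N * (T + 2) + 1 + 1) (?S 0) (mk (I N) (\<sigma> N) (c N))"
    unfolding For_def
    using runs_Seq[OF W[of N] runs_ISet[of \<omega> x "IConst 0" "(I N)(x := N)" "\<sigma> N" "c N"]] by (simp add: triv)
  then show ?thesis by (simp add: triv)
qed

section \<open>Filling an array with sums\<close>

fun reads_not :: "vname \<Rightarrow> rexp \<Rightarrow> bool" where
  "reads_not z (RConst k) = True"
| "reads_not z (RIdx a) = True"
| "reads_not z (RGet x a b) = (x \<noteq> z)"
| "reads_not z (RAdd p q) = (reads_not z p \<and> reads_not z q)"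
| "reads_not z (RSub p q) = (reads_not z p \<and> reads_not z q)"
| "reads_not z (RMul p q) = (reads_not z p \<and> reads_not z q)"
| "reads_not z (RDiv p q) = (reads_not z p \<and> reads_not z q)"
| "reads_not z (RSqrt p) = reads_not z p"

lemma ival_mk: "ival (mk I \<sigma> k) a = ival (mk I \<sigma>' k') a"
  by (induction a) auto

lemma rval_upd: "reads_not z p \<Longrightarrow> rval (mk I (\<sigma>(z := \<tau>)) k) p = rval (mk I \<sigma> k') p"
  by (induction p) (auto intro!: arg_cong2[where f = "\<lambda>a b. \<sigma> _ (a, b)"] ival_mk)

definition fill :: "vname \<Rightarrow> nat \<Rightarrow> nat \<Rightarrow> (nat \<Rightarrow> nat \<Rightarrow> real) \<Rightarrow> (vname \<Rightarrow> nat \<times> nat \<Rightarrow> real) \<Rightarrow> vname \<Rightarrow> nat \<times> nat \<Rightarrow> real" where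
  "fill z A B F \<sigma> = \<sigma>(z := (\<lambda>(p, q). if p < A \<and> q < B then F p q else \<sigma> z (p, q)))"

text \<open>Entry (i, j) becomes the sum of \<open>e\<close> over the counter \<open>l\<close> below
  \<open>c\<close>; with \<open>c\<close> equal to 1 this is a plain assignment. The matrix
  computations are built from this one nest of loops, whose effect and cost are established
  once.\<close>

definition Fill :: "vname \<Rightarrow> iexp \<Rightarrow> iexp \<Rightarrow> iexp \<Rightarrow> rexp \<Rightarrow> prog" where
  "Fill z a b c e = For ''i'' a (For ''j'' b (Seq (RSet z (IVar ''i'') (IVar ''j'') (RConst 0))
     (For ''l'' c (RSet z (IVar ''i'') (IVar ''j'') (RAdd (RGet z (IVar ''i'') (IVar ''j'')) e)))))"

fun iexp_fixed :: "iexp \<Rightarrow> bool" where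
  "iexp_fixed (IConst k) = True"
| "iexp_fixed (IVar x) = (x \<notin> {''i'', ''j'', ''l''})"
| "iexp_fixed (IAdd a b) = (iexp_fixed a \<and> iexp_fixed b)"
| "iexp_fixed (ISub a b) = (iexp_fixed a \<and> iexp_fixed b)"

definition loop_idx :: "(vname \<Rightarrow> nat) \<Rightarrow> nat \<Rightarrow> nat \<Rightarrow> nat \<Rightarrow> vname \<Rightarrow> nat" where
  "loop_idx I i j l = I(''i'' := i, ''j'' := j, ''l'' := l)"

lemma loop_idx_apply [simp]:
  "loop_idx I i j l ''i'' = i" "loop_idx I i j l ''j'' = j" "loop_idx I i j l ''l'' = l"
  "x \<noteq> ''i'' \<Longrightarrow> x \<noteq> ''j'' \<Longrightarrow> x \<noteq> ''l'' \<Longrightarrow> loop_idx I i j l x = I x"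
  by (simp_all add: loop_idx_def)

lemma loop_idx_upd [simp]:
  "(loop_idx I i j l)(''i'' := i') = loop_idx I i' j l"
  "(loop_idx I i j l)(''j'' := j') = loop_idx I i j' l"
  "(loop_idx I i j l)(''l'' := l') = loop_idx I i j l'"
  by (auto simp: loop_idx_def fun_eq_iff)

lemma ival_fixed: "iexp_fixed a \<Longrightarrow> ival (mk (loop_idx I i j l) \<sigma> k) a = ival (mk I \<sigma>' k') a"
  by (induction a) auto

text \<open>Since \<open>e\<close> does not read \<open>z\<close>, its values may be taken in the
  initial state throughout, although \<open>z\<close> is being overwritten.\<close>

lemma runs_Fill:
  fixes I :: "vname \<Rightarrow> nat" and F :: "nat \<Rightarrow> nat \<Rightarrow> real"
  assumes I: "I ''i'' = 0" "I ''j'' = 0" "I ''l'' = 0"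
    and fixed: "iexp_fixed a" "iexp_fixed b" "iexp_fixed c" and e: "reads_not z e"
    and A: "ival (mk I \<sigma> k) a = A" and B: "ival (mk I \<sigma> k) b = B" and C: "ival (mk I \<sigma> k) c = C"
    and F: "\<And>i j. i < A \<Longrightarrow> j < B \<Longrightarrow> (\<Sum>l<C. rval (mk (loop_idx I i j l) \<sigma> k) e) = F i j"
  shows "runs \<omega> (Fill z a b c e) (5 * ((A + 1) * (B + 1) * (C + 1))) (mk I \<sigma> k) (mk I (fill z A B F \<sigma>) k)"
proof -
  have I0: "loop_idx I 0 0 0 = I" using I by (auto simp: loop_idx_def fun_eq_iff)
  have val: "ival (mk (loop_idx I i j l) \<sigma>' k) a = A" "ival (mk (loop_idx I i j l) \<sigma>' k) b = B"
    "ival (mk (loop_idx I i j l) \<sigma>' k) c = C" for i j l \<sigma>'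
    using ival_fixed[OF fixed(1), of I i j l \<sigma>' k \<sigma> k] ival_fixed[OF fixed(2), of I i j l \<sigma>' k \<sigma> k]
      ival_fixed[OF fixed(3), of I i j l \<sigma>' k \<sigma> k] A B C by auto
  \<comment> \<open>\<open>s1\<close>, \<open>s2\<close> and \<open>s3\<close> describe memory after
    complete rows, within a row, and within the sum for a single entry.\<close>
  define s1 where "s1 i = \<sigma>(z := (\<lambda>(p, q). if p < i \<and> q < B then F p q else \<sigma> z (p, q)))" for i
  define s2 where "s2 i j = \<sigma>(z := (\<lambda>(p, q). if (p < i \<and> q < B) \<or> (p = i \<and> q < j) then F p q else \<sigma> z (p, q)))" for i j
  define s3 where "s3 i j l = (s2 i j)(z := (s2 i j z)((i, j) := (\<Sum>l<l. rval (mk (loop_idx I i j l) \<sigma> k) e)))" for i j l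
  have inner: "runs \<omega> (For ''l'' c (RSet z (IVar ''i'') (IVar ''j'') (RAdd (RGet z (IVar ''i'') (IVar ''j'')) e)))
      (C * (1 + 2) + 2) (mk (loop_idx I i j 0) (s3 i j 0) k) (mk (loop_idx I i j 0) (s3 i j C) k)" for i j
  proof (rule runs_For[where I = "\<lambda>_. loop_idx I i j 0" and \<sigma> = "s3 i j" and c = "\<lambda>_. k"])
    fix l
    have "rval (mk (loop_idx I i j l) (s3 i j l) k) e = rval (mk (loop_idx I i j l) \<sigma> k) e"
      unfolding s3_def s2_def fun_upd_upd by (rule rval_upd[OF e])
    then have "s3 i j (Suc l) = (s3 i j l)(z := (s3 i j l z)((i, j) := s3 i j l z (i, j) + rval (mk (loop_idx I i j l) (s3 i j l) k) e))"
      by (simp add: s3_def)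
    then show "runs \<omega> (RSet z (IVar ''i'') (IVar ''j'') (RAdd (RGet z (IVar ''i'') (IVar ''j'')) e)) 1
        (mk ((loop_idx I i j 0)(''l'' := l)) (s3 i j l) k) (mk ((loop_idx I i j 0)(''l'' := l)) (s3 i j (Suc l)) k)"
      using runs_RSet[of \<omega> z "IVar ''i''" "IVar ''j''" "RAdd (RGet z (IVar ''i'') (IVar ''j'')) e" "loop_idx I i j l" "s3 i j l" k]
      by simp
  qed (simp_all add: val)
  have cell: "runs \<omega> (Seq (RSet z (IVar ''i'') (IVar ''j'') (RConst 0))
     (For ''l'' c (RSet z (IVar ''i'') (IVar ''j'') (RAdd (RGet z (IVar ''i'') (IVar ''j'')) e))))
     (1 + (C * (1 + 2) + 2)) (mk (loop_idx I i j 0) (s2 i j) k) (mk (loop_idx I i j 0) (s2 i (Suc j)) k)"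
    if ij: "i < A" "j < B" for i j
  proof -
    have r: "runs \<omega> (RSet z (IVar ''i'') (IVar ''j'') (RConst 0)) 1 (mk (loop_idx I i j 0) (s2 i j) k) (mk (loop_idx I i j 0) (s3 i j 0) k)"
      using runs_RSet[of \<omega> z "IVar ''i''" "IVar ''j''" "RConst 0" "loop_idx I i j 0" "s2 i j" k] by (simp add: s3_def)
    have eq: "s3 i j C = s2 i (Suc j)"
      unfolding s3_def using ij F[OF ij] by (auto simp: s2_def fun_eq_iff less_Suc_eq)
    show ?thesis using runs_Seq[OF r inner[of i j]] unfolding eq .
  qed
  have row: "runs \<omega> (For ''j'' b (Seq (RSet z (IVar ''i'') (IVar ''j'') (RConst 0))
     (For ''l'' c (RSet z (IVar ''i'') (IVar ''j'') (RAdd (RGet z (IVar ''i'') (IVar ''j'')) e)))))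
     (B * (1 + (C * (1 + 2) + 2) + 2) + 2) (mk (loop_idx I i 0 0) (s1 i) k) (mk (loop_idx I i 0 0) (s1 (Suc i)) k)"
    if i: "i < A" for i
  proof -
    have "s2 i 0 = s1 i" by (auto simp: s1_def s2_def fun_eq_iff)
    moreover have "s2 i B = s1 (Suc i)" by (auto simp: s1_def s2_def fun_eq_iff less_Suc_eq)
    moreover have "runs \<omega> (For ''j'' b (Seq (RSet z (IVar ''i'') (IVar ''j'') (RConst 0))
     (For ''l'' c (RSet z (IVar ''i'') (IVar ''j'') (RAdd (RGet z (IVar ''i'') (IVar ''j'')) e)))))
     (B * (1 + (C * (1 + 2) + 2) + 2) + 2) (mk (loop_idx I i 0 0) (s2 i 0) k) (mk (loop_idx I i 0 0) (s2 i B) k)"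
      by (rule runs_For[where I = "\<lambda>_. loop_idx I i 0 0" and \<sigma> = "s2 i" and c = "\<lambda>_. k"])
         (use cell[OF i] in \<open>simp_all add: val\<close>)
    ultimately show ?thesis by simp
  qed
  have "runs \<omega> (Fill z a b c e) (A * (B * (1 + (C * (1 + 2) + 2) + 2) + 2 + 2) + 2) (mk (loop_idx I 0 0 0) (s1 0) k) (mk (loop_idx I 0 0 0) (s1 A) k)"
    unfolding Fill_def
    by (rule runs_For[where I = "\<lambda>_. loop_idx I 0 0 0" and \<sigma> = s1 and c = "\<lambda>_. k"])
       (use row in \<open>simp_all add: val\<close>)
  then have "runs \<omega> (Fill z a b c e) (A * (B * (1 + (C * (1 + 2) + 2) + 2) + 2 + 2) + 2) (mk I (s1 0) k) (mk I (s1 A) k)"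
    by (simp only: I0)
  moreover have "s1 0 = \<sigma>" by (auto simp: s1_def fun_eq_iff)
  moreover have "s1 A = fill z A B F \<sigma>" by (simp add: s1_def fill_def)
  moreover have "A * (B * (1 + (C * (1 + 2) + 2) + 2) + 2 + 2) + 2 \<le> 5 * ((A + 1) * (B + 1) * (C + 1))"
    by (simp add: algebra_simps)
  ultimately show ?thesis by (simp only: runs_mono)
qed

text \<open>For loops whose memory has no closed form: the states are chosen one after the other
  from the existential statement about the body, while the tape position \<open>c k\<close> stays
  explicit.\<close>

lemma runs_For_invariant:
  assumes x0: "I x = 0"
    and e: "\<And>k \<sigma>. k \<le> N \<Longrightarrow> ival (mk (I(x := k)) \<sigma> 0) e = N"
    and init: "Inv 0 \<sigma>"
    and body: "\<And>k \<sigma>. k < N \<Longrightarrow> Inv k \<sigma> \<Longrightarrow>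
      \<exists>\<sigma>'. runs \<omega> P T (mk (I(x := k)) \<sigma> (c k)) (mk (I(x := k)) \<sigma>' (c (Suc k))) \<and> Inv (Suc k) \<sigma>'"
  shows "\<exists>\<sigma>'. runs \<omega> (For x e P) (N * (T + 2) + 2) (mk I \<sigma> (c 0)) (mk I \<sigma>' (c N)) \<and> Inv N \<sigma>'"
proof -
  define nxt where "nxt k \<tau> = (SOME \<sigma>'. runs \<omega> P T (mk (I(x := k)) \<tau> (c k)) (mk (I(x := k)) \<sigma>' (c (Suc k))) \<and> Inv (Suc k) \<sigma>')" for k \<tau>
  define st where "st = rec_nat \<sigma> nxt"
  have st: "st 0 = \<sigma>" "st (Suc k) = nxt k (st k)" for k by (simp_all add: st_def)
  have step: "runs \<omega> P T (mk (I(x := k)) (st k) (c k)) (mk (I(x := k)) (st (Suc k)) (c (Suc k))) \<and> Inv (Suc k) (st (Suc k))"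
    if "k < N" "Inv k (st k)" for k
    unfolding st(2) nxt_def by (rule someI_ex[OF body[OF that]])
  have inv: "Inv k (st k)" if "k \<le> N" for k
    using that by (induction k) (use init step st in auto)
  have "runs \<omega> (For x e P) (N * (T + 2) + 2) (mk I (st 0) (c 0)) (mk I (st N) (c N))"
  proof (rule runs_For[where I = "\<lambda>_. I"])
    fix k assume "k \<le> N"
    then show "ival (mk (I(x := k)) (st k) (c k)) e = N"
      using e[of k "st k"] ival_mk[of "I(x := k)" "st k" "c k" e "st k" 0] by simp
  qed (use x0 step inv in auto)
  then show ?thesis using inv[of N] st by auto
qed

definition fillp :: "(vname \<Rightarrow> nat) \<Rightarrow> vname \<Rightarrow> nat \<Rightarrow> nat \<Rightarrow> nat \<Rightarrow> rexp \<Rightarrow> (vname \<Rightarrow> nat \<times> nat \<Rightarrow> real) \<Rightarrow> vname \<Rightarrow> nat \<times> nat \<Rightarrow> real" where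
  "fillp I z A B C e \<sigma> = fill z A B (\<lambda>i j. \<Sum>l<C. rval (mk (loop_idx I i j l) \<sigma> 0) e) \<sigma>"

lemma fillp_other [simp]: "y \<noteq> z \<Longrightarrow> fillp I z A B C e \<sigma> y = \<sigma> y"
  by (simp add: fillp_def fill_def)

lemma fillp_same: "i < A \<Longrightarrow> j < B \<Longrightarrow> fillp I z A B C e \<sigma> z (i, j) = (\<Sum>l<C. rval (mk (loop_idx I i j l) \<sigma> 0) e)"
  by (simp add: fillp_def fill_def)

lemma rval_mk: "rval (mk I \<sigma> k) p = rval (mk I \<sigma> k') p"
  by (induction p) (auto intro!: arg_cong2[where f = "\<lambda>a b. \<sigma> _ (a, b)"] ival_mk)

lemma runs_fillp:
  assumes "I ''i'' = 0" "I ''j'' = 0" "I ''l'' = 0"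
    and "iexp_fixed a" "iexp_fixed b" "iexp_fixed c" "reads_not z e"
    and "ival (mk I (\<lambda>_ _. 0) 0) a = A" "ival (mk I (\<lambda>_ _. 0) 0) b = B" "ival (mk I (\<lambda>_ _. 0) 0) c = C"
    and "5 * ((A + 1) * (B + 1) * (C + 1)) \<le> T"
  shows "runs \<omega> (Fill z a b c e) T (mk I \<sigma> k) (mk I (fillp I z A B C e \<sigma>) k)"
  unfolding fillp_def
proof (rule runs_mono[OF runs_Fill[OF assms(1-7)] assms(11)])
  show "ival (mk I \<sigma> k) a = A" "ival (mk I \<sigma> k) b = B" "ival (mk I \<sigma> k) c = C"
    using assms(8-10) ival_mk[of I \<sigma> k a "\<lambda>_ _. 0" 0] ival_mk[of I \<sigma> k b "\<lambda>_ _. 0" 0]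
      ival_mk[of I \<sigma> k c "\<lambda>_ _. 0" 0] by simp_all
  show "(\<Sum>l<C. rval (mk (loop_idx I i j l) \<sigma> k) e) = (\<Sum>l<C. rval (mk (loop_idx I i j l) \<sigma> 0) e)" for i j
    by (intro sum.cong refl rval_mk)
qed

section \<open>The program\<close>

text \<open>The smallest number of degrees of freedom for which \<open>student_moment\<close> covers
  the moment of order \<open>d\<close>.\<close>

definition chi_dof :: "nat \<Rightarrow> nat" where
  "chi_dof d = 4096 * d"

text \<open>Column \<open>j\<close> owns a block of consecutive cells, numerators before
  denominators, in the order in which the program draws them.\<close>

definition tape_block :: "nat \<Rightarrow> tape \<Rightarrow> nat \<Rightarrow> nat \<Rightarrow> real" where
  "tape_block d \<omega> j q = snd (\<omega> (j * (d + chi_dof d) + q))"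

definition tape_student :: "nat \<Rightarrow> tape \<Rightarrow> nat \<Rightarrow> nat \<Rightarrow> real" where
  "tape_student d \<omega> j = student d (chi_dof d) (tape_block d \<omega> j)"

definition half_diff :: "(nat \<Rightarrow> vector) \<Rightarrow> nat \<Rightarrow> nat \<Rightarrow> real" where
  "half_diff X l i = (X (l + l) i - X (l + l + 1) i) / 2"

text \<open>Half of an unbiased estimate of the covariance matrix, from \<open>n div 2\<close> disjoint pairs of samples.\<close>

definition pair_mean :: "nat \<Rightarrow> (nat \<Rightarrow> vector) \<Rightarrow> nat \<Rightarrow> nat \<Rightarrow> real" where
  "pair_mean n X i j = (\<Sum>l<n div 2. half_diff X l i * half_diff X l j / real (n div 2))"

text \<open>The constant 12294 is 3 * (4096 + 2). A changed sample costs two shifts, each with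
  exponent \<open>3 / 2 * \<beta> * real (d + chi_dof d + d)\<close>, where \<beta> is the
  reciprocal of the number of pairs times the scale; each exponent has to be \<epsilon> / 2.\<close>

definition noise_scale :: "nat \<Rightarrow> real \<Rightarrow> nat \<Rightarrow> real" where
  "noise_scale d \<epsilon> n = 12294 * real d / (real (n div 2) * \<epsilon>)"

text \<open>The noise is not symmetric, but the Frank-Wolfe oracle applies to symmetric matrices;
  averaging with the transpose leaves quadratic forms unchanged.\<close>

definition noisy :: "nat \<Rightarrow> real \<Rightarrow> nat \<Rightarrow> (nat \<Rightarrow> nat \<Rightarrow> real) \<Rightarrow> (nat \<Rightarrow> nat \<Rightarrow> real) \<Rightarrow> nat \<Rightarrow> nat \<Rightarrow> real" where
  "noisy d \<epsilon> n M A i j = (M i j + M j i + noise_scale d \<epsilon> n * (A i j + A j i)) / 2"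

text \<open>The factor 2 compensates for \<open>pair_mean\<close>, whose expectation is half the
  covariance. With \<open>n + (d + d) + 1\<close> squarings the exponent of the matrix power
  dominates \<open>n * d * d\<close>, so that the oracle error is of order 1 / n, like the error of
  \<open>n\<close> Frank-Wolfe steps.\<close>

definition estimate :: "nat \<Rightarrow> nat \<Rightarrow> (nat \<Rightarrow> nat \<Rightarrow> real) \<Rightarrow> matrix" where
  "estimate d n Y = (\<lambda>(i, j)\<in>{..<d} \<times> {..<d}. 2 * fw d (Suc (n + (d + d))) Y n i j)"

definition mech_out :: "nat \<Rightarrow> real \<Rightarrow> nat \<Rightarrow> (nat \<Rightarrow> vector) \<Rightarrow> tape \<Rightarrow> matrix" where
  "mech_out d \<epsilon> n X \<omega> = estimate d n (noisy d \<epsilon> n (pair_mean n X) (\<lambda>i j. gcol d (tape_student d \<omega>) j i))"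

section \<open>Index expressions and the text of the program\<close>

definition env :: "nat \<Rightarrow> nat \<Rightarrow> nat \<Rightarrow> nat \<Rightarrow> nat \<Rightarrow> nat \<Rightarrow> vname \<Rightarrow> nat" where
  "env d n m c k q = (\<lambda>_. 0)(''d'' := d, ''n'' := n, ''m'' := m, ''c'' := c, ''k'' := k, ''q'' := q)"

lemma env_apply [simp]:
  "env d n m c k q ''d'' = d" "env d n m c k q ''n'' = n" "env d n m c k q ''m'' = m"
  "env d n m c k q ''c'' = c" "env d n m c k q ''k'' = k" "env d n m c k q ''q'' = q"
  "env d n m c k q ''i'' = 0" "env d n m c k q ''j'' = 0" "env d n m c k q ''l'' = 0"
  by (simp_all add: env_def)

lemma env_upd [simp]:
  "(env d n m c k q)(''m'' := m') = env d n m' c k q"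
  "(env d n m c k q)(''c'' := c') = env d n m c' k q"
  "(env d n m c k q)(''k'' := k') = env d n m c k' q"
  "(env d n m c k q)(''q'' := q') = env d n m c k q'"
  by (auto simp: env_def fun_eq_iff)

text \<open>An indicator without a test, by truncated subtraction: 1 - (1 - x) is 1 for positive x
  and 0 for x = 0.\<close>

definition ilt :: "iexp \<Rightarrow> iexp \<Rightarrow> rexp" where
  "ilt a b = RIdx (ISub (IConst 1) (ISub (IConst 1) (ISub b a)))"

definition ieq :: "iexp \<Rightarrow> iexp \<Rightarrow> rexp" where
  "ieq a b = RIdx (ISub (ISub (IConst 1) (ISub a b)) (ISub b a))"

lemma rval_ilt [simp]: "rval s (ilt a b) = (if ival s a < ival s b then 1 else 0)"
  by (auto simp: ilt_def)

lemma rval_ieq [simp]: "rval s (ieq a b) = (if ival s a = ival s b then 1 else 0)"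
  by (auto simp: ieq_def)

lemma reads_not_ilt [simp]: "reads_not z (ilt a b)" "reads_not z (ieq a b)"
  by (simp_all add: ilt_def ieq_def)

text \<open>Indices cannot be multiplied; twelve doublings give the factor 4096.\<close>

primrec dbl :: "nat \<Rightarrow> iexp \<Rightarrow> iexp" where
  "dbl 0 a = a"
| "dbl (Suc k) a = IAdd (dbl k a) (dbl k a)"

lemma ival_dbl [simp]: "ival s (dbl k a) = 2 ^ k * ival s a"
  by (induction k) auto

lemma iexp_fixed_dbl [simp]: "iexp_fixed (dbl k a) = iexp_fixed a"
  by (induction k) auto

abbreviation "iI \<equiv> IVar ''i''"
abbreviation "iJ \<equiv> IVar ''j''"
abbreviation "iL \<equiv> IVar ''l''"
abbreviation "iD \<equiv> IVar ''d''"
abbreviation "i0 \<equiv> IConst 0"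
abbreviation "i1 \<equiv> IConst 1"
abbreviation "iC \<equiv> IVar ''c''"
abbreviation "iNu \<equiv> dbl 12 iD"

text \<open>Halving without division: the increment of \<open>m\<close> is 1 while n - 2m is at
  least 2, and 0 afterwards.\<close>

definition prog_half :: prog where
  "prog_half = For ''k'' (IVar ''n'') (ISet ''m'' (IAdd (IVar ''m'')
     (ISub i1 (ISub (IConst 2) (ISub (IVar ''n'') (IAdd (IVar ''m'') (IVar ''m'')))))))"

abbreviation half_diff_exp :: "iexp \<Rightarrow> rexp" where
  "half_diff_exp a \<equiv> RDiv (RSub (RGet ''X'' (IAdd iL iL) a) (RGet ''X'' (IAdd (IAdd iL iL) i1) a)) (RConst 2)"

definition prog_mean :: prog where
  "prog_mean = Fill ''S'' iD iD (IVar ''m'') (RDiv (RMul (half_diff_exp iI) (half_diff_exp iJ)) (RIdx (IVar ''m'')))"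

definition prog_draw :: prog where
  "prog_draw = For ''c'' iD (Seq (For ''k'' iD (DrawGaussian ''g'' (IVar ''k'') iC))
     (For ''k'' iNu (DrawGaussian ''h'' (IVar ''k'') iC)))"

definition prog_student :: prog where
  "prog_student = Seq (Fill ''R'' iD i1 iNu (RMul (RGet ''h'' iL iI) (RGet ''h'' iL iI)))
     (Fill ''T'' iD iD i1 (RDiv (RGet ''g'' iI iJ) (RSqrt (RGet ''R'' iJ i0))))"

abbreviation psum_exp :: "iexp \<Rightarrow> rexp" where
  "psum_exp a \<equiv> RSqrt (RAdd (RConst 1) (RGet ''u'' a i0))"

text \<open>\<open>u\<close> holds the prefix sums of squares including the full one, hence
  \<open>d + 1\<close> entries; \<open>K\<close> is the update factor and \<open>v\<close> the new
  column of noise. The new values of \<open>N\<close> and \<open>C\<close> pass through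
  \<open>V\<close> and \<open>E\<close> because \<open>Fill\<close> must not read its
  target.\<close>

definition prog_col :: prog where
  "prog_col =
    Seq (Fill ''u'' (IAdd iD i1) i1 iD (RMul (ilt iL iI) (RMul (RGet ''T'' iL iC) (RGet ''T'' iL iC))))
    (Seq (Fill ''K'' iD iD i1
       (RAdd (RMul (ilt iJ iI) (RDiv (RMul (RGet ''T'' iI iC) (RGet ''T'' iJ iC)) (RMul (psum_exp iJ) (psum_exp (IAdd iJ i1)))))
             (RMul (ieq iI iJ) (RDiv (psum_exp (IAdd iJ i1)) (psum_exp iJ)))))
    (Seq (Fill ''v'' iD i1 iD (RMul (RGet ''C'' iI iL) (RGet ''T'' iL iC)))
    (Seq (Fill ''V'' iD iD i1 (RAdd (RGet ''N'' iI iJ) (RMul (ieq iJ iC) (RGet ''v'' iI i0))))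
    (Seq (Fill ''N'' iD iD i1 (RGet ''V'' iI iJ))
    (Seq (Fill ''E'' iD iD iD (RMul (RGet ''C'' iI iL) (RGet ''K'' iL iJ)))
         (Fill ''C'' iD iD i1 (RGet ''E'' iI iJ)))))))"

definition prog_noise :: prog where
  "prog_noise = Seq (Fill ''C'' iD iD i1 (ieq iI iJ)) (For ''c'' iD prog_col)"

definition prog_noisy :: prog where
  "prog_noisy = Fill ''Y'' iD iD i1 (RDiv (RAdd (RAdd (RGet ''S'' iI iJ) (RGet ''S'' iJ iI))
     (RMul (RDiv (RMul (RConst 12294) (RIdx iD)) (RMul (RIdx (IVar ''m'')) (RGet ''eps'' i0 i0)))
       (RAdd (RGet ''N'' iI iJ) (RGet ''N'' iJ iI)))) (RConst 2))"

definition prog_square :: prog where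
  "prog_square = Seq (Fill ''E'' iD iD iD (RMul (RGet ''H'' iI iL) (RGet ''H'' iL iJ)))
     (Fill ''H'' iD iD i1 (RGet ''E'' iI iJ))"

abbreviation "rw \<equiv> RGet ''w'' i0 i0"
abbreviation "rr \<equiv> RGet ''r'' i0 i0"

text \<open>\<open>G\<close> is the negative gradient, \<open>w\<close> first its squared norm and
  later the trace, \<open>H\<close> the shifted matrix and its powers, \<open>D\<close> the
  normalised power, \<open>r\<close> its value. Double sums go through the row sums
  \<open>f\<close>, since one \<open>Fill\<close> sums over a single index.\<close>

definition prog_fw_step :: prog where
  "prog_fw_step =
    Seq (Fill ''G'' iD iD i1 (RSub (RGet ''Y'' iI iJ) (RGet ''B'' iI iJ)))
    (Seq (Fill ''f'' iD i1 iD (RMul (RGet ''G'' iI iL) (RGet ''G'' iI iL)))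
    (Seq (Fill ''w'' i1 i1 iD (RGet ''f'' iL i0))
    (Seq (Fill ''H'' iD iD i1 (RAdd (RGet ''G'' iI iJ) (RMul (RSqrt rw) (ieq iI iJ))))
    (Seq (For ''q'' (IAdd (IAdd (IVar ''n'') (IAdd iD iD)) i1) prog_square)
    (Seq (Fill ''w'' i1 i1 iD (RGet ''H'' iL iL))
    (Seq (Fill ''D'' iD iD i1 (RDiv (RGet ''H'' iI iJ) rw))
    (Seq (Fill ''f'' iD i1 iD (RMul (RGet ''G'' iI iL) (RGet ''D'' iI iL)))
    (Seq (Fill ''r'' i1 i1 iD (RGet ''f'' iL i0))
    (Seq (Fill ''E'' iD iD i1 (RAdd (RGet ''B'' iI iJ)
        (RMul (RDiv (RConst 2) (RAdd (RIdx (IVar ''k'')) (RConst 2)))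
          (RSub (RMul (RDiv (RAdd (RConst 1) (RDiv rr (RSqrt (RMul rr rr)))) (RConst 2)) (RGet ''D'' iI iJ))
            (RGet ''B'' iI iJ)))))
         (Fill ''B'' iD iD i1 (RGet ''E'' iI iJ)))))))))))"

definition prog_main :: prog where
  "prog_main = Seq prog_half (Seq prog_mean (Seq prog_draw (Seq prog_student (Seq prog_noise (Seq prog_noisy
     (Seq (For ''k'' (IVar ''n'') prog_fw_step)
       (Fill ''out'' iD iD i1 (RMul (RConst 2) (RGet ''B'' iI iJ)))))))))"

section \<open>Execution of the program\<close>

definition agrees :: "nat \<Rightarrow> (vname \<Rightarrow> nat \<times> nat \<Rightarrow> real) \<Rightarrow> vname \<Rightarrow> (nat \<Rightarrow> nat \<Rightarrow> real) \<Rightarrow> bool" where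
  "agrees d \<sigma> z M \<longleftrightarrow> (\<forall>i<d. \<forall>j<d. \<sigma> z (i, j) = M i j)"

lemma agreesD: "agrees d \<sigma> z M \<Longrightarrow> i < d \<Longrightarrow> j < d \<Longrightarrow> \<sigma> z (i, j) = M i j"
  by (simp add: agrees_def)

lemma agrees_other [simp]: "y \<noteq> z \<Longrightarrow> agrees d (fillp I z A B C e \<sigma>) y M = agrees d \<sigma> y M"
  by (simp add: agrees_def)

lemma agrees_fillp:
  assumes "\<And>i j. i < d \<Longrightarrow> j < d \<Longrightarrow> (\<Sum>l<C. rval (mk (loop_idx I i j l) \<sigma> 0) e) = M i j"
  shows "agrees d (fillp I z d d C e \<sigma>) z M"
  using assms by (simp add: agrees_def fillp_same)

abbreviation size_bound :: "nat \<Rightarrow> nat \<Rightarrow> nat" where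
  "size_bound d n \<equiv> 1 + d + n"

text \<open>The factor 4096 admits sums over the \<open>chi_dof d\<close> denominator entries; 5 * 2
  * 2 * 4097 is rounded up to 100000.\<close>

lemma fill_time:
  fixes A B C N :: nat
  assumes "A \<le> N" "B \<le> N" "C \<le> 4096 * N" "1 \<le> N"
  shows "5 * ((A + 1) * (B + 1) * (C + 1)) \<le> 100000 * N ^ 3"
proof -
  have "(A + 1) * (B + 1) * (C + 1) \<le> (2 * N) * (2 * N) * (4097 * N)"
    using assms by (intro mult_le_mono) auto
  then show ?thesis by (simp add: power3_eq_cube algebra_simps)
qed

lemma runs_fillp_env:
  assumes "iexp_fixed a" "iexp_fixed b" "iexp_fixed c" "reads_not z e"
    and "ival (mk (env d n m c' k q) (\<lambda>_ _. 0) 0) a = A" "ival (mk (env d n m c' k q) (\<lambda>_ _. 0) 0) b = B"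
    and "ival (mk (env d n m c' k q) (\<lambda>_ _. 0) 0) c = C"
    and "A \<le> size_bound d n" "B \<le> size_bound d n" "C \<le> 4096 * size_bound d n"
  shows "runs \<omega> (Fill z a b c e) (100000 * size_bound d n ^ 3) (mk (env d n m c' k q) \<sigma> t)
    (mk (env d n m c' k q) (fillp (env d n m c' k q) z A B C e \<sigma>) t)"
  by (rule runs_fillp[OF _ _ _ assms(1-7) fill_time[OF assms(8-10)]]) auto

lemma runs_prog_half:
  "runs \<omega> prog_half (n * 3 + 2) (mk (env d n 0 0 0 0) \<sigma> t) (mk (env d n (n div 2) 0 0 0) \<sigma> t)"
proof -
  let ?I = "\<lambda>k. env d n (min k (n div 2)) 0 0 0"
  have "runs \<omega> prog_half (n * (1 + 2) + 2) (mk (?I 0) \<sigma> t) (mk (?I n) \<sigma> t)"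
    unfolding prog_half_def
  proof (rule runs_For[where I = ?I and \<sigma> = "\<lambda>_. \<sigma>" and c = "\<lambda>_. t"])
    fix k
    let ?a = "IAdd (IVar ''m'') (ISub i1 (ISub (IConst 2) (ISub (IVar ''n'') (IAdd (IVar ''m'') (IVar ''m'')))))"
    \<comment> \<open>After \<open>k\<close> rounds \<open>m\<close> is the minimum of
      \<open>k\<close> and \<open>n div 2\<close>. Once it has reached \<open>n div 2\<close>, at
      most 1 remains of \<open>n\<close> and the increment is 0.\<close>
    have e: "min k (n div 2) + (1 - (2 - (n - (min k (n div 2) + min k (n div 2))))) = min (Suc k) (n div 2)"
      by (cases "k < n div 2") auto
    have "ival (mk ((?I k)(''k'' := k)) \<sigma> t) ?a = min (Suc k) (n div 2)"
      by (simp only: ival.simps mk_simps env_upd env_apply e)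
    then have "((?I k)(''k'' := k))(''m'' := ival (mk ((?I k)(''k'' := k)) \<sigma> t) ?a) = (?I (Suc k))(''k'' := k)"
      by (simp only: env_upd)
    then show "runs \<omega> (ISet ''m'' ?a) 1 (mk ((?I k)(''k'' := k)) \<sigma> t) (mk ((?I (Suc k))(''k'' := k)) \<sigma> t)"
      using runs_ISet[of \<omega> "''m''" ?a "(?I k)(''k'' := k)" \<sigma> t] by (simp only:)
  qed simp_all
  moreover have "min n (n div 2) = n div 2" "min 0 (n div 2) = 0" by simp_all
  moreover have "n * (1 + 2) + 2 = n * 3 + 2" by simp
  ultimately show ?thesis by (simp only:)
qed

lemma runs_prog_mean:
  assumes X: "\<And>i j. i < n \<Longrightarrow> j < d \<Longrightarrow> \<sigma> ''X'' (i, j) = X i j"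
  obtains \<sigma>' where
    "runs \<omega> prog_mean (100000 * size_bound d n ^ 3) (mk (env d n (n div 2) 0 0 0) \<sigma> t) (mk (env d n (n div 2) 0 0 0) \<sigma>' t)"
    "agrees d \<sigma>' ''S'' (pair_mean n X)" "\<And>y. y \<noteq> ''S'' \<Longrightarrow> \<sigma>' y = \<sigma> y"
proof -
  let ?I = "env d n (n div 2) 0 0 0"
  let ?e = "RDiv (RMul (half_diff_exp iI) (half_diff_exp iJ)) (RIdx (IVar ''m''))"
  let ?s = "fillp ?I ''S'' d d (n div 2) ?e \<sigma>"
  have "runs \<omega> prog_mean (100000 * size_bound d n ^ 3) (mk ?I \<sigma> t) (mk ?I ?s t)"
    unfolding prog_mean_def by (rule runs_fillp_env) auto
  moreover have "agrees d ?s ''S'' (pair_mean n X)"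
  proof (rule agrees_fillp)
    fix i j assume "i < d" "j < d"
    then show "(\<Sum>l<n div 2. rval (mk (loop_idx ?I i j l) \<sigma> 0) ?e) = pair_mean n X i j"
      unfolding pair_mean_def half_diff_def by (intro sum.cong) (auto simp: X)
  qed
  ultimately show ?thesis using that[of ?s] by simp
qed

definition drawn_cells :: "nat \<Rightarrow> tape \<Rightarrow> nat \<Rightarrow> (vname \<Rightarrow> nat \<times> nat \<Rightarrow> real) \<Rightarrow> bool" where
  "drawn_cells d \<omega> c \<sigma> \<longleftrightarrow> (\<forall>j<c. (\<forall>i<d. \<sigma> ''g'' (i, j) = tape_block d \<omega> j i) \<and>
     (\<forall>i<chi_dof d. \<sigma> ''h'' (i, j) = tape_block d \<omega> j (d + i)))"

lemma runs_prog_draw: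
  obtains \<sigma>' t' where
    "runs \<omega> prog_draw (d * ((d * 3 + 2) + (chi_dof d * 3 + 2) + 2) + 2) (mk (env d n m 0 0 0) \<sigma> 0) (mk (env d n m 0 0 0) \<sigma>' t')"
    "drawn_cells d \<omega> d \<sigma>'" "\<And>y. y \<noteq> ''g'' \<Longrightarrow> y \<noteq> ''h'' \<Longrightarrow> \<sigma>' y = \<sigma> y"
proof -
  define Inv where "Inv c \<tau> \<longleftrightarrow> drawn_cells d \<omega> c \<tau> \<and> (\<forall>y. y \<noteq> ''g'' \<longrightarrow> y \<noteq> ''h'' \<longrightarrow> \<tau> y = \<sigma> y)" for c \<tau>
  have "\<exists>\<sigma>'. runs \<omega> prog_draw (d * (((d * (1 + 2) + 2) + (chi_dof d * (1 + 2) + 2)) + 2) + 2) (mk (env d n m 0 0 0) \<sigma> (0 * (d + chi_dof d)))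
      (mk (env d n m 0 0 0) \<sigma>' (d * (d + chi_dof d))) \<and> Inv d \<sigma>'"
    unfolding prog_draw_def
  \<comment> \<open>The tape position is tracked exactly, so that the cells read are those of
    \<open>tape_block\<close>; memory is tracked through the invariant.\<close>
  proof (rule runs_For_invariant[where c = "\<lambda>c. c * (d + chi_dof d)"])
    show "Inv 0 \<sigma>" by (simp add: Inv_def drawn_cells_def)
    fix c \<tau> assume c: "c < d" and inv: "Inv c \<tau>"
    define b where "b = c * (d + chi_dof d)"
    let ?I = "env d n m c 0 0"
    define s1 where "s1 k = \<tau>(''g'' := (\<lambda>(i, j). if j = c \<and> i < k then tape_block d \<omega> c i else \<tau> ''g'' (i, j)))" for k
    define s2 where "s2 k = (s1 d)(''h'' := (\<lambda>(i, j). if j = c \<and> i < k then tape_block d \<omega> c (d + i) else s1 d ''h'' (i, j)))" for k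
    have r1: "runs \<omega> (For ''k'' iD (DrawGaussian ''g'' (IVar ''k'') iC)) (d * (1 + 2) + 2) (mk ?I (s1 0) (b + 0)) (mk ?I (s1 d) (b + d))"
    proof (rule runs_For[where I = "\<lambda>_. ?I"])
      fix k
      have "s1 (Suc k) = (s1 k)(''g'' := (s1 k ''g'')((k, c) := snd (\<omega> (b + k))))"
        by (auto simp: s1_def fun_eq_iff tape_block_def b_def less_Suc_eq)
      then show "runs \<omega> (DrawGaussian ''g'' (IVar ''k'') iC) 1 (mk (?I(''k'' := k)) (s1 k) (b + k)) (mk (?I(''k'' := k)) (s1 (Suc k)) (b + Suc k))"
        using runs_DrawGaussian[of \<omega> "''g''" "IVar ''k''" iC "?I(''k'' := k)" "s1 k" "b + k"] by simp
    qed simp_all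
    have r2: "runs \<omega> (For ''k'' iNu (DrawGaussian ''h'' (IVar ''k'') iC)) (chi_dof d * (1 + 2) + 2) (mk ?I (s2 0) (b + d + 0)) (mk ?I (s2 (chi_dof d)) (b + d + chi_dof d))"
    proof (rule runs_For[where I = "\<lambda>_. ?I"])
      fix k
      have "s2 (Suc k) = (s2 k)(''h'' := (s2 k ''h'')((k, c) := snd (\<omega> (b + d + k))))"
        by (auto simp: s2_def fun_eq_iff tape_block_def b_def less_Suc_eq add.assoc)
      then show "runs \<omega> (DrawGaussian ''h'' (IVar ''k'') iC) 1 (mk (?I(''k'' := k)) (s2 k) (b + d + k)) (mk (?I(''k'' := k)) (s2 (Suc k)) (b + d + Suc k))"
        using runs_DrawGaussian[of \<omega> "''h''" "IVar ''k''" iC "?I(''k'' := k)" "s2 k" "b + d + k"] by simp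
    qed (simp_all add: chi_dof_def)
    have s: "s1 0 = \<tau>" "s2 0 = s1 d" by (auto simp: s1_def s2_def fun_eq_iff)
    have bc: "b + d + chi_dof d = Suc c * (d + chi_dof d)" by (simp add: b_def)
    have "runs \<omega> (Seq (For ''k'' iD (DrawGaussian ''g'' (IVar ''k'') iC)) (For ''k'' iNu (DrawGaussian ''h'' (IVar ''k'') iC)))
      ((d * (1 + 2) + 2) + (chi_dof d * (1 + 2) + 2)) (mk ?I \<tau> b) (mk ?I (s2 (chi_dof d)) (Suc c * (d + chi_dof d)))"
      using runs_Seq[OF r1[unfolded s add_0_right] r2[unfolded s add_0_right]] unfolding bc .
    moreover have "Inv (Suc c) (s2 (chi_dof d))"
      using inv by (auto simp: Inv_def drawn_cells_def s2_def s1_def less_Suc_eq)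
    ultimately show "\<exists>\<sigma>'. runs \<omega> (Seq (For ''k'' iD (DrawGaussian ''g'' (IVar ''k'') iC)) (For ''k'' iNu (DrawGaussian ''h'' (IVar ''k'') iC)))
      ((d * (1 + 2) + 2) + (chi_dof d * (1 + 2) + 2)) (mk ((env d n m 0 0 0)(''c'' := c)) \<tau> (c * (d + chi_dof d)))
      (mk ((env d n m 0 0 0)(''c'' := c)) \<sigma>' (Suc c * (d + chi_dof d))) \<and> Inv (Suc c) \<sigma>'"
      unfolding b_def env_upd by blast
  qed simp_all
  then obtain \<sigma>' where r: "runs \<omega> prog_draw (d * (((d * (1 + 2) + 2) + (chi_dof d * (1 + 2) + 2)) + 2) + 2) (mk (env d n m 0 0 0) \<sigma> (0 * (d + chi_dof d)))
      (mk (env d n m 0 0 0) \<sigma>' (d * (d + chi_dof d)))" and inv: "Inv d \<sigma>'" by blast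
  show ?thesis
  proof (rule that)
    show "runs \<omega> prog_draw (d * ((d * 3 + 2) + (chi_dof d * 3 + 2) + 2) + 2) (mk (env d n m 0 0 0) \<sigma> 0)
      (mk (env d n m 0 0 0) \<sigma>' (d * (d + chi_dof d)))"
      using r by (simp only: one_add_one mult_zero_left add_One numeral_plus_numeral add_num_simps one_plus_numeral)
  qed (use inv in \<open>auto simp: Inv_def\<close>)
qed

lemma norm_on_block: "norm_on {d..<d + \<nu>} x = sqrt (\<Sum>l<\<nu>. x (d + l) * x (d + l))"
proof -
  have "(\<Sum>l\<in>{d..<d + \<nu>}. (x l)\<^sup>2) = (\<Sum>l\<in>{..<\<nu>}. (x (d + l))\<^sup>2)"
    by (rule sum.reindex_bij_witness[of _ "\<lambda>l. d + l" "\<lambda>l. l - d"]) auto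
  then show ?thesis by (simp add: norm_on_def power2_eq_square)
qed

lemma runs_prog_student:
  assumes "drawn_cells d \<omega> d \<sigma>"
  obtains \<sigma>' where
    "runs \<omega> prog_student (100000 * size_bound d n ^ 3 + 100000 * size_bound d n ^ 3) (mk (env d n m 0 0 0) \<sigma> t) (mk (env d n m 0 0 0) \<sigma>' t)"
    "agrees d \<sigma>' ''T'' (\<lambda>i j. tape_student d \<omega> j i)" "\<And>y. y \<noteq> ''R'' \<Longrightarrow> y \<noteq> ''T'' \<Longrightarrow> \<sigma>' y = \<sigma> y"
proof -
  let ?I = "env d n m 0 0 0"
  let ?e1 = "RMul (RGet ''h'' iL iI) (RGet ''h'' iL iI)"
  let ?e2 = "RDiv (RGet ''g'' iI iJ) (RSqrt (RGet ''R'' iJ i0))"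
  define s1 where "s1 = fillp ?I ''R'' d 1 (chi_dof d) ?e1 \<sigma>"
  define s2 where "s2 = fillp ?I ''T'' d d 1 ?e2 s1"
  have r1: "runs \<omega> (Fill ''R'' iD i1 iNu ?e1) (100000 * size_bound d n ^ 3) (mk ?I \<sigma> t) (mk ?I s1 t)"
    unfolding s1_def by (rule runs_fillp_env) (auto simp: chi_dof_def)
  have r2: "runs \<omega> (Fill ''T'' iD iD i1 ?e2) (100000 * size_bound d n ^ 3) (mk ?I s1 t) (mk ?I s2 t)"
    unfolding s2_def by (rule runs_fillp_env) auto
  have R: "s1 ''R'' (j, 0) = (norm_on {d..<d + chi_dof d} (tape_block d \<omega> j))\<^sup>2" if "j < d" for j
  proof -
    have "s1 ''R'' (j, 0) = (\<Sum>l<chi_dof d. tape_block d \<omega> j (d + l) * tape_block d \<omega> j (d + l))"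
      unfolding s1_def using that assms by (subst fillp_same) (auto simp: drawn_cells_def intro!: sum.cong)
    then show ?thesis unfolding norm_on_block by (simp add: sum_nonneg)
  qed
  have "s1 ''g'' = \<sigma> ''g''" by (simp add: s1_def)
  then have "agrees d s2 ''T'' (\<lambda>i j. tape_student d \<omega> j i)"
    unfolding s2_def using assms
    by (intro agrees_fillp) (auto simp: R tape_student_def student_def drawn_cells_def)
  moreover have "\<And>y. y \<noteq> ''R'' \<Longrightarrow> y \<noteq> ''T'' \<Longrightarrow> s2 y = \<sigma> y" by (simp add: s1_def s2_def)
  ultimately show ?thesis
    using that[of s2] runs_Seq[OF r1 r2] unfolding prog_student_def by blast
qed

text \<open>The arrays written in one round. The frame condition on all others carries
  \<open>T\<close>, \<open>S\<close> and \<open>eps\<close> through the loop.\<close>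

definition col_vars :: "vname set" where
  "col_vars = {''u'', ''K'', ''v'', ''V'', ''N'', ''E'', ''C''}"

lemma runs_prog_col:
  assumes c: "c < d" and T: "agrees d \<sigma> ''T'' (\<lambda>i j. \<tau> j i)" and C: "agrees d \<sigma> ''C'' (gfac d \<tau> c)"
    and N: "agrees d \<sigma> ''N'' (\<lambda>i j. if j < c then gcol d \<tau> j i else 0)"
  shows "\<exists>\<sigma>'. runs \<omega> prog_col (700000 * size_bound d n ^ 3) (mk (env d n m c 0 0) \<sigma> t) (mk (env d n m c 0 0) \<sigma>' t) \<and>
    agrees d \<sigma>' ''C'' (gfac d \<tau> (Suc c)) \<and> agrees d \<sigma>' ''N'' (\<lambda>i j. if j < Suc c then gcol d \<tau> j i else 0) \<and>
    (\<forall>y. y \<notin> col_vars \<longrightarrow> \<sigma>' y = \<sigma> y)"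
proof -
  let ?I = "env d n m c 0 0" and ?t = "\<tau> c" and ?T = "100000 * size_bound d n ^ 3"
  define s1 where "s1 = fillp ?I ''u'' (d + 1) 1 d (RMul (ilt iL iI) (RMul (RGet ''T'' iL iC) (RGet ''T'' iL iC))) \<sigma>"
  define eK where "eK = RAdd (RMul (ilt iJ iI) (RDiv (RMul (RGet ''T'' iI iC) (RGet ''T'' iJ iC)) (RMul (psum_exp iJ) (psum_exp (IAdd iJ i1)))))
             (RMul (ieq iI iJ) (RDiv (psum_exp (IAdd iJ i1)) (psum_exp iJ)))"
  define s2 where "s2 = fillp ?I ''K'' d d 1 eK s1"
  define s3 where "s3 = fillp ?I ''v'' d 1 d (RMul (RGet ''C'' iI iL) (RGet ''T'' iL iC)) s2"
  define s4 where "s4 = fillp ?I ''V'' d d 1 (RAdd (RGet ''N'' iI iJ) (RMul (ieq iJ iC) (RGet ''v'' iI i0))) s3"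
  define s5 where "s5 = fillp ?I ''N'' d d 1 (RGet ''V'' iI iJ) s4"
  define s6 where "s6 = fillp ?I ''E'' d d d (RMul (RGet ''C'' iI iL) (RGet ''K'' iL iJ)) s5"
  define s7 where "s7 = fillp ?I ''C'' d d 1 (RGet ''E'' iI iJ) s6"
  have u: "s1 ''u'' (i, 0) = sqn i ?t" if "i \<le> d" for i
  proof -
    have "s1 ''u'' (i, 0) = (\<Sum>l<d. if l < i then (?t l)\<^sup>2 else 0)"
      unfolding s1_def using that c agreesD[OF T]
      by (subst fillp_same) (auto intro!: sum.cong simp: power2_eq_square)
    also have "\<dots> = (\<Sum>l\<in>{..<i}. (?t l)\<^sup>2)"
      using that by (intro sum.mono_neutral_cong_right) auto
    finally show ?thesis by (simp add: sqn_def)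
  qed
  have K: "agrees d s2 ''K'' (upd_factor ?t)"
    unfolding s2_def
  proof (rule agrees_fillp)
    fix i j assume ij: "i < d" "j < d"
    have "s1 ''T'' = \<sigma> ''T''" by (simp add: s1_def)
    moreover have "psum ?t j = sqrt (1 + s1 ''u'' (j, 0))" "psum ?t (Suc j) = sqrt (1 + s1 ''u'' (Suc j, 0))"
      using ij by (simp_all add: psum_def u)
    ultimately show "(\<Sum>l<1. rval (mk (loop_idx ?I i j l) s1 0) eK) = upd_factor ?t i j"
      using ij c agreesD[OF T] by (auto simp: eK_def upd_factor_def)
  qed
  have v: "s3 ''v'' (i, 0) = gcol d \<tau> c i" if "i < d" for i
    unfolding s3_def gcol_def mvec_def using that c agreesD[OF T] agreesD[OF C]
    by (subst fillp_same) (auto intro!: sum.cong simp: s2_def s1_def)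
  \<comment> \<open>Column \<open>c\<close> of \<open>N\<close> is still zero, so adding the new
    column amounts to an assignment.\<close>
  have V: "agrees d s4 ''V'' (\<lambda>i j. if j < Suc c then gcol d \<tau> j i else 0)"
    unfolding s4_def using v agreesD[OF N]
    by (intro agrees_fillp) (auto simp: s3_def s2_def s1_def less_Suc_eq)
  have N': "agrees d s5 ''N'' (\<lambda>i j. if j < Suc c then gcol d \<tau> j i else 0)"
    unfolding s5_def using agreesD[OF V] by (intro agrees_fillp) auto
  have E: "agrees d s6 ''E'' (gfac d \<tau> (Suc c))"
    unfolding s6_def
  proof (rule agrees_fillp)
    fix i j assume ij: "i < d" "j < d"
    have "s5 ''C'' = \<sigma> ''C''" "s5 ''K'' = s2 ''K''" by (simp_all add: s5_def s4_def s3_def s2_def s1_def)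
    then show "(\<Sum>l<d. rval (mk (loop_idx ?I i j l) s5 0) (RMul (RGet ''C'' iI iL) (RGet ''K'' iL iJ))) = gfac d \<tau> (Suc c) i j"
      using ij agreesD[OF C] agreesD[OF K] by (auto simp: chol_step_def intro!: sum.cong)
  qed
  have C': "agrees d s7 ''C'' (gfac d \<tau> (Suc c))"
    unfolding s7_def using agreesD[OF E] by (intro agrees_fillp) auto
  have N7: "agrees d s7 ''N'' (\<lambda>i j. if j < Suc c then gcol d \<tau> j i else 0)"
    using N' by (simp add: s7_def s6_def)
  have r: "runs \<omega> prog_col (?T + (?T + (?T + (?T + (?T + (?T + ?T)))))) (mk ?I \<sigma> t) (mk ?I s7 t)"
    unfolding prog_col_def
  proof (intro runs_Seq)
    show "runs \<omega> (Fill ''u'' (IAdd iD i1) i1 iD (RMul (ilt iL iI) (RMul (RGet ''T'' iL iC) (RGet ''T'' iL iC)))) ?T (mk ?I \<sigma> t) (mk ?I s1 t)"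
      unfolding s1_def by (rule runs_fillp_env) auto
    show "runs \<omega> (Fill ''K'' iD iD i1 (RAdd (RMul (ilt iJ iI) (RDiv (RMul (RGet ''T'' iI iC) (RGet ''T'' iJ iC)) (RMul (psum_exp iJ) (psum_exp (IAdd iJ i1)))))
             (RMul (ieq iI iJ) (RDiv (psum_exp (IAdd iJ i1)) (psum_exp iJ))))) ?T (mk ?I s1 t) (mk ?I s2 t)"
      unfolding s2_def eK_def by (rule runs_fillp_env) auto
    show "runs \<omega> (Fill ''v'' iD i1 iD (RMul (RGet ''C'' iI iL) (RGet ''T'' iL iC))) ?T (mk ?I s2 t) (mk ?I s3 t)"
      unfolding s3_def by (rule runs_fillp_env) auto
    show "runs \<omega> (Fill ''V'' iD iD i1 (RAdd (RGet ''N'' iI iJ) (RMul (ieq iJ iC) (RGet ''v'' iI i0)))) ?T (mk ?I s3 t) (mk ?I s4 t)"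
      unfolding s4_def by (rule runs_fillp_env) auto
    show "runs \<omega> (Fill ''N'' iD iD i1 (RGet ''V'' iI iJ)) ?T (mk ?I s4 t) (mk ?I s5 t)"
      unfolding s5_def by (rule runs_fillp_env) auto
    show "runs \<omega> (Fill ''E'' iD iD iD (RMul (RGet ''C'' iI iL) (RGet ''K'' iL iJ))) ?T (mk ?I s5 t) (mk ?I s6 t)"
      unfolding s6_def by (rule runs_fillp_env) auto
    show "runs \<omega> (Fill ''C'' iD iD i1 (RGet ''E'' iI iJ)) ?T (mk ?I s6 t) (mk ?I s7 t)"
      unfolding s7_def by (rule runs_fillp_env) auto
  qed
  have "\<forall>y. y \<notin> col_vars \<longrightarrow> s7 y = \<sigma> y"
    by (auto simp: col_vars_def s1_def s2_def s3_def s4_def s5_def s6_def s7_def)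
  then show ?thesis using runs_mono[OF r, of "700000 * size_bound d n ^ 3"] C' N7 by auto
qed

lemma runs_prog_noise:
  assumes T: "agrees d \<sigma> ''T'' (\<lambda>i j. \<tau> j i)" and N: "agrees d \<sigma> ''N'' (\<lambda>i j. 0)"
  shows "\<exists>\<sigma>'. runs \<omega> prog_noise (100000 * size_bound d n ^ 3 + (d * (700000 * size_bound d n ^ 3 + 2) + 2)) (mk (env d n m 0 0 0) \<sigma> t) (mk (env d n m 0 0 0) \<sigma>' t) \<and>
    agrees d \<sigma>' ''N'' (\<lambda>i j. gcol d \<tau> j i) \<and> (\<forall>y. y \<notin> col_vars \<longrightarrow> \<sigma>' y = \<sigma> y)"
proof -
  let ?I = "env d n m 0 0 0"
  define s0 where "s0 = fillp ?I ''C'' d d 1 (ieq iI iJ) \<sigma>"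
  have r0: "runs \<omega> (Fill ''C'' iD iD i1 (ieq iI iJ)) (100000 * size_bound d n ^ 3) (mk ?I \<sigma> t) (mk ?I s0 t)"
    unfolding s0_def by (rule runs_fillp_env) auto
  define Inv where "Inv c s \<longleftrightarrow> agrees d s ''C'' (gfac d \<tau> c) \<and>
    agrees d s ''N'' (\<lambda>i j. if j < c then gcol d \<tau> j i else 0) \<and> (\<forall>y. y \<notin> col_vars \<longrightarrow> s y = \<sigma> y)" for c s
  have "\<exists>\<sigma>'. runs \<omega> (For ''c'' iD prog_col) (d * (700000 * size_bound d n ^ 3 + 2) + 2) (mk ?I s0 t) (mk ?I \<sigma>' t) \<and> Inv d \<sigma>'"
  proof (rule runs_For_invariant[where c = "\<lambda>_. t"])
    have "agrees d s0 ''C'' idm" unfolding s0_def by (rule agrees_fillp) (auto simp: idm_def)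
    then show "Inv 0 s0" using N by (auto simp: Inv_def s0_def col_vars_def)
    fix c s assume c: "c < d" and inv: "Inv c s"
    have "agrees d s ''T'' (\<lambda>i j. \<tau> j i)" using inv T by (simp add: Inv_def col_vars_def agrees_def)
    from runs_prog_col[OF c this, of \<omega> n m t] inv
    obtain s' where "runs \<omega> prog_col (700000 * size_bound d n ^ 3) (mk (env d n m c 0 0) s t) (mk (env d n m c 0 0) s' t)"
      "Inv (Suc c) s'" unfolding Inv_def by auto
    then show "\<exists>\<sigma>'. runs \<omega> prog_col (700000 * size_bound d n ^ 3) (mk (?I(''c'' := c)) s t) (mk (?I(''c'' := c)) \<sigma>' t) \<and> Inv (Suc c) \<sigma>'"
      unfolding env_upd by blast
  qed simp_all
  then obtain s' where r1: "runs \<omega> (For ''c'' iD prog_col) (d * (700000 * size_bound d n ^ 3 + 2) + 2) (mk ?I s0 t) (mk ?I s' t)"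
    and inv: "Inv d s'" by blast
  have "agrees d s' ''N'' (\<lambda>i j. gcol d \<tau> j i)" using inv by (auto simp: Inv_def agrees_def)
  then show ?thesis using runs_Seq[OF r0 r1] inv unfolding prog_noise_def Inv_def by blast
qed

lemma msq_cong:
  assumes "\<And>i j. i < d \<Longrightarrow> j < d \<Longrightarrow> A i j = B i j" "i < d" "j < d"
  shows "msq d A q i j = msq d B q i j"
  using assms(2,3)
proof (induction q arbitrary: i j)
  case (Suc q)
  then show ?case by (simp add: mmul_def)
qed (use assms in auto)

definition fw_vars :: "vname set" where
  "fw_vars = {''G'', ''f'', ''w'', ''H'', ''E'', ''D'', ''r'', ''B''}"

lemma runs_prog_squares:
  assumes H: "agrees d \<sigma> ''H'' M"
  shows "\<exists>\<sigma>'. runs \<omega> (For ''q'' (IAdd (IAdd (IVar ''n'') (IAdd iD iD)) i1) prog_square)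
      ((n + (d + d) + 1) * (200000 * size_bound d n ^ 3 + 2) + 2) (mk (env d n m 0 k 0) \<sigma> t) (mk (env d n m 0 k 0) \<sigma>' t) \<and>
    agrees d \<sigma>' ''H'' (msq d M (Suc (n + (d + d)))) \<and> (\<forall>y. y \<notin> {''E'', ''H''} \<longrightarrow> \<sigma>' y = \<sigma> y)"
proof -
  let ?I = "env d n m 0 k 0" and ?T = "100000 * size_bound d n ^ 3"
  define Inv where "Inv q s \<longleftrightarrow> agrees d s ''H'' (msq d M q) \<and> (\<forall>y. y \<notin> {''E'', ''H''} \<longrightarrow> s y = \<sigma> y)" for q s
  have "\<exists>\<sigma>'. runs \<omega> (For ''q'' (IAdd (IAdd (IVar ''n'') (IAdd iD iD)) i1) prog_square)
      ((n + (d + d) + 1) * (200000 * size_bound d n ^ 3 + 2) + 2) (mk ?I \<sigma> t) (mk ?I \<sigma>' t) \<and> Inv (n + (d + d) + 1) \<sigma>'"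
  proof (rule runs_For_invariant[where c = "\<lambda>_. t"])
    show "Inv 0 \<sigma>" using H by (simp add: Inv_def)
    fix q s assume inv: "Inv q s"
    let ?J = "env d n m 0 k q"
    let ?e = "RMul (RGet ''H'' iI iL) (RGet ''H'' iL iJ)"
    define s1 where "s1 = fillp ?J ''E'' d d d ?e s"
    define s2 where "s2 = fillp ?J ''H'' d d 1 (RGet ''E'' iI iJ) s1"
    have h: "agrees d s ''H'' (msq d M q)" using inv by (simp add: Inv_def)
    have E: "agrees d s1 ''E'' (msq d M (Suc q))"
      unfolding s1_def using agreesD[OF h] by (intro agrees_fillp) (auto simp: mmul_def intro!: sum.cong)
    have H2: "agrees d s2 ''H'' (msq d M (Suc q))"
      unfolding s2_def using agreesD[OF E] by (intro agrees_fillp) simp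
    have "runs \<omega> prog_square (?T + ?T) (mk ?J s t) (mk ?J s2 t)"
      unfolding prog_square_def
    proof (rule runs_Seq)
      show "runs \<omega> (Fill ''E'' iD iD iD ?e) ?T (mk ?J s t) (mk ?J s1 t)"
        unfolding s1_def by (rule runs_fillp_env) auto
      show "runs \<omega> (Fill ''H'' iD iD i1 (RGet ''E'' iI iJ)) ?T (mk ?J s1 t) (mk ?J s2 t)"
        unfolding s2_def by (rule runs_fillp_env) auto
    qed
    then have "runs \<omega> prog_square (200000 * size_bound d n ^ 3) (mk ?J s t) (mk ?J s2 t)"
      by (rule runs_mono) simp
    moreover have "Inv (Suc q) s2" using H2 inv by (auto simp: Inv_def s1_def s2_def simp del: msq.simps)
    ultimately show "\<exists>\<sigma>'. runs \<omega> prog_square (200000 * size_bound d n ^ 3) (mk (?I(''q'' := q)) s t) (mk (?I(''q'' := q)) \<sigma>' t) \<and> Inv (Suc q) \<sigma>'"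
      unfolding env_upd by blast
  qed simp_all
  then show ?thesis unfolding Inv_def by simp
qed

lemma runs_prog_fw_step:
  assumes Y: "agrees d \<sigma> ''Y'' Y" and B: "agrees d \<sigma> ''B'' (fw d (Suc (n + (d + d))) Y k)"
  shows "\<exists>\<sigma>'. runs \<omega> prog_fw_step (1000000 * size_bound d n ^ 3 + ((n + (d + d) + 1) * (200000 * size_bound d n ^ 3 + 2) + 2))
      (mk (env d n m 0 k 0) \<sigma> t) (mk (env d n m 0 k 0) \<sigma>' t) \<and>
    agrees d \<sigma>' ''B'' (fw d (Suc (n + (d + d))) Y (Suc k)) \<and> (\<forall>y. y \<notin> fw_vars \<longrightarrow> \<sigma>' y = \<sigma> y)"
proof -
  let ?I = "env d n m 0 k 0" and ?T = "100000 * size_bound d n ^ 3"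
  let ?q = "Suc (n + (d + d))"
  let ?Tq = "(n + (d + d) + 1) * (200000 * size_bound d n ^ 3 + 2) + 2"
  define G where "G = (\<lambda>i j. Y i j - fw d ?q Y k i j)"
  define P where "P = fw_power d ?q G"
  define s1 where "s1 = fillp ?I ''G'' d d 1 (RSub (RGet ''Y'' iI iJ) (RGet ''B'' iI iJ)) \<sigma>"
  define s2 where "s2 = fillp ?I ''f'' d 1 d (RMul (RGet ''G'' iI iL) (RGet ''G'' iI iL)) s1"
  define s3 where "s3 = fillp ?I ''w'' 1 1 d (RGet ''f'' iL i0) s2"
  define s4 where "s4 = fillp ?I ''H'' d d 1 (RAdd (RGet ''G'' iI iJ) (RMul (RSqrt rw) (ieq iI iJ))) s3"
  have G1: "agrees d s1 ''G'' G"
    unfolding s1_def using agreesD[OF Y] agreesD[OF B] by (intro agrees_fillp) (simp add: G_def del: fw.simps)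
  have f2: "s2 ''f'' (i, 0) = (\<Sum>j<d. G i j * G i j)" if "i < d" for i
    unfolding s2_def using that agreesD[OF G1] by (subst fillp_same) (auto intro!: sum.cong)
  have w3: "s3 ''w'' (0, 0) = frob d G G"
    unfolding s3_def frob_def using f2 by (subst fillp_same) (auto intro!: sum.cong)
  have H4: "agrees d s4 ''H'' (fw_shift d G)"
    unfolding s4_def
  proof (rule agrees_fillp)
    fix i j assume ij: "i < d" "j < d"
    have "s3 ''G'' = s1 ''G''" by (simp add: s3_def s2_def)
    then show "(\<Sum>l<1. rval (mk (loop_idx ?I i j l) s3 0) (RAdd (RGet ''G'' iI iJ) (RMul (RSqrt rw) (ieq iI iJ)))) = fw_shift d G i j"
      using ij agreesD[OF G1] by (simp add: w3 fw_shift_def idm_def)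
  qed
  from runs_prog_squares[OF H4, of \<omega> n m k t] obtain s5 where
    r5: "runs \<omega> (For ''q'' (IAdd (IAdd (IVar ''n'') (IAdd iD iD)) i1) prog_square) ?Tq (mk ?I s4 t) (mk ?I s5 t)"
    and H5: "agrees d s5 ''H'' (msq d (fw_shift d G) ?q)" and o5: "\<And>y. y \<notin> {''E'', ''H''} \<Longrightarrow> s5 y = s4 y"
    by auto
  define s6 where "s6 = fillp ?I ''w'' 1 1 d (RGet ''H'' iL iL) s5"
  define s7 where "s7 = fillp ?I ''D'' d d 1 (RDiv (RGet ''H'' iI iJ) rw) s6"
  define s8 where "s8 = fillp ?I ''f'' d 1 d (RMul (RGet ''G'' iI iL) (RGet ''D'' iI iL)) s7"
  define s9 where "s9 = fillp ?I ''r'' 1 1 d (RGet ''f'' iL i0) s8"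
  define eE where "eE = RAdd (RGet ''B'' iI iJ)
        (RMul (RDiv (RConst 2) (RAdd (RIdx (IVar ''k'')) (RConst 2)))
          (RSub (RMul (RDiv (RAdd (RConst 1) (RDiv rr (RSqrt (RMul rr rr)))) (RConst 2)) (RGet ''D'' iI iJ))
            (RGet ''B'' iI iJ)))"
  define s10 where "s10 = fillp ?I ''E'' d d 1 eE s9"
  define s11 where "s11 = fillp ?I ''B'' d d 1 (RGet ''E'' iI iJ) s10"
  have w6: "s6 ''w'' (0, 0) = mtrace d (msq d (fw_shift d G) ?q)"
    unfolding s6_def mtrace_def using agreesD[OF H5] by (subst fillp_same) (auto intro!: sum.cong)
  have D7: "agrees d s7 ''D'' P"
    unfolding s7_def
  proof (rule agrees_fillp)
    fix i j assume ij: "i < d" "j < d"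
    have "s6 ''H'' = s5 ''H''" by (simp add: s6_def)
    then show "(\<Sum>l<1. rval (mk (loop_idx ?I i j l) s6 0) (RDiv (RGet ''H'' iI iJ) rw)) = P i j"
      using ij agreesD[OF H5] by (simp add: w6 P_def fw_power_def del: msq.simps)
  qed
  have f8: "s8 ''f'' (i, 0) = (\<Sum>j<d. G i j * P i j)" if "i < d" for i
  proof -
    have "s7 ''G'' = s1 ''G''" by (simp add: s7_def s6_def o5 s4_def s3_def s2_def)
    then show ?thesis
      unfolding s8_def using that agreesD[OF G1] agreesD[OF D7] by (subst fillp_same) (auto intro!: sum.cong)
  qed
  have r9: "s9 ''r'' (0, 0) = frob d G P"
    unfolding s9_def frob_def using f8 by (subst fillp_same) (auto intro!: sum.cong)
  have E10: "agrees d s10 ''E'' (fw d ?q Y (Suc k))"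
    unfolding s10_def
  proof (rule agrees_fillp)
    fix i j assume ij: "i < d" "j < d"
    have "s9 ''B'' = \<sigma> ''B''" "s9 ''D'' = s7 ''D''"
      by (simp_all add: s9_def s8_def s7_def s6_def o5 s4_def s3_def s2_def s1_def)
    then show "(\<Sum>l<1. rval (mk (loop_idx ?I i j l) s9 0) eE) = fw d ?q Y (Suc k) i j"
      using ij agreesD[OF B] agreesD[OF D7]
      by (simp add: eE_def r9 fw_dir_def G_def[symmetric] P_def[symmetric])
  qed
  have B11: "agrees d s11 ''B'' (fw d ?q Y (Suc k))"
    unfolding s11_def using agreesD[OF E10] by (intro agrees_fillp) (simp del: fw.simps)
  have r: "runs \<omega> prog_fw_step (?T + (?T + (?T + (?T + (?Tq + (?T + (?T + (?T + (?T + (?T + ?T)))))))))) (mk ?I \<sigma> t) (mk ?I s11 t)"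
    unfolding prog_fw_step_def eE_def[symmetric]
  proof (intro runs_Seq)
    show "runs \<omega> (Fill ''G'' iD iD i1 (RSub (RGet ''Y'' iI iJ) (RGet ''B'' iI iJ))) ?T (mk ?I \<sigma> t) (mk ?I s1 t)"
      unfolding s1_def by (rule runs_fillp_env) auto
    show "runs \<omega> (Fill ''f'' iD i1 iD (RMul (RGet ''G'' iI iL) (RGet ''G'' iI iL))) ?T (mk ?I s1 t) (mk ?I s2 t)"
      unfolding s2_def by (rule runs_fillp_env) auto
    show "runs \<omega> (Fill ''w'' i1 i1 iD (RGet ''f'' iL i0)) ?T (mk ?I s2 t) (mk ?I s3 t)"
      unfolding s3_def by (rule runs_fillp_env) auto
    show "runs \<omega> (Fill ''H'' iD iD i1 (RAdd (RGet ''G'' iI iJ) (RMul (RSqrt rw) (ieq iI iJ)))) ?T (mk ?I s3 t) (mk ?I s4 t)"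
      unfolding s4_def by (rule runs_fillp_env) auto
    show "runs \<omega> (For ''q'' (IAdd (IAdd (IVar ''n'') (IAdd iD iD)) i1) prog_square) ?Tq (mk ?I s4 t) (mk ?I s5 t)"
      by (rule r5)
    show "runs \<omega> (Fill ''w'' i1 i1 iD (RGet ''H'' iL iL)) ?T (mk ?I s5 t) (mk ?I s6 t)"
      unfolding s6_def by (rule runs_fillp_env) auto
    show "runs \<omega> (Fill ''D'' iD iD i1 (RDiv (RGet ''H'' iI iJ) rw)) ?T (mk ?I s6 t) (mk ?I s7 t)"
      unfolding s7_def by (rule runs_fillp_env) auto
    show "runs \<omega> (Fill ''f'' iD i1 iD (RMul (RGet ''G'' iI iL) (RGet ''D'' iI iL))) ?T (mk ?I s7 t) (mk ?I s8 t)"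
      unfolding s8_def by (rule runs_fillp_env) auto
    show "runs \<omega> (Fill ''r'' i1 i1 iD (RGet ''f'' iL i0)) ?T (mk ?I s8 t) (mk ?I s9 t)"
      unfolding s9_def by (rule runs_fillp_env) auto
    show "runs \<omega> (Fill ''E'' iD iD i1 eE) ?T (mk ?I s9 t) (mk ?I s10 t)"
      unfolding s10_def by (rule runs_fillp_env) (auto simp: eE_def)
    show "runs \<omega> (Fill ''B'' iD iD i1 (RGet ''E'' iI iJ)) ?T (mk ?I s10 t) (mk ?I s11 t)"
      unfolding s11_def by (rule runs_fillp_env) auto
  qed
  have "\<forall>y. y \<notin> fw_vars \<longrightarrow> s11 y = \<sigma> y"
    by (auto simp: fw_vars_def o5 s1_def s2_def s3_def s4_def s6_def s7_def s8_def s9_def s10_def s11_def)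
  moreover have "runs \<omega> prog_fw_step (1000000 * size_bound d n ^ 3 + ?Tq) (mk ?I \<sigma> t) (mk ?I s11 t)"
    by (rule runs_mono[OF r]) simp
  ultimately show ?thesis using B11 by blast
qed

lemma runs_prog_fw:
  assumes Y: "agrees d \<sigma> ''Y'' Y" and B: "agrees d \<sigma> ''B'' (\<lambda>i j. 0)"
  shows "\<exists>\<sigma>'. runs \<omega> (For ''k'' (IVar ''n'') prog_fw_step)
      (n * ((1000000 * size_bound d n ^ 3 + ((n + (d + d) + 1) * (200000 * size_bound d n ^ 3 + 2) + 2)) + 2) + 2)
      (mk (env d n m 0 0 0) \<sigma> t) (mk (env d n m 0 0 0) \<sigma>' t) \<and> agrees d \<sigma>' ''B'' (fw d (Suc (n + (d + d))) Y n)"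
proof -
  let ?I = "env d n m 0 0 0"
  let ?T = "1000000 * size_bound d n ^ 3 + ((n + (d + d) + 1) * (200000 * size_bound d n ^ 3 + 2) + 2)"
  define Inv where "Inv k s \<longleftrightarrow> agrees d s ''Y'' Y \<and> agrees d s ''B'' (fw d (Suc (n + (d + d))) Y k)" for k s
  have "\<exists>\<sigma>'. runs \<omega> (For ''k'' (IVar ''n'') prog_fw_step) (n * (?T + 2) + 2) (mk ?I \<sigma> t) (mk ?I \<sigma>' t) \<and> Inv n \<sigma>'"
  proof (rule runs_For_invariant[where c = "\<lambda>_. t"])
    show "Inv 0 \<sigma>" using Y B by (simp add: Inv_def)
    fix k s assume inv: "Inv k s"
    from runs_prog_fw_step[OF inv[unfolded Inv_def, THEN conjunct1] inv[unfolded Inv_def, THEN conjunct2], of \<omega> m t]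
    obtain s' where "runs \<omega> prog_fw_step ?T (mk (env d n m 0 k 0) s t) (mk (env d n m 0 k 0) s' t)"
      and B': "agrees d s' ''B'' (fw d (Suc (n + (d + d))) Y (Suc k))" and o: "\<forall>y. y \<notin> fw_vars \<longrightarrow> s' y = s y" by blast
    moreover have "Inv (Suc k) s'" using B' o inv unfolding Inv_def by (auto simp: agrees_def fw_vars_def simp del: fw.simps)
    ultimately show "\<exists>\<sigma>'. runs \<omega> prog_fw_step ?T (mk (?I(''k'' := k)) s t) (mk (?I(''k'' := k)) \<sigma>' t) \<and> Inv (Suc k) \<sigma>'"
      unfolding env_upd by blast
  qed simp_all
  then show ?thesis unfolding Inv_def by blast
qed

section \<open>The running time\<close>

definition main_time :: "nat \<Rightarrow> nat \<Rightarrow> nat" where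
  "main_time d n = (n * 3 + 2) + (100000 * size_bound d n ^ 3 + ((d * ((d * 3 + 2) + (chi_dof d * 3 + 2) + 2) + 2) +
    ((100000 * size_bound d n ^ 3 + 100000 * size_bound d n ^ 3) +
    ((100000 * size_bound d n ^ 3 + (d * (700000 * size_bound d n ^ 3 + 2) + 2)) +
    (100000 * size_bound d n ^ 3 +
    ((n * ((1000000 * size_bound d n ^ 3 + ((n + (d + d) + 1) * (200000 * size_bound d n ^ 3 + 2) + 2)) + 2) + 2) +
    100000 * size_bound d n ^ 3))))))"

text \<open>The degree 5 comes from \<open>n\<close> iterations with O(n + d) squarings of cubic
  cost; all other parts have degree at most 4.\<close>

lemma main_time_le: "main_time d n \<le> 10000000 * size_bound d n ^ 5"
proof -
  define N where "N = size_bound d n"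
  have N: "1 \<le> N" "d \<le> N" "n \<le> N" "n + (d + d) + 1 \<le> 2 * N" by (auto simp: N_def)
  have p: "N ^ k \<le> N ^ 5" if "k \<le> 5" for k using that N by (intro power_increasing) auto
  have 1: "n * 3 + 2 \<le> 5 * N ^ 5" using p[of 1] N by simp
  have 2: "d * ((d * 3 + 2) + (chi_dof d * 3 + 2) + 2) + 2 \<le> 20000 * N ^ 5"
  proof -
    have "(d * 3 + 2) + (chi_dof d * 3 + 2) + 2 \<le> 13000 * N" unfolding chi_dof_def using N by simp
    then have "d * ((d * 3 + 2) + (chi_dof d * 3 + 2) + 2) \<le> N * (13000 * N)" using N by (intro mult_le_mono) auto
    then show ?thesis using p[of 2] p[of 0] by (simp add: power2_eq_square)
  qed
  have 3: "d * (700000 * N ^ 3 + 2) + 2 \<le> 700004 * N ^ 5"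
  proof -
    have "d * (700000 * N ^ 3 + 2) \<le> N * (700000 * N ^ 3 + 2)" using N by (intro mult_le_mono) auto
    also have "\<dots> = 700000 * N ^ 4 + 2 * N ^ 1" by (simp add: algebra_simps power_numeral_reduce)
    finally show ?thesis using p[of 4] p[of 1] p[of 0] by simp
  qed
  have 4: "n * ((1000000 * N ^ 3 + ((n + (d + d) + 1) * (200000 * N ^ 3 + 2) + 2)) + 2) + 2 \<le> 3000000 * N ^ 5"
  proof -
    have "(n + (d + d) + 1) * (200000 * N ^ 3 + 2) \<le> (2 * N) * (200000 * N ^ 3 + 2)" using N by (intro mult_le_mono) auto
    also have "\<dots> = 400000 * N ^ 4 + 4 * N ^ 1" by (simp add: algebra_simps power_numeral_reduce)
    finally have "(1000000 * N ^ 3 + ((n + (d + d) + 1) * (200000 * N ^ 3 + 2) + 2)) + 2 \<le> 1000000 * N ^ 3 + 400000 * N ^ 4 + 4 * N ^ 1 + 4" by simp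
    also have "\<dots> \<le> 2000000 * N ^ 4"
      using power_increasing[of 3 4 N] power_increasing[of 1 4 N] power_increasing[of 0 4 N] N by simp
    finally have "n * ((1000000 * N ^ 3 + ((n + (d + d) + 1) * (200000 * N ^ 3 + 2) + 2)) + 2) \<le> N * (2000000 * N ^ 4)"
      using N by (intro mult_le_mono) auto
    also have "\<dots> = 2000000 * N ^ 5" by (simp add: power_numeral_reduce)
    finally show ?thesis using p[of 0] by simp
  qed
  have 5: "N ^ 3 \<le> N ^ 5" by (rule p) simp
  \<comment> \<open>The nonlinear terms become opaque, so that linear arithmetic can add up the
    estimates.\<close>
  define A B C D where "A = n * 3 + 2" and "B = d * ((d * 3 + 2) + (chi_dof d * 3 + 2) + 2) + 2"
    and "C = d * (700000 * N ^ 3 + 2) + 2"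
    and "D = n * ((1000000 * N ^ 3 + ((n + (d + d) + 1) * (200000 * N ^ 3 + 2) + 2)) + 2) + 2"
  note main = 1[folded A_def] 2[folded B_def] 3[folded C_def] 4[folded D_def] 5
  show ?thesis unfolding main_time_def N_def[symmetric] A_def[symmetric] B_def[symmetric] C_def[symmetric] D_def[symmetric]
    using main by linarith
qed

lemma runs_prog_main:
  "\<exists>\<sigma> t. runs \<omega> prog_main (main_time d n) (input_state d \<epsilon> n X) (mk (env d n (n div 2) 0 0 0) \<sigma> t) \<and>
    (\<forall>i<d. \<forall>j<d. \<sigma> ''out'' (i, j) = mech_out d \<epsilon> n X \<omega> (i, j))"
proof -
  let ?I = "env d n (n div 2) 0 0 0" and ?T = "100000 * size_bound d n ^ 3"
  define \<sigma>0 where "\<sigma>0 = (\<lambda>_ _. 0)(''X'' := (\<lambda>(i, j). if i < n \<and> j < d then X i j else 0), ''eps'' := (\<lambda>_. 0)((0, 0) := \<epsilon>))"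
  have "(\<lambda>_. 0)(''d'' := d, ''n'' := n) = env d n 0 0 0 0" by (auto simp: env_def fun_eq_iff)
  then have inp: "input_state d \<epsilon> n X = mk (env d n 0 0 0 0) \<sigma>0 0"
    by (simp add: input_state_def mk_def \<sigma>0_def)
  have r0: "runs \<omega> prog_half (n * 3 + 2) (mk (env d n 0 0 0 0) \<sigma>0 0) (mk ?I \<sigma>0 0)"
    by (rule runs_prog_half)
  obtain s1 where r1: "runs \<omega> prog_mean ?T (mk ?I \<sigma>0 0) (mk ?I s1 0)"
    and S1: "agrees d s1 ''S'' (pair_mean n X)" and o1: "\<And>y. y \<noteq> ''S'' \<Longrightarrow> s1 y = \<sigma>0 y"
    by (rule runs_prog_mean[of n d \<sigma>0 X \<omega> 0]) (auto simp: \<sigma>0_def)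
  obtain s2 t2 where r2: "runs \<omega> prog_draw (d * ((d * 3 + 2) + (chi_dof d * 3 + 2) + 2) + 2) (mk ?I s1 0) (mk ?I s2 t2)"
    and g2: "drawn_cells d \<omega> d s2" and o2: "\<And>y. y \<noteq> ''g'' \<Longrightarrow> y \<noteq> ''h'' \<Longrightarrow> s2 y = s1 y"
    by (rule runs_prog_draw[of \<omega> d n "n div 2" s1]) blast
  obtain s3 where r3: "runs \<omega> prog_student (?T + ?T) (mk ?I s2 t2) (mk ?I s3 t2)"
    and T3: "agrees d s3 ''T'' (\<lambda>i j. tape_student d \<omega> j i)" and o3: "\<And>y. y \<noteq> ''R'' \<Longrightarrow> y \<noteq> ''T'' \<Longrightarrow> s3 y = s2 y"
    by (rule runs_prog_student[OF g2, of n "n div 2" t2]) blast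
  have N3: "agrees d s3 ''N'' (\<lambda>i j. 0)" by (simp add: agrees_def o3 o2 o1 \<sigma>0_def)
  obtain s4 where r4: "runs \<omega> prog_noise (?T + (d * (700000 * size_bound d n ^ 3 + 2) + 2)) (mk ?I s3 t2) (mk ?I s4 t2)"
    and N4: "agrees d s4 ''N'' (\<lambda>i j. gcol d (tape_student d \<omega>) j i)" and o4: "\<And>y. y \<notin> col_vars \<Longrightarrow> s4 y = s3 y"
    using runs_prog_noise[OF T3 N3, of \<omega> n "n div 2" t2] by blast
  let ?Y = "noisy d \<epsilon> n (pair_mean n X) (\<lambda>i j. gcol d (tape_student d \<omega>) j i)"
  let ?eY = "RDiv (RAdd (RAdd (RGet ''S'' iI iJ) (RGet ''S'' iJ iI))
     (RMul (RDiv (RMul (RConst 12294) (RIdx iD)) (RMul (RIdx (IVar ''m'')) (RGet ''eps'' i0 i0)))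
       (RAdd (RGet ''N'' iI iJ) (RGet ''N'' iJ iI)))) (RConst 2)"
  define s5 where "s5 = fillp ?I ''Y'' d d 1 ?eY s4"
  have r5: "runs \<omega> prog_noisy ?T (mk ?I s4 t2) (mk ?I s5 t2)"
    unfolding prog_noisy_def s5_def by (rule runs_fillp_env) auto
  have Y5: "agrees d s5 ''Y'' ?Y"
    unfolding s5_def
  proof (rule agrees_fillp)
    fix i j assume ij: "i < d" "j < d"
    have e: "s4 ''S'' = s1 ''S''" "s4 ''eps'' (0, 0) = \<epsilon>"
      by (simp_all add: o4 o3 o2 o1 col_vars_def \<sigma>0_def)
    then show "(\<Sum>l<1. rval (mk (loop_idx ?I i j l) s4 0) ?eY) = ?Y i j"
      using ij agreesD[OF S1] agreesD[OF N4] by (simp add: noisy_def noise_scale_def)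
  qed
  have B5: "agrees d s5 ''B'' (\<lambda>i j. 0)"
    by (simp add: agrees_def s5_def o4 o3 o2 o1 col_vars_def \<sigma>0_def)
  obtain s6 where r6: "runs \<omega> (For ''k'' (IVar ''n'') prog_fw_step)
      (n * ((1000000 * size_bound d n ^ 3 + ((n + (d + d) + 1) * (200000 * size_bound d n ^ 3 + 2) + 2)) + 2) + 2)
      (mk ?I s5 t2) (mk ?I s6 t2)" and B6: "agrees d s6 ''B'' (fw d (Suc (n + (d + d))) ?Y n)"
    using runs_prog_fw[OF Y5 B5, of \<omega> n "n div 2" t2] by blast
  define s7 where "s7 = fillp ?I ''out'' d d 1 (RMul (RConst 2) (RGet ''B'' iI iJ)) s6"
  have r7: "runs \<omega> (Fill ''out'' iD iD i1 (RMul (RConst 2) (RGet ''B'' iI iJ))) ?T (mk ?I s6 t2) (mk ?I s7 t2)"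
    unfolding s7_def by (rule runs_fillp_env) auto
  have "agrees d s7 ''out'' (\<lambda>i j. 2 * fw d (Suc (n + (d + d))) ?Y n i j)"
    unfolding s7_def using agreesD[OF B6] by (intro agrees_fillp) simp
  then have "\<forall>i<d. \<forall>j<d. s7 ''out'' (i, j) = mech_out d \<epsilon> n X \<omega> (i, j)"
    by (simp add: agrees_def mech_out_def estimate_def)
  moreover have "runs \<omega> prog_main (main_time d n) (input_state d \<epsilon> n X) (mk ?I s7 t2)"
    unfolding prog_main_def main_time_def inp
    by (rule runs_Seq[OF r0 runs_Seq[OF r1 runs_Seq[OF r2 runs_Seq[OF r3 runs_Seq[OF r4
          runs_Seq[OF r5 runs_Seq[OF r6 r7]]]]]]])
  ultimately show ?thesis by blast
qed

lemma mech_out_polynomial_time: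
  "\<exists>t s. exec \<omega> prog_main (input_state d \<epsilon> n X) t s \<and> mech_out d \<epsilon> n X \<omega> = output_matrix d s \<and>
    real t \<le> 10000000 * (1 + real d + real n) ^ 5"
proof -
  obtain \<sigma> t' where r: "runs \<omega> prog_main (main_time d n) (input_state d \<epsilon> n X) (mk (env d n (n div 2) 0 0 0) \<sigma> t')"
    and out: "\<forall>i<d. \<forall>j<d. \<sigma> ''out'' (i, j) = mech_out d \<epsilon> n X \<omega> (i, j)"
    using runs_prog_main by blast
  from r obtain t where t: "t \<le> main_time d n"
    and ex: "exec \<omega> prog_main (input_state d \<epsilon> n X) t (mk (env d n (n div 2) 0 0 0) \<sigma> t')"
    unfolding runs_def by blast
  have "mech_out d \<epsilon> n X \<omega> = output_matrix d (mk (env d n (n div 2) 0 0 0) \<sigma> t')"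
  proof
    fix p :: "nat \<times> nat"
    obtain i j where p: "p = (i, j)" by (cases p)
    show "mech_out d \<epsilon> n X \<omega> p = output_matrix d (mk (env d n (n div 2) 0 0 0) \<sigma> t') p"
    proof (cases "i < d \<and> j < d")
      case True
      then show ?thesis using out by (simp add: p output_matrix_def)
    next
      case False
      then have "p \<notin> {..<d} \<times> {..<d}" by (simp add: p)
      then show ?thesis by (simp only: mech_out_def estimate_def output_matrix_def restrict_apply if_False)
    qed
  qed
  moreover have "real t \<le> 10000000 * (1 + real d + real n) ^ 5"
  proof -
    have "real t \<le> real (10000000 * size_bound d n ^ 5)"
      by (rule of_nat_mono[OF order.trans[OF t main_time_le]])
    then show ?thesis by (simp only: of_nat_mult of_nat_power of_nat_add of_nat_numeral of_nat_1)
  qed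
  ultimately show ?thesis using ex by blast
qed

section \<open>Distribution of the output and privacy\<close>

lemma indep_vars_PiM_coordinates:
  assumes M: "prob_space M" and I: "I \<noteq> {}"
  shows "prob_space.indep_vars (Pi\<^sub>M I (\<lambda>_. M)) (\<lambda>_. M) (\<lambda>i \<omega>. \<omega> i) I"
proof -
  interpret P: prob_space "Pi\<^sub>M I (\<lambda>_. M)" by (rule prob_space_PiM) (rule M)
  have "distr (Pi\<^sub>M I (\<lambda>_. M)) (Pi\<^sub>M I (\<lambda>_. M)) (\<lambda>x. \<lambda>i\<in>I. x i) = distr (Pi\<^sub>M I (\<lambda>_. M)) (Pi\<^sub>M I (\<lambda>_. M)) (\<lambda>x. x)"
    by (rule distr_cong) (auto simp: space_PiM PiE_def extensional_restrict)
  also have "\<dots> = Pi\<^sub>M I (\<lambda>_. M)" by simp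
  also have "\<dots> = Pi\<^sub>M I (\<lambda>i. distr (Pi\<^sub>M I (\<lambda>_. M)) M (\<lambda>\<omega>. \<omega> i))"
    by (intro PiM_cong refl distr_PiM_component[symmetric] M)
  finally show ?thesis
    by (subst P.indep_vars_iff_distr_eq_PiM') (use I in auto)
qed

abbreviation cell_measure :: "(real \<times> real) measure" where
  "cell_measure \<equiv> uniform_measure lborel {0..1} \<Otimes>\<^sub>M std_normal"

lemma prob_space_cell: "prob_space cell_measure"
proof -
  interpret U: prob_space "uniform_measure lborel {0..1::real}" by (rule prob_space_uniform_measure) auto
  interpret N: prob_space std_normal by (rule prob_space_std_normal)
  interpret pair_prob_space "uniform_measure lborel {0..1::real}" std_normal ..
  show ?thesis by (rule prob_space_axioms)
qed

lemma distr_cell_snd: "distr cell_measure std_normal snd = std_normal"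
proof -
  interpret U: prob_space "uniform_measure lborel {0..1::real}" by (rule prob_space_uniform_measure) auto
  interpret N: prob_space std_normal by (rule prob_space_std_normal)
  show ?thesis
  proof (rule measure_eqI)
    fix A assume A: "A \<in> sets (distr cell_measure std_normal snd)"
    then have A': "A \<in> sets std_normal" by simp
    have "snd -` A \<inter> space cell_measure = space (uniform_measure lborel {0..1::real}) \<times> A"
      using sets.sets_into_space[OF A'] by (auto simp: space_pair_measure)
    then show "emeasure (distr cell_measure std_normal snd) A = emeasure std_normal A"
      using A' U.emeasure_space_1 by (subst emeasure_distr) (auto simp: sigma_finite_measure.emeasure_pair_measure_Times[OF prob_space_imp_sigma_finite[OF prob_space_std_normal]])
  qed simp
qed

lemma prob_space_tape: "prob_space random_tape"
  unfolding random_tape_def by (rule prob_space_PiM) (rule prob_space_cell)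

definition tape_blocks :: "nat \<Rightarrow> nat \<Rightarrow> tape \<Rightarrow> nat \<Rightarrow> nat \<Rightarrow> real" where
  "tape_blocks r q \<omega> = (\<lambda>j\<in>{..<r}. \<lambda>i\<in>{..<q}. snd (\<omega> (j * q + i)))"

lemma measurable_tape_cell: "(\<lambda>\<omega>. snd (\<omega> k)) \<in> random_tape \<rightarrow>\<^sub>M borel"
  unfolding random_tape_def by measurable

lemma measurable_tape_blocks: "tape_blocks r q \<in> random_tape \<rightarrow>\<^sub>M NNv r q"
  unfolding tape_blocks_def by (intro measurable_restrict) (simp add: measurable_tape_cell)

lemma distr_single_block:
  "distr random_tape (Nv {..<q}) (\<lambda>\<omega>. \<lambda>i\<in>{..<q}. snd (\<omega> (b + i))) = Nv {..<q}"
proof -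
  let ?f = "\<lambda>\<omega>. \<lambda>i\<in>{..<q}. \<omega> (b + i)" and ?g = "\<lambda>x. \<lambda>i\<in>{..<q}. snd (x i)"
  have m1: "?f \<in> random_tape \<rightarrow>\<^sub>M Pi\<^sub>M {..<q} (\<lambda>_. cell_measure)"
    unfolding random_tape_def by (intro measurable_restrict measurable_component_singleton) simp
  have m2: "?g \<in> Pi\<^sub>M {..<q} (\<lambda>_. cell_measure) \<rightarrow>\<^sub>M Nv {..<q}"
    by (intro measurable_restrict measurable_compose[OF measurable_component_singleton]) auto
  have 1: "distr random_tape (Pi\<^sub>M {..<q} (\<lambda>_. cell_measure)) ?f = Pi\<^sub>M {..<q} (\<lambda>_. cell_measure)"
    unfolding random_tape_def
    by (rule distr_PiM_reindex[of UNIV "\<lambda>_. cell_measure" "\<lambda>i. b + i" "{..<q}"]) (auto simp: prob_space_cell inj_on_def)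
  have 2: "distr (Pi\<^sub>M {..<q} (\<lambda>_. cell_measure)) (Nv {..<q}) ?g = Nv {..<q}"
    by (rule distr_PiM_coordinatewise[where f = "\<lambda>_. snd"])
       (auto simp: distr_cell_snd product_sigma_finite_def prob_space_imp_sigma_finite prob_space_cell prob_space_std_normal)
  have "distr random_tape (Nv {..<q}) (?g \<circ> ?f) = Nv {..<q}"
    using distr_distr[OF m2 m1] unfolding 1 2 ..
  moreover have "?g \<circ> ?f = (\<lambda>\<omega> :: tape. \<lambda>i\<in>{..<q}. snd (\<omega> (b + i)))" by (auto simp: fun_eq_iff)
  ultimately show ?thesis by (simp only:)
qed

text \<open>Disjoint sets of cells are independent, and renumbering each block from 0 gives all of
  them the same Gaussian law.\<close>

lemma distr_tape_blocks:
  assumes r: "0 < r"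
  shows "distr random_tape (NNv r q) (tape_blocks r q) = NNv r q"
proof -
  interpret P: prob_space random_tape by (rule prob_space_tape)
  let ?K = "\<lambda>j. {j * q..<j * q + q}"
  have "P.indep_vars (\<lambda>_. cell_measure) (\<lambda>k \<omega>. \<omega> k) UNIV"
    unfolding random_tape_def by (rule indep_vars_PiM_coordinates[OF prob_space_cell]) simp
  then have "P.indep_vars (\<lambda>_. std_normal) (\<lambda>k \<omega>. snd (\<omega> k)) UNIV"
    by (rule P.indep_vars_compose2) simp
  then have "P.indep_vars (\<lambda>j. Nv (?K j)) (\<lambda>j \<omega>. restrict (\<lambda>k. snd (\<omega> k)) (?K j)) {..<r}"
  proof (rule P.indep_vars_restrict)
    show "disjoint_family_on ?K {..<r}"
      unfolding disjoint_family_on_def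
    proof (intro ballI impI)
      fix i j :: nat assume "i \<noteq> j"
      have *: "?K i \<inter> ?K j = {}" if "i < j" for i j :: nat
      proof -
        have "i * q + q \<le> j * q" using that mult_le_mono1[of "Suc i" j q] by simp
        then show ?thesis by auto
      qed
      then show "?K i \<inter> ?K j = {}" using \<open>i \<noteq> j\<close> by (cases "i < j") (auto simp: Int_commute)
    qed
  qed simp
  then have "P.indep_vars (\<lambda>_. Nv {..<q}) (\<lambda>j \<omega>. (\<lambda>x. \<lambda>i\<in>{..<q}. x (j * q + i)) (restrict (\<lambda>k. snd (\<omega> k)) (?K j))) {..<r}"
  proof (rule P.indep_vars_compose2)
    fix j
    show "(\<lambda>x. \<lambda>i\<in>{..<q}. x (j * q + i)) \<in> Nv (?K j) \<rightarrow>\<^sub>M Nv {..<q}"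
      by (intro measurable_restrict measurable_component_singleton) simp
  qed
  moreover have "(\<lambda>x. \<lambda>i\<in>{..<q}. x (j * q + i)) (restrict (\<lambda>k. snd (\<omega> k)) (?K j)) = (\<lambda>i\<in>{..<q}. snd (\<omega> (j * q + i)))"
    for j and \<omega> :: tape by (auto simp: fun_eq_iff)
  ultimately have ind: "P.indep_vars (\<lambda>_. Nv {..<q}) (\<lambda>j \<omega>. \<lambda>i\<in>{..<q}. snd (\<omega> (j * q + i))) {..<r}" by simp
  have "distr random_tape (NNv r q) (tape_blocks r q) =
    Pi\<^sub>M {..<r} (\<lambda>j. distr random_tape (Nv {..<q}) (\<lambda>\<omega>. \<lambda>i\<in>{..<q}. snd (\<omega> (j * q + i))))"
    unfolding tape_blocks_def using ind r
    by (subst (asm) P.indep_vars_iff_distr_eq_PiM') (auto intro!: measurable_restrict simp: measurable_tape_cell)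
  then show ?thesis by (simp only: distr_single_block)
qed

lemma nn_integral_tape_blocks:
  assumes "f \<in> borel_measurable (NNv r q)" "0 < r"
  shows "(\<integral>\<^sup>+\<omega>. f (tape_blocks r q \<omega>) \<partial>random_tape) = (\<integral>\<^sup>+x. f x \<partial>NNv r q)"
  using nn_integral_distr[OF measurable_tape_blocks, of f r q] assms distr_tape_blocks[of r q] by simp

text \<open>\<open>tape_blocks\<close> is extensional and \<open>tape_block\<close> is not; they
  agree on the indices that a Student vector reads.\<close>

lemma tape_student_blocks:
  assumes "j < r" "i < d"
  shows "student d (chi_dof d) (tape_blocks r (d + chi_dof d) \<omega> j) i = tape_student d \<omega> j i"
  using assms unfolding tape_student_def student_def tape_blocks_def tape_block_def norm_on_def
  by (auto intro!: arg_cong2[where f = "(/)"] arg_cong[where f = sqrt] sum.cong)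

lemma gcol_tape_student:
  assumes "j < d" "i < d"
  shows "gcol d (tape_student d \<omega>) j i = noise_cols d (chi_dof d) d (tape_blocks d (d + chi_dof d) \<omega>) j i"
  unfolding noise_cols_def using assms
  by (auto intro!: gcol_cong simp: tape_student_blocks)

section \<open>The estimate as a measurable function of the noisy entries\<close>

lemma mtrace_cong: "(\<And>i j. i < d \<Longrightarrow> j < d \<Longrightarrow> A i j = B i j) \<Longrightarrow> mtrace d A = mtrace d B"
  by (simp add: mtrace_def)

lemma fw_shift_cong:
  assumes "\<And>i j. i < d \<Longrightarrow> j < d \<Longrightarrow> A i j = B i j" "i < d" "j < d"
  shows "fw_shift d A i j = fw_shift d B i j"
  using assms frob_cong[of d A B A B] by (simp add: fw_shift_def)

lemma fw_power_cong:
  assumes "\<And>i j. i < d \<Longrightarrow> j < d \<Longrightarrow> A i j = B i j" "i < d" "j < d"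
  shows "fw_power d q A i j = fw_power d q B i j"
proof -
  have m: "msq d (fw_shift d A) q i j = msq d (fw_shift d B) q i j" if "i < d" "j < d" for i j
    using that by (intro msq_cong fw_shift_cong assms)
  then show ?thesis unfolding fw_power_def using assms mtrace_cong[OF m] by simp
qed

lemma fw_dir_cong:
  assumes "\<And>i j. i < d \<Longrightarrow> j < d \<Longrightarrow> A i j = B i j" "i < d" "j < d"
  shows "fw_dir d q A i j = fw_dir d q B i j"
proof -
  have p: "fw_power d q A i j = fw_power d q B i j" if "i < d" "j < d" for i j
    using that assms by (intro fw_power_cong)
  then show ?thesis unfolding fw_dir_def using assms frob_cong[of d A B "fw_power d q A" "fw_power d q B"] by simp
qed

lemma fw_cong:
  assumes "\<And>i j. i < d \<Longrightarrow> j < d \<Longrightarrow> Y i j = Y' i j" "i < d" "j < d"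
  shows "fw d q Y k i j = fw d q Y' k i j"
  using assms(2,3)
proof (induction k arbitrary: i j)
  case (Suc k)
  have "fw_dir d q (\<lambda>i j. Y i j - fw d q Y k i j) i j = fw_dir d q (\<lambda>i j. Y' i j - fw d q Y' k i j) i j"
    using Suc assms(1) by (intro fw_dir_cong) auto
  then show ?case using Suc by simp
qed simp

lemma estimate_cong:
  assumes "\<And>i j. i < d \<Longrightarrow> j < d \<Longrightarrow> Y i j = Y' i j"
  shows "estimate d n Y = estimate d n Y'"
  unfolding estimate_def
proof (rule restrict_ext)
  fix p assume "p \<in> {..<d} \<times> {..<d}"
  then obtain i j where p: "p = (i, j)" "i < d" "j < d" by auto
  then show "(case p of (i, j) \<Rightarrow> 2 * fw d (Suc (n + (d + d))) Y n i j) = (case p of (i, j) \<Rightarrow> 2 * fw d (Suc (n + (d + d))) Y' n i j)"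
    using fw_cong[of d Y Y' i j "Suc (n + (d + d))" n] assms by (simp del: fw.simps)
qed

text \<open>The output as a deterministic function of the mean and the noise columns. Privacy then
  concerns the noisy matrix; what follows it is post-processing.\<close>

definition release :: "nat \<Rightarrow> real \<Rightarrow> nat \<Rightarrow> (nat \<Rightarrow> nat \<Rightarrow> real) \<Rightarrow> (nat \<Rightarrow> nat \<Rightarrow> real) \<Rightarrow> matrix" where
  "release d \<epsilon> n M a = estimate d n (noisy d \<epsilon> n M (\<lambda>i j. a j i))"

lemma mech_out_eq_release:
  "mech_out d \<epsilon> n X \<omega> = release d \<epsilon> n (pair_mean n X) (noise_cols d (chi_dof d) d (tape_blocks d (d + chi_dof d) \<omega>))"
  unfolding mech_out_def release_def
  by (rule estimate_cong) (simp add: noisy_def gcol_tape_student)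

lemma measurable_frob:
  assumes "\<And>i j. i < d \<Longrightarrow> j < d \<Longrightarrow> (\<lambda>x. A x i j) \<in> borel_measurable N" "\<And>i j. i < d \<Longrightarrow> j < d \<Longrightarrow> (\<lambda>x. B x i j) \<in> borel_measurable N"
  shows "(\<lambda>x. frob d (A x) (B x)) \<in> borel_measurable N"
  unfolding frob_def using assms by (intro borel_measurable_sum borel_measurable_times) auto

lemma measurable_msq:
  assumes "\<And>i j. i < d \<Longrightarrow> j < d \<Longrightarrow> (\<lambda>x. A x i j) \<in> borel_measurable N" "i < d" "j < d"
  shows "(\<lambda>x. msq d (A x) q i j) \<in> borel_measurable N"
  using assms(2,3)
proof (induction q arbitrary: i j)
  case (Suc q)
  then show ?case unfolding msq.simps mmul_def by (intro borel_measurable_sum borel_measurable_times) auto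
qed (use assms in auto)

lemma measurable_fw_dir:
  assumes A: "\<And>i j. i < d \<Longrightarrow> j < d \<Longrightarrow> (\<lambda>x. A x i j) \<in> borel_measurable N" and ij: "i < d" "j < d"
  shows "(\<lambda>x. fw_dir d q (A x) i j) \<in> borel_measurable N"
proof -
  have sh: "(\<lambda>x. fw_shift d (A x) i j) \<in> borel_measurable N" if "i < d" "j < d" for i j
    unfolding fw_shift_def using that A
    by (intro borel_measurable_add borel_measurable_times measurable_compose[OF measurable_frob borel_measurable_sqrt]) auto
  have pw: "(\<lambda>x. fw_power d q (A x) i j) \<in> borel_measurable N" if "i < d" "j < d" for i j
    unfolding fw_power_def mtrace_def using that
    by (intro borel_measurable_divide borel_measurable_sum measurable_msq sh) auto
  have [measurable]: "(\<lambda>x. frob d (A x) (fw_power d q (A x))) \<in> borel_measurable N" "(\<lambda>x. fw_power d q (A x) i j) \<in> borel_measurable N"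
    using ij by (intro measurable_frob A pw; simp)+
  show ?thesis unfolding fw_dir_def by measurable
qed

lemma measurable_fw:
  assumes Y: "\<And>i j. i < d \<Longrightarrow> j < d \<Longrightarrow> (\<lambda>x. Y x i j) \<in> borel_measurable N" and "i < d" "j < d"
  shows "(\<lambda>x. fw d q (Y x) k i j) \<in> borel_measurable N"
  using assms(2,3)
proof (induction k arbitrary: i j)
  case (Suc k)
  have "(\<lambda>x. fw_dir d q (\<lambda>i j. Y x i j - fw d q (Y x) k i j) i j) \<in> borel_measurable N"
    using Suc Y by (intro measurable_fw_dir borel_measurable_diff) auto
  then show ?case unfolding fw.simps using Suc
    by (intro borel_measurable_add borel_measurable_times borel_measurable_diff borel_measurable_const) auto
qed simp

lemma measurable_estimate:
  assumes Y: "\<And>i j. i < d \<Longrightarrow> j < d \<Longrightarrow> (\<lambda>x. Y x i j) \<in> borel_measurable N"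
  shows "(\<lambda>x. estimate d n (Y x)) \<in> N \<rightarrow>\<^sub>M matrix_space d"
  unfolding estimate_def matrix_space_def
proof (rule measurable_restrict)
  fix p assume "p \<in> {..<d} \<times> {..<d}"
  then obtain i j where p: "p = (i, j)" "i < d" "j < d" by auto
  have "(\<lambda>x. 2 * fw d (Suc (n + (d + d))) (Y x) n i j) \<in> borel_measurable N"
    using p by (intro borel_measurable_times borel_measurable_const measurable_fw Y)
  then show "(\<lambda>x. case p of (i, j) \<Rightarrow> 2 * fw d (Suc (n + (d + d))) (Y x) n i j) \<in> borel_measurable N"
    by (simp add: p del: fw.simps)
qed

lemma measurable_noisy:
  assumes "\<And>i j. i < d \<Longrightarrow> j < d \<Longrightarrow> (\<lambda>x. M x i j) \<in> borel_measurable N"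
    and "\<And>i j. i < d \<Longrightarrow> j < d \<Longrightarrow> (\<lambda>x. A x i j) \<in> borel_measurable N" and "i < d" "j < d"
  shows "(\<lambda>x. noisy d \<epsilon> n (M x) (A x) i j) \<in> borel_measurable N"
  unfolding noisy_def using assms
  by (intro borel_measurable_divide borel_measurable_add borel_measurable_times borel_measurable_const) auto

lemma measurable_release: "release d \<epsilon> n M \<in> LLv d d \<rightarrow>\<^sub>M matrix_space d"
  unfolding release_def by (intro measurable_estimate measurable_noisy measurable_LLv_component) auto

lemma measurable_tape_gcol:
  "j < d \<Longrightarrow> i < d \<Longrightarrow> (\<lambda>\<omega>. gcol d (tape_student d \<omega>) j i) \<in> borel_measurable random_tape"
proof (rule measurable_gcol)
  show "(\<lambda>\<omega>. tape_student d \<omega> j i) \<in> borel_measurable random_tape" if "i < d" for j i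
    unfolding tape_student_def student_def norm_on_def tape_block_def using that
    by (simp, intro borel_measurable_divide measurable_compose[OF _ borel_measurable_sqrt] borel_measurable_sum
        borel_measurable_power measurable_tape_cell)
qed

text \<open>Joint measurability in the data and the tape, which makes the mechanism a probability
  kernel.\<close>

lemma measurable_mech_out:
  assumes X: "\<And>l i. l < n \<Longrightarrow> i < d \<Longrightarrow> (\<lambda>X. X l i) \<in> borel_measurable N"
  shows "(\<lambda>(X, \<omega>). mech_out d \<epsilon> n X \<omega>) \<in> N \<Otimes>\<^sub>M random_tape \<rightarrow>\<^sub>M matrix_space d"
  unfolding mech_out_def split_beta
proof (intro measurable_estimate measurable_noisy)
  fix i j assume "i < d" "j < d"
  then show "(\<lambda>x. pair_mean n (fst x) i j) \<in> borel_measurable (N \<Otimes>\<^sub>M random_tape)"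
    unfolding pair_mean_def half_diff_def
    by (intro borel_measurable_sum borel_measurable_divide borel_measurable_times borel_measurable_diff
        borel_measurable_const measurable_compose[OF measurable_fst] X) auto
  show "(\<lambda>x. gcol d (tape_student d (snd x)) j i) \<in> borel_measurable (N \<Otimes>\<^sub>M random_tape)"
    using \<open>i < d\<close> \<open>j < d\<close> by (intro measurable_compose[OF measurable_snd] measurable_tape_gcol)
qed

section \<open>The mechanism as a probability kernel\<close>

definition mechanism :: "nat \<Rightarrow> real \<Rightarrow> nat \<Rightarrow> (nat \<Rightarrow> vector) \<Rightarrow> matrix measure" where
  "mechanism d \<epsilon> n X = distr random_tape (matrix_space d) (mech_out d \<epsilon> n X)"

lemma measurable_ball_component: "i < d \<Longrightarrow> (\<lambda>x. x i) \<in> borel_measurable (ball_space d)"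
  unfolding ball_space_def by (intro measurable_restrict_space1) simp

lemma measurable_dataset_component:
  "l < n \<Longrightarrow> i < d \<Longrightarrow> (\<lambda>X. X l i) \<in> borel_measurable (dataset_space d n)"
  unfolding dataset_space_def
  by (rule measurable_compose[OF measurable_component_singleton[of l] measurable_ball_component]) auto

lemma measurable_mech_out_tape: "mech_out d \<epsilon> n X \<in> random_tape \<rightarrow>\<^sub>M matrix_space d"
  unfolding mech_out_def
  by (intro measurable_estimate measurable_noisy measurable_tape_gcol) auto

lemma mechanism_measurable: "mechanism d \<epsilon> n \<in> dataset_space d n \<rightarrow>\<^sub>M prob_algebra (matrix_space d)"
proof (rule measurable_prob_algebraI)
  show "prob_space (mechanism d \<epsilon> n X)" for X
    unfolding mechanism_def by (rule prob_space.prob_space_distr[OF prob_space_tape measurable_mech_out_tape])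
  have "(\<lambda>X. distr random_tape (matrix_space d) (mech_out d \<epsilon> n X)) \<in> dataset_space d n \<rightarrow>\<^sub>M subprob_algebra (matrix_space d)"
    using measurable_mech_out[of n d "dataset_space d n" \<epsilon>] measurable_dataset_component
      prob_space_imp_subprob_space[OF prob_space_tape]
    by (intro measurable_distr2 measurable_const) (auto simp: space_subprob_algebra)
  then show "mechanism d \<epsilon> n \<in> dataset_space d n \<rightarrow>\<^sub>M subprob_algebra (matrix_space d)"
    unfolding mechanism_def .
qed

text \<open>Replaces the tape by independent Gaussian blocks, the setting of the density and of the
  moment bounds.\<close>

lemma nn_integral_mechanism:
  assumes d: "0 < d" and f: "f \<in> borel_measurable (matrix_space d)"
  shows "(\<integral>\<^sup>+A. f A \<partial>mechanism d \<epsilon> n X) =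
    (\<integral>\<^sup>+x. f (release d \<epsilon> n (pair_mean n X) (noise_cols d (chi_dof d) d x)) \<partial>NNv d (d + chi_dof d))"
proof -
  have "(\<integral>\<^sup>+A. f A \<partial>distr random_tape (matrix_space d) (mech_out d \<epsilon> n X)) = (\<integral>\<^sup>+\<omega>. f (mech_out d \<epsilon> n X \<omega>) \<partial>random_tape)"
    by (rule nn_integral_distr[OF measurable_mech_out_tape]) (simp add: f)
  also have "\<dots> = (\<integral>\<^sup>+\<omega>. f (release d \<epsilon> n (pair_mean n X) (noise_cols d (chi_dof d) d (tape_blocks d (d + chi_dof d) \<omega>))) \<partial>random_tape)"
    by (simp only: mech_out_eq_release)
  also have "\<dots> = (\<integral>\<^sup>+x. f (release d \<epsilon> n (pair_mean n X) (noise_cols d (chi_dof d) d x)) \<partial>NNv d (d + chi_dof d))"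
    by (rule nn_integral_tape_blocks[OF measurable_compose[OF measurable_noise_cols measurable_compose[OF measurable_release f]] d])
  finally show ?thesis by (simp only: mechanism_def)
qed

section \<open>Sensitivity of the mean and privacy\<close>

lemma half_diff_norm:
  assumes X: "X \<in> space (dataset_space d n)" and l: "l < n div 2"
  shows "sqn d (half_diff X l) \<le> 1"
proof -
  have b: "sqn d (X k) \<le> 1" if "k < n" for k
  proof -
    have "X k \<in> space (ball_space d)" using X that by (auto simp: dataset_space_def space_PiM)
    then have "L2_set (X k) {..<d} \<le> 1" by (simp add: ball_space_def space_restrict_space)
    then show ?thesis unfolding sqn_def L2_set_def by simp
  qed
  have "sqn d (half_diff X l) \<le> (\<Sum>i<d. (X (l + l) i)\<^sup>2 / 2 + (X (l + l + 1) i)\<^sup>2 / 2)"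
    unfolding sqn_def half_diff_def
  proof (rule sum_mono)
    fix i
    have "0 \<le> (X (l + l) i + X (l + l + 1) i)\<^sup>2" by simp
    then show "((X (l + l) i - X (l + l + 1) i) / 2)\<^sup>2 \<le> (X (l + l) i)\<^sup>2 / 2 + (X (l + l + 1) i)\<^sup>2 / 2"
      by (simp add: power2_eq_square field_simps)
  qed
  also have "\<dots> = sqn d (X (l + l)) / 2 + sqn d (X (l + l + 1)) / 2"
    by (simp add: sqn_def sum.distrib sum_divide_distrib)
  also have "\<dots> \<le> 1"
  proof -
    have "l + l < n" "l + l + 1 < n" using l by presburger+
    then show ?thesis using b[of "l + l"] b[of "l + l + 1"] by simp
  qed
  finally show ?thesis .
qed

text \<open>The pairs are disjoint, so a changed sample \<open>k\<close> affects the pair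
  \<open>k div 2\<close> only, or no pair if it is the unpaired last sample of an odd number; the
  first alternative covers the latter.\<close>

lemma pair_mean_neighbour:
  assumes "card {i \<in> {..<n}. X i \<noteq> X' i} \<le> 1"
  shows "pair_mean n X' = pair_mean n X \<or> (\<exists>l<n div 2. \<forall>i j. pair_mean n X' i j = pair_mean n X i j
     + (half_diff X' l i * half_diff X' l j - half_diff X l i * half_diff X l j) / real (n div 2))"
proof (cases "\<exists>l<n div 2. half_diff X' l \<noteq> half_diff X l")
  case False
  then show ?thesis by (auto simp: pair_mean_def fun_eq_iff intro!: disjI1 sum.cong)
next
  case True
  then obtain l where l: "l < n div 2" "half_diff X' l \<noteq> half_diff X l" by auto
  then have "X' (l + l) \<noteq> X (l + l) \<or> X' (l + l + 1) \<noteq> X (l + l + 1)" by (auto simp: half_diff_def)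
  moreover have "l + l < n" "l + l + 1 < n" "(l + l) div 2 = l" "(l + l + 1) div 2 = l" using l by presburger+
  ultimately obtain k where k: "k < n" "X k \<noteq> X' k" "k div 2 = l" by metis
  have "X i = X' i" if "i < n" "i \<noteq> k" for i
  proof (rule ccontr)
    assume "X i \<noteq> X' i"
    then have "{i, k} \<subseteq> {i \<in> {..<n}. X i \<noteq> X' i}" using that k by auto
    then have "card {i, k} \<le> card {i \<in> {..<n}. X i \<noteq> X' i}" by (intro card_mono) auto
    then show False using assms that by simp
  qed
  then have o: "half_diff X' l' = half_diff X l'" if "l' < n div 2" "l' \<noteq> l" for l'
    using that k by (auto simp: half_diff_def)
  have "pair_mean n X' i j = pair_mean n X i j + (half_diff X' l i * half_diff X' l j - half_diff X l i * half_diff X l j) / real (n div 2)" for i j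
  proof -
    have "(\<Sum>l'\<in>{..<n div 2} - {l}. half_diff X' l' i * half_diff X' l' j / real (n div 2))
      = (\<Sum>l'\<in>{..<n div 2} - {l}. half_diff X l' i * half_diff X l' j / real (n div 2))"
      using o by (intro sum.cong) auto
    then show ?thesis unfolding pair_mean_def using l by (simp add: sum.remove[of "{..<n div 2}" l] diff_divide_distrib)
  qed
  then show ?thesis using l by auto
qed

text \<open>Exchanging one sample shifts the mean by a difference of two rank-one matrices, each of which
  the noise hides at the price of \<open>\<epsilon> / 2\<close>.\<close>

lemma mechanism_private:
  assumes d: "0 < d" and eps: "0 < \<epsilon>"
  shows "differentially_private \<epsilon> n (ball_space d) (matrix_space d) (mechanism d \<epsilon> n)"
  unfolding differentially_private_def
proof (intro ballI impI)
  fix X X' S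
  assume X: "X \<in> space (Pi\<^sub>M {..<n} (\<lambda>_. ball_space d))" and X': "X' \<in> space (Pi\<^sub>M {..<n} (\<lambda>_. ball_space d))"
    and card: "card {i \<in> {..<n}. X i \<noteq> X' i} \<le> 1" and S: "S \<in> sets (matrix_space d)"
  have e1: "1 \<le> exp \<epsilon>" using eps by simp
  show "measure (mechanism d \<epsilon> n X) S \<le> exp \<epsilon> * measure (mechanism d \<epsilon> n X') S"
    using pair_mean_neighbour[OF card]
  proof (elim disjE exE conjE)
    assume "pair_mean n X' = pair_mean n X"
    then have "mechanism d \<epsilon> n X' = mechanism d \<epsilon> n X"
      by (simp add: mechanism_def mech_out_def[abs_def])
    then show ?thesis using mult_right_mono[OF e1, of "measure (mechanism d \<epsilon> n X) S"] by simp
  next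
    fix l assume l: "l < n div 2" and M': "\<forall>i j. pair_mean n X' i j = pair_mean n X i j
     + (half_diff X' l i * half_diff X' l j - half_diff X l i * half_diff X l j) / real (n div 2)"
    define m where "m = real (n div 2)"
    define s where "s = noise_scale d \<epsilon> n"
    have m: "0 < m" using l by (simp add: m_def)
    have s: "0 < s" using m d eps by (simp add: s_def noise_scale_def m_def)
    \<comment> \<open>In units of the noise scale, one pair contributes w w^T / (m s) to the matrix.
      Each of the two vectors in the outer product takes \<open>sqrt \<beta>\<close>, so
      \<open>u\<close> and \<open>v\<close> have squared norm at most \<beta>.\<close>
    define \<beta> where "\<beta> = 1 / (m * s)"
    have b: "0 < \<beta>" using m s by (simp add: \<beta>_def)
    define u where "u i = sqrt \<beta> * half_diff X' l i" for i
    define v where "v i = sqrt \<beta> * half_diff X l i" for i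
    have nu: "0 < chi_dof d" using d by (simp add: chi_dof_def)
    have un: "sqn d u \<le> \<beta>"
      unfolding u_def sqn_scale using half_diff_norm[of X' d n l] X' l b
      by (simp add: dataset_space_def mult_left_le)
    have v1: "sqn d v \<le> \<beta>"
      unfolding v_def sqn_scale using half_diff_norm[of X d n l] X l b
      by (simp add: dataset_space_def mult_left_le)
    moreover have "sqn d (\<lambda>i. - v i) = sqn d v" by (simp add: sqn_def)
    ultimately have vn: "sqn d v \<le> \<beta>" "sqn d (\<lambda>i. - v i) \<le> \<beta>" by simp_all
    define h where "h a = (indicator S (release d \<epsilon> n (pair_mean n X) a) :: ennreal)" for a
    have h: "h \<in> borel_measurable (LLv d d)"
      unfolding h_def using S by (intro borel_measurable_indicator' measurable_compose[OF measurable_release] measurable_ident) auto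
    let ?sh = "\<lambda>u v a. \<lambda>j\<in>{..<d}. \<lambda>i\<in>{..<d}. a j i + u j * v i"
    have h': "(\<lambda>a. h (?sh u u a)) \<in> borel_measurable (LLv d d)"
      by (rule measurable_compose[OF measurable_LLv_translation h])
    let ?E = "ennreal (exp (3 / 2 * \<beta> * real (d + chi_dof d + d)))"
    let ?N = "NNv d (d + chi_dof d)" and ?c = "noise_cols d (chi_dof d) d"
    have em: "emeasure (mechanism d \<epsilon> n Z) S = (\<integral>\<^sup>+x. indicator S (release d \<epsilon> n (pair_mean n Z) (?c x)) \<partial>?N)" for Z
    proof -
      have "emeasure (mechanism d \<epsilon> n Z) S = (\<integral>\<^sup>+A. indicator S A \<partial>mechanism d \<epsilon> n Z)"
        using S by (simp add: mechanism_def)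
      also have "\<dots> = (\<integral>\<^sup>+x. indicator S (release d \<epsilon> n (pair_mean n Z) (?c x)) \<partial>?N)"
        using S by (intro nn_integral_mechanism d) simp
      finally show ?thesis .
    qed
    have "emeasure (mechanism d \<epsilon> n X) S = (\<integral>\<^sup>+x. h (?c x) \<partial>?N)"
      by (simp add: em h_def)
    also have "\<dots> \<le> ?E * (\<integral>\<^sup>+x. h (?sh u u (?c x)) \<partial>?N)"
      by (rule noise_rank_one_shift[OF h nu d un un])
    \<comment> \<open>The old pair has to be subtracted; the sign is placed on one of its two
      vectors.\<close>
    also have "\<dots> \<le> ?E * (?E * (\<integral>\<^sup>+x. h (?sh u u (?sh (\<lambda>i. - v i) v (?c x))) \<partial>?N))"
      by (intro mult_left_mono noise_rank_one_shift[OF h' nu d vn(2) vn(1)]) simp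
    also have "(\<integral>\<^sup>+x. h (?sh u u (?sh (\<lambda>i. - v i) v (?c x))) \<partial>?N) = emeasure (mechanism d \<epsilon> n X') S"
      unfolding em h_def
    proof (intro nn_integral_cong arg_cong[where f = "indicator S"])
      fix x
      have eq: "s * (u i * u j - v i * v j) = (half_diff X' l i * half_diff X' l j - half_diff X l i * half_diff X l j) / m" for i j
      proof -
        have "sqrt \<beta> * sqrt \<beta> = \<beta>" using b by simp
        then have "u i * u j - v i * v j = \<beta> * (half_diff X' l i * half_diff X' l j - half_diff X l i * half_diff X l j)"
          unfolding u_def v_def by (metis (no_types, opaque_lifting) mult.assoc mult.left_commute right_diff_distrib')
        then show ?thesis using s m by (simp add: \<beta>_def)
      qed
      \<comment> \<open>Shifted noise on the old data and unshifted noise on the new data give the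
        same noisy matrix.\<close>
      show "release d \<epsilon> n (pair_mean n X) (?sh u u (?sh (\<lambda>i. - v i) v (?c x))) = release d \<epsilon> n (pair_mean n X') (?c x)"
        unfolding release_def
      proof (rule estimate_cong)
        fix i j assume ij: "i < d" "j < d"
        have "pair_mean n X i j + pair_mean n X j i + s * ((?c x j i - v j * v i + u j * u i) + (?c x i j - v i * v j + u i * u j))
          = pair_mean n X i j + s * (u j * u i - v j * v i) + (pair_mean n X j i + s * (u i * u j - v i * v j)) + s * (?c x j i + ?c x i j)"
          by (simp add: algebra_simps)
        also have "\<dots> = pair_mean n X' i j + pair_mean n X' j i + s * (?c x j i + ?c x i j)"
          unfolding eq using M' by (simp add: m_def mult.commute)
        finally show "noisy d \<epsilon> n (pair_mean n X) (\<lambda>i j. ?sh u u (?sh (\<lambda>i. - v i) v (?c x)) j i) i j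
          = noisy d \<epsilon> n (pair_mean n X') (\<lambda>i j. ?c x j i) i j"
          using ij by (simp add: noisy_def s_def)
      qed
    qed
    also have "?E * (?E * emeasure (mechanism d \<epsilon> n X') S) = ennreal (exp \<epsilon>) * emeasure (mechanism d \<epsilon> n X') S"
    proof -
      \<comment> \<open>Here the constant in \<open>noise_scale\<close> is used: 3 / 2 * 4098 * d /
        (m s) is \<epsilon> / 2.\<close>
      have "3 / 2 * \<beta> * real (d + chi_dof d + d) = \<epsilon> / 2"
        using m d eps unfolding \<beta>_def s_def noise_scale_def m_def[symmetric] chi_dof_def by (simp add: field_simps)
      then have "?E * ?E = ennreal (exp \<epsilon>)"
        by (simp add: ennreal_mult[symmetric] flip: exp_add)
      then show ?thesis by (simp only: mult.assoc[symmetric])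
    qed
    finally have le: "emeasure (mechanism d \<epsilon> n X) S \<le> ennreal (exp \<epsilon>) * emeasure (mechanism d \<epsilon> n X') S" .
    interpret A: prob_space "mechanism d \<epsilon> n X"
      unfolding mechanism_def by (rule prob_space.prob_space_distr[OF prob_space_tape measurable_mech_out_tape])
    interpret B: prob_space "mechanism d \<epsilon> n X'"
      unfolding mechanism_def by (rule prob_space.prob_space_distr[OF prob_space_tape measurable_mech_out_tape])
    show ?thesis
      using le unfolding A.emeasure_eq_measure B.emeasure_eq_measure
      by (subst (asm) ennreal_mult[symmetric]) (auto simp: ennreal_le_iff)
  qed
qed

lemma mechanism_polynomial_time: "polynomial_time mechanism"
  unfolding polynomial_time_def
proof (intro exI[of _ prog_main] exI[of _ "10000000 :: real"] exI[of _ "5 :: nat"] allI impI ballI)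
  fix d n :: nat and \<epsilon> :: real and X
  assume eps: "0 < \<epsilon>"
  show "\<exists>F \<in> random_tape \<rightarrow>\<^sub>M matrix_space d. mechanism d \<epsilon> n X = distr random_tape (matrix_space d) F \<and>
      (\<forall>\<omega>. \<exists>t s. exec \<omega> prog_main (input_state d \<epsilon> n X) t s \<and> F \<omega> = output_matrix d s \<and>
        real t \<le> 10000000 * (1 + real d + real n + 1 / \<epsilon>) ^ 5)"
  proof (intro bexI[of _ "mech_out d \<epsilon> n X"] conjI allI)
    fix \<omega>
    obtain t s where ts: "exec \<omega> prog_main (input_state d \<epsilon> n X) t s" "mech_out d \<epsilon> n X \<omega> = output_matrix d s"
      "real t \<le> 10000000 * (1 + real d + real n) ^ 5"
      using mech_out_polynomial_time by blast
    have "(1 + real d + real n) ^ 5 \<le> (1 + real d + real n + 1 / \<epsilon>) ^ 5"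
      using eps by (intro power_mono) auto
    then show "\<exists>t s. exec \<omega> prog_main (input_state d \<epsilon> n X) t s \<and> mech_out d \<epsilon> n X \<omega> = output_matrix d s \<and>
        real t \<le> 10000000 * (1 + real d + real n + 1 / \<epsilon>) ^ 5"
      using ts by (intro exI[of _ t] exI[of _ s]) auto
  qed (simp_all add: mechanism_def measurable_mech_out_tape)
qed

section \<open>Accuracy\<close>

lemma sqn_tvec_gfac: "sqn d (tvec d (gfac d \<tau> r) y) = sqn d y + (\<Sum>j<r. (dot d (gcol d \<tau> j) y)\<^sup>2)"
proof (induction r)
  case 0
  then show ?case by (simp add: sqn_cong[OF tvec_idm])
qed (simp add: sqn_tvec_chol_step gcol_def)

lemma sqn_idm: "i < d \<Longrightarrow> sqn d (idm i) = 1"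
  using dot_idm[of i d "idm i"] by (simp add: dot_self idm_def)

context
  fixes d :: nat and \<tau> :: "nat \<Rightarrow> nat \<Rightarrow> real" and t :: real
  assumes t: "1 \<le> t" and op: "\<And>v. sqn d v = 1 \<Longrightarrow> sqn d (tvec d (gfac d \<tau> d) v) \<le> t"
begin

lemma noise_qf_le:
  assumes v: "sqn d v = 1"
  shows "\<bar>qf d (\<lambda>i j. gcol d \<tau> j i) v\<bar> \<le> t"
proof -
  have "qf d (\<lambda>i j. gcol d \<tau> j i) v = (\<Sum>j<d. v j * dot d (gcol d \<tau> j) v)"
    unfolding qf_alt dot_def by (subst sum.swap) (simp add: sum_distrib_left mult_ac)
  then have "(qf d (\<lambda>i j. gcol d \<tau> j i) v)\<^sup>2 \<le> sqn d v * (\<Sum>j<d. (dot d (gcol d \<tau> j) v)\<^sup>2)"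
    unfolding sqn_def by (simp only: Cauchy_Schwarz_ineq_sum)
  also have "\<dots> \<le> t" using op[OF v] v by (simp add: sqn_tvec_gfac)
  \<comment> \<open>The argument gives the square root of \<open>t\<close>; the weaker bound
    \<open>t\<close> is kept because it is linear in the quantity whose expectation is
    known.\<close>
  also have "t \<le> t\<^sup>2" using t by (simp add: power2_eq_square)
  finally show ?thesis using t by (simp add: abs_le_square_iff[symmetric])
qed

text \<open>The form is summed over the \<open>d\<close> unit vectors; here the factor
  \<open>sqrt d\<close> of the first term of the minimum arises.\<close>

lemma noise_frob_le: "frob d (\<lambda>i j. gcol d \<tau> j i) (\<lambda>i j. gcol d \<tau> j i) \<le> real d * t"
proof -
  have "frob d (\<lambda>i j. gcol d \<tau> j i) (\<lambda>i j. gcol d \<tau> j i) = (\<Sum>i<d. \<Sum>j<d. (dot d (gcol d \<tau> j) (idm i))\<^sup>2)"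
    unfolding frob_def
    by (intro sum.cong refl) (simp add: dot_commute[of d "gcol d \<tau> _" "idm _"] dot_idm power2_eq_square)
  also have "\<dots> \<le> (\<Sum>i<d. t)"
  proof (rule sum_mono)
    fix i assume "i \<in> {..<d}"
    then show "(\<Sum>j<d. (dot d (gcol d \<tau> j) (idm i))\<^sup>2) \<le> t"
      using op[of "idm i"] by (simp add: sqn_tvec_gfac sqn_idm)
  qed
  finally show ?thesis by simp
qed

end

definition sym_noise :: "real \<Rightarrow> (nat \<Rightarrow> nat \<Rightarrow> real) \<Rightarrow> nat \<Rightarrow> nat \<Rightarrow> real" where
  "sym_noise s A i j = s * (A i j + A j i) / 2"

lemma qf_sym_noise: "qf d (sym_noise s A) v = s * qf d A v"
proof -
  have "qf d (sym_noise s A) v = s / 2 * ((\<Sum>i<d. \<Sum>j<d. A i j * (v i * v j)) + (\<Sum>i<d. \<Sum>j<d. A j i * (v i * v j)))"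
    unfolding qf_alt sym_noise_def sum.distrib[symmetric] sum_distrib_left
    by (intro sum.cong refl) (simp add: algebra_simps)
  also have "(\<Sum>i<d. \<Sum>j<d. A j i * (v i * v j)) = (\<Sum>i<d. \<Sum>j<d. A i j * (v i * v j))"
    by (subst sum.swap) (simp add: mult_ac)
  finally show ?thesis by (simp add: qf_alt)
qed

lemma frob_sym_noise_le: "frob d (sym_noise s A) (sym_noise s A) \<le> s\<^sup>2 * frob d A A"
proof -
  have "frob d (sym_noise s A) (sym_noise s A) \<le> (\<Sum>i<d. \<Sum>j<d. s\<^sup>2 / 2 * (A i j * A i j) + s\<^sup>2 / 2 * (A j i * A j i))"
    unfolding frob_def
  proof (intro sum_mono)
    fix i j
    have "(A i j + A j i)\<^sup>2 \<le> 2 * (A i j)\<^sup>2 + 2 * (A j i)\<^sup>2"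
      using zero_le_power2[of "A i j - A j i"] by (simp add: power2_eq_square algebra_simps)
    then have "s\<^sup>2 / 4 * (A i j + A j i)\<^sup>2 \<le> s\<^sup>2 / 4 * (2 * (A i j)\<^sup>2 + 2 * (A j i)\<^sup>2)"
      by (intro mult_left_mono) auto
    then show "sym_noise s A i j * sym_noise s A i j \<le> s\<^sup>2 / 2 * (A i j * A i j) + s\<^sup>2 / 2 * (A j i * A j i)"
      by (simp add: sym_noise_def power2_eq_square algebra_simps)
  qed
  also have "\<dots> = s\<^sup>2 / 2 * frob d A A + s\<^sup>2 / 2 * (\<Sum>i<d. \<Sum>j<d. A j i * A j i)"
    by (simp add: frob_def sum.distrib sum_distrib_left)
  also have "(\<Sum>i<d. \<Sum>j<d. A j i * A j i) = frob d A A"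
    unfolding frob_def by (rule sum.swap)
  finally show ?thesis by (simp add: mult.commute)
qed

text \<open>Turns a bound on a square into a bound on the number that is linear in the square, so
  that expectations pass through it where a square root would call for Jensen's inequality.\<close>

lemma real_le_of_sq_le: "x \<le> \<alpha> / 8 + 2 * x\<^sup>2 / \<alpha>" if "0 < \<alpha>" for x \<alpha> :: real
proof -
  have "0 \<le> (x - \<alpha> / 4)\<^sup>2" by simp
  then have "x * \<alpha> \<le> \<alpha>\<^sup>2 / 8 + 2 * x\<^sup>2" by (simp add: power2_eq_square algebra_simps)
  then show ?thesis using that by (simp add: field_simps power2_eq_square)
qed

lemma integral_double_sum:
  fixes f :: "nat \<Rightarrow> nat \<Rightarrow> 'a \<Rightarrow> real"
  assumes "\<And>a b. a < p \<Longrightarrow> b < q \<Longrightarrow> integrable M (f a b)"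
  shows "(\<integral>x. (\<Sum>a<p. \<Sum>b<q. f a b x) \<partial>M) = (\<Sum>a<p. \<Sum>b<q. \<integral>x. f a b x \<partial>M)"
proof -
  have "(\<integral>x. (\<Sum>a<p. \<Sum>b<q. f a b x) \<partial>M) = (\<Sum>a<p. \<integral>x. (\<Sum>b<q. f a b x) \<partial>M)"
    using assms by (intro Bochner_Integration.integral_sum Bochner_Integration.integrable_sum) auto
  also have "\<dots> = (\<Sum>a<p. \<Sum>b<q. \<integral>x. f a b x \<partial>M)"
    using assms by (intro sum.cong refl Bochner_Integration.integral_sum) auto
  finally show ?thesis .
qed

text \<open>The iterate is nearly as close to \<open>Y\<close> as \<open>M\<close> is; expanding
  both squares leaves \<open>frob d D D \<le> 2 * frob d N D + \<eta>\<close>. The inner product is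
  then bounded in two ways, by duality between the hull and the operator norm of \<open>N\<close>,
  and by the Cauchy-Schwarz inequality.\<close>

lemma fw_error:
  assumes d: "0 < d" and n: "0 < n" and M: "psd_hull d M" "sym_on d M" and N: "sym_on d N"
    and Y: "\<And>i j. i < d \<Longrightarrow> j < d \<Longrightarrow> Y i j = M i j + N i j"
    and \<tau>: "0 \<le> \<tau>" "\<And>v. sqn d v = 1 \<Longrightarrow> \<bar>qf d N v\<bar> \<le> \<tau>"
  defines "D \<equiv> \<lambda>i j. fw d (Suc (n + (d + d))) Y n i j - M i j"
  defines "\<eta> \<equiv> 4 * (sqrt (frob d Y Y) + 1) * real d / 2 ^ Suc (n + (d + d)) + 16 / (real n + 2)"
  shows "frob d D D \<le> 4 * \<tau> + \<eta>"
    and "frob d D D \<le> 2 * sqrt (frob d N N) * sqrt (frob d D D) + \<eta>"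
proof -
  let ?B = "fw d (Suc (n + (d + d))) Y n"
  have Ys: "sym_on d Y" using M N Y by (simp add: sym_on_def)
  \<comment> \<open>The convergence bound speaks of \<open>Suc k\<close> steps; its 8 / (k + 3) is 8
    / (n + 2) here.\<close>
  obtain k where k: "n = Suc k" using n by (cases n) auto
  have B: "psd_hull d ?B" by (rule psd_hull_fw[OF Ys d])
  have 1: "frob d (\<lambda>i j. ?B i j - Y i j) (\<lambda>i j. ?B i j - Y i j) = frob d D D - 2 * frob d N D + frob d N N"
  proof -
    have "frob d (\<lambda>i j. ?B i j - Y i j) (\<lambda>i j. ?B i j - Y i j) = frob d (\<lambda>i j. D i j - N i j) (\<lambda>i j. D i j - N i j)"
      by (intro frob_cong) (auto simp: D_def Y)
    then show ?thesis by (simp add: frob_diff_left frob_diff_right frob_commute[of d D N])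
  qed
  have 2: "frob d (\<lambda>i j. M i j - Y i j) (\<lambda>i j. M i j - Y i j) = frob d N N"
  proof -
    have "frob d (\<lambda>i j. M i j - Y i j) (\<lambda>i j. M i j - Y i j) = frob d (\<lambda>i j. - N i j) (\<lambda>i j. - N i j)"
      by (intro frob_cong) (auto simp: Y)
    then show ?thesis by (simp add: frob_def)
  qed
  have "frob d (\<lambda>i j. ?B i j - Y i j) (\<lambda>i j. ?B i j - Y i j) / 2
    \<le> frob d (\<lambda>i j. M i j - Y i j) (\<lambda>i j. M i j - Y i j) / 2 + 2 * (sqrt (frob d Y Y) + 1) * real d / 2 ^ Suc (n + (d + d)) + 8 / (real n + 2)"
    using fw_convergence[OF Ys d M(1), of "n + (d + d)" k] unfolding k by (simp add: add_ac del: fw.simps power_Suc)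
  moreover define E where "E = 2 * (sqrt (frob d Y Y) + 1) * real d / 2 ^ Suc (n + (d + d))"
  moreover have "\<eta> = 2 * E + 2 * (8 / (real n + 2))"
  proof -
    have "4 * u * v / p = 2 * (2 * u * v / p)" for u v p :: real by simp
    from this[of "sqrt (frob d Y Y) + 1" "real d"] show ?thesis unfolding \<eta>_def E_def by (simp only:)
  qed
  moreover have "x \<le> 2 * y + z" if "(x - 2 * y + w) / 2 \<le> w / 2 + a + b" "e = a" "z = 2 * e + 2 * b" for x y z w a b e :: real
    using that by (simp add: field_simps)
  ultimately have main: "frob d D D \<le> 2 * frob d N D + \<eta>"
    unfolding 1 2 by blast
  have "frob d N D = frob d N ?B - frob d N M" by (simp add: D_def frob_diff_right)
  also have "\<dots> \<le> 2 * \<tau>"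
    using psd_hull_abs_le[OF B \<tau>] psd_hull_abs_le[OF M(1) \<tau>] by linarith
  finally show "frob d D D \<le> 4 * \<tau> + \<eta>" using main by linarith
  have "\<bar>frob d N D\<bar> \<le> sqrt (frob d N N) * sqrt (frob d D D)"
    using frob_Cauchy_Schwarz[of d N D] by (simp add: real_le_rsqrt flip: real_sqrt_mult)
  then show "frob d D D \<le> 2 * sqrt (frob d N N) * sqrt (frob d D D) + \<eta>" using main by linarith
qed

lemma sqrt_le_of_sq_le_affine:
  fixes x a \<eta> :: real
  assumes "x\<^sup>2 \<le> a * x + \<eta>" "0 \<le> a" "0 \<le> \<eta>"
  shows "x \<le> a + sqrt \<eta>"
proof (rule ccontr)
  assume "\<not> ?thesis"
  then have lt: "a + sqrt \<eta> < x" by simp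
  have "sqrt \<eta> * sqrt \<eta> < x * (x - a)"
    using lt assms real_sqrt_ge_zero[OF assms(3)] by (intro mult_strict_mono') linarith+
  moreover have "x * (x - a) \<le> \<eta>" using assms by (simp add: power2_eq_square algebra_simps)
  ultimately show False using assms(3) by simp
qed

text \<open>Both bounds are linear in \<open>t\<close>, ready to be integrated over the noise. The
  first has the scale \<open>s / \<alpha>\<close>, the second \<open>s * sqrt (real d)\<close>; they
  lead to the two terms of the minimum.\<close>

lemma estimation_error:
  assumes d: "0 < d" and n: "0 < n" and M: "psd_hull d M" "sym_on d M"
    and s: "0 \<le> s" and t: "1 \<le> t" and \<alpha>: "0 < \<alpha>" "1 \<le> real n * \<alpha>"
    and op: "\<And>v. sqn d v = 1 \<Longrightarrow> sqn d (tvec d (gfac d \<tau> d) v) \<le> t"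
    and Y: "\<And>i j. i < d \<Longrightarrow> j < d \<Longrightarrow> Y i j = M i j + sym_noise s (\<lambda>i j. gcol d \<tau> j i) i j"
  defines "x \<equiv> sqrt (frob d (\<lambda>i j. fw d (Suc (n + (d + d))) Y n i j - M i j) (\<lambda>i j. fw d (Suc (n + (d + d))) Y n i j - M i j))"
  shows "2 * x \<le> 24 * s / \<alpha> * t + \<alpha> / 4 + 80 / (real n * \<alpha>)"
    and "2 * x \<le> 12 * s * sqrt (real d) * t + \<alpha> / 4 + 80 / (real n * \<alpha>)"
proof -
  let ?A = "\<lambda>i j. gcol d \<tau> j i"
  let ?N = "sym_noise s ?A"
  define \<eta> where "\<eta> = 4 * (sqrt (frob d Y Y) + 1) * real d / 2 ^ Suc (n + (d + d)) + 16 / (real n + 2)"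
  have N: "sym_on d ?N" by (simp add: sym_on_def sym_noise_def add.commute)
  have q: "\<bar>qf d ?N v\<bar> \<le> s * t" if "sqn d v = 1" for v
    unfolding qf_sym_noise abs_mult using s noise_qf_le[OF t op that] by (simp add: mult_left_mono)
  have x0: "0 \<le> x" by (simp add: x_def)
  have x2: "x\<^sup>2 = frob d (\<lambda>i j. fw d (Suc (n + (d + d))) Y n i j - M i j) (\<lambda>i j. fw d (Suc (n + (d + d))) Y n i j - M i j)"
    by (simp add: x_def)
  have e1: "x\<^sup>2 \<le> 4 * (s * t) + \<eta>"
    unfolding x2 \<eta>_def using s t by (intro fw_error(1)[OF d n M N Y]) (auto simp: q)
  have e2: "x\<^sup>2 \<le> 2 * sqrt (frob d ?N ?N) * x + \<eta>"
    unfolding x2 unfolding x_def \<eta>_def using s t by (intro fw_error(2)[OF d n M N Y, of "s * t"]) (auto simp: q)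
  have fN: "sqrt (frob d ?N ?N) \<le> s * sqrt (real d * t)"
  proof (rule real_le_lsqrt)
    have "frob d ?N ?N \<le> s\<^sup>2 * (real d * t)"
      using frob_sym_noise_le[of d s ?A] mult_left_mono[OF noise_frob_le[OF t op], of "s\<^sup>2"] by simp
    also have "\<dots> = (s * sqrt (real d * t))\<^sup>2" using t by (simp add: power_mult_distrib)
    finally show "frob d ?N ?N \<le> (s * sqrt (real d * t))\<^sup>2" .
  qed (use s t in auto)
  have d1: "1 \<le> real d" using d by simp
  have dt: "sqrt (real d * t) \<le> real d * t"
  proof (rule real_le_lsqrt)
    have "1 * (real d * t) \<le> (real d * t) * (real d * t)"
      using d1 t mult_mono[OF d1 t] by (intro mult_right_mono) auto
    then show "real d * t \<le> (real d * t)\<^sup>2" by (simp add: power2_eq_square)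
  qed (use t in auto)
  have dt': "sqrt (real d * t) \<le> sqrt (real d) * t"
  proof -
    have "sqrt t \<le> t" using t by (intro real_le_lsqrt) (auto simp: power2_eq_square)
    then show ?thesis by (simp add: real_sqrt_mult mult_left_mono)
  qed
  have "sqrt (frob d Y Y) \<le> 1 + s * (real d * t)"
  proof -
    have "frob d Y Y = frob d (\<lambda>i j. M i j - (- ?N i j)) (\<lambda>i j. M i j - (- ?N i j))"
      by (intro frob_cong) (auto simp: Y)
    then have "sqrt (frob d Y Y) \<le> sqrt (frob d M M) + sqrt (frob d (\<lambda>i j. - ?N i j) (\<lambda>i j. - ?N i j))"
      using sqrt_frob_diff_le[of d M "\<lambda>i j. - ?N i j"] by simp
    also have "frob d (\<lambda>i j. - ?N i j) (\<lambda>i j. - ?N i j) = frob d ?N ?N" by (simp add: frob_def)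
    also have "sqrt (frob d M M) \<le> 1" using psd_hull_frob_le[OF M(1)] by simp
    also have "sqrt (frob d ?N ?N) \<le> s * (real d * t)"
      using fN mult_left_mono[OF dt s] by linarith
    finally show ?thesis by simp
  qed
  then have "4 * (sqrt (frob d Y Y) + 1) * real d \<le> 4 * (real d * (2 + s * t)) * real d"
  proof (intro mult_right_mono mult_left_mono)
    assume "sqrt (frob d Y Y) \<le> 1 + s * (real d * t)"
    moreover have "2 * 1 \<le> 2 * real d" using d1 by simp
    ultimately show "sqrt (frob d Y Y) + 1 \<le> real d * (2 + s * t)" by (simp add: algebra_simps)
  qed auto
  then have "4 * (sqrt (frob d Y Y) + 1) * real d / 2 ^ Suc (n + (d + d)) \<le> 4 * (real d * (2 + s * t)) * real d / 2 ^ Suc (n + (d + d))"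
    by (intro divide_right_mono) auto
  also have "\<dots> = 2 * (2 + s * t) * (real d * real d) / (2 ^ n * (2 ^ d * 2 ^ d))"

  proof -
    have "2 ^ Suc (n + (d + d)) = (2::real) * (2 ^ n * (2 ^ d * 2 ^ d))" by (simp add: power_add)
    moreover have "4 * (a * b) * a / (2 * q) = 2 * b * (a * a) / q" for a b q :: real by simp
    ultimately show ?thesis by (simp only:)
  qed
  \<comment> \<open>Each of the three powers of two pays for one factor, \<open>n\<close> and twice
    \<open>d\<close>; this is what fixes the number of squarings.\<close>
  also have "\<dots> \<le> 2 * (2 + s * t) * (real d * real d) / (real n * (real d * real d))"
  proof (intro divide_left_mono mult_mono)
    show "real n \<le> 2 ^ n" "real d \<le> 2 ^ d" "real d \<le> 2 ^ d" using of_nat_less_two_power[of n] of_nat_less_two_power[of d] by (auto simp: less_imp_le)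
    show "0 < 2 ^ n * (2 ^ d * 2 ^ d) * (real n * (real d * real d))" using d n by simp
  qed (use s t in auto)
  also have "\<dots> = (4 + 2 * (s * t)) / real n" using d by simp
  finally have \<eta>: "\<eta> \<le> (20 + 2 * (s * t)) / real n"
  proof -
    assume "4 * (sqrt (frob d Y Y) + 1) * real d / 2 ^ Suc (n + (d + d)) \<le> (4 + 2 * (s * t)) / real n"
    moreover have "16 / (real n + 2) \<le> 16 / real n" using n by (intro divide_left_mono) auto
    moreover have "(4 + 2 * (s * t)) / real n + 16 / real n = (20 + 2 * (s * t)) / real n"
      by (simp add: add_divide_distrib)
    ultimately show ?thesis unfolding \<eta>_def by linarith
  qed
  have \<eta>0: "0 \<le> \<eta>" unfolding \<eta>_def by (intro add_nonneg_nonneg divide_nonneg_pos mult_nonneg_nonneg) auto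
  have st: "0 \<le> s * t" using s t by simp
  have n1: "1 \<le> real n" using n by simp
  have "2 * (s * t) / real n \<le> 2 * (s * t) / 1" using st n1 by (intro divide_left_mono) auto
  then have e3: "x\<^sup>2 \<le> 6 * (s * t) + 20 / real n" using e1 \<eta> by (simp add: add_divide_distrib)
  have "2 * x \<le> 2 * (\<alpha> / 8 + 2 * x\<^sup>2 / \<alpha>)"
    using real_le_of_sq_le[OF \<alpha>(1), of x] by simp
  also have "\<dots> \<le> 2 * (\<alpha> / 8 + 2 * (6 * (s * t) + 20 / real n) / \<alpha>)"
    using e3 \<alpha> by (intro mult_left_mono add_left_mono divide_right_mono) auto
  also have "\<dots> = 24 * s / \<alpha> * t + \<alpha> / 4 + 80 / (real n * \<alpha>)"
    using \<alpha> n by (simp add: field_simps)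
  finally show "2 * x \<le> 24 * s / \<alpha> * t + \<alpha> / 4 + 80 / (real n * \<alpha>)" .
  have "x\<^sup>2 \<le> (2 * (s * (sqrt (real d) * t))) * x + \<eta>"
  proof -
    have "sqrt (frob d ?N ?N) \<le> s * (sqrt (real d) * t)"
      using fN mult_left_mono[OF dt' s] by linarith
    then have "2 * sqrt (frob d ?N ?N) * x \<le> (2 * (s * (sqrt (real d) * t))) * x"
      using x0 by (intro mult_right_mono) auto
    then show ?thesis using e2 by linarith
  qed
  then have "x \<le> 2 * (s * (sqrt (real d) * t)) + sqrt \<eta>"
    using s t \<eta>0 by (intro sqrt_le_of_sq_le_affine) auto
  also have "sqrt \<eta> \<le> \<alpha> / 8 + 2 * (sqrt \<eta>)\<^sup>2 / \<alpha>" by (rule real_le_of_sq_le[OF \<alpha>(1)])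
  also have "2 * (sqrt \<eta>)\<^sup>2 / \<alpha> \<le> 2 * ((20 + 2 * (s * t)) / real n) / \<alpha>"
  proof (intro divide_right_mono mult_left_mono)
    show "(sqrt \<eta>)\<^sup>2 \<le> (20 + 2 * (s * t)) / real n" using \<eta> \<eta>0 by simp
  qed (use \<alpha> in auto)
  also have "2 * ((20 + 2 * (s * t)) / real n) / \<alpha> = 40 / (real n * \<alpha>) + 4 * (s * t) / (real n * \<alpha>)"
    by (simp add: add_divide_distrib)
  \<comment> \<open>The hypothesis on \<open>real n * \<alpha>\<close> absorbs the part of
    \<open>\<eta>\<close> that grows with \<open>t\<close>.\<close>
  also have "4 * (s * t) / (real n * \<alpha>) \<le> 4 * (s * t) / 1"
    using st \<alpha>(2) by (intro divide_left_mono) auto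
  also have "4 * (s * t) / 1 \<le> 4 * (s * (sqrt (real d) * t))"
  proof -
    have "1 * t \<le> sqrt (real d) * t" using d1 t by (intro mult_right_mono) auto
    then show ?thesis using s by (simp add: mult_left_mono)
  qed
  finally show "2 * x \<le> 12 * s * sqrt (real d) * t + \<alpha> / 4 + 80 / (real n * \<alpha>)"
    by (simp add: algebra_simps)
qed

lemma pair_mean_sym: "sym_on d (pair_mean n X)"
  by (simp add: sym_on_def pair_mean_def mult.commute)

lemma pair_mean_hull:
  assumes "X \<in> space (dataset_space d n)"
  shows "psd_hull d (pair_mean n X)"
  unfolding pair_mean_def using half_diff_norm[OF assms]
  by (intro psd_hull_mean psd_hull_outer) auto

lemma frobenius_norm_eq: "frobenius_norm d A = sqrt (frob d (\<lambda>i j. A (i, j)) (\<lambda>i j. A (i, j)))"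
  by (simp add: frobenius_norm_def mat_trace_def mat_mult_def mat_transpose_def frob_def)

definition sampling_error :: "nat \<Rightarrow> nat \<Rightarrow> vector measure \<Rightarrow> (nat \<Rightarrow> vector) \<Rightarrow> nat \<Rightarrow> nat \<Rightarrow> real" where
  "sampling_error d n \<mu> X i j = 2 * pair_mean n X i j - covariance_matrix \<mu> (i, j)"

text \<open>Holds pointwise in noise and sample; the right-hand side is linear in
  \<open>op_bound\<close> and in the squared sampling error, the two quantities whose expectations
  are known.\<close>

lemma release_error:
  assumes d: "0 < d" and n2: "2 \<le> n" and X: "X \<in> space (dataset_space d n)" and eps: "0 < \<epsilon>"
    and \<alpha>: "0 < \<alpha>" "1 \<le> real n * \<alpha>"
    and c: "c = 24 * noise_scale d \<epsilon> n / \<alpha> \<or> c = 12 * noise_scale d \<epsilon> n * sqrt (real d)"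
  shows "ennreal (frobenius_norm d (\<lambda>ij. release d \<epsilon> n (pair_mean n X) (noise_cols d (chi_dof d) d x) ij - covariance_matrix \<mu> ij))
    \<le> ennreal c * op_bound d (gfac d (\<lambda>j. student d (chi_dof d) (x j)) d)
      + ennreal (3 / 8 * \<alpha> + 80 / (real n * \<alpha>)) + ennreal (2 / \<alpha>) * ennreal (frob d (sampling_error d n \<mu> X) (sampling_error d n \<mu> X))"
proof -
  have n: "0 < n" using n2 by simp
  define \<tau> where "\<tau> j = student d (chi_dof d) (x j)" for j
  define s where "s = noise_scale d \<epsilon> n"
  have s0: "0 < s" using eps d n2 by (simp add: s_def noise_scale_def)
  then have s: "0 \<le> s" by simp
  have c1: "0 < c" using c s0 \<alpha> d by (auto simp: s_def)
  then have c0: "0 \<le> c" by simp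
  let ?E = "sampling_error d n \<mu> X"
  let ?Y = "noisy d \<epsilon> n (pair_mean n X) (\<lambda>i j. noise_cols d (chi_dof d) d x j i)"
  let ?B = "fw d (Suc (n + (d + d))) ?Y n"
  define D where "D = (\<lambda>i j. ?B i j - pair_mean n X i j)"
  have Y: "?Y i j = pair_mean n X i j + sym_noise s (\<lambda>i j. gcol d \<tau> j i) i j" if "i < d" "j < d" for i j
    using that pair_mean_sym[of d n X]
    by (simp add: noisy_def sym_noise_def s_def noise_cols_def \<tau>_def[abs_def] sym_on_def add_divide_distrib)
  have E0: "0 \<le> frob d ?E ?E" by simp
  have fe: "frobenius_norm d (\<lambda>ij. release d \<epsilon> n (pair_mean n X) (noise_cols d (chi_dof d) d x) ij - covariance_matrix \<mu> ij)
    \<le> 2 * sqrt (frob d D D) + sqrt (frob d ?E ?E)"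
  proof -
    have "frobenius_norm d (\<lambda>ij. release d \<epsilon> n (pair_mean n X) (noise_cols d (chi_dof d) d x) ij - covariance_matrix \<mu> ij)
      = sqrt (frob d (\<lambda>i j. 2 * D i j - (- ?E i j)) (\<lambda>i j. 2 * D i j - (- ?E i j)))"
      unfolding frobenius_norm_eq
      by (intro arg_cong[where f = sqrt] frob_cong) (auto simp: release_def estimate_def D_def sampling_error_def simp del: fw.simps)
    also have "\<dots> \<le> sqrt (frob d (\<lambda>i j. 2 * D i j) (\<lambda>i j. 2 * D i j)) + sqrt (frob d (\<lambda>i j. - ?E i j) (\<lambda>i j. - ?E i j))"
      by (rule sqrt_frob_diff_le)
    also have "frob d (\<lambda>i j. - ?E i j) (\<lambda>i j. - ?E i j) = frob d ?E ?E" by (simp add: frob_def)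
    also have "frob d (\<lambda>i j. 2 * D i j) (\<lambda>i j. 2 * D i j) = 2\<^sup>2 * frob d D D"
      by (simp add: frob_def sum_distrib_left mult_ac)
    finally show ?thesis by (simp add: real_sqrt_mult)
  qed
  have se: "sqrt (frob d ?E ?E) \<le> \<alpha> / 8 + 2 / \<alpha> * frob d ?E ?E"
    using real_le_of_sq_le[OF \<alpha>(1), of "sqrt (frob d ?E ?E)"] by simp
  have bound: "ennreal (frobenius_norm d (\<lambda>ij. release d \<epsilon> n (pair_mean n X) (noise_cols d (chi_dof d) d x) ij - covariance_matrix \<mu> ij))
    \<le> ennreal c * ennreal t + ennreal (3 / 8 * \<alpha> + 80 / (real n * \<alpha>)) + ennreal (2 / \<alpha>) * ennreal (frob d ?E ?E)"
    if t: "1 \<le> t" and op: "\<And>v. sqn d v = 1 \<Longrightarrow> sqn d (tvec d (gfac d \<tau> d) v) \<le> t" for t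
  proof -
    have "2 * sqrt (frob d D D) \<le> c * t + \<alpha> / 4 + 80 / (real n * \<alpha>)"
      using estimation_error[OF d n pair_mean_hull[OF X] pair_mean_sym s t \<alpha> op Y] c
      unfolding D_def s_def by auto
    then have "frobenius_norm d (\<lambda>ij. release d \<epsilon> n (pair_mean n X) (noise_cols d (chi_dof d) d x) ij - covariance_matrix \<mu> ij)
      \<le> c * t + (3 / 8 * \<alpha> + 80 / (real n * \<alpha>)) + 2 / \<alpha> * frob d ?E ?E"
      using fe se by linarith
    then have "ennreal (frobenius_norm d (\<lambda>ij. release d \<epsilon> n (pair_mean n X) (noise_cols d (chi_dof d) d x) ij - covariance_matrix \<mu> ij))
      \<le> ennreal (c * t + (3 / 8 * \<alpha> + 80 / (real n * \<alpha>)) + 2 / \<alpha> * frob d ?E ?E)" by (rule ennreal_leI)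
    also have "\<dots> = ennreal (c * t) + ennreal (3 / 8 * \<alpha> + 80 / (real n * \<alpha>)) + ennreal (2 / \<alpha> * frob d ?E ?E)"
      using c0 t \<alpha> E0 by (subst ennreal_plus, simp, simp, subst ennreal_plus) auto
    also have "ennreal (c * t) = ennreal c * ennreal t" using c0 t by (intro ennreal_mult) auto
    also have "ennreal (2 / \<alpha> * frob d ?E ?E) = ennreal (2 / \<alpha>) * ennreal (frob d ?E ?E)"
      using \<alpha> E0 by (intro ennreal_mult) auto
    finally show ?thesis .
  qed
  show ?thesis
    unfolding \<tau>_def[abs_def, symmetric]
  proof (cases "op_bound d (gfac d \<tau> d)")
    case (real t)
    have "ennreal 1 \<le> op_bound d (gfac d \<tau> d)"
      unfolding op_bound_def by (simp add: add_increasing2)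
    then have t: "1 \<le> t" using real by (simp add: ennreal_le_iff2)
    have "sqn d (tvec d (gfac d \<tau> d) v) \<le> t" if "sqn d v = 1" for v
      using sqn_tvec_le_op_bound[OF that d, of "gfac d \<tau> d"] real t by (simp add: ennreal_le_iff)
    from bound[OF t this] show "ennreal (frobenius_norm d (\<lambda>ij. release d \<epsilon> n (pair_mean n X) (noise_cols d (chi_dof d) d x) ij - covariance_matrix \<mu> ij))
      \<le> ennreal c * op_bound d (gfac d \<tau> d) + ennreal (3 / 8 * \<alpha> + 80 / (real n * \<alpha>)) + ennreal (2 / \<alpha>) * ennreal (frob d ?E ?E)"
      using real by simp
  next
    \<comment> \<open>Since \<open>c\<close> is positive, an infinite bound makes the claim
      trivial.\<close>
    case top
    then show "ennreal (frobenius_norm d (\<lambda>ij. release d \<epsilon> n (pair_mean n X) (noise_cols d (chi_dof d) d x) ij - covariance_matrix \<mu> ij))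
      \<le> ennreal c * op_bound d (gfac d \<tau> d) + ennreal (3 / 8 * \<alpha> + 80 / (real n * \<alpha>)) + ennreal (2 / \<alpha>) * ennreal (frob d ?E ?E)"
      using c1 by (simp add: ennreal_mult_top)
  qed
qed

section \<open>The sampling error of the paired estimate\<close>

context
  fixes d n :: nat and \<mu> :: "vector measure"
  assumes mu: "prob_space \<mu>" and sets_mu: "sets \<mu> = sets (ball_space d)" and n: "2 \<le> n"
begin

interpretation mu: prob_space \<mu> by (rule mu)

interpretation P: prob_space "Pi\<^sub>M {..<n} (\<lambda>_. \<mu>)"
  by (rule prob_space_PiM) (rule mu)

lemma space_mu: "x \<in> space \<mu> \<Longrightarrow> sqn d x \<le> 1"
proof -
  assume "x \<in> space \<mu>"
  then have "x \<in> space (ball_space d)" using sets_eq_imp_space_eq[OF sets_mu] by simp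
  then have "L2_set x {..<d} \<le> 1" by (simp add: ball_space_def space_restrict_space)
  then show "sqn d x \<le> 1" unfolding sqn_def L2_set_def by simp
qed

lemma abs_component_le:
  assumes "sqn d x \<le> 1" "a < d"
  shows "\<bar>x a\<bar> \<le> 1"
proof -
  have "(x a)\<^sup>2 \<le> sqn d x" unfolding sqn_def using assms by (intro member_le_sum) auto
  then have "(x a)\<^sup>2 \<le> 1\<^sup>2" using assms by simp
  then show ?thesis by (simp only: abs_le_square_iff[symmetric] abs_one)
qed

lemma measurable_mu_component: "a < d \<Longrightarrow> (\<lambda>x. x a) \<in> borel_measurable \<mu>"
  using measurable_ball_component[of a d] by (simp add: measurable_cong_sets[OF sets_mu refl])

lemma sets_sample: "sets (Pi\<^sub>M {..<n} (\<lambda>_. \<mu>)) = sets (dataset_space d n)"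
  unfolding dataset_space_def by (rule sets_PiM_cong) (auto simp: sets_mu)

lemma measurable_sample_component: "l < n \<Longrightarrow> a < d \<Longrightarrow> (\<lambda>X. X l a) \<in> borel_measurable (Pi\<^sub>M {..<n} (\<lambda>_. \<mu>))"
  using measurable_dataset_component[of l n a d] by (simp add: measurable_cong_sets[OF sets_sample refl])

lemma space_sample: "X \<in> space (Pi\<^sub>M {..<n} (\<lambda>_. \<mu>)) \<Longrightarrow> X \<in> space (dataset_space d n)"
  using sets_eq_imp_space_eq[OF sets_sample] by simp

lemma abs_sample_le: "X \<in> space (Pi\<^sub>M {..<n} (\<lambda>_. \<mu>)) \<Longrightarrow> l < n \<Longrightarrow> a < d \<Longrightarrow> \<bar>X l a\<bar> \<le> 1"
  by (rule abs_component_le[OF space_mu]) (auto simp: space_PiM)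

lemma integral_sample_component:
  assumes "f \<in> borel_measurable \<mu>" "l < n"
  shows "(\<integral>X. f (X l) \<partial>Pi\<^sub>M {..<n} (\<lambda>_. \<mu>)) = (\<integral>x. f x \<partial>\<mu> :: real)"
proof -
  have "distr (Pi\<^sub>M {..<n} (\<lambda>_. \<mu>)) \<mu> (\<lambda>X. X l) = \<mu>"
    using assms mu by (intro distr_PiM_component) auto
  then show ?thesis
    using integral_distr[of "\<lambda>X. X l" "Pi\<^sub>M {..<n} (\<lambda>_. \<mu>)" \<mu> f] assms by simp
qed

lemma indep_samples: "P.indep_vars (\<lambda>_. \<mu>) (\<lambda>i X. X i) {..<n}"
  using n by (intro indep_vars_PiM_coordinates mu) (auto simp: lessThan_empty_iff)

lemma integral_sample_product:
  assumes ab: "a < d" "b < d" and ik: "i < n" "k < n" "i \<noteq> k"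
  shows "(\<integral>X. X i a * X k b \<partial>Pi\<^sub>M {..<n} (\<lambda>_. \<mu>)) = (\<integral>x. x a \<partial>\<mu>) * (\<integral>x. x b \<partial>\<mu>)"
proof -
  define c where "c j = (if j = i then a else b)" for j
  have "P.indep_vars (\<lambda>_. \<mu>) (\<lambda>j X. X j) {i, k}"
    using ik by (intro P.indep_vars_subset[OF indep_samples]) auto
  then have ind: "P.indep_vars (\<lambda>_. borel) (\<lambda>j X. X j (c j)) {i, k}"
    by (rule P.indep_vars_compose2) (use ab in \<open>auto simp: c_def measurable_mu_component\<close>)
  have "(\<integral>X. (\<Prod>j\<in>{i, k}. X j (c j)) \<partial>Pi\<^sub>M {..<n} (\<lambda>_. \<mu>)) = (\<Prod>j\<in>{i, k}. \<integral>X. X j (c j) \<partial>Pi\<^sub>M {..<n} (\<lambda>_. \<mu>))"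
  proof (rule P.indep_vars_lebesgue_integral[OF _ ind])
    fix j assume j: "j \<in> {i, k}"
    show "integrable (Pi\<^sub>M {..<n} (\<lambda>_. \<mu>)) (\<lambda>X. X j (c j))"
      using j ab ik by (intro P.integrable_const_bound[of _ 1] AE_I2) (auto simp: c_def abs_sample_le measurable_sample_component)
  qed simp
  then show ?thesis
    using ik ab integral_sample_component[OF measurable_mu_component[OF ab(1)] ik(1)]
      integral_sample_component[OF measurable_mu_component[OF ab(2)] ik(2)] by (simp add: c_def)
qed

text \<open>An unbiased estimate of a covariance entry from one pair; taking differences removes the
  unknown mean.\<close>

definition pair_term :: "nat \<Rightarrow> nat \<Rightarrow> nat \<Rightarrow> (nat \<Rightarrow> vector) \<Rightarrow> real" where
  "pair_term a b l X = 2 * (half_diff X l a * half_diff X l b)"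

lemma measurable_pair_term:
  "a < d \<Longrightarrow> b < d \<Longrightarrow> l < n div 2 \<Longrightarrow> pair_term a b l \<in> borel_measurable (Pi\<^sub>M {..<n} (\<lambda>_. \<mu>))"
  unfolding pair_term_def half_diff_def
  by (intro borel_measurable_times borel_measurable_divide borel_measurable_diff borel_measurable_const measurable_sample_component) presburger+

lemma abs_pair_term_le:
  assumes "X \<in> space (Pi\<^sub>M {..<n} (\<lambda>_. \<mu>))" "l < n div 2" "a < d" "b < d"
  shows "\<bar>pair_term a b l X\<bar> \<le> 2"
proof -
  have "sqn d (half_diff X l) \<le> 1" by (rule half_diff_norm[OF space_sample[OF assms(1)] assms(2)])
  then have "\<bar>half_diff X l a\<bar> \<le> 1" "\<bar>half_diff X l b\<bar> \<le> 1" using assms by (auto intro: abs_component_le)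
  then have "\<bar>half_diff X l a\<bar> * \<bar>half_diff X l b\<bar> \<le> 1 * 1" by (intro mult_mono) auto
  then show ?thesis by (simp add: pair_term_def abs_mult)
qed

lemma covariance_eq:
  assumes "a < d" "b < d"
  shows "covariance_matrix \<mu> (a, b) = (\<integral>x. x a * x b \<partial>\<mu>) - (\<integral>x. x a \<partial>\<mu>) * (\<integral>x. x b \<partial>\<mu>)"
proof -
  have ab: "integrable \<mu> (\<lambda>x. x a * x b)"
  proof (rule mu.integrable_const_bound[of _ 1])
    show "AE x in \<mu>. norm (x a * x b) \<le> 1"
    proof (rule AE_I2)
      fix x assume "x \<in> space \<mu>"
      then have "\<bar>x a\<bar> * \<bar>x b\<bar> \<le> 1 * 1" using assms by (intro mult_mono abs_component_le[OF space_mu]) auto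
      then show "norm (x a * x b) \<le> 1" by (simp add: abs_mult)
    qed
  qed (use assms in \<open>auto intro!: borel_measurable_times measurable_mu_component\<close>)
  have i: "integrable \<mu> (\<lambda>x. x c)" if "c < d" for c
    using that by (intro mu.integrable_const_bound[of _ 1] AE_I2) (auto intro: abs_component_le[OF space_mu] measurable_mu_component)
  define A B where "A = (\<integral>x. x a \<partial>\<mu>)" and "B = (\<integral>x. x b \<partial>\<mu>)"
  have "covariance_matrix \<mu> (a, b) = (\<integral>x. x a * x b - B * x a - A * x b + A * B \<partial>\<mu>)"
    unfolding covariance_matrix_def by (simp add: A_def B_def algebra_simps)
  also have "\<dots> = (\<integral>x. x a * x b \<partial>\<mu>) - B * A - A * B + A * B"
    using ab i[OF assms(1)] i[OF assms(2)] by (simp add: A_def B_def mu.prob_space)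
  finally show ?thesis by (simp add: A_def B_def)
qed

lemma integral_pair_term:
  assumes ab: "a < d" "b < d" and l: "l < n div 2"
  shows "(\<integral>X. pair_term a b l X \<partial>Pi\<^sub>M {..<n} (\<lambda>_. \<mu>)) = covariance_matrix \<mu> (a, b)"
proof -
  let ?P = "Pi\<^sub>M {..<n} (\<lambda>_. \<mu>)"
  define i k where "i = l + l" and "k = l + l + 1"
  have ik: "i < n" "k < n" "i \<noteq> k" using l unfolding i_def k_def by presburger+
  have int: "integrable ?P (\<lambda>X. X p a * X q b)" if "p < n" "q < n" for p q
  proof (rule P.integrable_const_bound[of _ 1])
    show "AE X in ?P. norm (X p a * X q b) \<le> 1"
    proof (rule AE_I2)
      fix X assume "X \<in> space ?P"
      then have "\<bar>X p a\<bar> * \<bar>X q b\<bar> \<le> 1 * 1" using ab that by (intro mult_mono abs_sample_le) auto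
      then show "norm (X p a * X q b) \<le> 1" by (simp add: abs_mult)
    qed
  qed (use ab that in \<open>auto intro!: borel_measurable_times measurable_sample_component\<close>)
  have same: "(\<integral>X. X p a * X p b \<partial>?P) = (\<integral>x. x a * x b \<partial>\<mu>)" if "p < n" for p
    using ab that by (intro integral_sample_component[of "\<lambda>x. x a * x b"] borel_measurable_times measurable_mu_component)
  have "(\<integral>X. pair_term a b l X \<partial>?P) = (\<integral>X. (X i a * X i b - X i a * X k b - X k a * X i b + X k a * X k b) / 2 \<partial>?P)"
    by (intro Bochner_Integration.integral_cong refl) (simp add: pair_term_def half_diff_def i_def k_def field_simps)
  also have "\<dots> = ((\<integral>X. X i a * X i b \<partial>?P) - (\<integral>X. X i a * X k b \<partial>?P) - (\<integral>X. X k a * X i b \<partial>?P) + (\<integral>X. X k a * X k b \<partial>?P)) / 2"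
    using int ik by simp
  also have "\<dots> = covariance_matrix \<mu> (a, b)"
    using ik ab by (simp add: same integral_sample_product covariance_eq)
  finally show ?thesis .
qed

lemma indep_pair_terms:
  assumes ab: "a < d" "b < d"
  shows "P.indep_vars (\<lambda>_. borel) (pair_term a b) {..<n div 2}"
proof -
  let ?K = "\<lambda>l. {l + l, l + l + 1}"
  have "P.indep_vars (\<lambda>l. Pi\<^sub>M (?K l) (\<lambda>_. \<mu>)) (\<lambda>l X. restrict (\<lambda>i. X i) (?K l)) {..<n div 2}"
  proof (rule P.indep_vars_restrict[OF indep_samples])
    show "?K l \<subseteq> {..<n}" if "l \<in> {..<n div 2}" for l
    proof -
      have "l < n div 2" using that by simp
      then have "l + l < n" "l + l + 1 < n" by presburger+
      then show ?thesis by simp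
    qed
    show "disjoint_family_on ?K {..<n div 2}"
      unfolding disjoint_family_on_def
    proof (intro ballI impI equals0I)
      fix l k x :: nat assume "l \<noteq> k" and "x \<in> ?K l \<inter> ?K k"
      then have "x = l + l \<or> x = l + l + 1" "x = k + k \<or> x = k + k + 1" by auto
      with \<open>l \<noteq> k\<close> show False by presburger
    qed
  qed
  then have "P.indep_vars (\<lambda>_. borel) (\<lambda>l X. pair_term a b l (restrict (\<lambda>i. X i) (?K l))) {..<n div 2}"
  proof (rule P.indep_vars_compose2)
    fix l :: nat
    have "(\<lambda>x. x p c) \<in> borel_measurable (Pi\<^sub>M (?K l) (\<lambda>_. \<mu>))" if "p \<in> ?K l" "c < d" for p c
      using that by (intro measurable_compose[OF measurable_component_singleton[of p] measurable_mu_component]) auto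
    then show "pair_term a b l \<in> borel_measurable (Pi\<^sub>M (?K l) (\<lambda>_. \<mu>))"
      unfolding pair_term_def half_diff_def using ab
      by (intro borel_measurable_times borel_measurable_divide borel_measurable_diff borel_measurable_const) auto
  qed
  moreover have "pair_term a b l (restrict (\<lambda>i. X i) (?K l)) = pair_term a b l X" for l X
    by (simp add: pair_term_def half_diff_def)
  ultimately show ?thesis by simp
qed

text \<open>The centred terms are independent, so only the diagonal of the squared sum survives. The
  variance of each term is relaxed to its second moment, which can be summed over the entries of the
  matrix.\<close>

lemma sampling_variance:
  assumes ab: "a < d" "b < d"
  shows "integrable (Pi\<^sub>M {..<n} (\<lambda>_. \<mu>)) (\<lambda>X. (sampling_error d n \<mu> X a b)\<^sup>2)" (is ?int)
    and "(\<integral>X. (sampling_error d n \<mu> X a b)\<^sup>2 \<partial>Pi\<^sub>M {..<n} (\<lambda>_. \<mu>))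
      \<le> (\<Sum>l<n div 2. \<integral>X. (pair_term a b l X)\<^sup>2 \<partial>Pi\<^sub>M {..<n} (\<lambda>_. \<mu>)) / (real (n div 2))\<^sup>2" (is ?le)
proof -
  let ?P = "Pi\<^sub>M {..<n} (\<lambda>_. \<mu>)"
  define m where "m = n div 2"
  have m: "0 < m" using n by (simp add: m_def)
  define c where "c = covariance_matrix \<mu> (a, b)"
  define \<zeta> where "\<zeta> l X = pair_term a b l X - c" for l X
  have se: "sampling_error d n \<mu> X a b = (\<Sum>l<m. \<zeta> l X) / real m" for X
  proof -
    have "(\<Sum>l<m. \<zeta> l X) / real m = (\<Sum>l<m. pair_term a b l X / real m) - c"
      using m by (simp add: \<zeta>_def sum_subtractf diff_divide_distrib sum_divide_distrib)
    also have "(\<Sum>l<m. pair_term a b l X / real m) = 2 * pair_mean n X a b"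
      by (simp add: pair_term_def pair_mean_def m_def sum_distrib_left)
    finally show ?thesis by (simp add: sampling_error_def c_def)
  qed
  have pt: "pair_term a b l \<in> borel_measurable ?P" if "l < m" for l
    using that ab measurable_pair_term by (simp add: m_def)
  have bd: "\<bar>\<zeta> l X\<bar> \<le> 2 + \<bar>c\<bar>" if "l < m" "X \<in> space ?P" for l X
    using abs_pair_term_le[OF that(2), of l a b] that(1) ab unfolding \<zeta>_def m_def by linarith
  have meas: "\<zeta> l \<in> borel_measurable ?P" if "l < m" for l
    unfolding \<zeta>_def using pt[OF that] by (intro borel_measurable_diff) auto
  have int1: "integrable ?P (\<zeta> l)" if "l < m" for l
    using that bd by (intro P.integrable_const_bound[of _ "2 + \<bar>c\<bar>"] AE_I2 meas) auto
  have intp: "integrable ?P (pair_term a b l)" if "l < m" for l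
    using that ab abs_pair_term_le by (intro P.integrable_const_bound[of _ 2] AE_I2 pt) (auto simp: m_def)
  have intp2: "integrable ?P (\<lambda>X. (pair_term a b l X)\<^sup>2)" if "l < m" for l
  proof (rule P.integrable_const_bound[of _ 4])
    show "AE X in ?P. norm ((pair_term a b l X)\<^sup>2) \<le> 4"
    proof (rule AE_I2)
      fix X assume X: "X \<in> space ?P"
      have "\<bar>pair_term a b l X\<bar>\<^sup>2 \<le> 2\<^sup>2"
        using abs_pair_term_le[OF X, of l a b] that ab by (intro power_mono) (auto simp: m_def)
      then show "norm ((pair_term a b l X)\<^sup>2) \<le> 4" by simp
    qed
  qed (use that pt in auto)
  have int2: "integrable ?P (\<lambda>X. \<zeta> l X * \<zeta> k X)" if "l < m" "k < m" for l k
  proof (rule P.integrable_const_bound[of _ "(2 + \<bar>c\<bar>) * (2 + \<bar>c\<bar>)"])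
    show "AE X in ?P. norm (\<zeta> l X * \<zeta> k X) \<le> (2 + \<bar>c\<bar>) * (2 + \<bar>c\<bar>)"
    proof (rule AE_I2)
      fix X assume "X \<in> space ?P"
      then have "\<bar>\<zeta> l X\<bar> * \<bar>\<zeta> k X\<bar> \<le> (2 + \<bar>c\<bar>) * (2 + \<bar>c\<bar>)" using bd that by (intro mult_mono) auto
      then show "norm (\<zeta> l X * \<zeta> k X) \<le> (2 + \<bar>c\<bar>) * (2 + \<bar>c\<bar>)" by (simp add: abs_mult)
    qed
  qed (use that meas in auto)
  have E0: "(\<integral>X. \<zeta> l X \<partial>?P) = 0" if "l < m" for l
    using integral_pair_term[OF ab, of l] that intp[OF that]
    by (simp add: \<zeta>_def m_def c_def P.prob_space)
  have cross: "(\<integral>X. \<zeta> l X * \<zeta> k X \<partial>?P) = 0" if "l < m" "k < m" "l \<noteq> k" for l k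
  proof -
    have "P.indep_vars (\<lambda>_. borel) (pair_term a b) {l, k}"
      using that by (intro P.indep_vars_subset[OF indep_pair_terms[OF ab]]) (auto simp: m_def)
    then have "P.indep_vars (\<lambda>_. borel) (\<lambda>l X. (\<lambda>z. z - c) (pair_term a b l X)) {l, k}"
      by (rule P.indep_vars_compose2) simp
    then have ind: "P.indep_vars (\<lambda>_. borel) \<zeta> {l, k}" by (simp add: \<zeta>_def[abs_def])
    have "(\<integral>X. (\<Prod>j\<in>{l, k}. \<zeta> j X) \<partial>?P) = (\<Prod>j\<in>{l, k}. \<integral>X. \<zeta> j X \<partial>?P)"
      by (rule P.indep_vars_lebesgue_integral[OF _ ind]) (use that int1 in auto)
    then show ?thesis using that E0 by simp
  qed
  have sq: "(sampling_error d n \<mu> X a b)\<^sup>2 = (\<Sum>l<m. \<Sum>k<m. \<zeta> l X * \<zeta> k X) / (real m)\<^sup>2" for X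
    unfolding se power_divide power2_eq_square[of "\<Sum>l<m. \<zeta> l X"] sum_product ..
  show ?int unfolding sq using int2
    by (intro integrable_divide Bochner_Integration.integrable_sum) auto
  have "(\<integral>X. (sampling_error d n \<mu> X a b)\<^sup>2 \<partial>?P) = (\<Sum>l<m. \<Sum>k<m. \<integral>X. \<zeta> l X * \<zeta> k X \<partial>?P) / (real m)\<^sup>2"
    unfolding sq using integral_double_sum[of m m ?P "\<lambda>l k X. \<zeta> l X * \<zeta> k X", OF int2] by simp
  also have "(\<Sum>l<m. \<Sum>k<m. \<integral>X. \<zeta> l X * \<zeta> k X \<partial>?P) = (\<Sum>l<m. \<integral>X. \<zeta> l X * \<zeta> l X \<partial>?P)"
  proof (rule sum.cong[OF refl])
    fix l assume l: "l \<in> {..<m}"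
    have "(\<Sum>k<m. \<integral>X. \<zeta> l X * \<zeta> k X \<partial>?P) = (\<Sum>k<m. if k = l then \<integral>X. \<zeta> l X * \<zeta> l X \<partial>?P else 0)"
      using l cross by (intro sum.cong) auto
    then show "(\<Sum>k<m. \<integral>X. \<zeta> l X * \<zeta> k X \<partial>?P) = (\<integral>X. \<zeta> l X * \<zeta> l X \<partial>?P)" using l by simp
  qed
  also have "(\<Sum>l<m. \<integral>X. \<zeta> l X * \<zeta> l X \<partial>?P) \<le> (\<Sum>l<m. \<integral>X. (pair_term a b l X)\<^sup>2 \<partial>?P)"
  proof (rule sum_mono)
    fix l assume "l \<in> {..<m}"
    then have l: "l < m" by simp
    have "(\<integral>X. \<zeta> l X * \<zeta> l X \<partial>?P) = (\<integral>X. (pair_term a b l X)\<^sup>2 - 2 * c * pair_term a b l X + c * c \<partial>?P)"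
      by (intro Bochner_Integration.integral_cong refl) (simp add: \<zeta>_def power2_eq_square algebra_simps)
    also have "\<dots> = (\<integral>X. (pair_term a b l X)\<^sup>2 \<partial>?P) - 2 * c * c + c * c"
      using intp[OF l] intp2[OF l] integral_pair_term[OF ab, of l] l by (simp add: m_def c_def P.prob_space)
    finally show "(\<integral>X. \<zeta> l X * \<zeta> l X \<partial>?P) \<le> (\<integral>X. (pair_term a b l X)\<^sup>2 \<partial>?P)" by simp
  qed
  finally show ?le unfolding m_def by (simp add: divide_right_mono)
qed

lemma sampling_error_expectation:
  "(\<integral>\<^sup>+X. ennreal (frob d (sampling_error d n \<mu> X) (sampling_error d n \<mu> X)) \<partial>Pi\<^sub>M {..<n} (\<lambda>_. \<mu>))
    \<le> ennreal (4 / real (n div 2))"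
proof -
  let ?P = "Pi\<^sub>M {..<n} (\<lambda>_. \<mu>)"
  define m where "m = n div 2"
  have m: "0 < m" using n by (simp add: m_def)
  let ?E = "sampling_error d n \<mu>"
  have fr: "frob d (?E X) (?E X) = (\<Sum>a<d. \<Sum>b<d. (?E X a b)\<^sup>2)" for X
    by (simp add: frob_def power2_eq_square)
  have intE: "integrable ?P (\<lambda>X. (?E X a b)\<^sup>2)" if "a < d" "b < d" for a b
    by (rule sampling_variance(1)[OF that])
  have int: "integrable ?P (\<lambda>X. frob d (?E X) (?E X))"
    unfolding fr using intE by (intro Bochner_Integration.integrable_sum) auto
  have intp2: "integrable ?P (\<lambda>X. (pair_term a b l X)\<^sup>2)" if "a < d" "b < d" "l < m" for a b l
  proof (rule P.integrable_const_bound[of _ 4])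
    show "AE X in ?P. norm ((pair_term a b l X)\<^sup>2) \<le> 4"
    proof (rule AE_I2)
      fix X assume X: "X \<in> space ?P"
      have "\<bar>pair_term a b l X\<bar>\<^sup>2 \<le> 2\<^sup>2"
        using abs_pair_term_le[OF X, of l a b] that by (intro power_mono) (auto simp: m_def)
      then show "norm ((pair_term a b l X)\<^sup>2) \<le> 4" by simp
    qed
  qed (use that measurable_pair_term in \<open>auto simp: m_def\<close>)
  have "(\<integral>X. frob d (?E X) (?E X) \<partial>?P) = (\<Sum>a<d. \<Sum>b<d. \<integral>X. (?E X a b)\<^sup>2 \<partial>?P)"
    unfolding fr by (rule integral_double_sum[OF intE])
  also have "\<dots> \<le> (\<Sum>a<d. \<Sum>b<d. (\<Sum>l<m. \<integral>X. (pair_term a b l X)\<^sup>2 \<partial>?P) / (real m)\<^sup>2)"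
    unfolding m_def by (intro sum_mono sampling_variance(2)) auto
  \<comment> \<open>The entries are summed inside each pair, where the sum of their squares is 4
    |w|^4 and hence at most 4; bounding them one by one would bring in a factor d^2.\<close>
  also have "\<dots> = (\<Sum>l<m. \<Sum>a<d. \<Sum>b<d. \<integral>X. (pair_term a b l X)\<^sup>2 \<partial>?P) / (real m)\<^sup>2"
  proof -
    have "(\<Sum>a<d. \<Sum>b<d. \<Sum>l<m. f a b l) = (\<Sum>l<m. \<Sum>a<d. \<Sum>b<d. f a b l)" for f :: "nat \<Rightarrow> nat \<Rightarrow> nat \<Rightarrow> real"
    proof -
      have "(\<Sum>a<d. \<Sum>b<d. \<Sum>l<m. f a b l) = (\<Sum>a<d. \<Sum>l<m. \<Sum>b<d. f a b l)" by (intro sum.cong refl sum.swap)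
      also have "\<dots> = (\<Sum>l<m. \<Sum>a<d. \<Sum>b<d. f a b l)" by (rule sum.swap)
      finally show ?thesis .
    qed
    then show ?thesis by (simp add: sum_divide_distrib[symmetric])
  qed
  also have "(\<Sum>l<m. \<Sum>a<d. \<Sum>b<d. \<integral>X. (pair_term a b l X)\<^sup>2 \<partial>?P) \<le> (\<Sum>l<m. 4)"
  proof (rule sum_mono)
    fix l assume l: "l \<in> {..<m}"
    have "(\<Sum>a<d. \<Sum>b<d. \<integral>X. (pair_term a b l X)\<^sup>2 \<partial>?P) = (\<integral>X. (\<Sum>a<d. \<Sum>b<d. (pair_term a b l X)\<^sup>2) \<partial>?P)"
      using l by (intro integral_double_sum[symmetric] intp2) auto
    also have "\<dots> \<le> (\<integral>X. 4 \<partial>?P)"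
    proof (rule integral_mono)
      show "integrable ?P (\<lambda>X. \<Sum>a<d. \<Sum>b<d. (pair_term a b l X)\<^sup>2)"
        using intp2 l by (intro Bochner_Integration.integrable_sum) auto
      fix X assume X: "X \<in> space ?P"
      have w: "sqn d (half_diff X l) \<le> 1"
        using l by (intro half_diff_norm[OF space_sample[OF X]]) (simp add: m_def)
      have "(\<Sum>a<d. \<Sum>b<d. (pair_term a b l X)\<^sup>2) = 4 * (sqn d (half_diff X l) * sqn d (half_diff X l))"
        by (simp add: pair_term_def sqn_def sum_product sum_distrib_left power2_eq_square mult_ac)
      also have "\<dots> \<le> 4 * (1 * 1)" using w by (intro mult_left_mono mult_mono) auto
      finally show "(\<Sum>a<d. \<Sum>b<d. (pair_term a b l X)\<^sup>2) \<le> 4" by simp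
    qed simp
    also have "\<dots> = 4" by (simp add: P.prob_space)
    finally show "(\<Sum>a<d. \<Sum>b<d. \<integral>X. (pair_term a b l X)\<^sup>2 \<partial>?P) \<le> 4" .
  qed
  finally have "(\<integral>X. frob d (?E X) (?E X) \<partial>?P) \<le> (\<Sum>l<m. 4) / (real m)\<^sup>2"
    by (simp add: divide_right_mono)
  also have "\<dots> = 4 / real m" using m by (simp add: power2_eq_square)
  finally have "(\<integral>X. frob d (?E X) (?E X) \<partial>?P) \<le> 4 / real m" .
  then show ?thesis
    using nn_integral_eq_integral[OF int] by (simp add: m_def ennreal_leI)
qed

end

section \<open>The expected error and the sample size\<close>

lemma mechanism_expected_error:
  assumes mu: "prob_space \<mu>" "sets \<mu> = sets (ball_space d)" and d: "0 < d" and n: "2 \<le> n" and eps: "0 < \<epsilon>"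
    and \<alpha>: "0 < \<alpha>" "1 \<le> real n * \<alpha>"
    and c: "c = 24 * noise_scale d \<epsilon> n / \<alpha> \<or> c = 12 * noise_scale d \<epsilon> n * sqrt (real d)"
  shows "(\<integral>\<^sup>+A. ennreal (frobenius_norm d (\<lambda>ij. A ij - covariance_matrix \<mu> ij)) \<partial>(Pi\<^sub>M {..<n} (\<lambda>_. \<mu>) \<bind> mechanism d \<epsilon> n))
    \<le> ennreal (256 * c + (3 / 8 * \<alpha> + 80 / (real n * \<alpha>)) + 2 / \<alpha> * (4 / real (n div 2)))"
proof -
  let ?P = "Pi\<^sub>M {..<n} (\<lambda>_. \<mu>)" and ?N = "NNv d (d + chi_dof d)"
  let ?f = "\<lambda>A. ennreal (frobenius_norm d (\<lambda>ij. A ij - covariance_matrix \<mu> ij))"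
  let ?th = "\<lambda>x. op_bound d (gfac d (\<lambda>j. student d (chi_dof d) (x j)) d)"
  define k where "k = 3 / 8 * \<alpha> + 80 / (real n * \<alpha>)"
  have k: "0 \<le> k" using \<alpha> by (simp add: k_def)
  have c0: "0 \<le> c" using c \<alpha> eps by (auto simp: noise_scale_def)
  have nu: "4096 * d \<le> chi_dof d" by (simp add: chi_dof_def)
  have sets: "sets ?P = sets (dataset_space d n)" by (rule sets_sample[OF mu n])
  have f: "?f \<in> borel_measurable (matrix_space d)"
    unfolding frobenius_norm_eq matrix_space_def
    by (intro measurable_compose[OF _ measurable_ennreal] measurable_compose[OF measurable_frob borel_measurable_sqrt] borel_measurable_diff) auto
  interpret N: prob_space ?N by (rule prob_space_PiM) (rule prob_space_Nv)
  interpret P: prob_space ?P by (rule prob_space_PiM) (rule mu(1))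
  have M: "mechanism d \<epsilon> n \<in> ?P \<rightarrow>\<^sub>M subprob_algebra (matrix_space d)"
    using measurable_prob_algebraD[OF mechanism_measurable] by (simp add: measurable_cong_sets[OF sets refl])
  let ?E = "\<lambda>X. ennreal (frob d (sampling_error d n \<mu> X) (sampling_error d n \<mu> X))"
  have half: "l + l < n" "l + l + 1 < n" if "l \<in> {..<n div 2}" for l
    using that unfolding lessThan_iff by presburger+
  have Em: "?E \<in> borel_measurable ?P"
    unfolding sampling_error_def pair_mean_def half_diff_def
    by (intro measurable_compose[OF measurable_frob measurable_ennreal] borel_measurable_diff borel_measurable_times borel_measurable_sum
        borel_measurable_divide borel_measurable_const measurable_sample_component[OF mu n] half) assumption+
  have "(\<integral>\<^sup>+A. ?f A \<partial>(?P \<bind> mechanism d \<epsilon> n)) = (\<integral>\<^sup>+X. \<integral>\<^sup>+A. ?f A \<partial>mechanism d \<epsilon> n X \<partial>?P)"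
    by (rule nn_integral_bind[OF f M])
  also have "\<dots> \<le> (\<integral>\<^sup>+X. ennreal c * 256 + ennreal k + ennreal (2 / \<alpha>) * ?E X \<partial>?P)"
  proof (rule nn_integral_mono)
    fix X assume "X \<in> space ?P"
    then have X: "X \<in> space (dataset_space d n)" using sets_eq_imp_space_eq[OF sets] by simp
    have "(\<integral>\<^sup>+A. ?f A \<partial>mechanism d \<epsilon> n X) = (\<integral>\<^sup>+x. ?f (release d \<epsilon> n (pair_mean n X) (noise_cols d (chi_dof d) d x)) \<partial>?N)"
      by (rule nn_integral_mechanism[OF d f])
    also have "\<dots> \<le> (\<integral>\<^sup>+x. ennreal c * ?th x + (ennreal k + ennreal (2 / \<alpha>) * ?E X) \<partial>?N)"
      using release_error[OF d n X eps \<alpha> c] unfolding k_def by (intro nn_integral_mono) (simp add: add.assoc)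
    also have "\<dots> = ennreal c * (\<integral>\<^sup>+x. ?th x \<partial>?N) + (ennreal k + ennreal (2 / \<alpha>) * ?E X)"
      using op_bound_expectation(2)[OF d nu] N.emeasure_space_1
      by (subst nn_integral_add) (auto simp: nn_integral_cmult)
    also have "\<dots> \<le> ennreal c * 256 + (ennreal k + ennreal (2 / \<alpha>) * ?E X)"
      by (intro add_right_mono mult_left_mono op_bound_expectation(1)[OF d nu]) simp
    finally show "(\<integral>\<^sup>+A. ?f A \<partial>mechanism d \<epsilon> n X) \<le> ennreal c * 256 + ennreal k + ennreal (2 / \<alpha>) * ?E X"
      by (simp add: add.assoc)
  qed
  also have "\<dots> = ennreal c * 256 + ennreal k + ennreal (2 / \<alpha>) * (\<integral>\<^sup>+X. ?E X \<partial>?P)"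
    using Em P.emeasure_space_1 by (subst nn_integral_add) (auto simp: nn_integral_cmult)
  also have "\<dots> \<le> ennreal c * 256 + ennreal k + ennreal (2 / \<alpha>) * ennreal (4 / real (n div 2))"
    by (intro add_left_mono mult_left_mono sampling_error_expectation[OF mu n]) simp
  also have "\<dots> = ennreal (256 * c + k + 2 / \<alpha> * (4 / real (n div 2)))"
  proof -
    have 1: "ennreal (2 / \<alpha>) * ennreal (4 / real (n div 2)) = ennreal (2 / \<alpha> * (4 / real (n div 2)))"
      using \<alpha> by (intro ennreal_mult[symmetric]) auto
    have 2: "ennreal c * 256 = ennreal (256 * c)"
      using c0 by (simp add: ennreal_mult mult.commute)
    have "0 \<le> 2 / \<alpha> * (4 / real (n div 2))" using \<alpha> by simp
    then show ?thesis unfolding 1 2 using k c0 by (simp only: ennreal_plus add_nonneg_nonneg mult_nonneg_nonneg zero_le_numeral)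
  qed
  finally show ?thesis unfolding k_def .
qed

text \<open>The error budget: \<alpha> / 4 for the noise, 3/8 of \<alpha> from the linearised
  squares, and \<alpha> / 1000 for each of the two terms that decay like 1 / n. The constant
  \<open>10 ^ 10\<close> leaves ample room.\<close>

lemma sample_size_bounds:
  fixes \<alpha> \<epsilon> :: real
  assumes d: "1 \<le> d" and eps: "0 < \<epsilon>" and \<alpha>: "0 < \<alpha>" "\<alpha> < 1"
    and n: "10 ^ 10 * (min (real d powr (3/2) / (\<alpha> * \<epsilon>)) (real d / (\<alpha>\<^sup>2 * \<epsilon>)) + 1 / \<alpha>\<^sup>2) \<le> real n"
  shows "2 \<le> n" "1 \<le> real n * \<alpha>"
    and "\<exists>c. (c = 24 * noise_scale d \<epsilon> n / \<alpha> \<or> c = 12 * noise_scale d \<epsilon> n * sqrt (real d)) \<and>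
      256 * c + (3 / 8 * \<alpha> + 80 / (real n * \<alpha>)) + 2 / \<alpha> * (4 / real (n div 2)) \<le> \<alpha>"
proof -
  define T where "T = min (real d powr (3/2) / (\<alpha> * \<epsilon>)) (real d / (\<alpha>\<^sup>2 * \<epsilon>))"
  have T0: "0 < T" using d eps \<alpha> by (simp add: T_def)
  have a2: "0 < \<alpha>\<^sup>2" "\<alpha>\<^sup>2 \<le> 1" using \<alpha> by (auto simp: power_le_one)
  have n1: "10 ^ 10 / \<alpha>\<^sup>2 \<le> real n" and n2: "10 ^ 10 * T \<le> real n"
  proof -
    have "10 ^ 10 * T + 10 ^ 10 / \<alpha>\<^sup>2 \<le> real n" using n unfolding T_def distrib_left by simp
    moreover have "0 \<le> 10 ^ 10 * T" "0 \<le> 10 ^ 10 / \<alpha>\<^sup>2" using T0 a2 by (auto simp: less_imp_le)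
    ultimately show "10 ^ 10 / \<alpha>\<^sup>2 \<le> real n" "10 ^ 10 * T \<le> real n" by linarith+
  qed
  have big: "10 ^ 10 \<le> real n"
  proof -
    have "10 ^ 10 / 1 \<le> 10 ^ 10 / \<alpha>\<^sup>2" using a2 by (intro divide_left_mono) auto
    then show ?thesis using n1 by simp
  qed
  show n2': "2 \<le> n" using big by simp
  have na2: "10 ^ 10 \<le> real n * \<alpha>\<^sup>2" using n1 a2 by (simp add: field_simps)
  have na: "10 ^ 10 / \<alpha> \<le> real n * \<alpha>"
    using na2 \<alpha> by (simp add: field_simps power2_eq_square)
  have "1 \<le> 10 ^ 10 / \<alpha>" using \<alpha> by (simp add: field_simps)
  then show "1 \<le> real n * \<alpha>" using na by linarith
  define m where "m = real (n div 2)"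
  \<comment> \<open>The factor 3 is attained at \<open>n = 3\<close>, with a single pair; it turns
    12294 into the constant 36882 below.\<close>
  have m3: "real n \<le> 3 * m"
  proof -
    have "n \<le> 3 * (n div 2)" using n2' by presburger
    then show ?thesis unfolding m_def by (simp flip: of_nat_mult)
  qed
  have m: "0 < m" using m3 big by simp
  have e1: "80 / (real n * \<alpha>) \<le> \<alpha> / 1000"
  proof -
    have "80 / (real n * \<alpha>) \<le> 80 / (10 ^ 10 / \<alpha>)" using na \<alpha> big by (intro divide_left_mono) auto
    also have "\<dots> \<le> \<alpha> / 1000" using \<alpha> by simp
    finally show ?thesis .
  qed
  have e2: "2 / \<alpha> * (4 / m) \<le> \<alpha> / 1000"
  proof -
    have "m * \<alpha> \<ge> (10 ^ 10 / 3) / \<alpha>"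
    proof -
      have "real n * \<alpha> \<le> 3 * m * \<alpha>" using m3 \<alpha> by (intro mult_right_mono) auto
      then show ?thesis using na by simp
    qed
    then have "8 / (m * \<alpha>) \<le> 8 / ((10 ^ 10 / 3) / \<alpha>)" using \<alpha> m by (intro divide_left_mono) auto
    also have "\<dots> \<le> \<alpha> / 1000" using \<alpha> by simp
    finally show ?thesis by (simp add: mult.commute)
  qed
  have s: "noise_scale d \<epsilon> n \<le> 36882 * (real d / (real n * \<epsilon>))"
  proof -
    have "noise_scale d \<epsilon> n = 12294 * real d / (m * \<epsilon>)" by (simp add: noise_scale_def m_def)
    also have "\<dots> \<le> 12294 * real d / (real n / 3 * \<epsilon>)"
      using m3 m big eps by (intro divide_left_mono mult_right_mono mult_pos_pos) auto
    also have "\<dots> = 36882 * (real d / (real n * \<epsilon>))" by simp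
    finally show ?thesis .
  qed
  have fin: "256 * c + (3 / 8 * \<alpha> + 80 / (real n * \<alpha>)) + 2 / \<alpha> * (4 / real (n div 2)) \<le> \<alpha>" if "256 * c \<le> \<alpha> / 4" for c
    using that e1 e2 \<alpha> unfolding m_def[symmetric] by linarith
  show "\<exists>c. (c = 24 * noise_scale d \<epsilon> n / \<alpha> \<or> c = 12 * noise_scale d \<epsilon> n * sqrt (real d)) \<and>
      256 * c + (3 / 8 * \<alpha> + 80 / (real n * \<alpha>)) + 2 / \<alpha> * (4 / real (n div 2)) \<le> \<alpha>"
  \<comment> \<open>The term that attains the minimum decides which of the two noise bounds is
    used.\<close>
  proof (cases "T = real d / (\<alpha>\<^sup>2 * \<epsilon>)")
    case True
    have "10 ^ 10 * real d \<le> real n * (\<alpha>\<^sup>2 * \<epsilon>)"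
      using n2 a2 eps unfolding True by (simp add: field_simps)
    then have "real d / (real n * \<epsilon>) \<le> \<alpha>\<^sup>2 / 10 ^ 10"
      using big eps by (simp add: field_simps)
    then have "noise_scale d \<epsilon> n \<le> 36882 * (\<alpha>\<^sup>2 / 10 ^ 10)" using s by linarith
    then have "24 * noise_scale d \<epsilon> n / \<alpha> \<le> 24 * (36882 * (\<alpha>\<^sup>2 / 10 ^ 10)) / \<alpha>"
      using \<alpha> by (intro divide_right_mono mult_left_mono) auto
    also have "\<dots> = 24 * 36882 / 10 ^ 10 * \<alpha>" using \<alpha> by (simp add: power2_eq_square)
    finally have "256 * (24 * noise_scale d \<epsilon> n / \<alpha>) \<le> \<alpha> / 4" using \<alpha> by simp
    then show ?thesis using fin by blast
  next
    case False
    then have T: "T = real d powr (3/2) / (\<alpha> * \<epsilon>)" by (simp add: T_def min_def split: if_splits)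
    have pd: "real d powr (3/2) = real d * sqrt (real d)"
    proof -
      have "real d powr (1 + 1/2) = real d powr 1 * real d powr (1/2)" by (rule powr_add)
      then show ?thesis using d by (simp add: powr_half_sqrt)
    qed
    have "10 ^ 10 * (real d * sqrt (real d)) \<le> real n * (\<alpha> * \<epsilon>)"
      using n2 \<alpha> eps unfolding T pd by (simp add: field_simps)
    then have "real d / (real n * \<epsilon>) * sqrt (real d) \<le> \<alpha> / 10 ^ 10"
      using big eps by (simp add: field_simps)
    moreover have "noise_scale d \<epsilon> n * sqrt (real d) \<le> 36882 * (real d / (real n * \<epsilon>)) * sqrt (real d)"
      using s by (intro mult_right_mono) auto
    ultimately have "noise_scale d \<epsilon> n * sqrt (real d) \<le> 36882 * (\<alpha> / 10 ^ 10)" by linarith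
    then have "256 * (12 * noise_scale d \<epsilon> n * sqrt (real d)) \<le> \<alpha> / 4" using \<alpha> by simp
    then show ?thesis using fin by blast
  qed
qed

theorem theorem3:
  "\<exists>C>0. \<exists>M :: nat \<Rightarrow> real \<Rightarrow> nat \<Rightarrow> (nat \<Rightarrow> vector) \<Rightarrow> matrix measure.
     (\<forall>d\<ge>1. \<forall>\<epsilon>>0. \<forall>n.
        M d \<epsilon> n \<in> dataset_space d n \<rightarrow>\<^sub>M prob_algebra (matrix_space d) \<and>
        differentially_private \<epsilon> n (ball_space d) (matrix_space d) (M d \<epsilon> n) \<and>
        (\<forall>\<mu> :: vector measure. \<forall>\<alpha> :: real.
           prob_space \<mu> \<longrightarrow> sets \<mu> = sets (ball_space d) \<longrightarrow> 0 < \<alpha> \<longrightarrow> \<alpha> < 1 \<longrightarrow>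
           real n \<ge> C * (min (real d powr (3/2) / (\<alpha> * \<epsilon>)) (real d / (\<alpha>\<^sup>2 * \<epsilon>)) + 1 / \<alpha>\<^sup>2) \<longrightarrow>
           (\<integral>\<^sup>+A. ennreal (frobenius_norm d (\<lambda>ij. A ij - covariance_matrix \<mu> ij))
              \<partial>(Pi\<^sub>M {..<n} (\<lambda>_. \<mu>) \<bind> M d \<epsilon> n)) \<le> ennreal \<alpha>)) \<and>
     polynomial_time M"
proof (rule exI[of _ "10 ^ 10"], intro conjI)
  show "\<exists>M :: nat \<Rightarrow> real \<Rightarrow> nat \<Rightarrow> (nat \<Rightarrow> vector) \<Rightarrow> matrix measure.
     (\<forall>d\<ge>1. \<forall>\<epsilon>>0. \<forall>n.
        M d \<epsilon> n \<in> dataset_space d n \<rightarrow>\<^sub>M prob_algebra (matrix_space d) \<and>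
        differentially_private \<epsilon> n (ball_space d) (matrix_space d) (M d \<epsilon> n) \<and>
        (\<forall>\<mu> :: vector measure. \<forall>\<alpha> :: real.
           prob_space \<mu> \<longrightarrow> sets \<mu> = sets (ball_space d) \<longrightarrow> 0 < \<alpha> \<longrightarrow> \<alpha> < 1 \<longrightarrow>
           real n \<ge> 10 ^ 10 * (min (real d powr (3/2) / (\<alpha> * \<epsilon>)) (real d / (\<alpha>\<^sup>2 * \<epsilon>)) + 1 / \<alpha>\<^sup>2) \<longrightarrow>
           (\<integral>\<^sup>+A. ennreal (frobenius_norm d (\<lambda>ij. A ij - covariance_matrix \<mu> ij))
              \<partial>(Pi\<^sub>M {..<n} (\<lambda>_. \<mu>) \<bind> M d \<epsilon> n)) \<le> ennreal \<alpha>)) \<and>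
     polynomial_time M"
  \<comment> \<open>One mechanism serves every \<alpha>: the choice between the two bounds is made
    in the analysis alone.\<close>
  proof (intro exI[of _ mechanism] conjI allI impI)
    fix d n :: nat and \<epsilon> \<alpha> :: real and \<mu> :: "vector measure"
    assume d: "1 \<le> d" and eps: "0 < \<epsilon>" and mu: "prob_space \<mu>" "sets \<mu> = sets (ball_space d)"
      and \<alpha>: "0 < \<alpha>" "\<alpha> < 1"
      and n: "10 ^ 10 * (min (real d powr (3/2) / (\<alpha> * \<epsilon>)) (real d / (\<alpha>\<^sup>2 * \<epsilon>)) + 1 / \<alpha>\<^sup>2) \<le> real n"
    from d have d': "0 < d" by simp
    obtain c where c: "c = 24 * noise_scale d \<epsilon> n / \<alpha> \<or> c = 12 * noise_scale d \<epsilon> n * sqrt (real d)"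
      and le: "256 * c + (3 / 8 * \<alpha> + 80 / (real n * \<alpha>)) + 2 / \<alpha> * (4 / real (n div 2)) \<le> \<alpha>"
      using sample_size_bounds(3)[OF d eps \<alpha> n] by blast
    show "(\<integral>\<^sup>+A. ennreal (frobenius_norm d (\<lambda>ij. A ij - covariance_matrix \<mu> ij))
        \<partial>(Pi\<^sub>M {..<n} (\<lambda>_. \<mu>) \<bind> mechanism d \<epsilon> n)) \<le> ennreal \<alpha>"
      using mechanism_expected_error[OF mu d' sample_size_bounds(1)[OF d eps \<alpha> n] eps \<alpha>(1)
          sample_size_bounds(2)[OF d eps \<alpha> n] c] ennreal_leI[OF le] by (rule order.trans)
  qed (simp_all add: mechanism_measurable mechanism_private mechanism_polynomial_time)
qed simp

end
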